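(* Let $S$ be a connected, oriented, smooth, closed surface of genus $g\geq 2$, let $\mathcal{AF}(S)$ be its almost-Fuchsian space, viewed both as a subspace of Taubes' moduli space $\mathcal{H}$ of minimal hyperbolic germs (with its real symplectic structure $\omega_{\mathcal{H}}$) and as a subspace of the character variety $\mathcal{X}(S)$ of $\pi_1(S)$ in $\mathrm{PSL}_2(\mathbb{C})$ (with its complex Goldman symplectic structure $\omega_G$). Then, on $\mathcal{AF}(S)$, $$\omega_{\mathcal{H}} = -\mathrm{Im}(\omega_G).$$
   Context: **Teichmüller space.** $\mathcal{T}(S)$ is the deformation space of complex structures on $S$ compatible with its orientation and smooth structure, modulo $\mathrm{Diff}_0^+(S)$ (the orientation-preserving diffeomorphisms homotopic to the identity). It is a complex manifold; for $X\in\mathcal{T}(S)$ the complex cotangent space $T_X^*\mathcal{T}(S)$ is naturally identified with the space $Q(X)$ of holomorphic quadratic differentials on $X$ (via the natural integration pairing of quadratic differentials with Beltrami differentials). $T^*\mathcal{T}(S)$ denotes the holomorphic cotangent bundle, $\xi$ its canonical holomorphic $1$-form, and $\omega_{\mathrm{can}} = d\xi$ its canonical complex symplectic form. **Goldman's symplectic structure.** Let $\pi=\pi_1(S)$, $G=\mathrm{PSL}_2(\mathbb{C})$, $\mathfrak{g}=\mathfrak{sl}_2(\mathbb{C})$. $\mathcal{X}(S)=\mathrm{Hom}(\pi,G)/\!/G$ is the quotient in the sense of invariant theory; the set $\mathcal{X}(S)^s$ of conjugacy classes of irreducible representations is a complex manifold of dimension $6g-6$, with tangent space at $[\rho]$ equal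 to $H^1(\pi,\mathfrak{g}_{\mathrm{Ad}\circ\rho})$. The complex symplectic form $\omega_G$ on $\mathcal{X}(S)^s$ is the cup product with coefficient pairing $B/4$, where $B(u,v)=4\,\mathrm{tr}(uv)$ is the complex Killing form of $\mathfrak{sl}_2(\mathbb{C})$: $$H^1(\pi,\mathfrak{g}_{\mathrm{Ad}\circ\rho})\times H^1(\pi,\mathfrak{g}_{\mathrm{Ad}\circ\rho})\xrightarrow{\ \cup\ } H^2(\pi,\mathfrak{g}_{\mathrm{Ad}\circ\rho}\otimes\mathfrak{g}_{\mathrm{Ad}\circ\rho})\xrightarrow{\ B/4\ } H^2(\pi,\mathbb{C})\cong\mathbb{C}.$$ **Conventions for surfaces.** For an oriented surface $\Sigma$ immersed in an oriented hyperbolic $3$-manifold with Levi-Civita connection $\bar\nabla$: $I$ is the induced metric, the shape operator is $Bv=-\bar\nabla_v n$ with $n$ the positively oriented unit normal field, and $II(u,v)=I(Bu,v)$. $\Sigma$ is minimal if $H=\mathrm{tr}(B)=0$. **Taubes' moduli space.** A minimal hyperbolic germ on $S$ is a pair $(I,II)$ of a smooth Riemannian metric $I$ and a symmetric bilinear form $II$ on $S$ such that, with $B=I^{-1}II$ (the $I$-self-adjoint endomorphism associated to $II$), $\nabla$ the Levi-Civita connection and $K$ the curvature of $I$, one has $\det B=K+1$, $d^\nabla B=0$ and $\mathrm{tr}(B)=0$. $\mathcal{H}$ is the quotient of the set of minimal hyperbolic germs by $\mathrm{Diff}_0^+(S)$; it is a smooth manifold of dimension $12g-12$. For a minimal hyperbolic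 germ $(I,II)$, let $X$ be the complex structure on $S$ determined by the conformal class of $I$ and the orientation of $S$; then $II=\mathrm{Re}(\varphi)$ for a unique $\varphi\in Q(X)$. This defines a smooth map $\Psi:\mathcal{H}\to T^*\mathcal{T}(S)$, $[(I,II)]\mapsto (X,\varphi)$. The symplectic structure on $\mathcal{H}$ is $\omega_{\mathcal{H}}=\mathrm{Re}(\Psi^*\omega_{\mathrm{can}})$. **Almost-Fuchsian space.** A minimal hyperbolic germ $(I,II)$ is almost-Fuchsian if $\|II\|_I^2<2$ everywhere (equivalently $\det B>-1$ everywhere, i.e. the principal curvatures lie in $(-1,1)$). $\mathcal{AF}(S)\subset\mathcal{H}$ is the set of classes of almost-Fuchsian germs. By Uhlenbeck, for such a germ there is a unique quasi-Fuchsian $3$-manifold $M=\mathbb{H}^3/\Gamma$ (up to isometry) with a minimal isometric embedding $(S,I)\hookrightarrow M$ having $II$ as second fundamental form. Sending the germ to the (quasi-Fuchsian) holonomy representation $\pi_1(S)\to\Gamma\subset\mathrm{PSL}_2(\mathbb{C})$ of $M$ embeds $\mathcal{AF}(S)$ as an open subset of the space of quasi-Fuchsian structures, hence in $\mathcal{X}(S)$; $\omega_G$ is pulled back to $\mathcal{AF}(S)$ by this embedding. *)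

theory Defs
  imports "HOL-Homology.Homology" "HOL-Complex_Analysis.Complex_Analysis"
begin

section \<open>Smooth maps between Euclidean spaces\<close>

primrec Ck_on :: "nat \<Rightarrow> 'a::euclidean_space set \<Rightarrow> ('a \<Rightarrow> 'b::real_normed_vector) \<Rightarrow> bool" where
  "Ck_on 0 U f \<longleftrightarrow> continuous_on U f"
| "Ck_on (Suc k) U f \<longleftrightarrow> (\<forall>x\<in>U. f differentiable (at x)) \<and>
     (\<forall>i\<in>Basis. Ck_on k U (\<lambda>x. frechet_derivative f (at x) i))"

text \<open>Meant for open sets \<open>U\<close>.\<close>

definition smooth_on :: "'a::euclidean_space set \<Rightarrow> ('a \<Rightarrow> 'b::real_normed_vector) \<Rightarrow> bool" where
  "smooth_on U f \<longleftrightarrow> (\<forall>k. Ck_on k U f)"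

text \<open>The coordinate derivative \<open>\<partial>\<^sub>k f\<close> on the plane.  It is used both for the coordinates of the
  universal cover of the surface and for the two parameters of a family.\<close>

definition partial :: "(real^2 \<Rightarrow> 'b::real_normed_vector) \<Rightarrow> 2 \<Rightarrow> real^2 \<Rightarrow> 'b" where
  "partial f k x = frechet_derivative f (at x) (axis k 1)"

definition oriented_smooth_on :: "(real^2) set \<Rightarrow> (real^2 \<Rightarrow> real^2) \<Rightarrow> bool" where
  "oriented_smooth_on U f \<longleftrightarrow> open U \<and> smooth_on U f \<and> (\<forall>z\<in>U. det (jacobian f (at z)) > 0)"


section \<open>The surface and its universal covering\<close>

text \<open>A closed surface is a compact connected Hausdorff space \<open>S\<close> with an oriented smooth atlas \<open>A\<close> of
  charts \<open>(U, x)\<close>.\<close>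

definition closed_oriented_surface ::
    "'a::t2_space set \<Rightarrow> ('a set \<times> ('a \<Rightarrow> real^2)) set \<Rightarrow> bool" where
  "closed_oriented_surface S A \<longleftrightarrow>
     compact S \<and> connected S \<and> S \<noteq> {} \<and> (\<Union>(U, x)\<in>A. U) = S \<and>
     (\<forall>(U, x)\<in>A. openin (top_of_set S) U \<and> open (x ` U) \<and> homeomorphism U (x ` U) x (inv_into U x)) \<and>
     (\<forall>(U, x)\<in>A. \<forall>(V, y)\<in>A. oriented_smooth_on (x ` (U \<inter> V)) (y \<circ> inv_into U x))"

definition has_genus :: "'a::topological_space set \<Rightarrow> nat \<Rightarrow> bool" where
  "has_genus S g \<longleftrightarrow> homology_group 1 (top_of_set S) \<cong> free_Abelian_group {..<2 * g}"

text \<open>The universal cover of a surface of genus at least \<open>1\<close> is diffeomorphic to the plane, so a universal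
  covering is a covering \<open>p\<close> of \<open>S\<close> by the plane which is an oriented local diffeomorphism.  Tensor fields
  on \<open>S\<close> are represented by their pullbacks under \<open>p\<close>, i.e. by tensor fields on the plane which are
  invariant under the deck group; the deck group is the fundamental group \<open>\<pi>\<close>.\<close>

definition universal_covering ::
    "'a::t2_space set \<Rightarrow> ('a set \<times> ('a \<Rightarrow> real^2)) set \<Rightarrow> (real^2 \<Rightarrow> 'a) \<Rightarrow> bool" where
  "universal_covering S A p \<longleftrightarrow> covering_space UNIV p S \<and>
     (\<forall>(U, x)\<in>A. oriented_smooth_on (p -` U) (x \<circ> p))"

definition deck :: "(real^2 \<Rightarrow> 'a) \<Rightarrow> (real^2 \<Rightarrow> real^2) set" where
  "deck p = {\<gamma>. (\<exists>\<delta>. homeomorphism UNIV UNIV \<gamma> \<delta>) \<and> p \<circ> \<gamma> = p}"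

definition deck_group :: "(real^2 \<Rightarrow> 'a) \<Rightarrow> (real^2 \<Rightarrow> real^2) monoid" where
  "deck_group p = \<lparr>carrier = deck p, monoid.mult = (\<circ>), one = id\<rparr>"

text \<open>The integral over \<open>S\<close> of the \<open>2\<close>-form whose pullback to the plane is \<open>w dx \<and> dy\<close>, computed on a Borel
  set of representatives; for invariant continuous forms the choice of \<open>D\<close> is irrelevant.\<close>

definition surface_integral ::
    "'a set \<Rightarrow> (real^2 \<Rightarrow> 'a) \<Rightarrow> (real^2 \<Rightarrow> complex) \<Rightarrow> complex" where
  "surface_integral S p w =
     (THE a. \<exists>D\<in>sets borel. bij_betw p D S \<and> a = (LINT z:D|lborel. w z))"


section \<open>Minimal hyperbolic germs\<close>

text \<open>Symmetric bilinear forms are given by their matrices in the coordinates of the plane.\<close>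

type_synonym tensor = "real^2 \<Rightarrow> real^2^2"
type_synonym germ = "tensor \<times> tensor"

definition pullback :: "(real^2 \<Rightarrow> real^2) \<Rightarrow> tensor \<Rightarrow> tensor" where
  "pullback f h z = transpose (jacobian f (at z)) ** h (f z) ** jacobian f (at z)"

definition symmetric_form_on_surface :: "(real^2 \<Rightarrow> 'a) \<Rightarrow> tensor \<Rightarrow> bool" where
  "symmetric_form_on_surface p h \<longleftrightarrow> smooth_on UNIV h \<and> (\<forall>z. transpose (h z) = h z) \<and>
     (\<forall>\<gamma>\<in>deck p. pullback \<gamma> h = h)"

definition riemannian_metric :: "(real^2 \<Rightarrow> 'a) \<Rightarrow> tensor \<Rightarrow> bool" where
  "riemannian_metric p I \<longleftrightarrow> symmetric_form_on_surface p I \<and> (\<forall>z v. v \<noteq> 0 \<longrightarrow> v \<bullet> (I z *v v) > 0)"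

text \<open>\<open>christoffel I k i j\<close> is \<open>\<Gamma>\<^sup>k\<^sub>i\<^sub>j\<close>, that is, \<open>\<nabla>\<^sub>i \<partial>\<^sub>j = \<Sum>\<^sub>k \<Gamma>\<^sup>k\<^sub>i\<^sub>j \<partial>\<^sub>k\<close>.\<close>

definition christoffel :: "tensor \<Rightarrow> 2 \<Rightarrow> 2 \<Rightarrow> 2 \<Rightarrow> real^2 \<Rightarrow> real" where
  "christoffel I k i j z = (1/2) * (\<Sum>l\<in>UNIV. matrix_inv (I z) $ k $ l *
     (partial (\<lambda>w. I w $ j $ l) i z + partial (\<lambda>w. I w $ i $ l) j z - partial (\<lambda>w. I w $ i $ j) l z))"

text \<open>\<open>riemann I l k i j\<close> is the \<open>l\<close>-th component of
  \<open>R(\<partial>\<^sub>i, \<partial>\<^sub>j) \<partial>\<^sub>k = \<nabla>\<^sub>i \<nabla>\<^sub>j \<partial>\<^sub>k - \<nabla>\<^sub>j \<nabla>\<^sub>i \<partial>\<^sub>k\<close>.\<close>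

definition riemann :: "tensor \<Rightarrow> 2 \<Rightarrow> 2 \<Rightarrow> 2 \<Rightarrow> 2 \<Rightarrow> real^2 \<Rightarrow> real" where
  "riemann I l k i j z =
     partial (christoffel I l j k) i z - partial (christoffel I l i k) j z +
     (\<Sum>m\<in>UNIV. christoffel I l i m z * christoffel I m j k z
             - christoffel I l j m z * christoffel I m i k z)"

definition gauss_curvature :: "tensor \<Rightarrow> real^2 \<Rightarrow> real" where
  "gauss_curvature I z = (\<Sum>l\<in>UNIV. riemann I l 2 1 2 z * I z $ l $ 1) / det (I z)"

definition shape_operator :: "germ \<Rightarrow> tensor" where
  "shape_operator G z = matrix_inv (fst G z) ** snd G z"

text \<open>The \<open>k\<close>-th component of \<open>(\<nabla>\<^sub>i B) \<partial>\<^sub>j\<close> for an endomorphism field \<open>B\<close>.\<close>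

definition covariant_derivative :: "tensor \<Rightarrow> tensor \<Rightarrow> 2 \<Rightarrow> 2 \<Rightarrow> 2 \<Rightarrow> real^2 \<Rightarrow> real" where
  "covariant_derivative I B i k j z = partial (\<lambda>w. B w $ k $ j) i z +
     (\<Sum>m\<in>UNIV. christoffel I k i m z * B z $ m $ j - christoffel I m i j z * B z $ k $ m)"

definition minimal_hyperbolic_germs :: "(real^2 \<Rightarrow> 'a) \<Rightarrow> germ set" where
  "minimal_hyperbolic_germs p = {(I, II). riemannian_metric p I \<and> symmetric_form_on_surface p II \<and>
     (let B = shape_operator (I, II) in \<forall>z.
        det (B z) = gauss_curvature I z + 1 \<and>
        (\<forall>k. covariant_derivative I B 1 k 2 z = covariant_derivative I B 2 k 1 z) \<and>
        trace (B z) = 0)}"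

text \<open>\<open>\<parallel>II\<parallel>\<^sub>I\<^sup>2 = tr(B\<^sup>2)\<close>, since \<open>B\<close> is self-adjoint for \<open>I\<close>.\<close>

definition almost_fuchsian_germs :: "(real^2 \<Rightarrow> 'a) \<Rightarrow> germ set" where
  "almost_fuchsian_germs p = {G \<in> minimal_hyperbolic_germs p.
     \<forall>z. trace (shape_operator G z ** shape_operator G z) < 2}"

text \<open>\<open>Diff\<^sub>0\<^sup>+(S)\<close>, and its action on germs by pullback.  Germs live on the plane, so they are pulled back by a
  lift \<open>f\<close> of the diffeomorphism; by invariance of germs the choice of the lift does not matter.\<close>

definition diff0 :: "'a::t2_space set \<Rightarrow> ('a set \<times> ('a \<Rightarrow> real^2)) set \<Rightarrow> ('a \<Rightarrow> 'a) set" where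
  "diff0 S A = {\<phi>. (\<exists>\<psi>. homeomorphism S S \<phi> \<psi>) \<and>
     (\<forall>(U, x)\<in>A. \<forall>(V, y)\<in>A.
        oriented_smooth_on (x ` (U \<inter> \<phi> -` V)) (y \<circ> \<phi> \<circ> inv_into U x)) \<and>
     homotopic_with_canon (\<lambda>_. True) S S \<phi> id}"

definition diff0_rel ::
    "'a::t2_space set \<Rightarrow> ('a set \<times> ('a \<Rightarrow> real^2)) set \<Rightarrow> (real^2 \<Rightarrow> 'a) \<Rightarrow> (germ \<times> germ) set" where
  "diff0_rel S A p = {((I, II), (I', II')). \<exists>\<phi>\<in>diff0 S A. \<exists>f. continuous_on UNIV f \<and> p \<circ> f = \<phi> \<circ> p \<and>
     I' = pullback f I \<and> II' = pullback f II}"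

definition taubes_space ::
    "'a::t2_space set \<Rightarrow> ('a set \<times> ('a \<Rightarrow> real^2)) set \<Rightarrow> (real^2 \<Rightarrow> 'a) \<Rightarrow> germ set set" where
  "taubes_space S A p = minimal_hyperbolic_germs p // diff0_rel S A p"

definition almost_fuchsian_space ::
    "'a::t2_space set \<Rightarrow> ('a set \<times> ('a \<Rightarrow> real^2)) set \<Rightarrow> (real^2 \<Rightarrow> 'a) \<Rightarrow> germ set set" where
  "almost_fuchsian_space S A p = almost_fuchsian_germs p // diff0_rel S A p"

text \<open>Smooth maps from an open set \<open>U\<close> of a parameter plane to \<open>\<H>\<close> are the maps \<open>F\<close> which locally lift to smooth
  families \<open>\<sigma>\<close> of germs; \<open>germ_lift\<close> says that \<open>\<sigma>\<close> is such a lift.\<close>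

definition germ_lift ::
    "(real^2 \<Rightarrow> 'a) \<Rightarrow> (real^2) set \<Rightarrow> (real^2 \<Rightarrow> germ) \<Rightarrow> (real^2 \<Rightarrow> germ set) \<Rightarrow> bool" where
  "germ_lift p U \<sigma> F \<longleftrightarrow>
     (\<forall>u\<in>U. \<sigma> u \<in> F u \<and> \<sigma> u \<in> minimal_hyperbolic_germs p) \<and>
     smooth_on (U \<times> UNIV) (\<lambda>(u, z). fst (\<sigma> u) z) \<and>
     smooth_on (U \<times> UNIV) (\<lambda>(u, z). snd (\<sigma> u) z)"


section \<open>The cotangent bundle of Teichmueller space\<close>

text \<open>Complex structures on \<open>S\<close> are given by their almost complex structure.  That of \<open>X\<close> is the
  rotation by \<open>\<pi>/2\<close> for \<open>I\<close>: if \<open>I\<close> has the coefficients \<open>E, F, G\<close>, then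
  \<open>J = (EG - F\<^sup>2)\<^sup>-\<^sup>1\<^sup>/\<^sup>2 ((-F, -G), (E, F))\<close>.\<close>

definition complex_structure :: "tensor \<Rightarrow> tensor" where
  "complex_structure I z = (1 / sqrt (det (I z))) *\<^sub>R (vector [vector [0, -1], vector [1, 0]] ** I z)"

definition holomorphic_chart :: "tensor \<Rightarrow> (real^2) set \<Rightarrow> (real^2 \<Rightarrow> complex) \<Rightarrow> bool" where
  "holomorphic_chart J W w \<longleftrightarrow> open W \<and> smooth_on W w \<and> inj_on w W \<and>
     (\<forall>z\<in>W. inj (frechet_derivative w (at z)) \<and>
       (\<forall>v. frechet_derivative w (at z) (J z *v v) = \<i> * frechet_derivative w (at z) v))"

type_synonym quadratic_form = "real^2 \<Rightarrow> real^2 \<Rightarrow> real^2 \<Rightarrow> complex"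

text \<open>\<open>Q(X)\<close>: invariant \<open>J\<close>-complex bilinear symmetric forms, of the form \<open>q(w) dw\<^sup>2\<close> with \<open>q\<close> holomorphic in every
  local holomorphic coordinate \<open>w\<close>.\<close>

definition quadratic_differentials :: "(real^2 \<Rightarrow> 'a) \<Rightarrow> tensor \<Rightarrow> quadratic_form set" where
  "quadratic_differentials p J = {\<phi>.
     (\<forall>z. bilinear (\<phi> z) \<and> (\<forall>a b. \<phi> z a b = \<phi> z b a \<and> \<phi> z (J z *v a) b = \<i> * \<phi> z a b)) \<and>
     (\<forall>\<gamma>\<in>deck p. \<forall>z a b. \<phi> (\<gamma> z) (jacobian \<gamma> (at z) *v a) (jacobian \<gamma> (at z) *v b) = \<phi> z a b) \<and>
     (\<forall>W w. holomorphic_chart J W w \<longrightarrow> (\<exists>q. q holomorphic_on (w ` W) \<and>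
        (\<forall>z\<in>W. \<forall>a b. \<phi> z a b = q (w z) * frechet_derivative w (at z) a * frechet_derivative w (at z) b)))}"

text \<open>The map \<open>\<Psi>\<close>, \<open>(I, II) \<mapsto> (X, \<phi>)\<close> with \<open>II = Re \<phi>\<close>.\<close>

definition Psi :: "(real^2 \<Rightarrow> 'a) \<Rightarrow> germ \<Rightarrow> tensor \<times> quadratic_form" where
  "Psi p G = (let J = complex_structure (fst G) in
     (J, THE \<phi>. \<phi> \<in> quadratic_differentials p J \<and> (\<forall>z a b. Re (\<phi> z a b) = a \<bullet> (snd G z *v b))))"

text \<open>The Beltrami differential of \<open>J'\<close> relative to \<open>J\<close>, as a \<open>J\<close>-antilinear endomorphism \<open>\<mu>\<close> of the tangent
  plane: with \<open>\<partial> = (1 - J'J)/2\<close> and \<open>\<partial>' = (1 + J'J)/2\<close> the complex linear and antilinear parts of the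
  identity \<open>(S, J) \<rightarrow> (S, J')\<close>, it is \<open>\<partial>\<^sup>-\<^sup>1 \<partial>'\<close>.  In holomorphic coordinates \<open>w\<close> for \<open>J\<close> and \<open>w'\<close> for \<open>J'\<close> this is
  the usual quotient of the derivatives of \<open>w'\<close> with respect to \<open>w\<close>-bar and \<open>w\<close>.\<close>

definition beltrami :: "real^2^2 \<Rightarrow> real^2^2 \<Rightarrow> real^2^2" where
  "beltrami J J' = matrix_inv (mat 1 - J' ** J) ** (mat 1 + J' ** J)"

text \<open>The tangent vector \<open>\<partial>\<^sub>k X\<close> at \<open>u\<close> of a family of complex structures, as a Beltrami differential on \<open>X\<^sub>u\<close>.\<close>

definition teichmueller_velocity :: "(real^2 \<Rightarrow> tensor) \<Rightarrow> 2 \<Rightarrow> real^2 \<Rightarrow> tensor" where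
  "teichmueller_velocity J k u z = partial (\<lambda>v. beltrami (J u z) (J v z)) k u"

text \<open>The integration pairing.  If \<open>\<phi> = q dw\<^sup>2\<close> and \<open>\<mu> = n dw\<close>-bar\<open>/dw\<close> in a holomorphic coordinate
  \<open>w = x + i y\<close>, then the integrand is the \<open>2\<close>-form \<open>q n dx \<and> dy\<close>.\<close>

definition pairing ::
    "'a set \<Rightarrow> (real^2 \<Rightarrow> 'a) \<Rightarrow> quadratic_form \<Rightarrow> tensor \<Rightarrow> complex" where
  "pairing S p \<phi> \<mu> = surface_integral S p (\<lambda>z. \<i> / 2 *
     (\<phi> z (axis 1 1) (\<mu> z *v axis 2 1) - \<phi> z (axis 2 1) (\<mu> z *v axis 1 1)))"

text \<open>For a family \<open>c\<close> of points \<open>(X, \<phi>)\<close> of \<open>T\<^sup>*\<T>(S)\<close> the pullback of the canonical form \<open>\<xi>\<close> to the parameter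
  plane has the coefficients \<open>\<xi>(\<partial>\<^sub>k c) = \<langle>\<phi>, \<partial>\<^sub>k X\<rangle>\<close>; the pullback of \<open>\<omega>\<^sub>c\<^sub>a\<^sub>n = d\<xi>\<close> is its exterior derivative,
  here evaluated on \<open>(\<partial>\<^sub>1, \<partial>\<^sub>2)\<close>.\<close>

definition liouville_form ::
    "'a set \<Rightarrow> (real^2 \<Rightarrow> 'a) \<Rightarrow> (real^2 \<Rightarrow> tensor \<times> quadratic_form) \<Rightarrow> 2 \<Rightarrow> real^2 \<Rightarrow> complex" where
  "liouville_form S p c k u = pairing S p (snd (c u)) (teichmueller_velocity (\<lambda>v. fst (c v)) k u)"

definition omega_can ::
    "'a set \<Rightarrow> (real^2 \<Rightarrow> 'a) \<Rightarrow> (real^2 \<Rightarrow> tensor \<times> quadratic_form) \<Rightarrow> real^2 \<Rightarrow> complex" where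
  "omega_can S p c u =
     partial (liouville_form S p c 2) 1 u - partial (liouville_form S p c 1) 2 u"

text \<open>\<open>\<omega>\<^sub>\<H>\<close>, pulled back along a family of germs and evaluated on \<open>(\<partial>\<^sub>1, \<partial>\<^sub>2)\<close>.\<close>

definition omega_H ::
    "'a set \<Rightarrow> (real^2 \<Rightarrow> 'a) \<Rightarrow> (real^2 \<Rightarrow> germ) \<Rightarrow> real^2 \<Rightarrow> real" where
  "omega_H S p \<sigma> u = Re (omega_can S p (\<lambda>v. Psi p (\<sigma> v)) u)"


section \<open>Hyperbolic space and holonomy\<close>

definition SL2C :: "(complex^2^2) monoid" where
  "SL2C = \<lparr>carrier = {M. det M = 1}, monoid.mult = (**), one = mat 1\<rparr>"

definition PSL2C :: "(complex^2^2) set monoid" where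
  "PSL2C = SL2C Mod {mat 1, - mat 1}"

text \<open>Hyperbolic space is the hyperboloid in Minkowski space \<open>real^4\<close> (time is the fourth coordinate), identified
  with the Hermitian matrices of determinant \<open>1\<close> and positive trace, on which \<open>M\<close> acts by
  \<open>h \<mapsto> M h M\<^sup>*\<close>.\<close>

definition mink :: "real^4 \<Rightarrow> real^4 \<Rightarrow> real" where
  "mink x y = x$1 * y$1 + x$2 * y$2 + x$3 * y$3 - x$4 * y$4"

definition H3 :: "(real^4) set" where
  "H3 = {x. mink x x = -1 \<and> x$4 > 0}"

definition herm :: "real^4 \<Rightarrow> complex^2^2" where
  "herm x = vector [vector [complex_of_real (x$4 + x$3), Complex (x$1) (- x$2)],
                    vector [Complex (x$1) (x$2), complex_of_real (x$4 - x$3)]]"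

definition adjoint_matrix :: "complex^2^2 \<Rightarrow> complex^2^2" where
  "adjoint_matrix M = (\<chi> i j. cnj (M $ j $ i))"

definition psl_act :: "(complex^2^2) set \<Rightarrow> real^4 \<Rightarrow> real^4" where
  "psl_act C x = (THE y. \<exists>M\<in>C. herm y = M ** herm x ** adjoint_matrix M)"

definition representations :: "(real^2 \<Rightarrow> 'a) \<Rightarrow> ((real^2 \<Rightarrow> real^2) \<Rightarrow> (complex^2^2) set) set" where
  "representations p = hom (deck_group p) PSL2C"

text \<open>The limit set, in the projective (Klein) ball at height \<open>1\<close>.\<close>

definition limit_set ::
    "(real^2 \<Rightarrow> 'a) \<Rightarrow> ((real^2 \<Rightarrow> real^2) \<Rightarrow> (complex^2^2) set) \<Rightarrow> (real^4) set" where
  "limit_set p \<rho> = {y. y islimpt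
     (\<lambda>\<gamma>. let x = psl_act (\<rho> \<gamma>) (axis 4 1) in (1 / x$4) *\<^sub>R x) ` deck p}"

definition quasi_fuchsian ::
    "(real^2 \<Rightarrow> 'a) \<Rightarrow> ((real^2 \<Rightarrow> real^2) \<Rightarrow> (complex^2^2) set) \<Rightarrow> bool" where
  "quasi_fuchsian p \<rho> \<longleftrightarrow> \<rho> \<in> representations p \<and> inj_on \<rho> (deck p) \<and>
     (\<forall>K. compact K \<and> K \<subseteq> H3 \<longrightarrow> finite {\<gamma> \<in> deck p. psl_act (\<rho> \<gamma>) ` K \<inter> K \<noteq> {}}) \<and>
     limit_set p \<rho> homeomorphic sphere (0::complex) 1"

text \<open>\<open>f\<close> is an immersion into \<open>H3\<close> with unit normal \<open>n\<close>, induced metric \<open>I\<close> and second fundamental form \<open>II\<close>.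
  Since \<open>n\<close> is a unit field tangent to the hyperboloid and orthogonal to \<open>f\<close>, the Levi-Civita derivative of \<open>n\<close>
  in \<open>H3\<close> along the surface is its derivative in Minkowski space; so the last clause is
  \<open>II(u,v) = I(Bu,v)\<close> with \<open>B v = - \<nabla>\<^sub>v n\<close>.
  The orientation of \<open>H3\<close> is the one for which its boundary at infinity has the complex orientation of
  \<open>\<complex>P\<^sup>1\<close>; at the point \<open>axis 4 1\<close> it is that of the first three coordinates (it is opposite to the orientation
  \<open>(Re z, Im z, t)\<close> of the upper half-space model).\<close>

definition hyperbolic_immersion :: "(real^2 \<Rightarrow> real^4) \<Rightarrow> (real^2 \<Rightarrow> real^4) \<Rightarrow> germ \<Rightarrow> bool" where
  "hyperbolic_immersion f n G \<longleftrightarrow> smooth_on UNIV f \<and> smooth_on UNIV n \<and>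
     (\<forall>z. f z \<in> H3 \<and> mink (n z) (f z) = 0 \<and> mink (n z) (n z) = 1 \<and>
       (\<forall>i. mink (n z) (partial f i z) = 0) \<and>
       det (vector [partial f 1 z, partial f 2 z, n z, f z] :: real^4^4) > 0 \<and>
       (\<forall>i j. mink (partial f i z) (partial f j z) = fst G z $ i $ j) \<and>
       (\<forall>i j. - mink (partial n i z) (partial f j z) = snd G z $ i $ j))"

text \<open>\<open>\<rho>\<close> is the holonomy of the quasi-Fuchsian manifold \<open>M = H3/\<rho>(\<pi>)\<close> into which \<open>S\<close> embeds with data \<open>G\<close>.  The
  embedding is given by its equivariant lift \<open>f\<close> to the universal covers.\<close>

definition is_holonomy ::
    "(real^2 \<Rightarrow> 'a) \<Rightarrow> germ \<Rightarrow> ((real^2 \<Rightarrow> real^2) \<Rightarrow> (complex^2^2) set) \<Rightarrow> bool" where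
  "is_holonomy p G \<rho> \<longleftrightarrow> quasi_fuchsian p \<rho> \<and> (\<exists>f n. hyperbolic_immersion f n G \<and>
     (\<forall>\<gamma>\<in>deck p. \<forall>z. f (\<gamma> z) = psl_act (\<rho> \<gamma>) (f z)) \<and>
     (\<forall>\<gamma>\<in>deck p. \<forall>z w. f z = psl_act (\<rho> \<gamma>) (f w) \<longrightarrow> p z = p w))"

text \<open>The point of \<open>\<X>(S)\<close> defined by an almost-Fuchsian class, as a conjugacy class of representations (quasi-Fuchsian
  representations are irreducible, so near them \<open>\<X>(S)\<close> is the space of conjugacy classes).\<close>

definition holonomy_class ::
    "(real^2 \<Rightarrow> 'a) \<Rightarrow> germ set \<Rightarrow> ((real^2 \<Rightarrow> real^2) \<Rightarrow> (complex^2^2) set) set" where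
  "holonomy_class p C = {\<rho>. \<exists>G\<in>C. is_holonomy p G \<rho>}"


section \<open>Goldman's symplectic form\<close>

type_synonym 'p rep_family = "real^2 \<Rightarrow> 'p \<Rightarrow> (complex^2^2) set"

text \<open>\<open>R\<close> is a smooth lift to \<open>SL2C\<close>, near \<open>u\<close>, of a map \<open>c\<close> from the parameter plane to \<open>PSL2C\<close>.\<close>

definition local_lift :: "(real^2 \<Rightarrow> (complex^2^2) set) \<Rightarrow> real^2 \<Rightarrow> (real^2 \<Rightarrow> complex^2^2) \<Rightarrow> bool" where
  "local_lift c u R \<longleftrightarrow> (\<exists>V. open V \<and> u \<in> V \<and> smooth_on V R \<and> (\<forall>v\<in>V. R v \<in> c v))"

text \<open>\<open>\<rho>\<close> is a smooth lift to \<open>Hom(\<pi>, PSL2C)\<close> of the map \<open>C\<close> to the set of conjugacy classes.\<close>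

definition representation_lift ::
    "(real^2 \<Rightarrow> 'a) \<Rightarrow> (real^2) set \<Rightarrow> (real^2 \<Rightarrow> real^2) rep_family
      \<Rightarrow> (real^2 \<Rightarrow> ((real^2 \<Rightarrow> real^2) \<Rightarrow> (complex^2^2) set) set) \<Rightarrow> bool" where
  "representation_lift p U \<rho> C \<longleftrightarrow>
     (\<forall>u\<in>U. \<rho> u \<in> representations p \<and> \<rho> u \<in> C u \<and>
        (\<forall>\<gamma>\<in>deck p. \<exists>R. local_lift (\<lambda>v. \<rho> v \<gamma>) u R))"

text \<open>The cocycle \<open>\<gamma> \<mapsto> \<partial>\<^sub>k\<rho>(\<gamma>) \<rho>(\<gamma>)\<^sup>-\<^sup>1\<close>, which represents the tangent vector \<open>\<partial>\<^sub>k[\<rho>]\<close> in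
  \<open>H\<^sup>1(\<pi>, \<gg>\<^sub>A\<^sub>d\<^sub>\<rho>)\<close>.\<close>

definition tangent_cocycle ::
    "'p rep_family \<Rightarrow> 2 \<Rightarrow> real^2 \<Rightarrow> 'p \<Rightarrow> complex^2^2" where
  "tangent_cocycle \<rho> k u \<gamma> =
     (THE X. \<exists>R. local_lift (\<lambda>v. \<rho> v \<gamma>) u R \<and> X = partial R k u ** matrix_inv (R u))"

definition Ad :: "(complex^2^2) set \<Rightarrow> complex^2^2 \<Rightarrow> complex^2^2" where
  "Ad C X = (THE Y. \<exists>M\<in>C. Y = M ** X ** matrix_inv M)"

definition killing_form :: "complex^2^2 \<Rightarrow> complex^2^2 \<Rightarrow> complex" where
  "killing_form X Y = 4 * trace (X ** Y)"

text \<open>The cup product of inhomogeneous \<open>1\<close>-cocycles, \<open>(a \<union> b)(\<gamma>, \<delta>) = a(\<gamma>) \<otimes> \<gamma>\<cdot>b(\<delta>)\<close>, followed by the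
  coefficient pairing \<open>B/4\<close>.\<close>

definition cup_killing ::
    "('p \<Rightarrow> (complex^2^2) set) \<Rightarrow> ('p \<Rightarrow> complex^2^2) \<Rightarrow> ('p \<Rightarrow> complex^2^2) \<Rightarrow> 'p \<Rightarrow> 'p \<Rightarrow> complex" where
  "cup_killing \<rho> a b \<gamma> \<delta> = killing_form (a \<gamma>) (Ad (\<rho> \<gamma>) (b \<delta>)) / 4"

text \<open>The identification \<open>H\<^sup>2(\<pi>, \<complex>) \<cong> H\<^sup>2(S, \<complex>) \<cong> \<complex>\<close> given by the de Rham isomorphism and integration over
  \<open>S\<close>.  On the plane, a \<open>2\<close>-form on \<open>S\<close> is \<open>d\<theta>\<close> with \<open>\<theta> = \<theta>\<^sub>1 dx + \<theta>\<^sub>2 dy\<close>; by invariance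
  \<open>\<gamma>\<^sup>*\<theta> - \<theta> = dF\<^sub>\<gamma>\<close>, and the form has the class of the cocycle
  \<open>c(\<gamma>, \<delta>) = F\<^sub>\<gamma> \<circ> \<delta> + F\<^sub>\<delta> - F\<^sub>\<gamma>\<^sub>\<delta>\<close>.  Indeed, up to a coboundary \<open>c(\<gamma>, \<delta>)\<close> is the integral of
  \<open>d\<theta>\<close> over the singular simplex with vertices \<open>z, \<gamma> z, \<gamma> \<delta> z\<close>.\<close>

definition H2_evaluation ::
    "'a set \<Rightarrow> (real^2 \<Rightarrow> 'a) \<Rightarrow> ((real^2 \<Rightarrow> real^2) \<Rightarrow> (real^2 \<Rightarrow> real^2) \<Rightarrow> complex) \<Rightarrow> complex" where
  "H2_evaluation S p c = (THE a. \<exists>(\<theta> :: real^2 \<Rightarrow> complex^2) F.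
     smooth_on UNIV \<theta> \<and> (\<forall>\<gamma>\<in>deck p. smooth_on UNIV (F \<gamma>)) \<and>
     (\<forall>\<gamma>\<in>deck p. \<forall>z j. (\<Sum>i\<in>UNIV. \<theta> (\<gamma> z) $ i * complex_of_real (jacobian \<gamma> (at z) $ i $ j)) - \<theta> z $ j
         = partial (F \<gamma>) j z) \<and>
     (\<forall>\<gamma>\<in>deck p. \<forall>\<delta>\<in>deck p. \<forall>z. F \<gamma> (\<delta> z) + F \<delta> z - F (\<gamma> \<circ> \<delta>) z = c \<gamma> \<delta>) \<and>
     a = surface_integral S p (\<lambda>z. partial (\<lambda>w. \<theta> w $ 2) 1 z - partial (\<lambda>w. \<theta> w $ 1) 2 z))"

definition goldman_form ::
    "'a set \<Rightarrow> (real^2 \<Rightarrow> 'a) \<Rightarrow> ((real^2 \<Rightarrow> real^2) \<Rightarrow> (complex^2^2) set)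
      \<Rightarrow> ((real^2 \<Rightarrow> real^2) \<Rightarrow> complex^2^2) \<Rightarrow> ((real^2 \<Rightarrow> real^2) \<Rightarrow> complex^2^2) \<Rightarrow> complex" where
  "goldman_form S p \<rho> a b = H2_evaluation S p (cup_killing \<rho> a b)"

text \<open>\<open>\<omega>\<^sub>G\<close>, pulled back along a family of representations and evaluated on \<open>(\<partial>\<^sub>1, \<partial>\<^sub>2)\<close>.\<close>

definition omega_G ::
    "'a set \<Rightarrow> (real^2 \<Rightarrow> 'a) \<Rightarrow> (real^2 \<Rightarrow> real^2) rep_family \<Rightarrow> real^2 \<Rightarrow> complex" where
  "omega_G S p \<rho> u = goldman_form S p (\<rho> u) (tangent_cocycle \<rho> 1 u) (tangent_cocycle \<rho> 2 u)"

end

(* On the universal cover, each germ of the family is the pair of fundamental forms of an equivariant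
minimal immersion into the hyperboloid model. Its moving frame solves the Gauss-Weingarten equation,
and two holonomies with trivial common commutant make the frame differentiable in the
parameter. The spin part tau_k of the logarithmic derivative of the frame in the k-th parameter is an
equivariant potential for the k-th tangent cocycle, so that tr(tau_1 d tau_2) represents the cup product
and omega_G is the integral of its curl. The form omega_H is the integral of the exterior derivative of
the canonical form. Both become integrals over a fundamental domain of explicit expressions in the first
variations of I and II, and these expressions agree pointwise. The commutant is trivial because the limit
set of a quasi-Fuchsian group is a Jordan curve. *)
theory Submission
 imports Defs
begin

text \<open>The obstacle is regularity in the parameter. For each parameter separately the
  definitions supply some immersion realising the germ; it is determined only up to an isometry, and
  a choice made for each parameter may jump. What varies smoothly is the germ, hence the connection
  matrix of the frame, and the representation. At one point the frame is a triangular factor of the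
  metric times an unknown Lorentz matrix \<open>lor_mat (A t)\<close>. Transport by the connection
  shows that the frame with \<open>A t\<close> divided out is differentiable everywhere; so are then
  the conjugates of the holonomies by \<open>A t\<close>. Comparing these with the given holonomies
  is a linear equation for \<open>A t\<close>, which two noncommuting ones determine up to a scalar.
  Their traces must not vanish because the trace fixes the sign of a spin lift. The sign and scale
  of the identity come from algebra: the imaginary part of the trace form on sl(2,C) is the
  polarised Pfaffian of so(3,1), in which variations of Christoffel symbols meet a vanishing factor.
  What is left pairs variations of II with variations of I, as the canonical form does.\<close>

unbundle no fps_syntax
notation scaleR (infixr "*R" 75)
abbreviation "FD f x \<equiv> frechet_derivative f (at x)"

section \<open>Calculus of smooth maps\<close>

named_theorems smooth_intros

text \<open>\<open>frechet_derivative\<close> is a Hilbert choice among all derivatives. Functions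
  that agree near the point have the same candidates, so the choices coincide even where no
  derivative exists.\<close>

lemma frechet_derivative_cong_open:
 assumes "open U" "x \<in> U" "\<And>y. y \<in> U ==> f y = g y"
 shows "FD f x = FD g x"
proof -
 have "(f has_derivative D) (at x) \<longleftrightarrow> (g has_derivative D) (at x)" for D
  using has_derivative_transform_within_open[of f D x UNIV U g]
   has_derivative_transform_within_open[of g D x UNIV U f] assms by auto
 thus ?thesis by (simp add: frechet_derivative_def)
qed

lemma differentiable_cong_open:
 assumes "open U" "x \<in> U" "\<And>y. y \<in> U ==> f y = g y"
 shows "f differentiable at x \<longleftrightarrow> g differentiable at x"
 using has_derivative_transform_within_open[of f _ x UNIV U g]
  has_derivative_transform_within_open[of g _ x UNIV U f] assms
 unfolding differentiable_def by metis

lemma Ck_on_cong: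
 assumes "open U" "\<And>x. x \<in> U ==> f x = g x"
 shows "Ck_on k U f \<longleftrightarrow> Ck_on k U g"
 using assms(2)
proof (induction k arbitrary: f g)
 case 0
 thus ?case by (simp cong: continuous_on_cong)
next
 case (Suc k)
 have "Ck_on k U (\<lambda>x. FD f x i) \<longleftrightarrow> Ck_on k U (\<lambda>x. FD g x i)" for i
  using frechet_derivative_cong_open[OF assms(1) _ Suc.prems] by (intro Suc.IH) simp
 moreover have "(\<forall>x\<in>U. f differentiable at x) \<longleftrightarrow> (\<forall>x\<in>U. g differentiable at x)"
  using differentiable_cong_open[OF assms(1) _ Suc.prems] by simp
 ultimately show ?case by simp
qed

text \<open>The working form of the recursion: a derivative computed by the usual rules may replace
  the chosen one, so closure properties follow by induction on the order.\<close>

lemma Ck_on_Suc_iff: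
 assumes "open U" "\<And>x. x \<in> U ==> (f has_derivative f' x) (at x)"
 shows "Ck_on (Suc k) U f \<longleftrightarrow> (\<forall>i\<in>Basis. Ck_on k U (\<lambda>x. f' x i))"
proof -
 have "FD f x = f' x" if "x \<in> U" for x
  using assms(2)[OF that] frechet_derivative_at by metis
 hence "Ck_on k U (\<lambda>x. FD f x i) = Ck_on k U (\<lambda>x. f' x i)" for i
  by (intro Ck_on_cong assms(1)) simp
 thus ?thesis using assms(2) by (auto simp: differentiable_def)
qed

lemmas Ck_on_SucI = Ck_on_Suc_iff[THEN iffD2, OF _ _ ballI]

lemma Ck_on_imp_continuous: "Ck_on k U f ==> continuous_on U f"
proof (cases k)
 case (Suc j)
 moreover assume "Ck_on k U f"
 ultimately have "f differentiable (at x within U)" if "x \<in> U" for x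
  using that differentiable_at_withinI by auto
 thus ?thesis
  unfolding continuous_on_eq_continuous_within using differentiable_imp_continuous_within by blast
qed simp

lemma Ck_on_SucD: "Ck_on (Suc k) U f ==> Ck_on k U f"
proof (induction k arbitrary: f)
 case 0
 thus ?case using Ck_on_imp_continuous by (simp del: Ck_on.simps(2))
next
 case (Suc k)
 from Suc.prems have a: "\<forall>x\<in>U. f differentiable at x"
  and "\<forall>i\<in>Basis. Ck_on (Suc k) U (\<lambda>x. FD f x i)" by (simp_all only: Ck_on.simps(2)) blast+
 hence "\<forall>i\<in>Basis. Ck_on k U (\<lambda>x. FD f x i)" using Suc.IH by blast
 with a show ?case by simp
qed

lemma Ck_on_mono: "Ck_on k U f ==> j \<le> k ==> Ck_on j U f"
 by (induction k) (auto simp: le_Suc_eq simp del: Ck_on.simps(2) dest: Ck_on_SucD)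

lemma Ck_on_subset: "Ck_on k U f ==> V \<subseteq> U ==> Ck_on k V f"
 by (induction k arbitrary: f) (auto intro: continuous_on_subset)

lemma Ck_on_Suc_has_derivative:
 "Ck_on (Suc k) U f ==> x \<in> U ==> (f has_derivative FD f x) (at x)"
 by (simp add: frechet_derivative_works)

text \<open>The recursion only speaks of basis directions. By linearity any other direction is a
  fixed linear combination of them, and the order is stable under such combinations.\<close>

lemma Ck_on_Suc_deriv:
 assumes "Ck_on (Suc k) U f" "open U"
 shows "Ck_on k U (\<lambda>x. FD f x v)"
proof (cases "Ck_on (Suc k) U f")
 case True
 have *: "Ck_on k U (\<lambda>x. c *R g x)" if "Ck_on k U g" for c g
  using that
 proof (induction k arbitrary: g)
  case (Suc k)
  have "\<And>x. x \<in> U ==> ((\<lambda>x. c *R g x) has_derivative (\<lambda>v. c *R FD g x v)) (at x)"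
   using Ck_on_Suc_has_derivative[OF Suc.prems] by (intro derivative_intros)
  thus ?case using Suc by (subst Ck_on_Suc_iff[OF assms(2)]) auto
 qed (auto intro: continuous_intros)
 have add: "Ck_on k U (\<lambda>x. f x + g x)" if "Ck_on k U f" "Ck_on k U g" for f g
  using that
 proof (induction k arbitrary: f g)
  case (Suc k)
  have "\<And>x. x \<in> U ==> ((\<lambda>x. f x + g x) has_derivative (\<lambda>v. FD f x v + FD g x v)) (at x)"
   using Ck_on_Suc_has_derivative Suc.prems by (intro derivative_intros) blast+
  thus ?case using Suc by (subst Ck_on_Suc_iff[OF assms(2)]) auto
 qed (auto intro: continuous_intros)
 have zero: "Ck_on k U (\<lambda>x. 0)"
  by (induction k) (auto simp: frechet_derivative_const)
 have sum: "Ck_on k U (\<lambda>x. \<Sum>i\<in>B. g i x)" if "finite B" "\<And>i. i \<in> B ==> Ck_on k U (g i)" for B and g :: "'a => 'a => 'b"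
  using that zero by (induction B rule: finite_induct) (auto intro: add)
 have "FD f x v = (\<Sum>i\<in>Basis. (v \<bullet> i) *R FD f x i)" if "x \<in> U" for x
 proof -
  have l: "linear (FD f x)"
   using Ck_on_Suc_has_derivative[OF True that] has_derivative_linear by blast
  have "FD f x (\<Sum>i\<in>Basis. (v \<bullet> i) *R i) = (\<Sum>i\<in>Basis. (v \<bullet> i) *R FD f x i)"
   by (simp add: linear_sum[OF l] linear_scale[OF l])
  thus ?thesis by (simp add: euclidean_representation)
 qed
 moreover have "Ck_on k U (\<lambda>x. \<Sum>i\<in>Basis. (v \<bullet> i) *R FD f x i)"
  using True by (intro sum *) auto
 ultimately show ?thesis by (subst Ck_on_cong[OF assms(2)]) auto
qed (use assms in auto)

lemma Ck_on_const [smooth_intros]: "Ck_on k U (\<lambda>x. c)"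
proof (induction k arbitrary: c)
 case (Suc k)
 have "Ck_on k U (\<lambda>x. 0::'b)" using Suc .
 thus ?case by (simp add: frechet_derivative_const)
qed simp

lemma Ck_on_bounded_linear:
 assumes "bounded_linear L" "open U" "Ck_on k U f"
 shows "Ck_on k U (\<lambda>x. L (f x))"
 using assms(3)
proof (induction k arbitrary: f)
 case 0
 thus ?case using bounded_linear.continuous_on[OF assms(1)] by auto
next
 case (Suc k)
 have "\<And>x. x \<in> U ==> ((\<lambda>x. L (f x)) has_derivative (\<lambda>v. L (FD f x v))) (at x)"
  using Ck_on_Suc_has_derivative[OF Suc.prems] bounded_linear.has_derivative[OF assms(1)] by blast
 thus ?case using Suc by (subst Ck_on_Suc_iff[OF assms(2)]) auto
qed

lemma Ck_on_ident [smooth_intros]: "Ck_on k U (\<lambda>x. x)"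
 by (cases k) (auto simp: frechet_derivative_ident intro: smooth_intros)

lemma Ck_on_add [smooth_intros]:
 "open U ==> Ck_on k U f ==> Ck_on k U g ==> Ck_on k U (\<lambda>x. f x + g x)"
proof (induction k arbitrary: f g)
 case (Suc k)
 have "\<And>x. x \<in> U ==> ((\<lambda>x. f x + g x) has_derivative (\<lambda>v. FD f x v + FD g x v)) (at x)"
  using Ck_on_Suc_has_derivative Suc.prems by (intro derivative_intros) blast+
 thus ?case using Suc by (subst Ck_on_Suc_iff) auto
qed (auto intro: continuous_intros)

text \<open>The Leibniz rule pairs each derivative with an undifferentiated factor, so the induction
  also needs both factors at the lower order. All products below are instances.\<close>

lemma Ck_on_bilinear:
 assumes "bounded_bilinear B" "open U" "Ck_on k U f" "Ck_on k U g"
 shows "Ck_on k U (\<lambda>x. B (f x) (g x))"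
 using assms(3,4)
proof (induction k arbitrary: f g)
 case 0
 thus ?case using bounded_bilinear.continuous_on[OF assms(1)] by auto
next
 case (Suc k)
 have "((\<lambda>x. B (f x) (g x)) has_derivative
   (\<lambda>v. B (f x) (FD g x v) + B (FD f x v) (g x))) (at x)" if "x \<in> U" for x
  using bounded_bilinear.FDERIV[OF assms(1) Ck_on_Suc_has_derivative[OF Suc.prems(1) that]
   Ck_on_Suc_has_derivative[OF Suc.prems(2) that]] .
 thus ?case
  using Suc.IH Suc.prems Ck_on_SucD[OF Suc.prems(1)] Ck_on_SucD[OF Suc.prems(2)] assms(2)
  by (subst Ck_on_Suc_iff[OF assms(2)]) (auto intro!: Ck_on_add)
qed

lemmas Ck_on_scaleR [smooth_intros] = Ck_on_bilinear[OF bounded_bilinear_scaleR]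
lemmas Ck_on_mult [smooth_intros] = Ck_on_bilinear[OF bounded_bilinear_mult]
lemmas Ck_on_inner [smooth_intros] = Ck_on_bilinear[OF bounded_bilinear_inner]
lemmas Ck_on_minus [smooth_intros] = Ck_on_bounded_linear[OF bounded_linear_minus[OF bounded_linear_ident]]
lemmas Ck_on_nth [smooth_intros] = Ck_on_bounded_linear[OF bounded_linear_vec_nth]
lemmas Ck_on_of_real [smooth_intros] = Ck_on_bounded_linear[OF bounded_linear_of_real]
lemmas Ck_on_Re [smooth_intros] = Ck_on_bounded_linear[OF bounded_linear_Re]
lemmas Ck_on_Im [smooth_intros] = Ck_on_bounded_linear[OF bounded_linear_Im]
lemma Ck_on_diff [smooth_intros]:
 "open U ==> Ck_on k U f ==> Ck_on k U g ==> Ck_on k U (\<lambda>x. f x - g x)"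
 using Ck_on_add[of U k f "\<lambda>x. - g x"] Ck_on_minus[of U k g] by simp

lemma Ck_on_sum [smooth_intros]:
 "open U ==> (\<And>i. i \<in> B ==> Ck_on k U (f i)) ==> Ck_on k U (\<lambda>x. \<Sum>i\<in>B. f i x)"
 by (induction B rule: infinite_finite_induct) (auto intro!: smooth_intros)

lemma Ck_on_power [smooth_intros]:
 fixes f :: "'a::euclidean_space => 'b::real_normed_algebra_1"
 shows "open U ==> Ck_on k U f ==> Ck_on k U (\<lambda>x. f x ^ n)"
 by (induction n) (auto intro!: smooth_intros)

lemma Ck_on_euclidean:
 fixes f :: "'a::euclidean_space => 'b::euclidean_space"
 assumes "open U" "\<And>i. i \<in> Basis ==> Ck_on k U (\<lambda>x. f x \<bullet> i)"
 shows "Ck_on k U f"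
proof -
 have "Ck_on k U (\<lambda>x. \<Sum>i\<in>Basis. (f x \<bullet> i) *R i)"
  using assms by (intro Ck_on_sum Ck_on_scaleR Ck_on_const)
 thus ?thesis by (simp add: euclidean_representation)
qed

lemma Ck_on_vec:
 fixes f :: "'a::euclidean_space => 'b::euclidean_space^'n"
 assumes "open U" "\<And>i. Ck_on k U (\<lambda>x. f x$i)"
 shows "Ck_on k U f"
proof (rule Ck_on_euclidean[OF assms(1)])
 fix b :: "'b^'n" assume "b \<in> Basis"
 then obtain i c where "b = axis i c" by (auto simp: Basis_vec_def)
 thus "Ck_on k U (\<lambda>x. f x \<bullet> b)"
  using assms(2)[of i] by (simp add: inner_axis) (intro smooth_intros assms)
qed

lemma Ck_on_Pair [smooth_intros]:
 fixes f :: "'a::euclidean_space => 'b::euclidean_space" and g :: "'a => 'c::euclidean_space"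
 assumes "open U" "Ck_on k U f" "Ck_on k U g"
 shows "Ck_on k U (\<lambda>x. (f x, g x))"
proof (rule Ck_on_euclidean[OF assms(1)])
 fix i :: "'b \<times> 'c"
 have "(\<lambda>x. (f x, g x) \<bullet> i) = (\<lambda>x. f x \<bullet> fst i + g x \<bullet> snd i)" by (simp add: inner_prod_def)
 thus "Ck_on k U (\<lambda>x. (f x, g x) \<bullet> i)"
  using assms by (auto intro!: smooth_intros)
qed

lemma Ck_on_compose:
 fixes f :: "'a::euclidean_space => 'b::euclidean_space" and g :: "'b => 'c::real_normed_vector"
 assumes "open U" "open V" "f ` U \<subseteq> V" "Ck_on k U f" "Ck_on k V g"
 shows "Ck_on k U (\<lambda>x. g (f x))"
 using assms(4,5)
proof (induction k arbitrary: g)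
 case 0
 thus ?case using continuous_on_compose2[of V g U f] assms(3) by auto
next
 case (Suc k)
 have d: "((\<lambda>x. g (f x)) has_derivative
   (\<lambda>v. FD g (f x) (FD f x v))) (at x)" if "x \<in> U" for x
 proof (rule has_derivative_compose[where f=f and g=g])
  show "(f has_derivative FD f x) (at x)"
   using Ck_on_Suc_has_derivative[OF Suc.prems(1) that] .
  show "(g has_derivative FD g (f x)) (at (f x))"
   using assms(3) that by (intro Ck_on_Suc_has_derivative[OF Suc.prems(2)]) auto
 qed
 \<comment> \<open>The direction in which \<open>g\<close> is differentiated varies with
   \<open>x\<close>. Expanding it in the basis leaves derivatives of \<open>g\<close> in fixed
   directions composed with \<open>f\<close>, which the induction hypothesis covers.\<close>
 have e: "FD g (f x) w = (\<Sum>j\<in>Basis. (w \<bullet> j) *R FD g (f x) j)"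
  if "x \<in> U" for x w
 proof -
  have l: "linear (FD g (f x))"
   using Ck_on_Suc_has_derivative[OF Suc.prems(2)] has_derivative_linear that assms(3) by blast
  have "FD g (f x) (\<Sum>i\<in>Basis. (w \<bullet> i) *R i) = (\<Sum>i\<in>Basis. (w \<bullet> i) *R FD g (f x) i)"
   by (simp add: linear_sum[OF l] linear_scale[OF l])
  thus ?thesis by (simp add: euclidean_representation)
 qed
 have "Ck_on k U (\<lambda>x. FD g (f x) (FD f x i))" if "i \<in> Basis" for i
 proof (subst Ck_on_cong[OF assms(1) e], assumption)
  show "Ck_on k U (\<lambda>x. \<Sum>j\<in>Basis. (FD f x i \<bullet> j) *R FD g (f x) j)"
  proof (intro Ck_on_sum Ck_on_scaleR Ck_on_inner assms(1) Ck_on_const)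
   fix j :: 'b assume "j \<in> Basis"
   thus "Ck_on k U (\<lambda>x. FD g (f x) j)"
    using Suc.prems Ck_on_SucD[OF Suc.prems(1)] by (intro Suc.IH[where g="\<lambda>y. FD g y j"]) auto
  qed (use Suc.prems that in auto)
 qed
 thus ?case by (subst Ck_on_Suc_iff[OF assms(1) d]) auto
qed

text \<open>The derivative of 1/f contains 1/f again, so the induction keeps \<open>f\<close> fixed
  and returns its own hypothesis to the formula. The square root is treated in the same way.\<close>

lemma Ck_on_inverse [smooth_intros]:
 fixes f :: "'a::euclidean_space => 'b::real_normed_field"
 assumes "open U" "Ck_on k U f" "\<And>x. x \<in> U ==> f x \<noteq> 0"
 shows "Ck_on k U (\<lambda>x. inverse (f x))"
 using assms(2)
proof (induction k)
 case 0
 thus ?case using assms(3) by (auto intro!: continuous_intros)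
next
 case (Suc k)
 have d: "((\<lambda>x. inverse (f x)) has_derivative
   (\<lambda>v. - (inverse (f x) * FD f x v * inverse (f x)))) (at x)" if "x \<in> U" for x
  by (rule Deriv.has_derivative_inverse[OF assms(3)[OF that] Ck_on_Suc_has_derivative[OF Suc.prems that]])
 have "Ck_on k U (\<lambda>x. inverse (f x))" using Suc Ck_on_SucD by blast
 moreover have "\<forall>i\<in>Basis. Ck_on k U (\<lambda>x. FD f x i)" using Suc.prems by simp
 ultimately show ?case
  by (intro Ck_on_SucI[OF assms(1) d] Ck_on_minus Ck_on_mult assms(1)) blast+
qed

lemma Ck_on_divide [smooth_intros]:
 fixes f :: "'a::euclidean_space => 'b::real_normed_field"
 assumes "open U" "Ck_on k U f" "Ck_on k U g" "\<And>x. x \<in> U ==> g x \<noteq> 0"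
 shows "Ck_on k U (\<lambda>x. f x / g x)"
 unfolding divide_inverse using assms by (intro smooth_intros)

lemma Ck_on_sqrt [smooth_intros]:
 assumes "open U" "Ck_on k U f" "\<And>x. x \<in> U ==> f x > 0"
 shows "Ck_on k U (\<lambda>x. sqrt (f x))"
 using assms(2)
proof (induction k)
 case 0
 thus ?case by (simp add: continuous_on_real_sqrt)
next
 case (Suc k)
 have d: "((\<lambda>x. sqrt (f x)) has_derivative
   (\<lambda>v. FD f x v * (inverse (sqrt (f x)) / 2))) (at x)" if "x \<in> U" for x
  by (rule has_derivative_real_sqrt[OF assms(3)[OF that] Ck_on_Suc_has_derivative[OF Suc.prems that]])
 have nz: "sqrt (f x) \<noteq> 0" if "x \<in> U" for x using assms(3)[OF that] by simp
 have "Ck_on k U (\<lambda>x. sqrt (f x))" using Suc Ck_on_SucD by blast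
 thus ?case using Suc.prems
  by (subst Ck_on_Suc_iff[OF assms(1) d]) (auto intro!: smooth_intros assms(1) nz)
qed

lemma Ck_on_eqI:
 "open U ==> Ck_on k U g ==> (\<And>x. x \<in> U ==> f x = g x) ==> Ck_on k U f"
 using Ck_on_cong by blast

lemma smooth_onD: "smooth_on U f ==> Ck_on k U f"
 by (simp add: smooth_on_def)

lemma smooth_onI: "(\<And>k. Ck_on k U f) ==> smooth_on U f"
 by (simp add: smooth_on_def)

lemma Ck_on_differentiable: "Ck_on (Suc k) U f ==> x \<in> U ==> f differentiable (at x)"
 by simp

lemma smooth_on_differentiable: "smooth_on U f ==> x \<in> U ==> f differentiable (at x)"
 using smooth_onD[of U f 1] by simp

lemma Ck_on_partial [smooth_intros]: "open U ==> Ck_on (Suc k) U f ==> Ck_on k U (partial f i)"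
 unfolding partial_def by (rule Ck_on_Suc_deriv)

lemma Ck_on_smooth_iff: "open U ==> smooth_on U f ==> Ck_on k U (\<lambda>x. FD f x v)"
 by (intro Ck_on_Suc_deriv smooth_onD)

text \<open>The mean value theorem, once in the direction \<open>a\<close> and once in the direction
  \<open>b\<close>. The second difference itself is symmetric in \<open>a\<close> and
  \<open>b\<close>, which is what makes mixed derivatives commute.\<close>

lemma second_difference:
 fixes f :: "'a::euclidean_space => real"
 assumes U: "ball x r \<subseteq> U" and df: "\<And>y. y \<in> U ==> f differentiable (at y)"
  and dg: "\<And>y. y \<in> U ==> (\<lambda>y. FD f y a) differentiable (at y)"
  and s: "0 < s" "s * (norm a + norm b) < r"
 obtains y where "dist x y < r"
  "f (x + s *R a + s *R b) - f (x + s *R a) - f (x + s *R b) + f x = s * (s * FD (\<lambda>y. frechet_derivative f (at y) a) y b)"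
proof -
 define D where "D = (\<lambda>y. FD f y a)"
 have inB: "x + c *R a + d *R b \<in> ball x r" if "0 \<le> c" "c \<le> s" "0 \<le> d" "d \<le> s" for c d
 proof -
  have "norm (c *R a + d *R b) \<le> c * norm a + d * norm b"
   using norm_triangle_ineq[of "c *R a" "d *R b"] that by simp
  also have "\<dots> \<le> s * (norm a + norm b)" unfolding distrib_left using that by (intro add_mono mult_right_mono) auto
  finally show ?thesis using s by (simp add: dist_norm norm_minus_commute algebra_simps)
 qed
 have line: "((\<lambda>c. h (p + c *R v)) has_real_derivative FD h (p + c *R v) v) (at c)"
  if h: "h differentiable (at (p + c *R v))" for h :: "'a => real" and p v c
 proof -
  have "((\<lambda>c. p + c *R v) has_derivative (\<lambda>t. t *R v)) (at c)" by (auto intro!: derivative_eq_intros)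
  from has_derivative_compose[OF this h[unfolded frechet_derivative_works]] show ?thesis
   unfolding has_field_derivative_def linear_scale[OF linear_frechet_derivative[OF h]] by (simp add: mult_commute_abs)
 qed
 define g where "g = (\<lambda>c. f (x + s *R b + c *R a) - f (x + c *R a))"
 have "\<exists>c>0. c < s \<and> g s - g 0 = (s - 0) * (D (x + s *R b + c *R a) - D (x + c *R a))"
 proof (rule MVT2[OF s(1)])
  fix c assume "0 \<le> c" "c \<le> s"
  thus "(g has_real_derivative D (x + s *R b + c *R a) - D (x + c *R a)) (at c)"
   unfolding g_def D_def using inB[of c s] inB[of c 0] s U
   by (intro derivative_intros line df) (auto simp: algebra_simps subset_iff)
 qed
 then obtain c where c: "0 < c" "c < s" "g s - g 0 = s * (D (x + s *R b + c *R a) - D (x + c *R a))" by auto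
 have "\<exists>d>0. d < s \<and> D (x + c *R a + s *R b) - D (x + c *R a + 0 *R b) = (s - 0) * FD D (x + c *R a + d *R b) b"
  using c inB U by (intro MVT2[OF s(1)] line dg[folded D_def]) (auto simp: subset_iff)
 then obtain d where d: "0 < d" "d < s" "D (x + c *R a + s *R b) - D (x + c *R a) = s * FD D (x + c *R a + d *R b) b" by auto
 show thesis
  by (rule that[of "x + c *R a + d *R b"]) (use inB[of c d] c d in \<open>simp_all add: g_def algebra_simps flip: D_def\<close>)
qed

lemma symmetric_second_derivative:
 fixes f :: "'a::euclidean_space => 'b::euclidean_space"
 assumes "open U" "x \<in> U" "Ck_on 2 U f"
 shows "FD (\<lambda>y. frechet_derivative f (at y) a) x b
   = FD (\<lambda>y. frechet_derivative f (at y) b) x a"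
proof -
 have C: "Ck_on (Suc (Suc 0)) U f" using assms(3) by (simp add: numeral_2_eq_2)
 have real: "FD (\<lambda>y. frechet_derivative h (at y) a) x b
   = FD (\<lambda>y. frechet_derivative h (at y) b) x a"
  if h: "Ck_on (Suc (Suc 0)) U h" for h :: "'a => real"
 proof -
  define D where "D = (\<lambda>a b y. FD (\<lambda>y. frechet_derivative h (at y) a) y b)"
  have c1: "Ck_on (Suc 0) U (\<lambda>y. FD h y v)" for v by (rule Ck_on_Suc_deriv[OF h assms(1)])
  have "continuous_on U (D v w)" for v w unfolding D_def using Ck_on_Suc_deriv[OF c1 assms(1)] by simp
  hence c: "isCont (D v w) x" for v w using assms(1,2) by (simp add: continuous_on_eq_continuous_at)
  note sd = second_difference[OF _ Ck_on_differentiable[OF h] Ck_on_differentiable[OF c1]]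
  have "dist (D a b x) (D b a x) < e" if e: "e > 0" for e
  proof -
   obtain d1 d2 where d: "d1 > 0" "\<And>y. dist y x < d1 ==> dist (D a b y) (D a b x) < e / 2"
    "d2 > 0" "\<And>y. dist y x < d2 ==> dist (D b a y) (D b a x) < e / 2"
    using c[unfolded continuous_at_eps_delta] half_gt_zero[OF e] by metis
   obtain r0 where r0: "r0 > 0" "ball x r0 \<subseteq> U" using assms(1,2) open_contains_ball by blast
   define r where "r = min r0 (min d1 d2)"
   have r: "r > 0" "ball x r \<subseteq> U" using r0 d by (auto simp: r_def)
   \<comment> \<open>The summand 1 keeps the quotient meaningful when both directions vanish and
     makes \<open>s * (norm a + norm b) < r\<close> strict.\<close>
   define s where "s = r / (norm a + norm b + 1)"
   have n: "norm a + norm b + 1 > 0" by (simp add: add_nonneg_pos)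
   have "r * (norm a + norm b) < r * (norm a + norm b + 1)" using r(1) by simp
   hence "s * (norm a + norm b) < r" by (simp only: s_def times_divide_eq_left pos_divide_less_eq[OF n])
   hence s: "s > 0" "s * (norm a + norm b) < r" "s * (norm b + norm a) < r"
    using r(1) n by (simp_all add: s_def add.commute)
   obtain y where y: "dist x y < r" "h (x + s *R a + s *R b) - h (x + s *R a) - h (x + s *R b) + h x = s * (s * D a b y)"
    by (rule sd[OF r(2) _ _ s(1,2)]) (auto simp: D_def)
   obtain z where z: "dist x z < r" "h (x + s *R b + s *R a) - h (x + s *R b) - h (x + s *R a) + h x = s * (s * D b a z)"
    by (rule sd[OF r(2) _ _ s(1,3)]) (auto simp: D_def)
   have "s * (s * D a b y) = s * (s * D b a z)" unfolding y(2)[symmetric] z(2)[symmetric] by (simp add: algebra_simps)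
   hence "D a b y = D b a z" using s(1) by simp
   thus ?thesis using d(2)[of y] d(4)[of z] y(1) z(1) dist_triangle_half_r[of "D a b y" "D a b x" e "D b a x"] by (simp add: r_def dist_commute)
  qed
  from this[of "dist (D a b x) (D b a x)"] show ?thesis unfolding D_def by fastforce
 qed
 have inner: "FD (\<lambda>y. g y \<bullet> i) y v = FD g y v \<bullet> i"
  if "g differentiable (at y)" for g :: "'a => 'b" and y v i
  using frechet_derivative_at[OF has_derivative_inner_left[OF that[unfolded frechet_derivative_works]]] by metis
 show ?thesis
 proof (rule euclidean_eqI)
  fix i :: 'b assume "i \<in> Basis"
  have *: "FD (\<lambda>y. frechet_derivative f (at y) v) x w \<bullet> i
   = FD (\<lambda>y. frechet_derivative (\<lambda>y. f y \<bullet> i) (at y) v) x w" for v w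
   unfolding inner[OF Ck_on_differentiable[OF Ck_on_Suc_deriv[OF C assms(1)] assms(2)], symmetric]
   using C inner by (subst frechet_derivative_cong_open[OF assms(1,2)]) auto
  have "Ck_on (Suc (Suc 0)) U (\<lambda>y. f y \<bullet> i)" by (intro smooth_intros assms(1) C)
  from real[OF this]
  show "FD (\<lambda>y. frechet_derivative f (at y) a) x b \<bullet> i
   = FD (\<lambda>y. frechet_derivative f (at y) b) x a \<bullet> i"
   by (simp only: *)
 qed
qed

lemma partial_partial_commute:
 fixes f :: "real^2 => 'b::euclidean_space"
 assumes "open U" "x \<in> U" "Ck_on 2 U f"
 shows "partial (partial f i) j x = partial (partial f j) i x"
 using symmetric_second_derivative[OF assms] unfolding partial_def[abs_def] .

text \<open>A left inverse \<open>G\<close> of the injective \<open>F'\<close> turns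
  \<open>F (g y) = H y\<close> into a formula for the increment of \<open>g\<close>. Continuity of
  \<open>g\<close> first gives a Lipschitz bound at \<open>x\<close>, and this bound then makes the
  remainder of \<open>F\<close> negligible.\<close>

lemma has_derivative_implicit:
 fixes g :: "'a::real_normed_vector => 'b::euclidean_space" and F :: "'b => 'c::euclidean_space"
 assumes cont: "isCont g x"
  and F: "(F has_derivative F') (at (g x))" and inj: "inj F'"
  and eq: "\<forall>\<^sub>F y in nhds x. F (g y) = H y"
  and H: "(H has_derivative H') (at x)"
 shows "\<exists>g'. (g has_derivative g') (at x) \<and> (\<forall>v. F' (g' v) = H' v)"
proof -
 have lF: "linear F'" and lH: "bounded_linear H'" using F H has_derivative_linear has_derivative_bounded_linear by blast+
 obtain G where G: "linear G" "G \<circ> F' = id" using linear_injective_left_inverse[OF lF inj] by blast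
 have bG: "bounded_linear G" using G(1) linear_conv_bounded_linear by blast
 from bG obtain K where K: "K > 0" "\<And>v. norm (G v) \<le> norm v * K"
  using bounded_linear.pos_bounded by blast
 from lH obtain M where M: "M > 0" "\<And>v. norm (H' v) \<le> norm v * M"
  using bounded_linear.pos_bounded by blast
 have Gsub: "G (v - w) = G v - G w" for v w using G(1) linear_diff by blast
 have GF: "G (F' v) = v" for v using G(2) by (metis comp_apply id_apply)
 have der: "(g has_derivative (\<lambda>v. G (H' v))) (at x)"
  unfolding has_derivative_at_alt
 proof (intro conjI allI impI)
  show "bounded_linear (\<lambda>v. G (H' v))" using bounded_linear_compose[OF bG lH] .
  fix e :: real assume "e > 0"
  define C where "C = 2 * K * (M + 1)"
  have C: "C > 0" using K M by (simp add: C_def)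
  \<comment> \<open>The first bound lets the remainder of \<open>F\<close>, at most half the
    increment, be absorbed into the left-hand side, whence the Lipschitz constant \<open>C\<close>;
    the second makes its final contribution at most \<open>e / 2\<close>.\<close>
  define e1 where "e1 = min (1 / (2 * K)) (e / (2 * K * C))"
  have e1: "e1 > 0" "e1 * K \<le> 1/2" "e1 * K * C \<le> e / 2"
   using K C \<open>e > 0\<close> by (auto simp: e1_def min_def field_simps)
  define e2 where "e2 = min 1 (e / (2 * K))"
  have e2: "e2 > 0" "e2 \<le> 1" "e2 * K \<le> e / 2"
   using K \<open>e > 0\<close> by (auto simp: e2_def min_def field_simps)
  obtain d1 where d1: "d1 > 0" and F1: "\<And>y. norm (y - g x) < d1 ==> norm (F y - F (g x) - F' (y - g x)) \<le> e1 * norm (y - g x)"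
   using F e1(1) unfolding has_derivative_at_alt by blast
  obtain d2 where d2: "d2 > 0" and H1: "\<And>y. norm (y - x) < d2 ==> norm (H y - H x - H' (y - x)) \<le> e2 * norm (y - x)"
   using H e2(1) unfolding has_derivative_at_alt by blast
  obtain d3 where d3: "d3 > 0" and g1: "\<And>y. norm (y - x) < d3 ==> norm (g y - g x) < d1"
   using cont d1 unfolding continuous_at_eps_delta dist_norm by metis
  obtain d4 where d4: "d4 > 0" and eq1: "\<And>y. norm (y - x) < d4 ==> F (g y) = H y"
   using eq unfolding eventually_nhds_metric dist_norm by metis
  show "\<exists>d>0. \<forall>y. norm (y - x) < d \<longrightarrow> norm (g y - g x - G (H' (y - x))) \<le> e * norm (y - x)"
  proof (intro exI[of _ "min d2 (min d3 d4)"] conjI allI impI)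
   show "min d2 (min d3 d4) > 0" using d2 d3 d4 by simp
   fix y assume y: "norm (y - x) < min d2 (min d3 d4)"
   define d where "d = g y - g x"
   define r1 where "r1 = F (g y) - F (g x) - F' d"
   define r2 where "r2 = H y - H x - H' (y - x)"
   have r1: "norm r1 \<le> e1 * norm d" using F1 g1 y unfolding r1_def d_def by simp
   have r2: "norm r2 \<le> e2 * norm (y - x)" using H1 y unfolding r2_def by simp
   have "F (g y) = H y" "F (g x) = H x" using eq1[of y] eq1[of x] y d4 by auto
   hence "F' d = H' (y - x) + r2 - r1" unfolding r1_def r2_def by simp
   hence *: "d = G (H' (y - x)) + G r2 - G r1"
    using GF[of d] Gsub linear_add[OF G(1)] by metis
   have "norm d \<le> norm (G (H' (y - x))) + norm (G r2) + norm (G r1)"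
    by (subst *) (meson norm_triangle_ineq4 norm_triangle_ineq order.trans add_right_mono)
   also have "\<dots> \<le> norm (y - x) * M * K + e2 * norm (y - x) * K + e1 * norm d * K"
    using K(1) M r1 r2 less_imp_le by (intro add_mono order.trans[OF K(2)] mult_right_mono) auto
   also have "\<dots> \<le> norm (y - x) * M * K + 1 * norm (y - x) * K + (e1 * K) * norm d"
    using e2 K M(1) by (intro add_mono mult_right_mono) auto
   also have "\<dots> \<le> norm (y - x) * M * K + 1 * norm (y - x) * K + 1 / 2 * norm d"
    using e1 K(1) M(1) by (intro add_mono mult_right_mono) auto
   finally have dC: "norm d \<le> C * norm (y - x)" by (simp add: C_def algebra_simps)
   have "norm (g y - g x - G (H' (y - x))) = norm (G r2 - G r1)"
    using * by (simp add: d_def)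
   also have "\<dots> \<le> norm (G r2) + norm (G r1)" by (rule norm_triangle_ineq4)
   also have "\<dots> \<le> e2 * norm (y - x) * K + e1 * norm d * K"
    using K r1 r2 by (intro add_mono order.trans[OF K(2)] mult_right_mono) auto
   also have "\<dots> = (e2 * K) * norm (y - x) + (e1 * K) * norm d" by simp
   also have "\<dots> \<le> (e / 2) * norm (y - x) + (e1 * K) * (C * norm (y - x))"
    using e2 dC e1 K by (intro add_mono mult_right_mono mult_left_mono) auto
   also have "\<dots> \<le> (e / 2) * norm (y - x) + (e / 2) * norm (y - x)"
    using mult_right_mono[OF e1(3), of "norm (y - x)"] by (simp add: algebra_simps)
   finally show "norm (g y - g x - G (H' (y - x))) \<le> e * norm (y - x)" by simp
  qed
 qed
 have "F' (G (H' v)) = H' v" for v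
 proof -
  have "((\<lambda>y. F (g y)) has_derivative (\<lambda>v. F' (G (H' v)))) (at x)"
   using has_derivative_compose[OF der F] .
  moreover have "((\<lambda>y. F (g y)) has_derivative H') (at x)"
  proof -
   obtain T where "open T" "x \<in> T" "\<forall>y\<in>T. F (g y) = H y" using eq unfolding eventually_nhds by blast
   thus ?thesis using has_derivative_transform_within_open[OF H, of T "\<lambda>y. F (g y)"] by simp
  qed
  ultimately show ?thesis using has_derivative_unique by metis
 qed
 with der show ?thesis by blast
qed

lemma jacobian_nth: "jacobian f (at z)$i$j = FD f z (axis j 1)$i"
 by (simp add: jacobian_def matrix_def)

lemma jacobian_mult:
 fixes f :: "real^'n => real^'m"
 shows "f differentiable (at z) ==> jacobian f (at z) *v v = FD f z v"
 by (simp add: jacobian_def matrix_vector_mul(2) linear_frechet_derivative)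

lemma jacobian_compose:
 fixes f :: "real^'n => real^'m" and g :: "real^'k => real^'n"
 assumes "g differentiable (at z)" "f differentiable (at (g z))"
 shows "jacobian (\<lambda>z. f (g z)) (at z) = jacobian f (at (g z)) ** jacobian g (at z)"
 using frechet_derivative_compose[OF assms] matrix_compose[OF linear_frechet_derivative[OF assms(1)] linear_frechet_derivative[OF assms(2)]]
 by (simp add: jacobian_def o_def)

lemma inj_frechet_derivative_iff_det:
 fixes f :: "real^'n => real^'n"
 assumes "f differentiable (at z)"
 shows "inj (FD f z) \<longleftrightarrow> det (jacobian f (at z)) \<noteq> 0"
 using det_nz_iff_inj[OF linear_frechet_derivative[OF assms]] by (simp add: jacobian_def)

text \<open>Bootstrapping: differentiating \<open>F (b x)\<close> gives a linear system for the
  derivative of \<open>b\<close> whose coefficients are composed with \<open>b\<close>. Cramer's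
  rule shows the derivative to be as regular as \<open>b\<close> is already known to be, so
  \<open>b\<close> gains one order.\<close>

lemma Ck_on_implicit:
 fixes b F :: "real^2 => real^2"
 assumes "open U" "open V" "continuous_on U b" "b ` U \<subseteq> V"
  and "Ck_on k V F" "Ck_on k U (\<lambda>x. F (b x))"
  and det: "\<And>y. y \<in> V ==> det (jacobian F (at y)) \<noteq> 0"
 shows "Ck_on k U b"
 using assms(5,6)
proof (induction k)
 case 0
 thus ?case using assms(3) by simp
next
 case (Suc k)
 let ?H = "\<lambda>x. F (b x)"
 let ?P = "\<lambda>x. jacobian F (at (b x))"
 let ?h = "\<lambda>x v. FD ?H x v"
 have IH: "Ck_on k U b" using Suc Ck_on_SucD by blast
 have ex: "\<exists>b'. (b has_derivative b') (at x) \<and> (\<forall>v. ?P x *v b' v = ?h x v)" if x: "x \<in> U" for x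
 proof -
  have \<gamma>x: "b x \<in> V" using x assms(4) by blast
  have Fd: "F differentiable (at (b x))" using Suc.prems(1) \<gamma>x by simp
  have c: "isCont b x" using assms(1,3) x by (simp add: continuous_on_eq_continuous_at)
  have "inj (FD F (b x))" using det[OF \<gamma>x] inj_frechet_derivative_iff_det[OF Fd] by simp
  from has_derivative_implicit[OF c _ this, where H="?H"] Fd Ck_on_Suc_has_derivative[OF Suc.prems(2) x]
  show ?thesis by (auto simp: frechet_derivative_works jacobian_mult[OF Fd])
 qed
 then obtain D where D: "\<And>x. x \<in> U ==> (b has_derivative D x) (at x)" "\<And>x v. x \<in> U ==> ?P x *v D x v = ?h x v"
  by metis
 have P: "Ck_on k U (\<lambda>x. ?P x$i$j)" for i j
  unfolding jacobian_nth
  by (intro Ck_on_nth assms(1) Ck_on_compose[OF assms(1,2,4) IH, where g="\<lambda>y. FD F y (axis j 1)"]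
    Ck_on_Suc_deriv[OF Suc.prems(1) assms(2)])
 have dP: "det (?P x) \<noteq> 0" if "x \<in> U" for x using det assms(4) that by blast
 show ?case
 proof (rule Ck_on_SucI[OF assms(1) D(1)], assumption)
  fix i :: "real^2"
  have h: "Ck_on k U (\<lambda>x. ?h x i$j)" for j
   by (intro Ck_on_nth assms(1) Ck_on_Suc_deriv[OF Suc.prems(2)])
  have cramer: "D x i$1 = (?P x$2$2 * ?h x i$1 - ?P x$1$2 * ?h x i$2) / det (?P x)"
    "D x i$2 = (?P x$1$1 * ?h x i$2 - ?P x$2$1 * ?h x i$1) / det (?P x)" if "x \<in> U" for x
   using dP[OF that] unfolding D(2)[OF that, of i, symmetric]
   by (simp_all add: matrix_vector_mult_def sum_2 det_2 field_simps)
  show "Ck_on k U (\<lambda>x. D x i)"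
  proof (rule Ck_on_vec[OF assms(1)])
   fix j :: 2
   have 1: "Ck_on k U (\<lambda>x. (?P x$2$2 * ?h x i$1 - ?P x$1$2 * ?h x i$2) / det (?P x))"
   and 2: "Ck_on k U (\<lambda>x. (?P x$1$1 * ?h x i$2 - ?P x$2$1 * ?h x i$1) / det (?P x))"
    using dP by (auto simp: det_2 intro!: Ck_on_divide Ck_on_diff Ck_on_mult P h assms(1))
   have "Ck_on k U (\<lambda>x. D x i$1)" using cramer(1) by (rule Ck_on_eqI[OF assms(1) 1])
   moreover have "Ck_on k U (\<lambda>x. D x i$2)" using cramer(2) by (rule Ck_on_eqI[OF assms(1) 2])
   ultimately show "Ck_on k U (\<lambda>x. D x i$j)" using exhaust_2[of j] by blast
  qed
 qed
qed

section \<open>The deck group\<close>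

text \<open>The lifting theorems of the library ask for a base space of a normed type.\<close>

lemma covering_space_lift_local_homotopy:
 fixes p :: "'a::real_normed_vector => 'b::topological_space"
  and h :: "real \<times> 'c::real_normed_vector => 'b"
 assumes cov: "covering_space UNIV p S"
  and h: "continuous_on ({0..1} \<times> UNIV) h" "h ` ({0..1} \<times> UNIV) \<subseteq> S"
  and f: "continuous_on UNIV f" "\<And>y. h (0, y) = p (f y)"
 shows "\<exists>N k. open N \<and> y0 \<in> N \<and> continuous_on ({0..1} \<times> N) k \<and>
  (\<forall>y\<in>N. k (0, y) = f y) \<and> (\<forall>t\<in>{0..1}. \<forall>y\<in>N. p (k (t, y)) = h (t, y))"
proof -
 \<comment> \<open>\<open>good t\<close> says that a lift exists over the times up to
   \<open>t\<close> on some neighbourhood of \<open>y0\<close>, which may shrink with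
   \<open>t\<close>. A supremum argument yields \<open>good 1\<close>.\<close>
 define good where "good = (\<lambda>t. \<exists>N k. open N \<and> y0 \<in> N \<and> continuous_on ({0..t} \<times> N) k \<and>
  (\<forall>y\<in>N. k (0, y) = f y) \<and> (\<forall>s\<in>{0..t}. \<forall>y\<in>N. p (k (s, y)) = h (s, y)))"
 have mono: "good s" if "good t" "s \<le> t" for s t
 proof -
  from that(1) obtain N k where "open N" "y0 \<in> N" "continuous_on ({0..t} \<times> N) k"
   "\<forall>y\<in>N. k (0, y) = f y" "\<forall>s\<in>{0..t}. \<forall>y\<in>N. p (k (s, y)) = h (s, y)"
   unfolding good_def by blast
  moreover have "{0..s} \<times> N \<subseteq> {0..t} \<times> N" using that(2) by auto
  ultimately show ?thesis unfolding good_def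
   using that(2) continuous_on_subset by (intro exI[of _ N] exI[of _ k]) auto
 qed
 have good0: "good 0"
  unfolding good_def
 proof (intro exI[of _ UNIV] exI[of _ "\<lambda>z. f (snd z)"] conjI)
  show "continuous_on ({0..0} \<times> UNIV) (\<lambda>z. f (snd z))"
   using continuous_on_compose2[OF f(1), of "{0..0} \<times> UNIV" snd] continuous_on_snd[OF continuous_on_id] by auto
 qed (use f(2) in auto)
 \<comment> \<open>Near \<open>(t0, y0)\<close> the homotopy stays in one evenly covered set, so a
   lift up to any good time within \<open>d\<close> of \<open>t0\<close>, on either side, extends by
   a local section beyond \<open>t0\<close> or up to 1.\<close>
 have step: "\<exists>d>0. \<forall>t\<in>{0..1}. \<bar>t - t0\<bar> < d \<and> good t \<longrightarrow> good (min 1 (t0 + d / 2))" if t0: "t0 \<in> {0..1}" for t0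
 proof -
  have "h (t0, y0) \<in> S" using h(2) t0 by auto
  then obtain T v where T: "h (t0, y0) \<in> T" "openin (top_of_set S) T"
   and v: "\<Union>v = UNIV \<inter> p -` T" "\<forall>u\<in>v. openin (top_of_set UNIV) u" "\<forall>u\<in>v. \<exists>q. homeomorphism u T p q"
   using cov unfolding covering_space_def by meson
  have "openin (top_of_set ({0..1} \<times> UNIV)) (({0..1} \<times> UNIV) \<inter> h -` T)"
   using continuous_openin_preimage[OF h(1) _ T(2)] h(2) by auto
  then obtain O' where O': "open O'" "({0..1} \<times> UNIV) \<inter> h -` T = ({0..1} \<times> UNIV) \<inter> O'"
   unfolding openin_open by blast
  have "(t0, y0) \<in> O'" using O'(2) T(1) t0 by blast
  then obtain D N0 where D: "open D" "open N0" "t0 \<in> D" "y0 \<in> N0" "D \<times> N0 \<subseteq> O'"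
   using O'(1) open_prod_elim by (metis mem_Sigma_iff)
  obtain d where d: "d > 0" "\<And>s. \<bar>s - t0\<bar> < d ==> s \<in> D"
   using D(1,3) unfolding open_dist dist_real_def by blast
  have hT: "h (s, y) \<in> T" if "s \<in> {0..1}" "\<bar>s - t0\<bar> < d" "y \<in> N0" for s y
   using that d(2) D(5) O'(2) by blast
  have "good (min 1 (t0 + d / 2))" if t: "t \<in> {0..1}" "\<bar>t - t0\<bar> < d" "good t" for t
  proof (cases "min 1 (t0 + d / 2) \<le> t")
   case True
   thus ?thesis using mono t(3) by blast
  next
   case False
   define e where "e = min 1 (t0 + d / 2)"
   have e: "t < e" "e \<le> 1" "e < t0 + d" using False d(1) by (auto simp: e_def)
   from t(3) obtain N k where k: "open N" "y0 \<in> N" "continuous_on ({0..t} \<times> N) k"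
    "\<forall>y\<in>N. k (0, y) = f y" "\<forall>s\<in>{0..t}. \<forall>y\<in>N. p (k (s, y)) = h (s, y)"
    unfolding good_def by blast
   have "p (k (t, y0)) \<in> T" using k(2,5) t hT D(4) by auto
   then obtain u where u: "u \<in> v" "k (t, y0) \<in> u" using v(1) by blast
   then obtain q where q: "homeomorphism u T p q" using v(3) by blast
   have opu: "open u" using v(2) u(1) by (simp add: openin_open)
   have "continuous_on N (\<lambda>y. k (t, y))"
    using t by (intro continuous_on_compose2[OF k(3)] continuous_intros) auto
   hence "open (N \<inter> (\<lambda>y. k (t, y)) -` u)" using k(1) opu continuous_open_preimage by blast
   hence M: "open (N \<inter> N0 \<inter> (\<lambda>y. k (t, y)) -` u)" (is "open ?M")
    using D(2) by (metis Int_assoc Int_commute open_Int)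
   define k' where "k' = (\<lambda>z. if fst z \<le> t then k z else q (h z))"
   have hTM: "h (s, y) \<in> T" if "s \<in> {t..e}" "y \<in> ?M" for s y
    using that e t by (intro hT) auto
   have "continuous_on ({0..t} \<times> ?M \<union> {t..e} \<times> ?M) k'"
    unfolding k'_def
   proof (rule continuous_on_cases_local)
    show "closedin (top_of_set ({0..t} \<times> ?M \<union> {t..e} \<times> ?M)) ({0..t} \<times> ?M)"
     unfolding closedin_closed
     using t e by (intro exI[of _ "{0..t} \<times> UNIV"]) (auto intro: closed_Times)
    show "closedin (top_of_set ({0..t} \<times> ?M \<union> {t..e} \<times> ?M)) ({t..e} \<times> ?M)"
     unfolding closedin_closed
     using t e by (intro exI[of _ "{t..e} \<times> UNIV"]) (auto intro: closed_Times)
    show "continuous_on ({0..t} \<times> ?M) k" by (rule continuous_on_subset[OF k(3)]) auto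
    have "{t..e} \<times> ?M \<subseteq> {0..1} \<times> UNIV" using t e by auto
    thus "continuous_on ({t..e} \<times> ?M) (\<lambda>z. q (h z))"
     using q hTM by (intro continuous_on_compose2[of T q _ h] continuous_on_subset[OF h(1)])
      (auto simp: homeomorphism_def)
    show "k x = q (h x)" if "x \<in> {0..t} \<times> ?M \<and> \<not> fst x \<le> t \<or> x \<in> {t..e} \<times> ?M \<and> fst x \<le> t" for x
    proof -
     from that obtain y where y: "x = (t, y)" "y \<in> ?M" by (cases x) auto
     have "q (p (k (t, y))) = k (t, y)" using q y(2) by (auto simp: homeomorphism_def)
     thus ?thesis using y t k(5) by auto
    qed
   qed
   moreover have "{0..t} \<times> ?M \<union> {t..e} \<times> ?M = {0..e} \<times> ?M" using e t by auto
   moreover have "y0 \<in> ?M" using k(2) D(4) u(2) by auto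
   moreover have "\<forall>y\<in>?M. k' (0, y) = f y" using k(4) t by (auto simp: k'_def)
   moreover have "\<forall>s\<in>{0..e}. \<forall>y\<in>?M. p (k' (s, y)) = h (s, y)"
    using k(5) hTM q by (auto simp: k'_def homeomorphism_def)
   ultimately show ?thesis using M unfolding good_def e_def[symmetric]
    by (intro exI[of _ ?M] exI[of _ k'] conjI) auto
  qed
  thus ?thesis using d(1) by blast
 qed
 \<comment> \<open>A good time arbitrarily close below the supremum is pushed past it by
   \<open>step\<close>, unless the supremum is 1.\<close>
 define t0 where "t0 = Sup {t\<in>{0..1}. good t}"
 have "0 \<in> {t\<in>{0..1}. good t}" using good0 by simp
 hence ne: "{t\<in>{0..1}. good t} \<noteq> {}" by blast
 have bdd: "bdd_above {t\<in>{0..1}. good t}" by (rule bdd_aboveI[of _ 1]) auto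
 have t00: "0 \<le> t0" unfolding t0_def using good0 by (intro cSup_upper bdd) auto
 moreover have t01: "t0 \<le> 1" unfolding t0_def by (intro cSup_least ne) auto
 ultimately have "t0 \<in> {0..1}" by simp
 from step[OF this] obtain d where d: "d > 0"
  "\<And>t. t\<in>{0..1} ==> \<bar>t - t0\<bar> < d ==> good t ==> good (min 1 (t0 + d / 2))"
  by blast
 have "t0 - d < Sup {t\<in>{0..1}. good t}" using d by (simp add: t0_def)
 then obtain t where t: "t \<in> {0..1}" "good t" "t0 - d < t" using less_cSup_iff[OF ne bdd] by blast
 have "t \<le> t0" unfolding t0_def using t by (intro cSup_upper bdd) auto
 hence g: "good (min 1 (t0 + d / 2))" using d t by simp
 have "min 1 (t0 + d / 2) \<le> t0" unfolding t0_def using g t00 d by (intro cSup_upper bdd) (auto simp: t0_def)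
 hence "good 1" using g d t01 by (auto simp: min_def split: if_splits)
 thus ?thesis unfolding good_def .
qed

lemma covering_space_lift_homotopy_UNIV:
 fixes p :: "'a::real_normed_vector => 'b::topological_space"
  and h :: "real \<times> 'c::real_normed_vector => 'b"
 assumes cov: "covering_space UNIV p S"
  and h: "continuous_on ({0..1} \<times> UNIV) h" "h ` ({0..1} \<times> UNIV) \<subseteq> S"
  and f: "continuous_on UNIV f" "\<And>y. h (0, y) = p (f y)"
 obtains k where "continuous_on ({0..1} \<times> UNIV) k" "\<And>y. k (0, y) = f y"
  "\<And>t y. t \<in> {0..1} ==> p (k (t, y)) = h (t, y)"
proof -
 obtain N K where NK: "\<And>y0. open (N y0)" "\<And>y0. y0 \<in> N y0" "\<And>y0. continuous_on ({0..1} \<times> N y0) (K y0)"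
  "\<And>y0 y. y \<in> N y0 ==> K y0 (0, y) = f y"
  "\<And>y0 t y. t \<in> {0..1} ==> y \<in> N y0 ==> p (K y0 (t, y)) = h (t, y)"
  using covering_space_lift_local_homotopy[OF assms] by metis
 define k where "k = (\<lambda>(t, y). K y (t, y))"
 \<comment> \<open>Two local lifts over the same \<open>y\<close> both start at \<open>f y\<close>;
   uniqueness of path lifting makes them equal, so the pieces glue.\<close>
 have eq: "k (t, y) = K y0 (t, y)" if "y \<in> N y0" "t \<in> {0..1}" for t y y0
 proof -
  have c: "continuous_on {0..1} (\<lambda>t. K y1 (t, y))" if "y \<in> N y1" for y1
   using that by (intro continuous_on_compose2[OF NK(3)[of y1]] continuous_intros) auto
  have "continuous_on {0..1} (\<lambda>t. h (t, y))"
   by (intro continuous_on_compose2[OF h(1)] continuous_intros) auto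
  hence "K y (t, y) = K y0 (t, y)"
  proof (rule covering_space_lift_unique[OF cov, of "\<lambda>t. K y (t, y)" 0 "\<lambda>t. K y0 (t, y)" "{0..1}", rotated])
   show "continuous_on {0..1} (\<lambda>t. K y (t, y))" "continuous_on {0..1} (\<lambda>t. K y0 (t, y))"
    using c NK(2) that by auto
  qed (use that NK(2,4,5) h(2) in auto)
  thus ?thesis by (simp add: k_def)
 qed
 have "continuous_on ({0..1} \<times> UNIV) k"
  unfolding continuous_on_def
 proof
  fix z :: "real \<times> 'c" assume z: "z \<in> {0..1} \<times> UNIV"
  have "at z within {0..1} \<times> UNIV = at z within {0..1} \<times> N (snd z)"
   using NK(1,2) by (intro at_within_nhd[of z "UNIV \<times> N (snd z)"]) (auto intro: open_Times simp: mem_Times_iff)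
  moreover have "continuous_on ({0..1} \<times> N (snd z)) k"
   using NK(3)[of "snd z"] eq by (subst continuous_on_cong[OF refl]) auto
  ultimately show "(k \<longlongrightarrow> k z) (at z within {0..1} \<times> UNIV)"
   using z NK(2)[of "snd z"] unfolding continuous_on_def by (cases z) auto
 qed
 thus ?thesis using that[of k] NK(2,4,5) by (auto simp: k_def)
qed

lemma Ck_on_local:
 assumes "\<And>x. x \<in> U ==> \<exists>V. open V \<and> x \<in> V \<and> Ck_on k V f"
 shows "Ck_on k U f"
 using assms
proof (induction k arbitrary: f)
 case 0
 have "isCont f x" if "x \<in> U" for x
  using 0[OF that] continuous_on_eq_continuous_at by (metis Ck_on.simps(1))
 thus ?case by (simp add: continuous_at_imp_continuous_on)
next
 case (Suc k)
 have "f differentiable (at x)" if "x \<in> U" for x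
  using Suc.prems[OF that] by auto
 moreover have "Ck_on k U (\<lambda>x. FD f x i)" if "i \<in> Basis" for i
  using Suc.prems that by (intro Suc.IH) fastforce
 ultimately show ?case by simp
qed

lemma smooth_on_local:
 assumes "\<And>x. x \<in> U ==> \<exists>V. open V \<and> x \<in> V \<and> smooth_on V f"
 shows "smooth_on U f"
 using assms by (auto intro!: smooth_onI Ck_on_local dest: smooth_onD)

lemma oriented_smooth_onD:
 assumes "oriented_smooth_on V F"
 shows "open V" "Ck_on k V F" "z \<in> V ==> det (jacobian F (at z)) > 0" "z \<in> V ==> F differentiable (at z)"
 using assms smooth_onD smooth_on_differentiable unfolding oriented_smooth_on_def by blast+

text \<open>In charts a lift \<open>f\<close> satisfies \<open>F (f z) = G (h z)\<close> with known
  oriented maps. Implicit regularity gives smoothness, and multiplicativity of Jacobian determinants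
  gives the orientation.\<close>

lemma oriented_smooth_on_mult:
 assumes "open W" "\<And>z. z \<in> W ==> F (f z) = G (h z)" "continuous_on W f"
  and F: "oriented_smooth_on V F" and G: "oriented_smooth_on V' G" and h: "oriented_smooth_on V'' h"
  and "f ` W \<subseteq> V" "h ` W \<subseteq> V'" "W \<subseteq> V''"
 shows "oriented_smooth_on W f"
proof -
 have op: "open V" "open V'" "open V''" using F G h by (auto simp: oriented_smooth_on_def)
 have hs: "Ck_on k W h" for k
 proof (rule Ck_on_subset[OF _ assms(9)])
  show "Ck_on k V'' h" using h by (simp add: oriented_smooth_on_def smooth_on_def)
 qed
 have H: "Ck_on k W (\<lambda>z. F (f z))" for k
 proof (rule Ck_on_eqI[OF assms(1)])
  show "Ck_on k W (\<lambda>z. G (h z))"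
  proof (rule Ck_on_compose[OF assms(1) op(2) assms(8) hs])
   show "Ck_on k V' G" using G unfolding oriented_smooth_on_def smooth_on_def by blast
  qed
 qed (use assms(2) in auto)
 have "Ck_on k W f" for k
 proof (rule Ck_on_implicit[OF assms(1) op(1) assms(3,7) _ H])
  show "Ck_on k V F" "\<And>y. y \<in> V ==> det (jacobian F (at y)) \<noteq> 0"
   using F unfolding oriented_smooth_on_def smooth_on_def by force+
 qed
 hence sm: "smooth_on W f" by (simp add: smooth_on_def)
 have "det (jacobian f (at z)) > 0" if z: "z \<in> W" for z
 proof -
  have d: "f differentiable (at z)" using sm z smooth_on_differentiable by blast
  have dF: "F differentiable (at (f z))"
   using F z assms(7) smooth_on_differentiable unfolding oriented_smooth_on_def by blast
  have dG: "G differentiable (at (h z))"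
   using G z assms(8) smooth_on_differentiable unfolding oriented_smooth_on_def by blast
  have dh: "h differentiable (at z)"
   using h z assms(9) smooth_on_differentiable unfolding oriented_smooth_on_def by blast
  have "jacobian (\<lambda>z. F (f z)) (at z) = jacobian (\<lambda>z. G (h z)) (at z)"
   unfolding jacobian_def using frechet_derivative_cong_open[OF assms(1) z assms(2)] by simp
  hence "jacobian F (at (f z)) ** jacobian f (at z) = jacobian G (at (h z)) ** jacobian h (at z)"
   unfolding jacobian_compose[OF d dF] jacobian_compose[OF dh dG] .
  hence "det (jacobian F (at (f z))) * det (jacobian f (at z)) = det (jacobian G (at (h z))) * det (jacobian h (at z))"
   by (metis det_mul)
  moreover have "det (jacobian G (at (h z))) * det (jacobian h (at z)) > 0"
   using z assms(8,9) by (intro mult_pos_pos oriented_smooth_onD(3)[OF G] oriented_smooth_onD(3)[OF h]) auto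
  moreover have "det (jacobian F (at (f z))) > 0"
   using z assms(7) by (intro oriented_smooth_onD(3)[OF F]) auto
  ultimately show ?thesis by (metis zero_less_mult_pos)
 qed
 with sm assms(1) show ?thesis by (simp add: oriented_smooth_on_def)
qed

locale surface_cover =
 fixes S :: "'a::t2_space set" and A :: "('a set \<times> ('a => real^2)) set" and p :: "real^2 => 'a"
 assumes surface: "closed_oriented_surface S A" and universal: "universal_covering S A p"
begin

lemma cov: "covering_space UNIV p S"
 using universal by (simp add: universal_covering_def)

lemma p_cont: "continuous_on UNIV p"
 using cov covering_space_imp_continuous by blast

lemma range_p: "range p = S"
 using cov covering_space_imp_surjective by blast

lemma p_in_S [simp]: "p z \<in> S"
 using range_p by blast

lemma chart_smooth: "(U, x) \<in> A ==> oriented_smooth_on (p -` U) (x \<circ> p)"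
 using universal by (auto simp: universal_covering_def)

lemma lift_unique:
 fixes f g :: "real^2 => real^2"
 assumes "continuous_on UNIV f" "continuous_on UNIV g" "\<And>z. p (f z) = p (g z)" "f a = g a"
 shows "f = g"
proof
 fix z
 have "continuous_on UNIV (\<lambda>z. p (f z))"
  using continuous_on_compose2[OF p_cont assms(1)] by simp
 from covering_space_lift_unique[where p=p and S=S and c=UNIV and ?g1.0=f and ?g2.0=g and a=a and T=UNIV,
   OF cov assms(4) this _ assms(1) _ refl assms(2) _ assms(3)]
 show "f z = g z" by (simp add: connected_UNIV)
qed

text \<open>The plane contracts radially to \<open>x\<close>. The image of this contraction under
  \<open>p\<close>, lifted from the constant start \<open>y\<close>, ends in a lift of
  \<open>p\<close>; over \<open>x\<close> itself the path is constant, so the lift sends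
  \<open>x\<close> to \<open>y\<close>. This is where deck transformations come from.\<close>

lemma translation_lift:
 assumes "p x = p y"
 obtains q where "continuous_on UNIV q" "\<And>z. p (q z) = p z" "q x = y"
proof -
 let ?h = "\<lambda>(t::real, z). p (x + t *R (z - x))"
 have "continuous_on ({0..1} \<times> UNIV) ?h"
  unfolding split_beta by (intro continuous_on_compose2[OF p_cont] continuous_intros) auto
 then obtain k where k: "continuous_on ({0..1} \<times> UNIV) k" "\<And>z::real^2. k (0, z) = y"
  "\<And>t z. t \<in> {0..1} ==> p (k (t, z)) = ?h (t, z)"
 proof (rule covering_space_lift_homotopy_UNIV[OF cov, of ?h "\<lambda>_. y"])
  show "?h ` ({0..1} \<times> UNIV) \<subseteq> S" by auto
  show "?h (0, z) = p y" for z using assms by simp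
 qed (use that in auto)
 have c: "continuous_on T (\<lambda>t. k (g t))" if "continuous_on T g" "g ` T \<subseteq> {0..1} \<times> UNIV" for T :: "'b::topological_space set" and g
  using continuous_on_compose2[OF k(1) that] .
 have "k (1, x) = y"
 proof (rule covering_space_lift_unique[OF cov, of "\<lambda>t. k (t, x)" 0 "\<lambda>_. y" "{0..1}"])
  show "continuous_on {0..1} (\<lambda>t. k (t, x))" by (rule c) (auto intro!: continuous_intros)
 qed (use k assms in auto)
 moreover have "continuous_on UNIV (\<lambda>z. k (1, z))" by (rule c) (auto intro!: continuous_intros)
 moreover have "p (k (1, z)) = p z" for z using k(3)[of 1 z] by simp
 ultimately show thesis using that by blast
qed

text \<open>Invertibility is automatic: the lift of \<open>p\<close> that takes \<open>g 0\<close>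
  back to 0 is inverse to \<open>g\<close>, because two lifts of \<open>p\<close> that agree at one
  point are equal.\<close>

lemma deck_iff: "g \<in> deck p \<longleftrightarrow> continuous_on UNIV g \<and> (\<forall>z. p (g z) = p z)"
proof
 assume "g \<in> deck p"
 thus "continuous_on UNIV g \<and> (\<forall>z. p (g z) = p z)"
  by (auto simp: deck_def homeomorphism_def fun_eq_iff)
next
 assume g: "continuous_on UNIV g \<and> (\<forall>z. p (g z) = p z)"
 then obtain d where d: "continuous_on UNIV d" "\<And>z. p (d z) = p z" "d (g 0) = 0"
  using translation_lift[of "g 0" 0] by auto
 have 1: "g \<circ> d = id"
  using g d by (intro lift_unique[where a="g 0"]) (auto simp: comp_def intro: continuous_on_compose2)
 have 2: "d \<circ> g = id"
  using g d by (intro lift_unique[where a=0]) (auto simp: comp_def intro: continuous_on_compose2)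
 have "g (d z) = z" "d (g z) = z" for z using 1 2 by (auto simp: fun_eq_iff)
 moreover from this have "range g = UNIV" "range d = UNIV" by (metis surjI)+
 ultimately have "homeomorphism UNIV UNIV g d"
  using g d by (auto simp: homeomorphism_def)
 thus "g \<in> deck p" using g by (auto simp: deck_def)
qed

lemma deck_cont: "g \<in> deck p ==> continuous_on UNIV g" and deck_p [simp]: "g \<in> deck p ==> p (g z) = p z"
 by (auto simp: deck_iff)

lemma deck_exists: "p x = p y ==> \<exists>g\<in>deck p. g x = y"
 by (metis translation_lift deck_iff)

lemma deck_eqI: "g \<in> deck p ==> d \<in> deck p ==> g a = d a ==> g = d"
 by (rule lift_unique[of _ _ a]) (simp_all add: deck_cont)

lemma id_deck [simp]: "id \<in> deck p"
 by (simp add: deck_iff continuous_on_id)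

lemma comp_deck [simp]: "g \<in> deck p ==> d \<in> deck p ==> g \<circ> d \<in> deck p"
 by (auto simp: deck_iff comp_def intro: continuous_on_compose2)

lemma inv_deck_ex: "g \<in> deck p ==> \<exists>d\<in>deck p. g \<circ> d = id \<and> d \<circ> g = id"
proof -
 assume g: "g \<in> deck p"
 then obtain d where d: "d \<in> deck p" "d (g 0) = 0" using deck_exists[of "g 0" 0] by auto
 have "g \<circ> d = id" using g d by (intro deck_eqI[where a="g 0"]) auto
 moreover have "d \<circ> g = id" using g d by (intro deck_eqI[where a=0]) auto
 ultimately show ?thesis using d by blast
qed

lemma deck_bij: "g \<in> deck p ==> bij g"
 using inv_deck_ex o_bij by metis

lemma inv_deck [simp]: "g \<in> deck p ==> inv_into UNIV g \<in> deck p"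
 using inv_deck_ex inv_unique_comp by metis

lemma deck_inv_apply [simp]: "g \<in> deck p ==> inv_into UNIV g (g z) = z" "g \<in> deck p ==> g (inv_into UNIV g z) = z"
 using deck_bij by (simp_all add: bij_is_inj bij_is_surj surj_f_inv_f)

lemma deck_inv_o [simp]: "g \<in> deck p ==> inv_into UNIV g \<circ> g = id" "g \<in> deck p ==> g \<circ> inv_into UNIV g = id"
 by (auto simp: fun_eq_iff)

lemma chart_at:
 assumes "s \<in> S" obtains U x where "(U, x) \<in> A" "s \<in> U"
 using surface assms unfolding closed_oriented_surface_def by blast

text \<open>Serves both deck transformations, with \<open>h\<close> the identity, and lifts of
  diffeomorphisms. Smoothness is local and is read off in charts.\<close>

lemma lift_smooth:
 assumes f: "continuous_on UNIV f" "\<And>z. p (f z) = h (p z)"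
  and h: "\<And>U x V y. (U, x) \<in> A ==> (V, y) \<in> A ==> oriented_smooth_on (x ` (U \<inter> h -` V)) (y \<circ> h \<circ> inv_into U x)"
 shows "oriented_smooth_on UNIV f"
proof -
 have loc: "\<exists>W. z \<in> W \<and> oriented_smooth_on W f" for z
 proof -
  obtain U x where U: "(U, x) \<in> A" "p z \<in> U" using chart_at p_in_S by metis
  obtain V y where V: "(V, y) \<in> A" "p (f z) \<in> V" using chart_at p_in_S by metis
  let ?W = "p -` U \<inter> f -` (p -` V)"
  note oU = chart_smooth[OF U(1)] and oV = chart_smooth[OF V(1)]
  have "open ?W"
   using oU oV f(1) by (metis oriented_smooth_on_def open_Int open_vimage)
  moreover have "(y \<circ> p) (f w) = (y \<circ> h \<circ> inv_into U x) ((x \<circ> p) w)" if "w \<in> ?W" for w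
  proof -
   have "homeomorphism U (x ` U) x (inv_into U x)"
    using surface U(1) unfolding closed_oriented_surface_def by blast
   hence "inv_into U x (x (p w)) = p w" using that by (auto simp: homeomorphism_def)
   thus ?thesis using f(2) by simp
  qed
  moreover have "continuous_on ?W f" using f(1) continuous_on_subset by blast
  ultimately have "oriented_smooth_on ?W f"
  proof (rule oriented_smooth_on_mult[OF _ _ _ oV h[OF U(1) V(1)] oU])
   show "(x \<circ> p) ` ?W \<subseteq> x ` (U \<inter> h -` V)"
   proof (rule image_subsetI)
    fix w assume "w \<in> ?W"
    hence "p w \<in> U \<inter> h -` V" using f(2)[of w] by simp
    thus "(x \<circ> p) w \<in> x ` (U \<inter> h -` V)" by simp
   qed
   show "f ` ?W \<subseteq> p -` V" "?W \<subseteq> p -` U" by blast+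
  qed
  moreover have "z \<in> ?W" using U V by simp
  ultimately show ?thesis by (intro exI[of _ ?W] conjI)
 qed
 have "smooth_on UNIV f"
  using loc by (intro smooth_on_local) (auto simp: oriented_smooth_on_def)
 with loc show ?thesis by (auto simp: oriented_smooth_on_def)
qed

lemma deck_smooth: "g \<in> deck p ==> oriented_smooth_on UNIV g"
proof (rule lift_smooth[where h=id])
 show "oriented_smooth_on (x ` (U \<inter> id -` V)) (y \<circ> id \<circ> inv_into U x)" if "(U, x) \<in> A" "(V, y) \<in> A" for U x V y
  using surface that unfolding closed_oriented_surface_def by auto
qed (auto simp: deck_cont)

lemma deck_Ck: "g \<in> deck p ==> Ck_on k UNIV g"
 and deck_differentiable: "g \<in> deck p ==> g differentiable (at z)"
 and deck_det: "g \<in> deck p ==> det (jacobian g (at z)) > 0"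
 using deck_smooth smooth_on_differentiable smooth_onD unfolding oriented_smooth_on_def by blast+

lemma open_inj_neighbourhood:
 obtains W where "open W" "x \<in> W" "inj_on p W" "openin (top_of_set S) (p ` W)"
proof -
 obtain T u q where T: "x \<in> T" "openin (top_of_set UNIV) T" "openin (top_of_set S) u" "homeomorphism T u p q"
  using covering_space_local_homeomorphism[OF cov] by (metis UNIV_I)
 hence "inj_on p T" "p ` T = u" by (auto simp: homeomorphism_def intro: inj_on_inverseI)
 thus thesis using that[of T] T by (auto simp: openin_open)
qed

text \<open>On a neighbourhood where \<open>p\<close> is injective, a coincidence between translates
  forces equal points, and deck elements that agree at a point are equal.\<close>

lemma deck_disjoint_neighbourhood:
 obtains W where "open W" "x \<in> W" "\<And>g d. g \<in> deck p ==> d \<in> deck p ==> g ` W \<inter> d ` W \<noteq> {} ==> g = d"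
proof -
 obtain W where W: "open W" "x \<in> W" "inj_on p W" using open_inj_neighbourhood by blast
 have "g = d" if "g \<in> deck p" "d \<in> deck p" "g ` W \<inter> d ` W \<noteq> {}" for g d
 proof -
  from that(3) obtain a b where ab: "a \<in> W" "b \<in> W" "g a = d b" by blast
  hence "p a = p b" using that by (metis deck_p)
  hence "a = b" using W(3) ab by (auto dest: inj_onD)
  thus ?thesis using deck_eqI that ab by metis
 qed
 thus thesis using that W by blast
qed

lemma deck_image_open: "g \<in> deck p ==> open W ==> open (g ` W)"
proof -
 assume g: "g \<in> deck p" and "open W"
 hence "open (inv_into UNIV g -` W)" using deck_cont[OF inv_deck[OF g]] by (rule_tac open_vimage) auto
 moreover have "g ` W = inv_into UNIV g -` W" using g by (force simp: image_iff)
 ultimately show ?thesis by simp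
qed

text \<open>Proper discontinuity. Points of one fibre have neighbourhoods related by a single deck
  element, points of different fibres are separated in the Hausdorff space \<open>S\<close>;
  compactness of \<open>K \<times> L\<close> leaves finitely many such pairs of
  neighbourhoods.\<close>

lemma deck_finite:
 assumes "compact K" "compact L"
 shows "finite {g \<in> deck p. g ` K \<inter> L \<noteq> {}}"
proof -
 have loc: "\<exists>M N. open M \<and> open N \<and> x \<in> M \<and> y \<in> N \<and> finite {g \<in> deck p. g ` M \<inter> N \<noteq> {}}" for x y
 proof (cases "p x = p y")
  case True
  then obtain g0 where g0: "g0 \<in> deck p" "g0 x = y" using deck_exists by blast
  obtain W where W: "open W" "x \<in> W" "\<And>g d. g \<in> deck p ==> d \<in> deck p ==> g ` W \<inter> d ` W \<noteq> {} ==> g = d"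
   using deck_disjoint_neighbourhood by blast
  have "{g \<in> deck p. g ` W \<inter> g0 ` W \<noteq> {}} \<subseteq> {g0}" using W(3) g0 by blast
  hence "finite {g \<in> deck p. g ` W \<inter> g0 ` W \<noteq> {}}" using finite_subset by blast
  thus ?thesis using W g0 deck_image_open by blast
 next
  case False
  then obtain M N where MN: "open M" "open N" "p x \<in> M" "p y \<in> N" "M \<inter> N = {}" using hausdorff[OF False] by blast
  have eq: "{g \<in> deck p. g ` (p -` M) \<inter> p -` N \<noteq> {}} = {}" using MN(5) by (auto simp: disjoint_iff)
  have "open (p -` M)" "open (p -` N)" using MN p_cont open_vimage by blast+
  moreover have "finite {g \<in> deck p. g ` (p -` M) \<inter> p -` N \<noteq> {}}" unfolding eq by simp
  moreover have "x \<in> p -` M" "y \<in> p -` N" using MN(3,4) by auto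
  ultimately show ?thesis by blast
 qed
 have "\<forall>z. \<exists>M N. open M \<and> open N \<and> fst z \<in> M \<and> snd z \<in> N \<and> finite {g \<in> deck p. g ` M \<inter> N \<noteq> {}}"
  using loc by simp
 then obtain M where "\<forall>z. \<exists>N. open (M z) \<and> open N \<and> fst z \<in> M z \<and> snd z \<in> N \<and> finite {g \<in> deck p. g ` M z \<inter> N \<noteq> {}}"
  by (rule choice[THEN exE])
 then obtain N where "\<forall>z. open (M z) \<and> open (N z) \<and> fst z \<in> M z \<and> snd z \<in> N z \<and> finite {g \<in> deck p. g ` M z \<inter> N z \<noteq> {}}"
  by (rule choice[THEN exE])
 hence MN: "open (M z)" "open (N z)" "fst z \<in> M z" "snd z \<in> N z"
  "finite {g \<in> deck p. g ` (M z) \<inter> (N z) \<noteq> {}}" for z by blast+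
 have "compact (K \<times> L)" using assms compact_Times by blast
 moreover have "\<And>z. open (M z \<times> N z)" using MN open_Times by blast
 moreover have "K \<times> L \<subseteq> (\<Union>z\<in>K \<times> L. M z \<times> N z)" using MN(3,4) by (force simp: mem_Times_iff)
 ultimately obtain Z where Z: "Z \<subseteq> K \<times> L" "finite Z" "K \<times> L \<subseteq> (\<Union>z\<in>Z. M z \<times> N z)"
  by (rule compactE_image[of "K \<times> L" "K \<times> L" "\<lambda>z. M z \<times> N z"])
 have "{g \<in> deck p. g ` K \<inter> L \<noteq> {}} \<subseteq> (\<Union>z\<in>Z. {g \<in> deck p. g ` (M z) \<inter> (N z) \<noteq> {}})"
 proof
  fix g assume "g \<in> {g \<in> deck p. g ` K \<inter> L \<noteq> {}}"
  then obtain k where k: "g \<in> deck p" "k \<in> K" "g k \<in> L" by blast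
  have "(k, g k) \<in> K \<times> L" using k by simp
  with Z(3) have "(k, g k) \<in> (\<Union>z\<in>Z. M z \<times> N z)" by (rule subsetD)
  then obtain z where "z \<in> Z" "k \<in> M z" "g k \<in> N z" by blast
  thus "g \<in> (\<Union>z\<in>Z. {g \<in> deck p. g ` (M z) \<inter> (N z) \<noteq> {}})" using k(1) by blast
 qed
 thus ?thesis by (rule finite_subset) (simp add: Z(2) MN(5))
qed

lemma countable_deck: "countable (deck p)"
proof -
 have "deck p \<subseteq> (\<Union>n::nat. {g \<in> deck p. g ` {0} \<inter> cball 0 (real n) \<noteq> {}})"
 proof
  fix g assume "g \<in> deck p"
  moreover obtain n where "norm (g 0) \<le> real n" using real_arch_simple by blast
  hence "g 0 \<in> g ` {0} \<inter> cball 0 (real n)" by simp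
  ultimately have "g \<in> {g \<in> deck p. g ` {0} \<inter> cball 0 (real n) \<noteq> {}}" by blast
  thus "g \<in> (\<Union>n::nat. {g \<in> deck p. g ` {0} \<inter> cball 0 (real n) \<noteq> {}})" by blast
 qed
 moreover have "countable (\<Union>n::nat. {g \<in> deck p. g ` {0} \<inter> cball 0 (real n) \<noteq> {}})"
  by (intro countable_UN[OF countableI_type] countable_finite deck_finite) auto
 ultimately show ?thesis using countable_subset by blast
qed

text \<open>The images of the balls are open and exhaust the compact \<open>S\<close>, so one ball
  meets every orbit.\<close>

lemma compact_fundamental_ball: "\<exists>r>0. p ` cball 0 r = S"
proof -
 have op: "openin (top_of_set S) (p ` ball 0 r)" for r
 proof (subst openin_subopen, intro ballI)
  fix s assume "s \<in> p ` ball 0 r"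
  then obtain x where x: "x \<in> ball 0 r" "s = p x" by blast
  obtain T u q where T: "x \<in> T" "openin (top_of_set UNIV) T" "openin (top_of_set S) u" "homeomorphism T u p q"
   using covering_space_local_homeomorphism[OF cov] by (metis UNIV_I)
  have "openin (top_of_set T) (T \<inter> ball 0 r)" by auto
  hence "openin (top_of_set u) (p ` (T \<inter> ball 0 r))" using T(4) homeomorphism_imp_open_map by blast
  hence "openin (top_of_set S) (p ` (T \<inter> ball 0 r))" using T(3) openin_trans by blast
  thus "\<exists>T. openin (top_of_set S) T \<and> s \<in> T \<and> T \<subseteq> p ` ball 0 r" using x T(1) by blast
 qed
 have "compact S" using surface by (simp add: closed_oriented_surface_def)
 have "\<forall>n::nat. \<exists>T. open T \<and> p ` ball 0 (real n) = S \<inter> T"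
  using op unfolding openin_open by blast
 then obtain Ob where Ob: "\<And>n::nat. open (Ob n)" "\<And>n::nat. p ` ball 0 (real n) = S \<inter> Ob n"
  by metis
 have "S \<subseteq> (\<Union>n. Ob n)"
 proof
  fix s assume "s \<in> S"
  then obtain x where x: "s = p x" using range_p by blast
  obtain n where "norm x < real n" using reals_Archimedean2 by blast
  hence "s \<in> p ` ball 0 (real n)" using x by auto
  thus "s \<in> (\<Union>n. Ob n)" using Ob(2) by blast
 qed
 then obtain F where F: "finite F" "S \<subseteq> (\<Union>n\<in>F. Ob n)"
  using compactE_image[OF \<open>compact S\<close>, of UNIV Ob] Ob(1) by auto
 define r where "r = real (Max (insert 1 F))"
 have "S \<subseteq> p ` cball 0 r"
 proof
  fix s assume s: "s \<in> S"
  then obtain n where n: "n \<in> F" "s \<in> Ob n" using F by blast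
  hence "s \<in> p ` ball 0 (real n)" using Ob(2) s by blast
  moreover have "real n \<le> r" unfolding r_def using n(1) F(1) by simp
  ultimately show "s \<in> p ` cball 0 r" by (force simp: image_iff)
 qed
 moreover have "r > 0" using F(1) unfolding r_def by (simp add: Max_gr_iff)
 ultimately show ?thesis using range_p by (intro exI[of _ r]) auto
qed

end

section \<open>Integration over the surface\<close>

text \<open>The cube of the positive part is half of \<open>t ^ 3 + t * (t * \<bar>t\<bar>)\<close>,
  and \<open>t * \<bar>t\<bar>\<close> is continuously differentiable with derivative
  \<open>2 * \<bar>t\<bar>\<close>. Class 2 is enough for a cut-off that is differentiated at most
  twice.\<close>

lemma Ck_on_max_cube: "Ck_on 2 UNIV (\<lambda>t::real. (max 0 t) ^ 3)"
proof -
 have d1: "((\<lambda>t. t * \<bar>t\<bar>) has_derivative (\<lambda>v. v * (2 * \<bar>t\<bar>))) (at t)" for t :: real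
 proof -
  consider "t > 0" | "t < 0" | "t = 0" by linarith
  hence "((\<lambda>t. t * \<bar>t\<bar>) has_real_derivative 2 * \<bar>t\<bar>) (at t)"
  proof cases
   case 1
   have "((\<lambda>t. t * t) has_real_derivative 2 * \<bar>t\<bar>) (at t)"
    using 1 by (auto intro!: derivative_eq_intros)
   thus ?thesis
    by (rule has_field_derivative_transform_within_open[where S="{0<..}"]) (use 1 in auto)
  next
   case 2
   have "((\<lambda>t. - (t * t)) has_real_derivative 2 * \<bar>t\<bar>) (at t)"
    using 2 by (auto intro!: derivative_eq_intros)
   thus ?thesis
    by (rule has_field_derivative_transform_within_open[where S="{..<0}"]) (use 2 in auto)
  next
   case 3
   have "(\<lambda>h::real. \<bar>h\<bar>) \<midarrow>0\<rightarrow> \<bar>0\<bar>" by (intro tendsto_intros)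
   moreover have "\<forall>\<^sub>F h in at 0. \<bar>h\<bar> = (h * \<bar>h\<bar>) / (h::real)"
    by (auto simp: eventually_at_filter)
   ultimately have "(\<lambda>h::real. (h * \<bar>h\<bar>) / h) \<midarrow>0\<rightarrow> 0" using tendsto_cong by fastforce
   thus ?thesis using 3 by (simp add: has_field_derivative_iff)
  qed
  thus ?thesis by (simp add: has_field_derivative_def mult_commute_abs)
 qed
 have 1: "Ck_on 1 UNIV (\<lambda>t::real. t * \<bar>t\<bar>)"
  unfolding One_nat_def by (rule Ck_on_SucI[OF open_UNIV d1]) (auto intro!: continuous_intros)
 have d2: "((\<lambda>t. (t ^ 3 + t * (t * \<bar>t\<bar>)) / 2) has_derivative (\<lambda>v. v * ((3 * t\<^sup>2 + 3 * (t * \<bar>t\<bar>)) / 2))) (at t)" for t :: real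
 proof -
  have "((\<lambda>t. t * (t * \<bar>t\<bar>)) has_derivative (\<lambda>v. t * (v * (2 * \<bar>t\<bar>)) + v * (t * \<bar>t\<bar>))) (at t)"
   by (rule has_derivative_mult[OF has_derivative_ident d1])
  hence T: "((\<lambda>t. t * (t * \<bar>t\<bar>)) has_real_derivative 3 * (t * \<bar>t\<bar>)) (at t)"
   unfolding has_field_derivative_def by (rule has_derivative_eq_rhs) (auto simp: algebra_simps)
  have P: "((\<lambda>t. t ^ 3) has_real_derivative 3 * t\<^sup>2) (at t)"
   by (auto intro!: derivative_eq_intros)
  show ?thesis
   by (rule has_derivative_eq_rhs[OF DERIV_cdivide[OF DERIV_add[OF P T], of 2, unfolded has_field_derivative_def]])
    (simp add: fun_eq_iff mult.commute)
 qed
 have "Ck_on (Suc 1) UNIV (\<lambda>t::real. (t ^ 3 + t * (t * \<bar>t\<bar>)) / 2)"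
  by (rule Ck_on_SucI[OF open_UNIV d2]) (intro 1 smooth_intros open_UNIV, auto)
 moreover have "(\<lambda>t::real. (t ^ 3 + t * (t * \<bar>t\<bar>)) / 2) = (\<lambda>t. (max 0 t) ^ 3)"
  by (rule ext) (auto simp: max_def abs_if power3_eq_cube)
 ultimately show ?thesis by (simp add: numeral_2_eq_2)
qed

context surface_cover
begin

definition near :: "real => real^2 => (real^2 => real^2) set" where
 "near r z = {\<gamma> \<in> deck p. norm (\<gamma> z) \<le> r}"

text \<open>The set \<open>near r z\<close> varies with the point. This larger set is finite and
  serves all points of the unit ball about \<open>z0\<close>, so that sums over the deck group can
  be differentiated term by term.\<close>

definition near_ball :: "real => real^2 => (real^2 => real^2) set" where
 "near_ball r z0 = {\<gamma> \<in> deck p. \<gamma> ` cball z0 1 \<inter> cball 0 r \<noteq> {}}"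

lemma finite_near_ball [simp]: "finite (near_ball r z0)"
 unfolding near_ball_def by (rule deck_finite) auto

lemma near_ball_deck: "g \<in> near_ball r z0 ==> g \<in> deck p"
 by (simp add: near_ball_def)

lemma near_subset: "z \<in> ball z0 1 ==> near r z \<subseteq> near_ball r z0"
 unfolding near_def near_ball_def by (auto simp: disjoint_iff)

lemma finite_near [simp]: "finite (near r z)"
 using near_subset[of z z] finite_subset[OF _ finite_near_ball] by (metis centre_in_ball zero_less_one)

lemma sum_near_ball:
 assumes "z \<in> ball z0 1" "\<And>h. h \<in> deck p ==> norm (h z) > r ==> g h = 0"
 shows "(\<Sum>h\<in>near r z. g h) = (\<Sum>h\<in>near_ball r z0. g h)"
proof (rule sum.mono_neutral_left[OF finite_near_ball near_subset[OF assms(1)]])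
 show "\<forall>h\<in>near_ball r z0 - near r z. g h = 0"
 proof
  fix h assume "h \<in> near_ball r z0 - near r z"
  hence "h \<in> deck p" "norm (h z) > r" by (auto simp: near_def near_ball_def)
  thus "g h = 0" by (rule assms(2))
 qed
qed

lemma sum_near_comp:
 assumes "d \<in> deck p"
 shows "(\<Sum>h\<in>near r (d z). g (h \<circ> d)) = (\<Sum>h\<in>near r z. g h)"
proof (rule sum.reindex_bij_betw)
 show "bij_betw (\<lambda>h. h \<circ> d) (near r (d z)) (near r z)"
 proof (rule bij_betwI[where g="\<lambda>h. h \<circ> inv_into UNIV d"])
  show "h \<circ> d \<circ> inv_into UNIV d = h" "h \<circ> inv_into UNIV d \<circ> d = h" for h
   using assms by (auto simp: fun_eq_iff)
 qed (use assms in \<open>auto simp: near_def\<close>)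
qed

text \<open>A bump that is positive on a ball meeting every orbit is divided by the sum of its
  translates, which is positive and invariant.\<close>

lemma bump_exists:
 "\<exists>r b. r > 0 \<and> Ck_on 2 UNIV b \<and> (\<forall>z. 0 \<le> b z) \<and> (\<forall>z. norm z > r \<longrightarrow> b z = 0) \<and>
  (\<forall>z. (\<Sum>h\<in>near r z. b (h z)) = (1::real))"
proof -
 obtain r0 where r0: "r0 > 0" "p ` cball 0 r0 = S" using compact_fundamental_ball by blast
 \<comment> \<open>Enlarging the radius makes the bump positive on the whole closed ball of radius
   \<open>r0\<close>.\<close>
 define r where "r = r0 + 1"
 define q where "q = (\<lambda>z::real^2. (max 0 (r\<^sup>2 - z \<bullet> z)) ^ 3)"
 have q0: "q z = 0" if "norm z > r" for z
 proof -
  have "r\<^sup>2 \<le> (norm z)\<^sup>2" using that r0 by (intro power_mono) (auto simp: r_def)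
  thus ?thesis by (simp add: q_def dot_square_norm)
 qed
 have \<psi>pos: "q z > 0" if "norm z \<le> r0" for z
 proof -
  have "(norm z)\<^sup>2 \<le> r0\<^sup>2" using that by (intro power_mono) auto
  moreover have "r0\<^sup>2 < r\<^sup>2" using r0 by (intro power_strict_mono) (auto simp: r_def)
  ultimately show ?thesis by (simp add: q_def dot_square_norm max_def)
 qed
 have \<psi>nn: "q z \<ge> 0" for z by (simp add: q_def)
 have "Ck_on 2 UNIV (\<lambda>z::real^2. r\<^sup>2 - z \<bullet> z)" by (intro smooth_intros open_UNIV)
 from Ck_on_compose[OF open_UNIV open_UNIV _ this Ck_on_max_cube]
 have \<psi>C: "Ck_on 2 UNIV q" unfolding q_def by simp
 define Q where "Q = (\<lambda>z. \<Sum>h\<in>near r z. q (h z))"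
 have pos: "Q z > 0" for z
 proof -
  have "p z \<in> p ` cball 0 r0" using r0(2) p_in_S by simp
  then obtain y where y: "norm y \<le> r0" "p z = p y" by auto
  then obtain h where h: "h \<in> deck p" "h z = y" using deck_exists by blast
  hence "h \<in> near r z" using y(1) by (auto simp: near_def r_def)
  thus ?thesis unfolding Q_def using \<psi>nn \<psi>pos[OF y(1)] h(2)
   by (intro sum_pos2[of _ h]) auto
 qed
 have \<Psi>C: "Ck_on 2 UNIV Q"
 proof (rule Ck_on_local)
  fix z0 :: "real^2"
  have "Ck_on 2 (ball z0 1) (\<lambda>z. \<Sum>h\<in>near_ball r z0. q (h z))"
  proof (intro Ck_on_sum open_ball)
   fix h assume "h \<in> near_ball r z0"
   hence "Ck_on 2 UNIV h" using deck_Ck near_ball_deck by blast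
   hence "Ck_on 2 (ball z0 1) h" using Ck_on_subset by blast
   from Ck_on_compose[OF open_ball open_UNIV _ this \<psi>C]
   show "Ck_on 2 (ball z0 1) (\<lambda>z. q (h z))" by simp
  qed
  hence "Ck_on 2 (ball z0 1) Q"
   by (rule Ck_on_eqI[OF open_ball]) (auto simp: Q_def intro!: sum_near_ball q0)
  thus "\<exists>V. open V \<and> z0 \<in> V \<and> Ck_on 2 V Q" by (intro exI[of _ "ball z0 1"]) auto
 qed
 have inv: "Q (d z) = Q z" if "d \<in> deck p" for d z
  unfolding Q_def using sum_near_comp[OF that, where g="\<lambda>h. q (h z)"] by simp
 have "(\<Sum>h\<in>near r z. q (h z) / Q (h z)) = 1" for z
 proof -
  have "(\<Sum>h\<in>near r z. q (h z) / Q (h z)) = (\<Sum>h\<in>near r z. q (h z) / Q z)"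
   using inv by (intro sum.cong) (auto simp: near_def)
  also have "\<dots> = Q z / Q z" unfolding sum_divide_distrib[symmetric] by (simp add: Q_def)
  finally show ?thesis using pos[of z] by simp
 qed
 moreover have "Ck_on 2 UNIV (\<lambda>z. q z / Q z)"
  using pos by (intro Ck_on_divide open_UNIV \<psi>C \<Psi>C) (metis less_irrefl)
 moreover have "r > 0" using r0 by (simp add: r_def)
 ultimately show ?thesis using pos \<psi>nn q0
  by (intro exI[of _ r] exI[of _ "\<lambda>z. q z / Q z"]) (auto simp: less_imp_le)
qed

definition radius :: real where
 "radius = (SOME r. \<exists>\<beta>. r > 0 \<and> Ck_on 2 UNIV \<beta> \<and> (\<forall>z. 0 \<le> \<beta> z) \<and> (\<forall>z. norm z > r \<longrightarrow> \<beta> z = 0) \<and>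
  (\<forall>z. (\<Sum>\<gamma>\<in>near r z. \<beta> (\<gamma> z)) = (1::real)))"

text \<open>A \<open>C\<^sup>2\<close> cut-off whose translates sum to one: integrating an invariant density against it is the same as
 integrating over a fundamental domain.\<close>

definition bump :: "real^2 => real" where
 "bump = (SOME \<beta>. radius > 0 \<and> Ck_on 2 UNIV \<beta> \<and> (\<forall>z. 0 \<le> \<beta> z) \<and> (\<forall>z. norm z > radius \<longrightarrow> \<beta> z = 0) \<and>
  (\<forall>z. (\<Sum>\<gamma>\<in>near radius z. \<beta> (\<gamma> z)) = (1::real)))"

lemma bump:
 shows radius_pos: "radius > 0" and bump_C2: "Ck_on 2 UNIV bump" and bump_nonneg: "0 \<le> bump z"
  and bump_zero: "norm z > radius ==> bump z = 0"
  and bump_sum: "(\<Sum>g\<in>near radius z. bump (g z)) = 1"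
proof -
 have "\<exists>b. radius > 0 \<and> Ck_on 2 UNIV b \<and> (\<forall>z. 0 \<le> b z) \<and> (\<forall>z. norm z > radius \<longrightarrow> b z = 0) \<and>
  (\<forall>z. (\<Sum>g\<in>near radius z. b (g z)) = (1::real))"
  unfolding radius_def by (rule someI_ex[OF bump_exists])
 from someI_ex[OF this]
 have "radius > 0 \<and> Ck_on 2 UNIV bump \<and> (\<forall>z. 0 \<le> bump z) \<and> (\<forall>z. norm z > radius \<longrightarrow> bump z = 0) \<and>
  (\<forall>z. (\<Sum>g\<in>near radius z. bump (g z)) = 1)"
  unfolding bump_def .
 thus "radius > 0" "Ck_on 2 UNIV bump" "0 \<le> bump z" "norm z > radius ==> bump z = 0"
  "(\<Sum>g\<in>near radius z. bump (g z)) = 1" by blast+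
qed

lemma bump_continuous: "continuous_on UNIV bump"
 using bump_C2 Ck_on_imp_continuous by blast

text \<open>Countably many open sets on which \<open>p\<close> is injective cover the plane. From
  each of them the points over the images of earlier ones are removed; what remains meets every
  fibre exactly once.\<close>

lemma borel_fundamental_domain: "\<exists>D\<in>sets borel. bij_betw p D S"
proof -
 have "\<exists>W. open W \<and> x \<in> W \<and> inj_on p W \<and> openin (top_of_set S) (p ` W)" for x
  by (rule open_inj_neighbourhood[of x]) blast
 hence "\<forall>x. \<exists>W. open W \<and> x \<in> W \<and> inj_on p W \<and> openin (top_of_set S) (p ` W)" by blast
 from choice[OF this] obtain V where
  V: "open (V x)" "x \<in> V x" "inj_on p (V x)" "openin (top_of_set S) (p ` V x)" for x by blast
 obtain F where F: "F \<subseteq> range V" "countable F" "\<Union>F = \<Union>(range V)"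
  by (rule Lindelof[of "range V"]) (use V(1) in auto)
 have "F \<noteq> {}" using F(3) V(2) by auto
 define W where "W = from_nat_into F"
 have W: "range W = F" unfolding W_def using \<open>F \<noteq> {}\<close> F(2) by (rule range_from_nat_into)
 have WV: "\<exists>x. W n = V x" for n using W F(1) by blast
 define D where "D = (\<Union>n::nat. W n - p -` (\<Union>m<n. p ` W m))"
 have op: "open (p -` (p ` W n))" for n
 proof -
  obtain T where T: "open T" "p ` W n = S \<inter> T" using V(4) WV[of n] unfolding openin_open by metis
  have "p -` (p ` W n) = p -` T" unfolding T(2) by auto
  thus ?thesis using T(1) p_cont open_vimage by metis
 qed
 have "D \<in> sets borel"
  unfolding D_def
 proof (intro sets.countable_UN sets.Diff image_subsetI)
  fix n
  show "W n \<in> sets borel" using V(1) WV[of n] by auto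
  have "open (p -` (\<Union>m<n. p ` W m))" unfolding vimage_UN using op by blast
  thus "p -` (\<Union>m<n. p ` W m) \<in> sets borel" by (rule borel_open)
 qed
 moreover have "inj_on p D"
 proof (rule inj_onI)
  fix a b assume "a \<in> D" "b \<in> D" and eq: "p a = p b"
  from \<open>a \<in> D\<close> obtain n where n: "a \<in> W n" "\<forall>k<n. p a \<notin> p ` W k" unfolding D_def by auto
  from \<open>b \<in> D\<close> obtain m where m: "b \<in> W m" "\<forall>k<m. p b \<notin> p ` W k" unfolding D_def by auto
  have "n = m" using n m eq by (metis imageI linorder_neqE_nat)
  thus "a = b" using n(1) m(1) eq V(3) WV[of n] by (metis inj_onD)
 qed
 moreover have "S \<subseteq> p ` D"
 proof
  fix s assume "s \<in> S"
  then obtain x where x: "s = p x" using range_p by blast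
  have "x \<in> \<Union>F" using F(3) V(2) by blast
  hence "\<exists>n. s \<in> p ` W n" using x W by blast
  then obtain n where n: "s \<in> p ` W n" "\<forall>k<n. s \<notin> p ` W k" using exists_least_iff[of "\<lambda>n. s \<in> p ` W n"] by blast
  then obtain y where "y \<in> W n" "s = p y" by blast
  hence "y \<in> D" unfolding D_def using n(2) by blast
  thus "s \<in> p ` D" using \<open>s = p y\<close> by blast
 qed
 ultimately show ?thesis using range_p unfolding bij_betw_def by blast
qed

end

section \<open>Change of variables and unfolding over the deck group\<close>

lemma has_absolute_integral_change_of_variables_real:
 fixes f :: "real^2 => real" and g :: "real^2 => real^2"
 assumes "S \<in> sets lebesgue" "\<And>x. x \<in> S ==> (g has_derivative g' x) (at x within S)" "inj_on g S"
 shows "(\<lambda>x. \<bar>det (matrix (g' x))\<bar> * f(g x)) absolutely_integrable_on S \<and>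
     integral S (\<lambda>x. \<bar>det (matrix (g' x))\<bar> * f(g x)) = b
  \<longleftrightarrow> f absolutely_integrable_on (g ` S) \<and> integral (g ` S) f = b"
proof -
 have "(\<lambda>x. \<bar>det (matrix (g' x))\<bar> *R vec (f(g x)) :: real ^ 1) absolutely_integrable_on S \<and>
     integral S (\<lambda>x. \<bar>det (matrix (g' x))\<bar> *R vec (f(g x))) = (vec b :: real ^ 1)
    \<longleftrightarrow> (\<lambda>x. vec (f x) :: real ^ 1) absolutely_integrable_on (g ` S) \<and>
     integral (g ` S) (\<lambda>x. vec (f x)) = (vec b :: real ^ 1)"
  by (intro has_absolute_integral_change_of_variables assms)
 thus ?thesis
  by (simp add: absolutely_integrable_on_1_iff integral_on_1_eq)
qed

lemma absolutely_integrable_compact_support: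
 fixes f :: "real^2 => 'b::euclidean_space"
 assumes "continuous_on UNIV f" "\<And>z. norm z > r ==> f z = 0"
 shows "f absolutely_integrable_on UNIV"
proof -
 obtain a :: "real^2" where a: "cball 0 r \<subseteq> cbox (- a) a"
  using bounded_subset_cbox_symmetric[OF bounded_cball] by blast
 have "f absolutely_integrable_on cbox (- a) a"
  by (intro absolutely_integrable_continuous continuous_on_subset[OF assms(1)]) auto
 hence "(\<lambda>x. if x \<in> cbox (- a) a then f x else 0) absolutely_integrable_on UNIV"
  by (simp only: absolutely_integrable_restrict_UNIV)
 moreover have "(\<lambda>x. if x \<in> cbox (- a) a then f x else 0) = f"
 proof
  fix x show "(if x \<in> cbox (- a) a then f x else 0) = f x"
   using a assms(2)[of x] by (cases "norm x \<le> r") auto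
 qed
 ultimately show ?thesis by (simp only:)
qed

context surface_cover
begin

lemma deck_measurable: "g \<in> deck p ==> g \<in> borel_measurable borel"
 using borel_measurable_continuous_onI deck_cont by blast

lemma deck_image_borel: "g \<in> deck p ==> D \<in> sets borel ==> g ` D \<in> sets borel"
proof -
 assume g: "g \<in> deck p" and D: "D \<in> sets borel"
 have "g ` D = inv_into UNIV g -` D \<inter> space borel" using g by (force simp: image_iff)
 thus ?thesis using measurable_sets[OF deck_measurable[OF inv_deck[OF g]] D] by simp
qed

lemma deck_change_of_variables:
 assumes "g \<in> deck p" "D \<in> sets lebesgue"
 shows "(\<lambda>x. det (jacobian g (at x)) * f (g x)) absolutely_integrable_on D \<and>
     integral D (\<lambda>x. det (jacobian g (at x)) * f (g x)) = b
  \<longleftrightarrow> f absolutely_integrable_on (g ` D) \<and> integral (g ` D) f = (b::real)"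
proof -
 have "\<And>x. x \<in> D ==> (g has_derivative FD g x) (at x within D)"
  using deck_differentiable[OF assms(1)] frechet_derivative_works has_derivative_at_withinI by blast
 moreover have "inj_on g D" using deck_bij[OF assms(1)] by (meson bij_is_inj inj_on_subset subset_UNIV)
 ultimately show ?thesis
  using has_absolute_integral_change_of_variables_real[OF assms(2), of g "\<lambda>x. FD g x" f b]
  by (simp add: jacobian_def abs_of_pos[OF deck_det[OF assms(1), unfolded jacobian_def]])
qed

lemma deck_nn_change:
 assumes h: "h \<in> deck p" and D: "D \<in> sets borel" and f: "continuous_on UNIV f" "\<And>z. norm z > r ==> f z = 0" "\<And>z. f z \<ge> (0::real)"
 shows "(\<integral>\<^sup>+x. ennreal (f x) * indicator (h ` D) x \<partial>lborel) =
    (\<integral>\<^sup>+x. ennreal (det (jacobian h (at x)) * f (h x)) * indicator D x \<partial>lborel)"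
proof -
 have nn: "(\<integral>\<^sup>+x. ennreal (g x) * indicator E x \<partial>lborel) = ennreal (integral E g)"
  if "g absolutely_integrable_on E" "\<And>z. g z \<ge> 0" for g :: "real^2 => real" and E
 proof -
  have "(\<integral>\<^sup>+x. ennreal (g x) * indicator E x \<partial>lborel) = (\<integral>\<^sup>+x. ennreal (indicator E x *R g x) \<partial>lebesgue)"
   unfolding nn_integral_completion by (intro nn_integral_cong) (auto simp: indicator_def)
  also have "\<dots> = ennreal (\<integral>x. indicator E x *R g x \<partial>lebesgue)"
   using that by (intro nn_integral_eq_integral) (auto simp: set_integrable_def)
  also have "(\<integral>x. indicator E x *R g x \<partial>lebesgue) = integral E g"
   using set_lebesgue_integral_eq_integral(2)[OF that(1)] by (simp add: set_lebesgue_integral_def)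
  finally show ?thesis .
 qed
 have "h ` D \<in> sets lebesgue" using deck_image_borel[OF h D] by simp
 hence 1: "f absolutely_integrable_on (h ` D)"
  using absolutely_integrable_compact_support[OF f(1,2)] set_integrable_subset by blast
 hence "(\<lambda>x. det (jacobian h (at x)) * f (h x)) absolutely_integrable_on D"
  "integral D (\<lambda>x. det (jacobian h (at x)) * f (h x)) = integral (h ` D) f"
  using deck_change_of_variables[OF h, of D f] D by auto
 thus ?thesis using nn[OF 1 f(3)] nn deck_det[OF h] f(3) by (simp add: less_imp_le)
qed

text \<open>The transformation law of the coefficient of an invariant 2-form. The determinant stands
  without absolute value because deck transformations preserve orientation.\<close>

definition invariant_density :: "(real^2 => 'b::real_vector) => bool" where
 "invariant_density w \<longleftrightarrow> (\<forall>\<gamma>\<in>deck p. \<forall>z. det (jacobian \<gamma> (at z)) *R w (\<gamma> z) = w z)"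

text \<open>Tonelli over the countable deck group: the translates of \<open>D\<close> tile the
  plane, and the translates of \<open>bump\<close> sum to one. Inserting the first fact and moving
  each tile back to \<open>D\<close> produces the sum in the second.\<close>

lemma nn_integral_fundamental_domain:
 assumes D: "D \<in> sets borel" "bij_betw p D S"
  and w: "continuous_on UNIV w" "\<And>z. w z \<ge> (0::real)" "invariant_density w"
 shows "(\<integral>\<^sup>+x. ennreal (w x) * indicator D x \<partial>lborel) = (\<integral>\<^sup>+x. ennreal (bump x * w x) \<partial>lborel)"
proof -
 let ?C = "count_space (deck p)"
 have wm: "w \<in> borel_measurable borel" using w(1) borel_measurable_continuous_onI by blast
 have bm: "bump \<in> borel_measurable borel" using bump_continuous borel_measurable_continuous_onI by blast
 have ex1: "(\<integral>\<^sup>+g. c * indicator (g ` D) x \<partial>?C) = c" for x and c :: ennreal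
 proof -
  have "p x \<in> p ` D" using D(2) by (simp add: bij_betw_def)
  then obtain y where y: "y \<in> D" "p y = p x" by (elim imageE) simp
  then obtain g where g: "g \<in> deck p" "g y = x" using deck_exists by blast
  have "d = g" if "d \<in> deck p" "x \<in> d ` D" for d
  proof -
   obtain y' where y': "y' \<in> D" "x = d y'" using \<open>x \<in> d ` D\<close> by blast
   hence "p y' = p y" using that(1) y(2) by simp
   hence "y' = y" using D(2) y(1) y'(1) by (auto simp: bij_betw_def dest: inj_onD)
   thus ?thesis using deck_eqI[OF that(1) g(1)] y' g by metis
  qed
  hence "c * indicator (d ` D) x = 0" if "d \<in> deck p" "d \<notin> {g}" for d
   using that by (metis indicator_simps(2) mult_zero_right singletonI)
  hence "(\<integral>\<^sup>+g. c * indicator (g ` D) x \<partial>?C) = (\<Sum>g\<in>{g}. c * indicator (g ` D) x)"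
   using g(1) by (intro nn_integral_count_space') simp_all
  also have "\<dots> = c" using y g by (auto simp: indicator_def)
  finally show ?thesis .
 qed
 have ex2: "(\<integral>\<^sup>+g. ennreal (bump (g x) * c) \<partial>?C) = ennreal c" if "c \<ge> 0" for x c
 proof -
  have "(\<integral>\<^sup>+g. ennreal (bump (g x) * c) \<partial>?C) = (\<Sum>g\<in>near radius x. ennreal (bump (g x) * c))"
  proof (rule nn_integral_count_space'[OF finite_near])
   show "near radius x \<subseteq> deck p" by (auto simp: near_def)
   show "ennreal (bump (g x) * c) = 0" if "g \<in> deck p" "g \<notin> near radius x" for g
   proof -
    have "norm (g x) > radius" using that by (auto simp: near_def)
    thus ?thesis by (simp add: bump_zero)
   qed
  qed
  also have "\<dots> = ennreal (\<Sum>g\<in>near radius x. bump (g x) * c)"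
   using bump_nonneg that by (intro sum_ennreal) auto
  also have "(\<Sum>g\<in>near radius x. bump (g x) * c) = c"
   unfolding sum_distrib_right[symmetric] by (simp add: bump_sum)
  finally show ?thesis .
 qed
 have "(\<integral>\<^sup>+x. ennreal (bump x * w x) \<partial>lborel) =
  (\<integral>\<^sup>+x. \<integral>\<^sup>+g. ennreal (bump x * w x) * indicator (g ` D) x \<partial>?C \<partial>lborel)"
  by (simp only: ex1)
 also have "\<dots> = (\<integral>\<^sup>+g. \<integral>\<^sup>+x. ennreal (bump x * w x) * indicator (g ` D) x \<partial>lborel \<partial>?C)"
  using deck_image_borel D(1) wm bm countable_deck
  by (intro nn_integral_count_space_nn_integral) auto
 also have "\<dots> = (\<integral>\<^sup>+g. \<integral>\<^sup>+x. ennreal (bump (g x) * w x) * indicator D x \<partial>lborel \<partial>?C)"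
 proof (rule nn_integral_cong)
  fix g assume "g \<in> space ?C"
  hence g: "g \<in> deck p" by simp
  have "(\<integral>\<^sup>+x. ennreal (bump x * w x) * indicator (g ` D) x \<partial>lborel)
   = (\<integral>\<^sup>+x. ennreal (det (jacobian g (at x)) * (bump (g x) * w (g x))) * indicator D x \<partial>lborel)"
   using bump_nonneg bump_zero w
   by (intro deck_nn_change[OF g D(1), where r=radius]) (auto intro!: continuous_intros bump_continuous)
  also have "\<dots> = (\<integral>\<^sup>+x. ennreal (bump (g x) * w x) * indicator D x \<partial>lborel)"
  proof (rule nn_integral_cong)
   fix x
   have "det (jacobian g (at x)) * w (g x) = w x" using w(3) g by (auto simp: invariant_density_def)
   hence *: "det (jacobian g (at x)) * (bump (g x) * w (g x)) = bump (g x) * w x"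
    by (metis mult.left_commute)
   thus "ennreal (det (jacobian g (at x)) * (bump (g x) * w (g x))) * indicator D x =
    ennreal (bump (g x) * w x) * indicator D x" by (simp only: *)
  qed
  finally show "(\<integral>\<^sup>+x. ennreal (bump x * w x) * indicator (g ` D) x \<partial>lborel)
   = (\<integral>\<^sup>+x. ennreal (bump (g x) * w x) * indicator D x \<partial>lborel)" .
 qed
 also have "\<dots> = (\<integral>\<^sup>+x. \<integral>\<^sup>+g. ennreal (bump (g x) * w x) * indicator D x \<partial>?C \<partial>lborel)"
 proof (rule nn_integral_count_space_nn_integral[symmetric, OF countable_deck])
  fix g assume "g \<in> deck p"
  hence [measurable]: "(\<lambda>x. bump (g x)) \<in> borel_measurable borel"
   using measurable_compose[OF deck_measurable bm] by blast
  note wm [measurable] D(1) [measurable]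
  show "(\<lambda>x. ennreal (bump (g x) * w x) * indicator D x) \<in> borel_measurable lborel" by measurable
 qed
 also have "\<dots> = (\<integral>\<^sup>+x. ennreal (w x) * indicator D x \<partial>lborel)"
  using w(2) by (intro nn_integral_cong) (simp add: nn_integral_multc ex2)
 finally show ?thesis by simp
qed

lemma invariant_density_Re: "invariant_density w ==> invariant_density (\<lambda>z. Re (w z))"
 and invariant_density_Im: "invariant_density w ==> invariant_density (\<lambda>z. Im (w z))"
proof -
 assume w: "invariant_density w"
 have "Re (det (jacobian g (at z)) *R w (g z)) = Re (w z)" "Im (det (jacobian g (at z)) *R w (g z)) = Im (w z)"
  if "g \<in> deck p" for g z
  using w that unfolding invariant_density_def by simp_all
 thus "invariant_density (\<lambda>z. Re (w z))" "invariant_density (\<lambda>z. Im (w z))"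
  unfolding invariant_density_def by simp_all
qed

lemma has_integral_fundamental_domain_real:
 assumes D: "D \<in> sets borel" "bij_betw p D S"
  and w: "continuous_on UNIV w" "invariant_density w"
 shows "has_bochner_integral lborel (\<lambda>x. indicator D x * w x) (integral UNIV (\<lambda>x. bump x * w x))"
proof -
 have pos: "has_bochner_integral lborel (\<lambda>x. indicator D x * u x) (integral UNIV (\<lambda>x. bump x * u x))"
  if u: "continuous_on UNIV u" "\<And>z. u z \<ge> (0::real)" "invariant_density u" for u
 proof -
  have um: "u \<in> borel_measurable borel" using u(1) borel_measurable_continuous_onI by blast
  have ai: "(\<lambda>x. bump x * u x) absolutely_integrable_on UNIV"
   using bump_zero by (intro absolutely_integrable_compact_support[where r=radius] continuous_intros bump_continuous u(1)) auto
  have "(\<integral>\<^sup>+x. ennreal (indicator D x * u x) \<partial>lborel) = (\<integral>\<^sup>+x. ennreal (u x) * indicator D x \<partial>lborel)"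
   by (intro nn_integral_cong) (auto simp: indicator_def)
  also have "\<dots> = (\<integral>\<^sup>+x. ennreal (bump x * u x) \<partial>lborel)"
   by (rule nn_integral_fundamental_domain[OF D u])
  also have "\<dots> = (\<integral>\<^sup>+x. ennreal (bump x * u x) \<partial>lebesgue)" by (simp add: nn_integral_completion)
  also have "\<dots> = ennreal (\<integral>x. bump x * u x \<partial>lebesgue)"
   using ai bump_nonneg u(2) by (intro nn_integral_eq_integral) (auto simp: set_integrable_def)
  also have "(\<integral>x. bump x * u x \<partial>lebesgue) = integral UNIV (\<lambda>x. bump x * u x)"
   using set_lebesgue_integral_eq_integral(2)[OF ai] by (simp add: set_lebesgue_integral_def)
  finally have "(\<integral>\<^sup>+x. ennreal (indicator D x * u x) \<partial>lborel) = ennreal (integral UNIV (\<lambda>x. bump x * u x))" .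
  moreover have "integral UNIV (\<lambda>x. bump x * u x) \<ge> 0"
   using ai bump_nonneg u(2) by (intro integral_nonneg) (auto simp: set_lebesgue_integral_eq_integral(1))
  ultimately show ?thesis using um D(1) u(2)
   by (intro has_bochner_integral_nn_integral) auto
 qed
 \<comment> \<open>Multiplication by a positive determinant commutes with positive and negative
   parts, which reduces the signed case to the nonnegative one.\<close>
 have inv: "invariant_density (\<lambda>x. max 0 (w x))" "invariant_density (\<lambda>x. max 0 (- w x))"
 proof -
  have *: "d * max 0 a = max 0 (d * a)" if "d > 0" for d a :: real
   using that by (auto simp: max_def zero_le_mult_iff)
  have "d * max 0 (- a) = max 0 (- (d * a))" if "d > 0" for d a :: real
   using *[OF that, of "-a"] by simp
  with * show "invariant_density (\<lambda>x. max 0 (w x))" "invariant_density (\<lambda>x. max 0 (- w x))"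
   using w(2) deck_det unfolding invariant_density_def by simp_all
 qed
 have c: "continuous_on UNIV (\<lambda>x. max 0 (w x))" "continuous_on UNIV (\<lambda>x. max 0 (- w x))"
  by (intro continuous_intros w(1))+
 have ii: "(\<lambda>x. bump x * u x) integrable_on UNIV" if "continuous_on UNIV u" for u
  using bump_zero set_lebesgue_integral_eq_integral(1)
  by (intro set_lebesgue_integral_eq_integral(1) absolutely_integrable_compact_support[where r=radius] continuous_intros bump_continuous that) auto
 have "has_bochner_integral lborel (\<lambda>x. indicator D x * max 0 (w x) - indicator D x * max 0 (- w x))
  (integral UNIV (\<lambda>x. bump x * max 0 (w x)) - integral UNIV (\<lambda>x. bump x * max 0 (- w x)))"
  by (intro has_bochner_integral_diff pos c inv) auto
 moreover have "integral UNIV (\<lambda>x. bump x * max 0 (w x)) - integral UNIV (\<lambda>x. bump x * max 0 (- w x))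
  = integral UNIV (\<lambda>x. bump x * max 0 (w x) - bump x * max 0 (- w x))"
  by (rule integral_diff[symmetric]) (intro ii c)+
 moreover have "b * max 0 a - b * max 0 (- a) = b * a" for a b :: real by (simp add: max_def)
 ultimately show ?thesis by simp
qed

lemma integral_bump_complex:
 fixes w :: "real^2 => complex"
 assumes "continuous_on UNIV w"
 shows "(\<lambda>x. bump x *R w x) integrable_on UNIV"
  and "integral UNIV (\<lambda>x. bump x *R w x) =
   Complex (integral UNIV (\<lambda>x. bump x * Re (w x))) (integral UNIV (\<lambda>x. bump x * Im (w x)))"
proof -
 show ii: "(\<lambda>x. bump x *R w x) integrable_on UNIV"
  using bump_zero
  by (intro set_lebesgue_integral_eq_integral(1) absolutely_integrable_compact_support[where r=radius] continuous_intros bump_continuous assms) auto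
 show "integral UNIV (\<lambda>x. bump x *R w x) =
   Complex (integral UNIV (\<lambda>x. bump x * Re (w x))) (integral UNIV (\<lambda>x. bump x * Im (w x)))"
  using integral_linear[OF ii bounded_linear_Re] integral_linear[OF ii bounded_linear_Im]
  by (simp add: complex_eq_iff o_def)
qed

text \<open>Every Borel set of representatives gives the same value, so the definite description
  denotes it. The right-hand side has a fixed compactly supported weight, ready for integration by
  parts and for differentiation in a parameter.\<close>

lemma surface_integral_eq:
 assumes "continuous_on UNIV w" "invariant_density w"
 shows "surface_integral S p w = integral UNIV (\<lambda>z. bump z *R w z)"
proof -
 have eq: "(LINT z:D|lborel. w z) = integral UNIV (\<lambda>z. bump z *R w z)"
  if D: "D \<in> sets borel" "bij_betw p D S" for D
 proof -
  have c: "continuous_on UNIV (\<lambda>z. Re (w z))" "continuous_on UNIV (\<lambda>z. Im (w z))"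
   by (intro continuous_intros assms(1))+
  note re = has_integral_fundamental_domain_real[OF D c(1) invariant_density_Re[OF assms(2)]]
  note im = has_integral_fundamental_domain_real[OF D c(2) invariant_density_Im[OF assms(2)]]
  have "has_bochner_integral lborel (\<lambda>x. complex_of_real (indicator D x * Re (w x)) + \<i> * complex_of_real (indicator D x * Im (w x)))
   (complex_of_real (integral UNIV (\<lambda>x. bump x * Re (w x))) + \<i> * complex_of_real (integral UNIV (\<lambda>x. bump x * Im (w x))))"
   by (intro has_bochner_integral_add has_bochner_integral_mult_right has_bochner_integral_bounded_linear[OF bounded_linear_of_real] re im)
  moreover have "(\<lambda>x. complex_of_real (indicator D x * Re (w x)) + \<i> * complex_of_real (indicator D x * Im (w x)))
   = (\<lambda>x. indicator D x *R w x)"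
   by (rule ext) (auto simp: complex_eq_iff indicator_def)
  ultimately have *: "has_bochner_integral lborel (\<lambda>x. indicator D x *R w x)
   (complex_of_real (integral UNIV (\<lambda>x. bump x * Re (w x))) + \<i> * complex_of_real (integral UNIV (\<lambda>x. bump x * Im (w x))))"
   by (simp only:)
  show ?thesis
   unfolding integral_bump_complex(2)[OF assms(1)] set_lebesgue_integral_def has_bochner_integral_integral_eq[OF *]
   by (simp add: Complex_eq)
 qed
 obtain D where D: "D \<in> sets borel" "bij_betw p D S" using borel_fundamental_domain by blast
 show ?thesis unfolding surface_integral_def
 proof (rule the_equality)
  show "\<exists>D\<in>sets borel. bij_betw p D S \<and> integral UNIV (\<lambda>z. bump z *R w z) = (LINT z:D|lborel. w z)"
   using eq[OF D] D by metis
 qed (use eq in metis)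
qed

end

section \<open>Stokes' theorem on the surface\<close>

no_notation fps_nth (infixl "$" 75)

declare Ck_on.simps(2) [simp del] One_nat_def [simp del]

lemma partial_eqI: "(f has_derivative D) (at x) ==> partial f k x = D (axis k 1)"
 unfolding partial_def using frechet_derivative_at by metis

lemma partial_cong:
 assumes "open U" "x \<in> U" "\<And>y. y \<in> U ==> f y = g y"
 shows "partial f k x = partial g k x"
 using frechet_derivative_cong_open[OF assms] by (simp add: partial_def)

lemma frechet_works: "f differentiable (at x) ==> (f has_derivative FD f x) (at x)"
 by (simp add: frechet_derivative_works)

lemma partial_const [simp]: "partial (\<lambda>z. c) k x = 0"
 by (rule partial_eqI[OF has_derivative_const])

lemma partial_add: "f differentiable (at x) ==> g differentiable (at x) ==>
  partial (\<lambda>z. f z + g z) k x = partial f k x + partial g k x"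
 using partial_eqI[OF has_derivative_add[OF frechet_works frechet_works]] by (simp add: partial_def)

lemma partial_diff: "f differentiable (at x) ==> g differentiable (at x) ==>
  partial (\<lambda>z. f z - g z) k x = partial f k x - partial g k x"
 using partial_eqI[OF has_derivative_diff[OF frechet_works frechet_works]] by (simp add: partial_def)

lemma partial_bounded_linear: "bounded_linear L ==> f differentiable (at x) ==>
  partial (\<lambda>z. L (f z)) k x = L (partial f k x)"
 using partial_eqI[OF bounded_linear.has_derivative[OF _ frechet_works]] by (simp add: partial_def)

lemmas partial_minus = partial_bounded_linear[OF bounded_linear_minus[OF bounded_linear_ident]]
lemmas partial_nth = partial_bounded_linear[OF bounded_linear_vec_nth]
lemmas partial_of_real = partial_bounded_linear[OF bounded_linear_of_real]
lemmas partial_Re = partial_bounded_linear[OF bounded_linear_Re]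
lemmas partial_Im = partial_bounded_linear[OF bounded_linear_Im]

lemma partial_bilinear: "bounded_bilinear B ==> f differentiable (at x) ==> g differentiable (at x) ==>
  partial (\<lambda>z. B (f z) (g z)) k x = B (f x) (partial g k x) + B (partial f k x) (g x)"
 using partial_eqI[OF bounded_bilinear.FDERIV[OF _ frechet_works frechet_works]] by (simp add: partial_def)

lemmas partial_mult = partial_bilinear[OF bounded_bilinear_mult]
lemma partial_sum: "(\<And>i. i \<in> B ==> f i differentiable (at x)) ==>
  partial (\<lambda>z. \<Sum>i\<in>B. f i z) k x = (\<Sum>i\<in>B. partial (f i) k x)"
proof -
 assume "\<And>i. i \<in> B ==> f i differentiable (at x)"
 hence "((\<lambda>z. \<Sum>i\<in>B. f i z) has_derivative (\<lambda>v. \<Sum>i\<in>B. FD (f i) x v)) (at x)"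
  by (intro has_derivative_sum frechet_works)
 from partial_eqI[OF this] show ?thesis by (simp add: partial_def)
qed

lemma frechet_partial:
 fixes f :: "real^2 => 'b::real_normed_vector"
 assumes "f differentiable (at x)"
 shows "FD f x v = (v$1) *R partial f 1 x + (v$2) *R partial f 2 x"
proof -
 have l: "linear (FD f x)" using linear_frechet_derivative[OF assms] .
 have "v = (v$1) *R axis 1 1 + (v$2) *R axis 2 1"
  by (simp add: vec_eq_iff forall_2 axis_def)
 hence "FD f x v = FD f x ((v$1) *R axis 1 1 + (v$2) *R axis 2 1)"
  by simp
 also have "\<dots> = (v$1) *R partial f 1 x + (v$2) *R partial f 2 x"
  by (simp only: linear_add[OF l] linear_scale[OF l] partial_def)
 finally show ?thesis .
qed

lemma partial_chain:
 fixes f :: "real^2 => 'b::real_normed_vector" and g :: "real^2 => real^2"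
 assumes "g differentiable (at x)" "f differentiable (at (g x))"
 shows "partial (\<lambda>z. f (g z)) k x =
  (jacobian g (at x)$1$k) *R partial f 1 (g x) + (jacobian g (at x)$2$k) *R partial f 2 (g x)"
proof -
 have "((\<lambda>z. f (g z)) has_derivative (\<lambda>v. FD f (g x) (FD g x v))) (at x)"
  using has_derivative_compose[OF frechet_works[OF assms(1)] frechet_works[OF assms(2)]] .
 from partial_eqI[OF this] show ?thesis
  by (simp add: frechet_partial[OF assms(2)] jacobian_nth)
qed

lemma jacobian_partial: "jacobian g (at z)$i$j = partial g j z$i"
 by (simp add: jacobian_nth partial_def)

text \<open>The coefficient of the exterior derivative of a 1-form, in the shape in which it occurs
  in \<open>H2_evaluation\<close>.\<close>

definition curl :: "(real^2 => complex^2) => real^2 => complex" where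
 "curl \<theta> z = partial (\<lambda>w. \<theta> w$2) 1 z - partial (\<lambda>w. \<theta> w$1) 2 z"

definition pull :: "(real^2 => real^2) => (real^2 => complex^2) => real^2 => complex^2" where
 "pull \<gamma> \<theta> z = (\<chi> j. \<Sum>i\<in>UNIV. \<theta> (\<gamma> z)$i * complex_of_real (jacobian \<gamma> (at z)$i$j))"

lemma Ck_on_jacobian_entry:
 fixes g :: "real^2 => real^'n"
 shows "open U ==> Ck_on (Suc k) U g ==> Ck_on k U (\<lambda>z. jacobian g (at z)$i$j)"
 unfolding jacobian_partial by (intro smooth_intros)

lemma Ck_1_differentiable: "Ck_on 1 U f ==> x \<in> U ==> f differentiable (at x)"
 and Ck_2_differentiable: "Ck_on 2 U f ==> x \<in> U ==> f differentiable (at x)"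
 by (auto simp: numeral_2_eq_2 One_nat_def Ck_on.simps(2))

lemma Ck_2_partial: "open U ==> Ck_on 2 U f ==> Ck_on 1 U (partial f i)"
 using Ck_on_partial[of U 1 f i] by (simp add: numeral_2_eq_2 One_nat_def)

text \<open>Exterior differentiation commutes with pullback: the second derivatives of
  \<open>g\<close> enter symmetrically and cancel.\<close>

lemma curl_pull:
 assumes g: "Ck_on 2 UNIV g" and \<theta>: "Ck_on 1 UNIV \<theta>"
 shows "curl (pull g \<theta>) z = det (jacobian g (at z)) *R curl \<theta> (g z)"
proof -
 have d\<gamma>: "g differentiable (at z)" using Ck_2_differentiable[OF g] by simp
 have dJ: "(\<lambda>z. jacobian g (at z)$i$j) differentiable (at z)" for i j
  using Ck_1_differentiable[OF Ck_on_jacobian_entry[OF open_UNIV, of 1 g i j]] g by (simp add: numeral_2_eq_2 One_nat_def)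
 have dp: "partial g i differentiable (at z)" for i
  using Ck_2_partial[OF open_UNIV g] Ck_1_differentiable by blast
 have \<theta>1: "Ck_on 1 UNIV (\<lambda>z. \<theta> z$i)" for i by (intro smooth_intros open_UNIV \<theta>)
 have d\<theta>: "(\<lambda>z. \<theta> z$i) differentiable (at (g z))" for i
  using Ck_1_differentiable[OF \<theta>1] by simp
 have d\<theta>\<gamma>: "(\<lambda>z. \<theta> (g z)$i) differentiable (at z)" for i
  using differentiable_compose[OF d\<theta> d\<gamma>] by simp
 have dJ': "(\<lambda>z. complex_of_real (jacobian g (at z)$i$j)) differentiable (at z)" for i j
  using dJ[of i j] has_derivative_of_real unfolding differentiable_def by blast
 have J2: "partial (\<lambda>z. jacobian g (at z)$i$j) k z = partial (partial g j) k z$i" for i j k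
  unfolding jacobian_partial by (rule partial_nth[OF dp])
 have P: "partial (\<lambda>z. pull g \<theta> z$j) k z = (\<Sum>i\<in>UNIV. \<theta> (g z)$i * complex_of_real (partial (partial g j) k z$i)
  + (jacobian g (at z)$1$k *R partial (\<lambda>z. \<theta> z$i) 1 (g z) + jacobian g (at z)$2$k *R partial (\<lambda>z. \<theta> z$i) 2 (g z))
    * complex_of_real (jacobian g (at z)$i$j))" for j k
  unfolding pull_def vec_lambda_beta
  by (subst partial_sum, intro differentiable_mult d\<theta>\<gamma> dJ', intro sum.cong refl,
    subst partial_mult[OF d\<theta>\<gamma> dJ'], subst partial_of_real[OF dJ], subst J2,
    subst partial_chain[OF d\<gamma> d\<theta>], rule refl)
 have sym: "partial (partial g 1) 2 z = partial (partial g 2) 1 z"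
  by (rule partial_partial_commute[OF open_UNIV _ g]) simp
 show ?thesis
  unfolding curl_def P sum_2 sym det_2 by (simp add: scaleR_conv_of_real algebra_simps)
qed

lemma curl_cong:
 assumes "open U" "x \<in> U" "\<And>y. y \<in> U ==> f y = g y"
 shows "curl f x = curl g x"
 unfolding curl_def
 using partial_cong[OF assms(1,2), of "\<lambda>w. f w$2" "\<lambda>w. g w$2"] partial_cong[OF assms(1,2), of "\<lambda>w. f w$1" "\<lambda>w. g w$1"] assms(3)
 by simp

lemma curl_add:
 assumes "f differentiable (at z)" "g differentiable (at z)"
 shows "curl (\<lambda>z. f z + g z) z = curl f z + curl g z"
proof -
 have d: "(\<lambda>z. h z$i) differentiable (at z)" if "h differentiable (at z)" for h :: "real^2 => complex^2" and i
  using that bounded_linear.has_derivative[OF bounded_linear_vec_nth] unfolding differentiable_def by blast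
 show ?thesis using assms by (simp add: curl_def partial_add d)
qed

lemma curl_sum:
 assumes "finite B" "\<And>i. i \<in> B ==> f i differentiable (at z)"
 shows "curl (\<lambda>z. \<Sum>i\<in>B. f i z) z = (\<Sum>i\<in>B. curl (f i) z)"
 using assms
proof (induction B rule: finite_induct)
 case empty
 show ?case by (simp add: curl_def)
next
 case (insert i B)
 thus ?case by (simp add: curl_add)
qed

lemma curl_gradient:
 assumes "Ck_on 2 UNIV h"
 shows "curl (\<lambda>z. \<chi> j. partial h j z) z = 0"
 using partial_partial_commute[OF open_UNIV _ assms, of z 1 2] by (simp add: curl_def)

lemma integral_translation_real:
 fixes f :: "real^2 => real"
 assumes "f absolutely_integrable_on UNIV"
 shows "integral UNIV (\<lambda>z. f (z + a)) = integral UNIV f"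
proof -
 have "inj (\<lambda>z::real^2. z + a)" by (simp add: inj_on_def)
 moreover have "range (\<lambda>z::real^2. z + a) = UNIV" by (rule surjI[of _ "\<lambda>z. z - a"]) simp
 moreover have "\<And>x. ((\<lambda>z::real^2. z + a) has_derivative (\<lambda>v. v)) (at x within UNIV)" by (auto intro!: derivative_eq_intros)
 ultimately show ?thesis
  using has_absolute_integral_change_of_variables_real[of UNIV "\<lambda>z. z + a" "\<lambda>_ v. v" f "integral UNIV f"] assms
  by (simp add: matrix_id_mat_1 flip: id_def)
qed

text \<open>The integral of the translate of \<open>f\<close> by \<open>t *R axis k 1\<close> does
  not depend on \<open>t\<close>; differentiating under the integral sign at 0 gives the integral of
  the partial derivative.\<close>

lemma integral_partial_real:
 fixes f :: "real^2 => real"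
 assumes f: "Ck_on 1 UNIV f" and supp: "\<And>z. norm z > r ==> f z = 0"
 shows "integral UNIV (partial f k) = 0"
proof -
 let ?e = "axis k 1 :: real^2"
 \<comment> \<open>Radius \<open>r + 1\<close>, because the support is translated by vectors of
   length at most one.\<close>
 obtain a :: "real^2" where a: "cball 0 (r + 1) \<subseteq> cbox (- a) a"
  using bounded_subset_cbox_symmetric[OF bounded_cball] by blast
 have fc: "continuous_on UNIV f" using f Ck_on_imp_continuous by blast
 have pc: "continuous_on UNIV (partial f k)"
  using Ck_on_partial[OF open_UNIV, of 0 f k] f by (simp add: One_nat_def)
 have fd: "f differentiable (at z)" for z using Ck_1_differentiable[OF f] by simp
 have restrict: "integral (cbox (- a) a) g = integral UNIV g" if "\<And>z. norm z > r + 1 ==> g z = 0" for g :: "real^2 => real"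
 proof -
  have "(\<lambda>z. if z \<in> cbox (- a) a then g z else 0) = g"
  proof
   fix x show "(if x \<in> cbox (- a) a then g x else 0) = g x"
    using a that[of x] by (cases "norm x \<le> r + 1") auto
  qed
  thus ?thesis using integral_restrict_UNIV[of "cbox (- a) a" g] by simp
 qed
 have D: "((\<lambda>t. integral (cbox (- a) a) (\<lambda>z. f (z + t *R ?e))) has_vector_derivative
   integral (cbox (- a) a) (\<lambda>z. partial f k (z + 0 *R ?e))) (at 0 within {-1..1})"
 proof (rule leibniz_rule_vector_derivative)
  fix t z
  have "((\<lambda>t. z + t *R ?e) has_derivative (\<lambda>s. s *R ?e)) (at t within {-1..1})"
   by (auto intro!: derivative_eq_intros)
  from has_derivative_compose[OF this frechet_works[OF fd]]
  show "((\<lambda>t. f (z + t *R ?e)) has_vector_derivative partial f k (z + t *R ?e)) (at t within {-1..1})"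
   unfolding has_vector_derivative_def partial_def
   by (simp add: linear_scale[OF linear_frechet_derivative[OF fd]])
  show "(\<lambda>z. f (z + t *R ?e)) integrable_on cbox (- a) a"
   by (intro integrable_continuous continuous_on_compose2[OF fc] continuous_intros) auto
 next
  show "continuous_on ({-1..1} \<times> cbox (- a) a) (\<lambda>(t, z). partial f k (z + t *R ?e))"
   unfolding split_beta by (intro continuous_on_compose2[OF pc] continuous_intros) auto
 qed auto
 have E: "integral (cbox (- a) a) (\<lambda>z. f (z + t *R ?e)) = integral UNIV f" if "t \<in> {-1..1}" for t
 proof -
  have "f (z + t *R ?e) = 0" if "norm z > r + 1" for z
  proof (rule supp)
   have "norm z \<le> norm (z + t *R ?e) + norm (t *R ?e)"
    by (metis add_diff_cancel_right' norm_triangle_ineq4)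
   moreover have "norm (t *R ?e) \<le> 1" using \<open>t \<in> {-1..1}\<close> by (auto simp: norm_axis_1)
   ultimately show "norm (z + t *R ?e) > r" using that by simp
  qed
  hence "integral (cbox (- a) a) (\<lambda>z. f (z + t *R ?e)) = integral UNIV (\<lambda>z. f (z + t *R ?e))"
   by (rule restrict)
  also have "\<dots> = integral UNIV f"
   by (rule integral_translation_real[OF absolutely_integrable_compact_support[OF fc supp]])
  finally show ?thesis .
 qed
 have "((\<lambda>t. integral UNIV f) has_vector_derivative
   integral (cbox (- a) a) (\<lambda>z. partial f k (z + 0 *R ?e))) (at 0 within {-1..1})"
  by (rule has_vector_derivative_transform[OF _ E[symmetric] D]) auto
 hence 1: "((\<lambda>t. integral UNIV f) has_vector_derivative integral (cbox (- a) a) (partial f k)) (at 0)"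
  by (simp add: at_within_Icc_at)
 have 0: "integral (cbox (- a) a) (partial f k) = 0"
  by (rule vector_derivative_unique_at[OF 1 has_vector_derivative_const])
 have "partial f k z = 0" if "norm z > r + 1" for z
 proof -
  have "partial f k z = partial (\<lambda>_. 0) k z"
   by (rule partial_cong[of "- cball 0 r"]) (use that supp in auto)
  thus ?thesis by simp
 qed
 from restrict[OF this] 0 show ?thesis by simp
qed

lemma integral_curl_compact_support:
 assumes \<theta>: "Ck_on 1 UNIV \<theta>" and supp: "\<And>z. norm z > r ==> \<theta> z = 0"
 shows "integral UNIV (curl \<theta>) = 0"
proof -
 have P: "((partial (\<lambda>z. \<theta> z$j) k) has_integral 0) UNIV" for j k
 proof -
  have c: "Ck_on 1 UNIV (\<lambda>z. \<theta> z$j)" by (intro smooth_intros open_UNIV \<theta>)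
  have d: "(\<lambda>z. \<theta> z$j) differentiable (at z)" for z using Ck_1_differentiable[OF c] by simp
  have "Ck_on 0 UNIV (partial (\<lambda>z. \<theta> z$j) k)" using Ck_on_partial[OF open_UNIV, of 0] c by (simp add: One_nat_def)
  hence pc: "continuous_on UNIV (partial (\<lambda>z. \<theta> z$j) k)" by simp
  have "partial (\<lambda>z. \<theta> z$j) k z = 0" if "norm z > r" for z
  proof -
   have "partial (\<lambda>z. \<theta> z$j) k z = partial (\<lambda>_. 0) k z"
    by (rule partial_cong[of "- cball 0 r"]) (use that supp in auto)
   thus ?thesis by simp
  qed
  hence i: "(partial (\<lambda>z. \<theta> z$j) k) integrable_on UNIV"
   by (intro set_lebesgue_integral_eq_integral(1) absolutely_integrable_compact_support[OF pc]) auto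
  have "Re (integral UNIV (partial (\<lambda>z. \<theta> z$j) k)) = integral UNIV (partial (\<lambda>z. Re (\<theta> z$j)) k)"
   using integral_linear[OF i bounded_linear_Re] unfolding partial_Re[OF d, THEN ext[where g="\<lambda>x. Re (partial (\<lambda>z. \<theta> z$j) k x)"]] by (simp add: o_def)
  also have "\<dots> = 0" by (rule integral_partial_real[where r=r]) (auto intro!: smooth_intros c simp: supp)
  finally have re: "Re (integral UNIV (partial (\<lambda>z. \<theta> z$j) k)) = 0" .
  have "Im (integral UNIV (partial (\<lambda>z. \<theta> z$j) k)) = integral UNIV (partial (\<lambda>z. Im (\<theta> z$j)) k)"
   using integral_linear[OF i bounded_linear_Im] unfolding partial_Im[OF d, THEN ext[where g="\<lambda>x. Im (partial (\<lambda>z. \<theta> z$j) k x)"]] by (simp add: o_def)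
  also have "\<dots> = 0" by (rule integral_partial_real[where r=r]) (auto intro!: smooth_intros c simp: supp)
  finally have "integral UNIV (partial (\<lambda>z. \<theta> z$j) k) = 0" using re by (simp add: complex_eq_iff)
  thus ?thesis using integrable_integral[OF i] by simp
 qed
 have "(curl \<theta> has_integral 0 - 0) UNIV"
  unfolding curl_def by (intro has_integral_diff P)
 thus ?thesis by (simp add: integral_unique)
qed

lemma Ck_on_curl: "Ck_on 1 UNIV \<theta> ==> continuous_on UNIV (curl \<theta>)"
proof -
 assume \<theta>: "Ck_on 1 UNIV \<theta>"
 have "Ck_on 0 UNIV (partial (\<lambda>z. \<theta> z$j) k)" for j k
  using Ck_on_partial[OF open_UNIV, of 0 "\<lambda>z. \<theta> z$j"] Ck_on_nth[OF open_UNIV \<theta>] by (simp add: One_nat_def)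
 thus ?thesis unfolding curl_def by (auto intro!: continuous_intros)
qed

context surface_cover
begin

lemma deck_integral:
 fixes f :: "real^2 => complex"
 assumes g: "g \<in> deck p" and f: "continuous_on UNIV f" "\<And>z. norm z > r ==> f z = 0"
 shows "((\<lambda>z. det (jacobian g (at z)) *R f (g z)) has_integral integral UNIV f) UNIV"
proof -
 have real: "((\<lambda>z. det (jacobian g (at z)) * h (g z)) has_integral integral UNIV h) UNIV"
  if "continuous_on UNIV h" "\<And>z. norm z > r ==> h z = (0::real)" for h
 proof -
  have "h absolutely_integrable_on g ` UNIV"
   using absolutely_integrable_compact_support[OF that] deck_bij[OF g] by (simp add: bij_is_surj)
  hence "(\<lambda>z. det (jacobian g (at z)) * h (g z)) absolutely_integrable_on UNIV"
   "integral UNIV (\<lambda>z. det (jacobian g (at z)) * h (g z)) = integral UNIV h"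
   using deck_change_of_variables[OF g, of UNIV h "integral UNIV h"] deck_bij[OF g] by (simp_all add: bij_is_surj)
  thus ?thesis
   using set_lebesgue_integral_eq_integral(1) unfolding has_integral_integrable_integral by blast
 qed
 have i: "f integrable_on UNIV"
  by (intro set_lebesgue_integral_eq_integral(1) absolutely_integrable_compact_support[OF f])
 have "((\<lambda>z. complex_of_real (det (jacobian g (at z)) * Re (f (g z))) + \<i> * complex_of_real (det (jacobian g (at z)) * Im (f (g z))))
  has_integral (complex_of_real (integral UNIV (\<lambda>z. Re (f z))) + \<i> * complex_of_real (integral UNIV (\<lambda>z. Im (f z))))) UNIV"
  by (intro has_integral_add has_integral_mult_right has_integral_linear[OF _ bounded_linear_of_real, unfolded o_def] real continuous_intros f)
   (auto simp: f(2))
 moreover have "complex_of_real (integral UNIV (\<lambda>z. Re (f z))) + \<i> * complex_of_real (integral UNIV (\<lambda>z. Im (f z))) = integral UNIV f"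
  using integral_linear[OF i bounded_linear_Re] integral_linear[OF i bounded_linear_Im] by (simp add: complex_eq_iff o_def)
 moreover have "complex_of_real (d * Re a) + \<i> * complex_of_real (d * Im a) = d *R a" for d a
  by (simp add: complex_eq_iff)
 ultimately show ?thesis by simp
qed

text \<open>The constant one is written as the sum of the translates of \<open>bump\<close>. After
  \<open>h\<close> is replaced by its inverse in this sum, a change of variables by \<open>h\<close>
  moves the translation from the cut-off to \<open>b\<close>.\<close>

lemma integral_unfold:
 fixes b :: "real^2 => complex"
 assumes b: "continuous_on UNIV b" "\<And>z. norm z > radius ==> b z = 0"
 shows "integral UNIV b = integral UNIV (\<lambda>z. bump z *R (\<Sum>h\<in>near radius z. det (jacobian h (at z)) *R b (h z)))"
proof -
 \<comment> \<open>A finite index set, closed under inversion, that contains every element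
   contributing on the ball carrying \<open>bump\<close> and \<open>b\<close>.\<close>
 define H where "H = {h \<in> deck p. h ` cball 0 radius \<inter> cball 0 radius \<noteq> {}}"
 have finH: "finite H" unfolding H_def by (intro deck_finite compact_cball)
 have Hd: "h \<in> deck p" if "h \<in> H" for h using that by (simp add: H_def)
 have sub: "near radius z \<subseteq> H" if "norm z \<le> radius" for z
 proof
  fix h assume "h \<in> near radius z"
  hence "h \<in> deck p" "h z \<in> h ` cball 0 radius \<inter> cball 0 radius" using that by (auto simp: near_def)
  thus "h \<in> H" unfolding H_def by blast
 qed
 have Hinv: "bij_betw (inv_into UNIV) H H"
 proof (rule bij_betwI[where g="inv_into UNIV"])
  show "inv_into UNIV \<in> H \<rightarrow> H"
  proof
   fix h assume "h \<in> H"
   then obtain x where x: "h \<in> deck p" "norm x \<le> radius" "norm (h x) \<le> radius" unfolding H_def by auto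
   hence "x \<in> inv_into UNIV h ` cball 0 radius \<inter> cball 0 radius"
    by (intro IntI image_eqI[where x="h x"]) simp_all
   thus "inv_into UNIV h \<in> H" using x(1) unfolding H_def by auto
  qed
  thus "inv_into UNIV \<in> H \<rightarrow> H" .
 qed (auto dest!: Hd simp: inv_inv_eq deck_bij)
 have 1: "b z = (\<Sum>h\<in>H. bump (h z) *R b z)" for z
 proof (cases "norm z \<le> radius")
  case True
  have "(\<Sum>h\<in>H. bump (h z)) = (\<Sum>h\<in>near radius z. bump (h z))"
   using bump_zero Hd by (intro sum.mono_neutral_right[OF finH sub[OF True]]) (auto simp: near_def not_le)
  thus ?thesis unfolding scaleR_sum_left[symmetric] by (simp add: bump_sum)
 qed (simp add: b)
 have 2: "(\<Sum>h\<in>H. bump z *R det (jacobian h (at z)) *R b (h z))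
  = bump z *R (\<Sum>h\<in>near radius z. det (jacobian h (at z)) *R b (h z))" for z
 proof (cases "norm z \<le> radius")
  case True
  have "(\<Sum>h\<in>H. det (jacobian h (at z)) *R b (h z)) = (\<Sum>h\<in>near radius z. det (jacobian h (at z)) *R b (h z))"
   using b(2) Hd by (intro sum.mono_neutral_right[OF finH sub[OF True]]) (auto simp: near_def not_le)
  thus ?thesis unfolding scaleR_sum_right[symmetric] by simp
 qed (simp add: bump_zero)
 have I: "((\<lambda>z. bump z *R det (jacobian h (at z)) *R b (h z)) has_integral
   integral UNIV (\<lambda>z. bump (inv_into UNIV h z) *R b z)) UNIV" if "h \<in> H" for h
 proof -
  have c: "continuous_on UNIV (\<lambda>z. bump (inv_into UNIV h z) *R b z)"
   using deck_cont[OF inv_deck[OF Hd[OF that]]]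
   by (intro continuous_intros b continuous_on_compose2[OF bump_continuous]) auto
  have "(\<lambda>z. det (jacobian h (at z)) *R bump (inv_into UNIV h (h z)) *R b (h z))
   = (\<lambda>z. bump z *R det (jacobian h (at z)) *R b (h z))"
   using Hd[OF that] by (simp add: mult.commute)
  thus ?thesis using deck_integral[OF Hd[OF that] c, of radius] b(2) by simp
 qed
 have "integral UNIV (\<lambda>z. bump z *R (\<Sum>h\<in>near radius z. det (jacobian h (at z)) *R b (h z)))
  = (\<Sum>h\<in>H. integral UNIV (\<lambda>z. bump (inv_into UNIV h z) *R b z))"
  unfolding 2[symmetric] by (intro integral_unique has_integral_sum finH I)
 also have "\<dots> = (\<Sum>h\<in>H. integral UNIV (\<lambda>z. bump (h z) *R b z))"
  by (rule sum.reindex_bij_betw[OF Hinv])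
 also have "\<dots> = integral UNIV (\<lambda>z. \<Sum>h\<in>H. bump (h z) *R b z)"
 proof (rule integral_sum[symmetric, OF finH])
  fix h assume "h \<in> H"
  hence "continuous_on UNIV (\<lambda>z. bump (h z) *R b z)"
   using deck_cont[OF Hd] by (intro continuous_intros b continuous_on_compose2[OF bump_continuous]) auto
  thus "(\<lambda>z. bump (h z) *R b z) integrable_on UNIV"
   using b(2) by (intro set_lebesgue_integral_eq_integral(1) absolutely_integrable_compact_support[where r=radius]) auto
 qed
 also have "\<dots> = integral UNIV b" by (simp only: 1[symmetric])
 finally show ?thesis by simp
qed

text \<open>The form \<open>bump z *R q z\<close> has compact support, so its curl integrates to
  zero. Summed over the deck group this curl becomes \<open>curl q\<close>, since the translates of
  the cut-off sum to a constant; unfolding compares the two integrals.\<close>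

lemma stokes:
 assumes q: "Ck_on 1 UNIV q" and inv: "\<And>g. g \<in> deck p ==> pull g q = q"
 shows "integral UNIV (\<lambda>z. bump z *R curl q z) = 0"
proof -
 let ?b = "\<lambda>z. bump z *R q z"
 have b1: "Ck_on 1 UNIV bump" by (rule Ck_on_mono[OF bump_C2]) simp
 have bC: "Ck_on 1 UNIV ?b" by (intro smooth_intros open_UNIV q b1)
 have \<eta>d: "q differentiable (at z)" for z using Ck_1_differentiable[OF q] by simp
 have b0: "curl ?b z = 0" if "norm z > radius" for z
 proof -
  have "curl ?b z = curl (\<lambda>_. 0) z"
   by (rule curl_cong[of "- cball 0 radius"]) (use that bump_zero in auto)
  thus ?thesis by (simp add: curl_def)
 qed
 have "(\<Sum>g\<in>near radius z. det (jacobian g (at z)) *R curl ?b (g z)) = curl q z" for z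
 proof -
  let ?N = "near_ball radius z"
  have bd: "(\<lambda>w. bump (g w) *R q w) differentiable (at z)" if "g \<in> deck p" for g
  proof -
   have "Ck_on 1 UNIV (\<lambda>w. bump (g w))"
    using Ck_on_compose[OF open_UNIV open_UNIV _ deck_Ck[OF that] b1] by simp
   hence "Ck_on 1 UNIV (\<lambda>w. bump (g w) *R q w)" by (intro smooth_intros open_UNIV q)
   thus ?thesis using Ck_1_differentiable by blast
  qed
  have "(\<Sum>g\<in>near radius z. det (jacobian g (at z)) *R curl ?b (g z))
   = (\<Sum>g\<in>?N. det (jacobian g (at z)) *R curl ?b (g z))"
   by (rule sum_near_ball) (auto simp: b0)
  also have "\<dots> = (\<Sum>g\<in>?N. curl (\<lambda>w. bump (g w) *R q w) z)"
  proof (rule sum.cong[OF refl])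
   fix g assume "g \<in> ?N"
   hence g: "g \<in> deck p" by (rule near_ball_deck)
   have "pull g ?b = (\<lambda>w. bump (g w) *R pull g q w)"
    by (rule ext) (simp add: pull_def vec_eq_iff scaleR_sum_right)
   thus "det (jacobian g (at z)) *R curl ?b (g z) = curl (\<lambda>w. bump (g w) *R q w) z"
    using curl_pull[OF deck_Ck[OF g] bC, of z] inv[OF g] by simp
  qed
  also have "\<dots> = curl (\<lambda>w. \<Sum>g\<in>?N. bump (g w) *R q w) z"
   by (rule curl_sum[symmetric]) (auto intro: bd near_ball_deck)
  also have "\<dots> = curl q z"
  proof (rule curl_cong[OF open_ball])
   show "z \<in> ball z 1" by simp
   fix w assume "w \<in> ball z 1"
   hence "(\<Sum>g\<in>?N. bump (g w)) = 1"
    using sum_near_ball[of w z radius "\<lambda>g. bump (g w)"] bump_zero bump_sum by simp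
   thus "(\<Sum>g\<in>?N. bump (g w) *R q w) = q w" unfolding scaleR_sum_left[symmetric] by simp
  qed
  finally show ?thesis .
 qed
 hence "integral UNIV (\<lambda>z. bump z *R curl q z) = integral UNIV (curl ?b)"
  using integral_unfold[OF Ck_on_curl[OF bC] b0] by simp
 also have "\<dots> = 0" by (rule integral_curl_compact_support[OF bC, of radius]) (simp add: bump_zero)
 finally show ?thesis .
qed

text \<open>De Rham representation of a group two-cocycle \<open>c\<close>: the one-form \<open>\<theta>\<close> is invariant up to the
 differentials of functions \<open>F \<gamma>\<close>, whose coboundary is \<open>c\<close>.\<close>

definition cochain_rep :: "((real^2 => real^2) => (real^2 => real^2) => complex) => (real^2 => complex^2) =>
  ((real^2 => real^2) => real^2 => complex) => bool" where
 "cochain_rep c \<theta> F \<longleftrightarrow> smooth_on UNIV \<theta> \<and> (\<forall>\<gamma>\<in>deck p. smooth_on UNIV (F \<gamma>)) \<and>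
  (\<forall>\<gamma>\<in>deck p. \<forall>z j. pull \<gamma> \<theta> z$j - \<theta> z$j = partial (F \<gamma>) j z) \<and>
  (\<forall>\<gamma>\<in>deck p. \<forall>\<delta>\<in>deck p. \<forall>z. F \<gamma> (\<delta> z) + F \<delta> z - F (\<gamma> \<circ> \<delta>) z = c \<gamma> \<delta>)"

text \<open>The 1-form is invariant only up to gradients, but the curl of a gradient
  vanishes.\<close>

lemma cochain_rep_density:
 assumes "cochain_rep c \<theta> F"
 shows "invariant_density (curl \<theta>)" "continuous_on UNIV (curl \<theta>)"
proof -
 have \<theta>: "Ck_on k UNIV \<theta>" for k using assms by (auto simp: cochain_rep_def smooth_on_def)
 show "continuous_on UNIV (curl \<theta>)" by (rule Ck_on_curl[OF \<theta>])
 show "invariant_density (curl \<theta>)"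
  unfolding invariant_density_def
 proof (intro ballI allI)
  fix g z assume g: "g \<in> deck p"
  have F: "Ck_on k UNIV (F g)" for k using assms g by (auto simp: cochain_rep_def smooth_on_def)
  have "pull g \<theta> w = \<theta> w + (\<chi> j. partial (F g) j w)" for w
   using assms g by (auto simp: cochain_rep_def vec_eq_iff algebra_simps)
  hence eq: "pull g \<theta> = (\<lambda>w. \<theta> w + (\<chi> j. partial (F g) j w))" by blast
  have dF: "Ck_on 1 UNIV (\<lambda>w. \<chi> j. partial (F g) j w)"
   by (rule Ck_on_vec) (auto intro: Ck_2_partial[OF open_UNIV F])
  have "curl (pull g \<theta>) z = curl \<theta> z + curl (\<lambda>w. \<chi> j. partial (F g) j w) z"
   unfolding eq by (rule curl_add[OF Ck_1_differentiable[OF \<theta> UNIV_I] Ck_1_differentiable[OF dF UNIV_I]])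
  thus "det (jacobian g (at z)) *R curl \<theta> (g z) = curl \<theta> z"
   by (simp add: curl_gradient[OF F] curl_pull[OF deck_Ck[OF g] \<theta>])
 qed
qed

lemma cochain_rep_diff:
 assumes "cochain_rep c \<theta> F" "cochain_rep c' \<theta>' F'"
 shows "cochain_rep (\<lambda>h d. c h d - c' h d) (\<lambda>z. \<theta> z - \<theta>' z) (\<lambda>h z. F h z - F' h z)"
proof -
 have sm: "smooth_on UNIV (\<lambda>z. f z - g z)" if "smooth_on UNIV f" "smooth_on UNIV g"
  for f g :: "real^2 => 'c::real_normed_vector"
  using that by (auto simp: smooth_on_def intro!: smooth_intros)
 have p: "pull h (\<lambda>z. \<theta> z - \<theta>' z) z$j = pull h \<theta> z$j - pull h \<theta>' z$j" for h z j
  by (simp add: pull_def algebra_simps sum_subtractf)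
 have q: "partial (\<lambda>z. F h z - F' h z) j z = partial (F h) j z - partial (F' h) j z" if "h \<in> deck p" for h j z
  using assms that unfolding cochain_rep_def by (intro partial_diff smooth_on_differentiable) auto
 show ?thesis
  unfolding cochain_rep_def
 proof (intro conjI ballI allI)
  fix h d z j assume h: "h \<in> deck p" and d: "d \<in> deck p"
  have "F h (d z) + F d z - F (h \<circ> d) z = c h d" "F' h (d z) + F' d z - F' (h \<circ> d) z = c' h d"
   using assms h d unfolding cochain_rep_def by blast+
  thus "F h (d z) - F' h (d z) + (F d z - F' d z) - (F (h \<circ> d) z - F' (h \<circ> d) z) = c h d - c' h d"
   by (simp add: algebra_simps)
 next
  fix h z j assume h: "h \<in> deck p"
  have "pull h \<theta> z$j - \<theta> z$j = partial (F h) j z" "pull h \<theta>' z$j - \<theta>' z$j = partial (F' h) j z"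
   using assms h unfolding cochain_rep_def by blast+
  thus "pull h (\<lambda>z. \<theta> z - \<theta>' z) z$j - (\<theta> z - \<theta>' z)$j = partial (\<lambda>z. F h z - F' h z) j z"
   by (simp add: p q[OF h] algebra_simps)
 qed (use assms in \<open>auto simp: cochain_rep_def intro!: sm\<close>)
qed

text \<open>If the cocycle vanishes, averaging the functions \<open>F g\<close> against the cut-off
  gives one function \<open>h\<close> with \<open>h (d z) = h z - F d z\<close>. The form plus the
  gradient of \<open>h\<close> is then invariant and has the same curl, so Stokes applies.\<close>

lemma cochain_rep_zero:
 assumes "cochain_rep (\<lambda>g d. 0) \<theta> F"
 shows "integral UNIV (\<lambda>z. bump z *R curl \<theta> z) = 0"
proof -
 have \<theta>: "Ck_on k UNIV \<theta>" for k using assms by (auto simp: cochain_rep_def smooth_on_def)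
 have F: "Ck_on k UNIV (F g)" if "g \<in> deck p" for k g using assms that by (auto simp: cochain_rep_def smooth_on_def)
 define h where "h = (\<lambda>z. \<Sum>g\<in>near radius z. bump (g z) *R F g z)"
 have h: "Ck_on 2 UNIV h"
 proof (rule Ck_on_local)
  fix z0 :: "real^2"
  have "Ck_on 2 (ball z0 1) (\<lambda>z. \<Sum>g\<in>near_ball radius z0. bump (g z) *R F g z)"
  proof (intro Ck_on_sum Ck_on_scaleR open_ball)
   fix g assume "g \<in> near_ball radius z0"
   hence g: "g \<in> deck p" by (rule near_ball_deck)
   have "Ck_on 2 UNIV (\<lambda>z. bump (g z))"
    using Ck_on_compose[OF open_UNIV open_UNIV _ deck_Ck[OF g] bump_C2] by simp
   thus "Ck_on 2 (ball z0 1) (\<lambda>z. bump (g z))" "Ck_on 2 (ball z0 1) (F g)"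
    using F[OF g] Ck_on_subset by blast+
  qed
  hence "Ck_on 2 (ball z0 1) h"
   by (rule Ck_on_eqI[OF open_ball]) (auto simp: h_def bump_zero intro!: sum_near_ball)
  thus "\<exists>V. open V \<and> z0 \<in> V \<and> Ck_on 2 V h" by (intro exI[of _ "ball z0 1"]) auto
 qed
 have hd: "h (d z) = h z - F d z" if d: "d \<in> deck p" for d z
 proof -
  have "h (d z) = (\<Sum>g\<in>near radius (d z). bump ((g \<circ> d) z) *R (F (g \<circ> d) z - F d z))"
   unfolding h_def
  proof (rule sum.cong[OF refl])
   fix g assume "g \<in> near radius (d z)"
   hence "F g (d z) + F d z - F (g \<circ> d) z = 0"
    using assms d unfolding cochain_rep_def near_def by blast
   hence "F g (d z) = F (g \<circ> d) z - F d z" by (simp add: algebra_simps)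
   thus "bump (g (d z)) *R F g (d z) = bump ((g \<circ> d) z) *R (F (g \<circ> d) z - F d z)" by simp
  qed
  also have "\<dots> = (\<Sum>g\<in>near radius z. bump (g z) *R (F g z - F d z))"
   by (rule sum_near_comp[OF d])
  also have "\<dots> = h z - (\<Sum>g\<in>near radius z. bump (g z)) *R F d z"
   by (simp add: h_def scaleR_diff_right sum_subtractf scaleR_sum_left)
  finally show ?thesis by (simp add: bump_sum)
 qed
 define q where "q = (\<lambda>z. \<theta> z + (\<chi> j. partial h j z))"
 have dh: "Ck_on 1 UNIV (\<lambda>z. \<chi> j. partial h j z)"
  by (rule Ck_on_vec) (auto intro: Ck_2_partial[OF open_UNIV h])
 have q: "Ck_on 1 UNIV q" unfolding q_def by (intro smooth_intros open_UNIV \<theta> dh)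
 have "pull g q = q" if g: "g \<in> deck p" for g
 proof
  fix z
  have "pull g q z$j = q z$j" for j
  proof -
   have hdiff: "h differentiable (at w)" for w using Ck_2_differentiable[OF h] by simp
   have "pull g (\<lambda>z. \<chi> j. partial h j z) z$j = partial (\<lambda>z. h (g z)) j z"
    unfolding partial_chain[OF deck_differentiable[OF g] hdiff]
    by (simp add: pull_def sum_2 scaleR_conv_of_real mult.commute)
   also have "\<dots> = partial (\<lambda>z. h z - F g z) j z" by (simp add: hd[OF g])
   also have "\<dots> = partial h j z - partial (F g) j z"
    using Ck_2_differentiable[OF F[OF g]] by (intro partial_diff hdiff) auto
   finally have "pull g (\<lambda>z. \<chi> j. partial h j z) z$j = partial h j z - partial (F g) j z" .
   moreover have "pull g \<theta> z$j - \<theta> z$j = partial (F g) j z" using assms g by (auto simp: cochain_rep_def)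
   moreover have "pull g q z$j = pull g \<theta> z$j + pull g (\<lambda>z. \<chi> j. partial h j z) z$j"
    by (simp add: pull_def q_def sum.distrib distrib_right)
   ultimately show ?thesis by (simp add: q_def algebra_simps)
  qed
  thus "pull g q z = q z" by (simp add: vec_eq_iff)
 qed
 from stokes[OF q this] have "integral UNIV (\<lambda>z. bump z *R curl q z) = 0" .
 moreover have "curl q z = curl \<theta> z" for z
  unfolding q_def
  using Ck_1_differentiable[OF \<theta>] Ck_1_differentiable[OF dh] by (simp add: curl_add curl_gradient[OF h])
 ultimately show ?thesis by simp
qed

text \<open>Two representatives of one cocycle differ by a representative of the zero cocycle, so
  their integrals agree and the definite description denotes the common value.\<close>

lemma H2_evaluation_eq:
 assumes "cochain_rep c \<theta> F"
 shows "H2_evaluation S p c = integral UNIV (\<lambda>z. bump z *R curl \<theta> z)"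
proof -
 have si: "surface_integral S p (curl \<theta>) = integral UNIV (\<lambda>z. bump z *R curl \<theta> z)"
  if "cochain_rep c \<theta> F" for \<theta> F
  using surface_integral_eq cochain_rep_density[OF that] by blast
 have eq: "surface_integral S p (curl \<theta>') = integral UNIV (\<lambda>z. bump z *R curl \<theta> z)" if r: "cochain_rep c \<theta>' F'" for \<theta>' F'
 proof -
  have "integral UNIV (\<lambda>z. bump z *R curl (\<lambda>z. \<theta>' z - \<theta> z) z) = 0"
   using cochain_rep_zero cochain_rep_diff[OF r assms] by simp
  moreover have "curl (\<lambda>z. \<theta>' z - \<theta> z) z = curl \<theta>' z - curl \<theta> z" for z
  proof -
   have d: "\<theta> differentiable (at z)" "\<theta>' differentiable (at z)"
    using assms r smooth_on_differentiable by (auto simp: cochain_rep_def)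
   have "(\<lambda>z. h z$i) differentiable (at z)" if "h differentiable (at z)" for h :: "real^2 => complex^2" and i
    using that bounded_linear.has_derivative[OF bounded_linear_vec_nth] unfolding differentiable_def by blast
   with d show ?thesis by (simp add: curl_def partial_diff)
  qed
  ultimately show ?thesis
   using integral_bump_complex(1)[OF cochain_rep_density(2)[OF r]] integral_bump_complex(1)[OF cochain_rep_density(2)[OF assms]] si[OF r]
   by (simp add: scaleR_diff_right integral_diff)
 qed
 have "H2_evaluation S p c = (THE a. \<exists>\<theta> F. cochain_rep c \<theta> F \<and> a = surface_integral S p (curl \<theta>))"
  by (simp only: H2_evaluation_def cochain_rep_def pull_def vec_lambda_beta curl_def[abs_def] conj_assoc)
 also have "\<dots> = integral UNIV (\<lambda>z. bump z *R curl \<theta> z)"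
 proof (rule the_equality)
  show "\<exists>\<theta>' F. cochain_rep c \<theta>' F \<and> integral UNIV (\<lambda>z. bump z *R curl \<theta> z) = surface_integral S p (curl \<theta>')"
   using assms si[OF assms] by metis
 qed (use eq in blast)
 finally show ?thesis .
qed

end

section \<open>Lorentz transformations and two-by-two complex matrices\<close>

lemma vector_4 [simp]:
 "(vector [a,b,c,d] :: 'a::zero^4)$1 = a" "(vector [a,b,c,d] :: 'a::zero^4)$2 = b"
 "(vector [a,b,c,d] :: 'a::zero^4)$3 = c" "(vector [a,b,c,d] :: 'a::zero^4)$4 = d"
 unfolding vector_def by simp_all

lemma det_4:
 fixes A :: "'a::comm_ring_1^4^4"
 shows "det A =
  A$1$1 * (A$2$2 * (A$3$3 * A$4$4 - A$3$4 * A$4$3) - A$2$3 * (A$3$2 * A$4$4 - A$3$4 * A$4$2) + A$2$4 * (A$3$2 * A$4$3 - A$3$3 * A$4$2))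
 - A$1$2 * (A$2$1 * (A$3$3 * A$4$4 - A$3$4 * A$4$3) - A$2$3 * (A$3$1 * A$4$4 - A$3$4 * A$4$1) + A$2$4 * (A$3$1 * A$4$3 - A$3$3 * A$4$1))
 + A$1$3 * (A$2$1 * (A$3$2 * A$4$4 - A$3$4 * A$4$2) - A$2$2 * (A$3$1 * A$4$4 - A$3$4 * A$4$1) + A$2$4 * (A$3$1 * A$4$2 - A$3$2 * A$4$1))
 - A$1$4 * (A$2$1 * (A$3$2 * A$4$3 - A$3$3 * A$4$2) - A$2$2 * (A$3$1 * A$4$3 - A$3$3 * A$4$1) + A$2$3 * (A$3$1 * A$4$2 - A$3$2 * A$4$1))"
proof -
 have f1234: "finite {2::4, 3, 4}" "1 \<notin> {2::4, 3, 4}" by auto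
 have f234: "finite {3::4, 4}" "2 \<notin> {3::4, 4}" by auto
 have f34: "finite {4::4}" "3 \<notin> {4::4}" by auto
 show ?thesis
  unfolding det_def UNIV_4
  unfolding sum_over_permutations_insert[OF f1234]
  unfolding sum_over_permutations_insert[OF f234]
  unfolding sum_over_permutations_insert[OF f34]
  unfolding permutes_sing
  by (simp add: sign_swap_id sign_compose permutation_swap_id permutation_compose sign_id)
   (simp add: Transposition.transpose_def algebra_simps)
qed

text \<open>The adjugate: it is the inverse on determinant one, yet linear in the matrix, which
  keeps differentiation and polynomial identities simple.\<close>

definition adj2 :: "complex^2^2 => complex^2^2" where
 "adj2 M = vector [vector [M$2$2, - M$1$2], vector [- M$2$1, M$1$1]]"

lemmas mat2_simps = vec_eq_iff forall_2 matrix_matrix_mult_def sum_2 mat_def det_2 trace_def adj2_def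
 adjoint_matrix_def

lemma adj2_mult: "adj2 (M ** N) = adj2 N ** adj2 M"
 by (simp add: mat2_simps algebra_simps)

lemma mult_adj2: "M ** adj2 M = (\<chi> i. \<chi> j. det M * mat 1$i$j)" "adj2 M ** M = (\<chi> i. \<chi> j. det M * mat 1$i$j)"
 by (simp_all add: mat2_simps algebra_simps)

lemma mult_adj2_1 [simp]: "det M = 1 ==> M ** adj2 M = mat 1" "det M = 1 ==> adj2 M ** M = mat 1"
 by (simp_all add: mult_adj2 vec_eq_iff)

lemma matrix_inv_eqI:
 fixes M :: "'a::semiring_1^'n^'n"
 assumes "M ** N = mat 1" "N ** M = mat 1"
 shows "matrix_inv M = N"
 unfolding matrix_inv_def
proof (rule some_equality)
 fix A' assume "M ** A' = mat 1 \<and> A' ** M = mat 1"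
 thus "A' = N" by (metis assms(1) matrix_mul_assoc matrix_mul_lid matrix_mul_rid)
qed (use assms in simp)

lemma matrix_inv_adj2: "det M = 1 ==> matrix_inv M = adj2 M"
 by (rule matrix_inv_eqI) simp_all

lemma det_adj2 [simp]: "det (adj2 M) = det M"
 by (simp add: mat2_simps algebra_simps)

lemma adj2_adj2 [simp]: "adj2 (adj2 M) = M"
 by (simp add: mat2_simps)

lemma det_uminus2 [simp]: "det (- M :: complex^2^2) = det M"
 by (simp add: mat2_simps)

lemma adj2_uminus [simp]: "adj2 (- M) = - adj2 M"
 by (simp add: mat2_simps)

lemma uminus_mat_mult: "(- M) ** N = - (M ** N)" "M ** (- N) = - (M ** N :: complex^2^2)"
 by (simp_all add: vec_eq_iff matrix_matrix_mult_def sum_negf)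

lemma adjoint_matrix_mult: "adjoint_matrix (M ** N) = adjoint_matrix N ** adjoint_matrix M"
 by (simp add: mat2_simps algebra_simps)

lemma adjoint_matrix_mat1 [simp]: "adjoint_matrix (mat 1) = mat 1"
 by (simp add: mat2_simps)

lemma adjoint_adjoint [simp]: "adjoint_matrix (adjoint_matrix M) = M"
 by (simp add: mat2_simps)

lemma det_adjoint_matrix [simp]: "det (adjoint_matrix M) = cnj (det M)"
 by (simp add: mat2_simps)

lemma adjoint_uminus [simp]: "adjoint_matrix (- M) = - adjoint_matrix M"
 by (simp add: mat2_simps)

lemma herm_nth [simp]: "herm x$1$1 = complex_of_real (x$4 + x$3)" "herm x$1$2 = Complex (x$1) (- x$2)"
 "herm x$2$1 = Complex (x$1) (x$2)" "herm x$2$2 = complex_of_real (x$4 - x$3)"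
 by (simp_all add: herm_def)

definition unherm :: "complex^2^2 => real^4" where
 "unherm H = vector [Re (H$2$1), Im (H$2$1), Re (H$1$1 - H$2$2) / 2, Re (H$1$1 + H$2$2) / 2]"

lemma unherm_herm [simp]: "unherm (herm x) = x"
 by (simp add: unherm_def vec_eq_iff forall_4)

lemma herm_eq_iff: "herm x = herm y \<longleftrightarrow> x = y"
 by (metis unherm_herm)

lemma herm_unherm: "adjoint_matrix H = H ==> herm (unherm H) = H"
proof -
 assume H: "adjoint_matrix H = H"
 have e: "cnj (H$j$i) = H$i$j" for i j using arg_cong[OF H, of "\<lambda>M. M$i$j"] by (simp add: adjoint_matrix_def)
 have "Im (H$1$1) = 0" "Im (H$2$2) = 0" "Re (H$1$2) = Re (H$2$1)" "Im (H$1$2) = - Im (H$2$1)"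
  using arg_cong[OF e[of 1 1], of Im] arg_cong[OF e[of 2 2], of Im] arg_cong[OF e[of 2 1], of Re] arg_cong[OF e[of 2 1], of Im]
  by simp_all
 thus "herm (unherm H) = H"
  by (simp add: vec_eq_iff forall_2 unherm_def complex_eq_iff field_simps)
qed

lemma adjoint_herm [simp]: "adjoint_matrix (herm x) = herm x"
 by (simp add: mat2_simps complex_eq_iff)

lemma herm_add: "herm (x + y) = herm x + herm y"
 by (simp add: vec_eq_iff forall_2 complex_eq_iff)

lemma herm_scaleR: "herm (c *R x) = c *R herm x"
 unfolding vec_eq_iff forall_2 vector_scaleR_component herm_nth
 by (intro conjI; rule complex_eqI; simp add: distrib_left right_diff_distrib)

lemma linear_herm: "linear herm"
 by (rule linearI[OF herm_add herm_scaleR])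

lemma linear_unherm: "linear unherm"
 by (intro linearI) (simp_all add: unherm_def vec_eq_iff forall_4 add_divide_distrib diff_divide_distrib distrib_left right_diff_distrib)

lemma det_herm: "det (herm x) = - complex_of_real (mink x x)"
 by (simp add: det_2 mink_def complex_eq_iff algebra_simps)

text \<open>Polarises the preceding identity, by which the Minkowski form is minus the determinant
  on Hermitian matrices.\<close>

lemma trace_herm_adj2: "trace (herm x ** adj2 (herm y)) = - complex_of_real (2 * mink x y)"
 by (simp add: mat2_simps mink_def complex_eq_iff algebra_simps)

definition lorentz :: "complex^2^2 => real^4 => real^4" where
 "lorentz M x = unherm (M ** herm x ** adjoint_matrix M)"

lemma herm_lorentz: "herm (lorentz M x) = M ** herm x ** adjoint_matrix M"
 unfolding lorentz_def by (rule herm_unherm) (simp add: adjoint_matrix_mult matrix_mul_assoc)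

lemma lorentz_unique: "herm y = M ** herm x ** adjoint_matrix M ==> y = lorentz M x"
 using herm_eq_iff herm_lorentz by metis

lemma lorentz_mult: "lorentz (M ** N) x = lorentz M (lorentz N x)"
 by (rule lorentz_unique[symmetric]) (simp add: herm_lorentz adjoint_matrix_mult matrix_mul_assoc)

lemma lorentz_1 [simp]: "lorentz (mat 1) x = x"
 by (rule lorentz_unique[symmetric]) (simp add: matrix_mul_lid matrix_mul_rid)

lemma lorentz_uminus [simp]: "lorentz (- M) x = lorentz M x"
 by (simp add: lorentz_def uminus_mat_mult)

lemma lorentz_adj2 [simp]: "det M = 1 ==> lorentz M (lorentz (adj2 M) x) = x" "det M = 1 ==> lorentz (adj2 M) (lorentz M x) = x"
 by (simp_all flip: lorentz_mult)

lemma mat_mult_linear: "linear (\<lambda>X::complex^2^2. M ** X)" "linear (\<lambda>X::complex^2^2. X ** M)"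
 by (intro linearI; simp add: mat2_simps algebra_simps)+

lemma linear_lorentz: "linear (lorentz M)"
proof -
 have "linear (unherm \<circ> (\<lambda>X. X ** adjoint_matrix M) \<circ> (\<lambda>X. M ** X) \<circ> herm)"
  by (intro linear_compose linear_herm linear_unherm mat_mult_linear)
 moreover have "unherm \<circ> (\<lambda>X. X ** adjoint_matrix M) \<circ> (\<lambda>X. M ** X) \<circ> herm = lorentz M"
  by (auto simp: lorentz_def fun_eq_iff)
 ultimately show ?thesis by simp
qed

lemma mink_herm: "mink x y = - Re (trace (herm x ** adj2 (herm y))) / 2"
 by (simp add: trace_herm_adj2)

lemma herm_adj2_lorentz:
 assumes "det M = 1"
 shows "herm (lorentz M x) ** adj2 (herm (lorentz M y)) = M ** (herm x ** adj2 (herm y)) ** adj2 M"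
proof -
 have "adjoint_matrix M ** adj2 (adjoint_matrix M) = mat 1" using assms by simp
 thus ?thesis
  unfolding herm_lorentz adj2_mult
  by (metis (no_types, lifting) matrix_mul_assoc matrix_mul_rid)
qed

lemma trace_conj: "det M = 1 ==> trace (M ** X ** adj2 M) = trace (X :: complex^2^2)"
proof -
 assume "det M = 1"
 hence "trace (adj2 M ** (M ** X)) = trace X" by (simp add: matrix_mul_assoc matrix_mul_lid)
 thus ?thesis by (metis trace_mul_sym)
qed

lemma mink_lorentz: "det M = 1 ==> mink (lorentz M x) (lorentz M y) = mink x y"
 by (simp add: mink_herm herm_adj2_lorentz trace_conj)

lemma mink_add_left: "mink (x + y) z = mink x z + mink y z" and mink_add_right: "mink x (y + z) = mink x y + mink x z"
 and mink_scaleR_left: "mink (c *R x) y = c * mink x y" and mink_scaleR_right: "mink x (c *R y) = c * mink x y"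
 and mink_commute: "mink x y = mink y x"
 by (simp_all add: mink_def algebra_simps)

lemma mink_zero [simp]: "mink 0 y = 0" "mink x 0 = 0"
 by (simp_all add: mink_def)

text \<open>Expresses orientation through a trace, so that its invariance under the Lorentz action
  follows from the invariance of traces under conjugation.\<close>

lemma det_herm_trace:
 "det (vector [x, y, z, w] :: real^4^4) = - Im (trace (herm x ** adj2 (herm y) ** (herm z ** adj2 (herm w)))) / 2"
 by (simp add: det_4 mat2_simps complex_eq_iff) (simp add: field_simps)

lemma det_lorentz_frame:
 assumes "det M = 1"
 shows "det (vector [lorentz M x, lorentz M y, lorentz M z, lorentz M w] :: real^4^4) = det (vector [x, y, z, w] :: real^4^4)"
proof -
 have *: "M ** X ** adj2 M ** (M ** Y ** adj2 M) = M ** (X ** Y) ** adj2 M" for X Y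
  by (metis (no_types, lifting) assms matrix_mul_assoc matrix_mul_rid mult_adj2_1(2))
 show ?thesis
  unfolding det_herm_trace herm_adj2_lorentz[OF assms] * trace_conj[OF assms] ..
qed

subsection \<open>The Lie algebra homomorphism\<close>

definition eta :: "4 => real" where
 "eta c = (if c = 4 then -1 else 1)"

lemma eta_simps [simp]: "eta 1 = 1" "eta 2 = 1" "eta 3 = 1" "eta 4 = -1" "eta c * eta c = 1"
 by (auto simp: eta_def)

text \<open>The rows are the images of the basis vectors. Frames are matrices of row vectors, so
  \<open>lor_mat M\<close> acts on them from the right and products are reversed.\<close>

definition lor_mat :: "complex^2^2 => real^4^4" where
 "lor_mat M = (\<chi> c. lorentz M (axis c 1))"

text \<open>A left inverse of the Lie algebra map \<open>lor_diff\<close> from sl(2,C) to so(3,1),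
  extended linearly to all matrices so that membership in so(3,1) never has to be checked. On
  \<open>lor_diff X\<close> each of the four terms contributes a quarter of \<open>X\<close>, and
  the terms with the adjoint of \<open>X\<close> cancel for trace zero.\<close>

definition spin_part :: "real^4^4 => complex^2^2" where
 "spin_part E = (\<Sum>c\<in>UNIV. (- eta c / 4) *R (herm (E$c) ** adj2 (herm (axis c 1))))"

lemma mult_lor_mat: "(E ** lor_mat M)$c = lorentz M (E$c)"
proof -
 have "E$c = (\<Sum>d\<in>UNIV. (E$c$d) *R axis d 1)"
  by (simp add: vec_eq_iff sum_4 forall_4 axis_def)
 hence "lorentz M (E$c) = (\<Sum>d\<in>UNIV. (E$c$d) *R lorentz M (axis d 1))"
  by (metis (mono_tags, lifting) linear_scale[OF linear_lorentz] linear_sum[OF linear_lorentz] sum.cong)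
 thus ?thesis by (simp add: matrix_matrix_mult_def lor_mat_def vec_eq_iff)
qed

lemma lor_mat_mult: "lor_mat (M ** N) = lor_mat N ** lor_mat M"
 by (subst vec_eq_iff) (simp add: mult_lor_mat, simp add: lor_mat_def lorentz_mult)

lemma lor_mat_1 [simp]: "lor_mat (mat 1) = mat 1"
 unfolding lor_mat_def lorentz_1 by (simp add: vec_eq_iff mat_def axis_def)

lemma lor_mat_inv [simp]: "det M = 1 ==> lor_mat M ** lor_mat (adj2 M) = mat 1" "det M = 1 ==> lor_mat (adj2 M) ** lor_mat M = mat 1"
 by (simp_all flip: lor_mat_mult)

lemma mink_axis: "mink x (axis c 1) = eta c * x$c"
 using exhaust_4[of c] by (auto simp: mink_def axis_def)

lemma lor_mat_transpose:
 assumes "det M = 1"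
 shows "eta c * lor_mat (adj2 M)$c$d = eta d * lor_mat M$d$c"
proof -
 have "mink (lorentz (adj2 M) (axis c 1)) (axis d 1) = mink (axis c 1) (lorentz M (axis d 1))"
  by (metis assms lorentz_adj2(1) mink_lorentz)
 hence "eta d * lor_mat (adj2 M)$c$d = eta c * lor_mat M$d$c"
  by (simp add: mink_axis mink_commute[of "axis c 1"] lor_mat_def)
 thus ?thesis by (auto simp: eta_def split: if_splits)
qed

lemma linear_spin_part: "linear spin_part"
 unfolding spin_part_def
proof (intro linear_compose_sum ballI)
 fix c :: 4
 have "linear ((\<lambda>X. (- eta c / 4) *R X) \<circ> (\<lambda>X. X ** adj2 (herm (axis c 1))) \<circ> herm \<circ> (\<lambda>E::real^4^4. E$c))"
  by (intro linear_compose linear_herm mat_mult_linear linear_scaleR linearI) auto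
 thus "linear (\<lambda>E::real^4^4. (- eta c / 4) *R (herm (E$c) ** adj2 (herm (axis c 1))))"
  by (simp add: o_def)
qed

lemma scaleR_mat_mult:
 fixes X Y :: "complex^2^2"
 shows "(c *R X) ** Y = c *R (X ** Y)" "X ** (c *R Y) = c *R (X ** Y)"
proof -
 show "(c *R X) ** Y = c *R (X ** Y)" by (rule linear_scale[OF mat_mult_linear(2)])
 show "X ** (c *R Y) = c *R (X ** Y)" by (rule linear_scale[OF mat_mult_linear(1)])
qed

lemma sum_mat_mult:
 fixes Y :: "complex^2^2"
 shows "(\<Sum>d\<in>UNIV. f d *R X d) ** Y = (\<Sum>d\<in>UNIV. f d *R (X d ** Y))"
  "Y ** (\<Sum>d\<in>UNIV. f d *R X d) = (\<Sum>d\<in>UNIV. f d *R (Y ** X d))"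
 unfolding linear_sum[OF mat_mult_linear(2)] linear_sum[OF mat_mult_linear(1)] scaleR_mat_mult by (rule refl)+

text \<open>The left factor is carried over to the summation index by
  \<open>lor_mat_transpose\<close>, which turns the basis vectors into their images under
  \<open>M\<close>. Both factors of each product are then moved by \<open>M\<close>, and
  \<open>herm_adj2_lorentz\<close> pulls it out.\<close>

lemma spin_part_conj:
 assumes M: "det M = 1"
 shows "spin_part (lor_mat (adj2 M) ** E ** lor_mat M) = M ** spin_part E ** adj2 M"
proof -
 have row: "(lor_mat (adj2 M) ** E ** lor_mat M)$c = (\<Sum>d\<in>UNIV. lor_mat (adj2 M)$c$d *R lorentz M (E$d))" for c
 proof -
  have "(lor_mat (adj2 M) ** E)$c = (\<Sum>d\<in>UNIV. lor_mat (adj2 M)$c$d *R E$d)"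
   by (simp add: matrix_matrix_mult_def vec_eq_iff)
  thus ?thesis
   by (simp add: mult_lor_mat linear_sum[OF linear_lorentz] linear_scale[OF linear_lorentz])
 qed
 have linadj: "linear adj2" by (intro linearI) (simp_all add: mat2_simps)
 have "spin_part (lor_mat (adj2 M) ** E ** lor_mat M)
  = (\<Sum>c\<in>UNIV. \<Sum>d\<in>UNIV. (- eta c / 4 * lor_mat (adj2 M)$c$d) *R (herm (lorentz M (E$d)) ** adj2 (herm (axis c 1))))"
  unfolding spin_part_def row
  by (simp add: linear_sum[OF linear_herm] linear_scale[OF linear_herm] sum_mat_mult(1) scaleR_sum_right)
 also have "\<dots> = (\<Sum>d\<in>UNIV. \<Sum>c\<in>UNIV. (- eta d / 4 * lor_mat M$d$c) *R (herm (lorentz M (E$d)) ** adj2 (herm (axis c 1))))"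
  by (subst sum.swap) (intro sum.cong refl, use lor_mat_transpose[OF M] in simp)
 also have "\<dots> = (\<Sum>d\<in>UNIV. (- eta d / 4) *R (herm (lorentz M (E$d)) ** adj2 (herm (lorentz M (axis d 1)))))"
 proof (intro sum.cong refl)
  fix d :: 4
  have "lorentz M (axis d 1) = (\<Sum>c\<in>UNIV. lor_mat M$d$c *R axis c 1)"
   by (simp add: vec_eq_iff sum_4 forall_4 axis_def lor_mat_def)
  hence "herm (lorentz M (E$d)) ** adj2 (herm (lorentz M (axis d 1)))
   = (\<Sum>c\<in>UNIV. lor_mat M$d$c *R (herm (lorentz M (E$d)) ** adj2 (herm (axis c 1))))"
   by (simp add: linear_sum[OF linear_herm] linear_scale[OF linear_herm] linear_sum[OF linadj] linear_scale[OF linadj] sum_mat_mult(2))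
  thus "(\<Sum>c\<in>UNIV. (- eta d / 4 * lor_mat M$d$c) *R (herm (lorentz M (E$d)) ** adj2 (herm (axis c 1))))
   = (- eta d / 4) *R (herm (lorentz M (E$d)) ** adj2 (herm (lorentz M (axis d 1))))"
   by (simp add: scaleR_sum_right)
 qed
 also have "\<dots> = M ** spin_part E ** adj2 M"
  unfolding spin_part_def herm_adj2_lorentz[OF M] sum_mat_mult(2) sum_mat_mult(1) ..
 finally show ?thesis .
qed

definition lor_diff :: "complex^2^2 => real^4^4" where
 "lor_diff X = (\<chi> c. unherm (X ** herm (axis c 1) + herm (axis c 1) ** adjoint_matrix X))"

lemma spin_part_lor_diff:
 assumes "trace X = 0"
 shows "spin_part (lor_diff X) = X"
proof -
 have H: "herm (lor_diff X$c) = X ** herm (axis c 1) + herm (axis c 1) ** adjoint_matrix X" for c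
 proof -
  have "adjoint_matrix (X ** H + H ** adjoint_matrix X) = X ** H + H ** adjoint_matrix X" if "adjoint_matrix H = H" for H
  proof -
   have "adjoint_matrix (U + V) = adjoint_matrix U + adjoint_matrix V" for U V by (simp add: mat2_simps)
   thus ?thesis using that by (simp add: adjoint_matrix_mult add.commute)
  qed
  thus ?thesis by (simp add: lor_diff_def herm_unherm)
 qed
 have X: "X$2$2 = - X$1$1" using assms by (simp add: trace_def sum_2 add_eq_0_iff)
 show ?thesis
  unfolding spin_part_def H sum_4
  by (simp add: mat2_simps axis_def complex_eq_iff X) (simp add: field_simps)
qed

definition e3 :: "real^4" where "e3 = vector [0, 0, 1, 0]"
definition e4 :: "real^4" where "e4 = vector [0, 0, 0, 1]"

text \<open>Boosts and rotations are easiest to write with an unnormalised matrix; a common factor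
  \<open>s\<close> in the determinant and in the action disappears on division by its square
  root.\<close>

lemma lorentz_scaled:
 assumes "det B = complex_of_real s" "s > 0"
 shows "det ((1 / sqrt s) *R B) = 1"
  "B ** herm x ** adjoint_matrix B = s *R herm y ==> lorentz ((1 / sqrt s) *R B) x = y"
proof -
 have k: "1 / sqrt s * (1 / sqrt s * s) = 1" using assms(2) by simp
 have dc: "det (c *R B) = complex_of_real (c * c) * det B" for c
  by (simp add: det_2) (simp add: scaleR_conv_of_real algebra_simps)
 have "det ((1 / sqrt s) *R B) = complex_of_real (1 / sqrt s * (1 / sqrt s * s))"
  unfolding dc assms(1) of_real_mult[symmetric] by (simp only: mult.assoc)
 thus "det ((1 / sqrt s) *R B) = 1" unfolding k by simp
 assume "B ** herm x ** adjoint_matrix B = s *R herm y"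
 moreover have "adjoint_matrix (c *R B) = c *R adjoint_matrix B" for c by (simp add: vec_eq_iff adjoint_matrix_def)
 ultimately have "((1 / sqrt s) *R B) ** herm x ** adjoint_matrix ((1 / sqrt s) *R B) = (1 / sqrt s * (1 / sqrt s * s)) *R herm y"
  by (simp only: scaleR_mat_mult scaleR_scaleR)
 thus "lorentz ((1 / sqrt s) *R B) x = y" unfolding k by (intro lorentz_unique[symmetric]) simp
qed

text \<open>\<open>herm e4\<close> is the identity, so a Hermitian square root of h =
  \<open>herm f\<close> is wanted. For determinant one, Cayley-Hamilton says that the square of 1 +
  h is (2 + tr h) h; hence \<open>mat 1 + herm f\<close> after scaling.\<close>

lemma lorentz_boost:
 assumes "mink f f = -1" "f$4 > 0"
 obtains M where "det M = 1" "lorentz M e4 = f"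
proof -
 have f: "f$4 * f$4 = f$1 * f$1 + f$2 * f$2 + f$3 * f$3 + 1" using assms(1) by (simp add: mink_def)
 have d: "det (mat 1 + herm f) = complex_of_real (2 + 2 * f$4)"
  using f by (simp add: det_2 mat_def complex_eq_iff algebra_simps)
 have "(mat 1 + herm f) ** herm e4 ** adjoint_matrix (mat 1 + herm f) = (2 + 2 * f$4) *R herm f"
  using f by (simp add: mat2_simps e4_def complex_eq_iff algebra_simps)
 thus thesis using that lorentz_scaled[OF d] assms(2) by simp
qed

lemma lorentz_unitary_e4: "M ** adjoint_matrix M = mat 1 ==> lorentz M e4 = e4"
proof -
 have "herm e4 = mat 1" by (simp add: vec_eq_iff forall_2 mat_def e4_def complex_eq_iff)
 moreover assume "M ** adjoint_matrix M = mat 1"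
 ultimately show ?thesis by (intro lorentz_unique[symmetric]) (simp add: matrix_mul_rid)
qed

lemma lorentz_rotation_e3:
 assumes "n$4 = 0" "mink n n = 1"
 obtains M where "det M = 1" "lorentz M e4 = e4" "lorentz M e3 = n"
\<comment> \<open>The scale factor \<open>2 + 2 * n$3\<close> of the general rotation vanishes
  exactly at the antipode of \<open>e3\<close>, where a half turn is used.\<close>
proof (cases "n$3 = -1")
 case True
 have "n$1 * n$1 + n$2 * n$2 = 0" using assms True by (simp add: mink_def)
 hence n: "n$1 = 0" "n$2 = 0" by (simp_all add: sum_squares_eq_zero_iff)
 define M where "M = (vector [vector [0, \<i>], vector [\<i>, 0]] :: complex^2^2)"
 have "det M = 1" by (simp add: det_2 M_def)
 moreover have "M ** adjoint_matrix M = mat 1" by (simp add: mat2_simps M_def)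
 moreover have "herm n = M ** herm e3 ** adjoint_matrix M"
  using n True assms(1) by (simp add: mat2_simps M_def e3_def complex_eq_iff)
 ultimately show thesis using that lorentz_unitary_e4 lorentz_unique by metis
next
 case False
 have n: "n$1 * n$1 = 1 - n$2 * n$2 - n$3 * n$3" using assms by (simp add: mink_def)
 hence "n$3 * n$3 \<le> 1" by (smt (verit) zero_le_square)
 hence "n$3 \<ge> -1" by (smt (verit) mult_less_cancel_right1 mult_minus_left)
 hence n3: "2 + 2 * n$3 > 0" using False by simp
 define B where "B = (vector [vector [of_real (1 + n$3), Complex (- n$1) (n$2)],
  vector [Complex (n$1) (n$2), of_real (1 + n$3)]] :: complex^2^2)"
 have d: "det B = complex_of_real (2 + 2 * n$3)"
  using n by (simp add: det_2 B_def complex_eq_iff algebra_simps)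
 have "B ** herm e4 ** adjoint_matrix B = (2 + 2 * n$3) *R herm e4"
  using n by (simp add: mat2_simps B_def e4_def complex_eq_iff algebra_simps)
 moreover have "B ** herm e3 ** adjoint_matrix B = (2 + 2 * n$3) *R herm n"
  using n assms(1) by (simp add: mat2_simps B_def e3_def complex_eq_iff algebra_simps)
 ultimately show thesis using that lorentz_scaled[OF d n3] by blast
qed

lemma lorentz_rotation_e1:
 assumes "x$3 = 0" "x$4 = 0" "mink x x = a * a" "a > 0"
 obtains M where "det M = 1" "lorentz M e4 = e4" "lorentz M e3 = e3" "lorentz M (vector [a, 0, 0, 0]) = x"
proof -
 have x: "x$1 * x$1 + x$2 * x$2 = a * a" using assms by (simp add: mink_def)
 \<comment> \<open>The diagonal matrix with entries w and its conjugate rotates by twice the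
   argument of w; hence the square root.\<close>
 define w where "w = csqrt (Complex (x$1 / a) (- x$2 / a))"
 have w2: "w * w = Complex (x$1 / a) (- x$2 / a)" using power2_csqrt unfolding w_def power2_eq_square by blast
 have "cmod (w * w) = sqrt ((x$1 * x$1 + x$2 * x$2) / (a * a))"
  unfolding w2 by (simp add: cmod_def power2_eq_square add_divide_distrib)
 also have "\<dots> = 1" unfolding x using assms(4) by simp
 finally have "cmod w * cmod w = 1" by (simp add: norm_mult)
 hence "cmod w = 1" by (smt (verit) mult_less_cancel_right1 norm_ge_zero mult_le_cancel_left1)
 hence ww: "w * cnj w = 1" "cnj w * w = 1" by (simp_all add: complex_norm_square[symmetric] mult.commute)
 define M where "M = (vector [vector [w, 0], vector [0, cnj w]] :: complex^2^2)"
 have d: "det M = 1" by (simp add: det_2 M_def ww)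
 have u: "M ** adjoint_matrix M = mat 1" by (simp add: mat2_simps M_def ww)
 have "herm e3 = M ** herm e3 ** adjoint_matrix M"
  using ww by (simp add: mat2_simps M_def e3_def zero_complex.code[symmetric])
 moreover have "herm x = M ** herm (vector [a, 0, 0, 0]) ** adjoint_matrix M"
 proof -
  have "w * complex_of_real a * w = Complex (x$1) (- x$2)"
  proof -
   have "w * complex_of_real a * w = complex_of_real a * (w * w)" by simp
   also have "\<dots> = Complex (x$1) (- x$2)" unfolding w2 using assms(4) by (simp add: complex_eq_iff)
   finally show ?thesis .
  qed
  moreover from arg_cong[OF this, of cnj] have "cnj w * complex_of_real a * cnj w = Complex (x$1) (x$2)"
   by (simp add: complex_eq_iff)
  moreover have "Complex a 0 = complex_of_real a" by (simp add: complex_eq_iff)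
  ultimately show ?thesis
   using assms(1,2) by (simp add: mat2_simps M_def zero_complex.code[symmetric])
 qed
 ultimately show thesis using that[OF d lorentz_unitary_e4[OF u]] lorentz_unique by metis
qed

text \<open>Gram-Schmidt by group elements: boost \<open>f\<close> to \<open>e4\<close>, rotate
  \<open>n\<close> to \<open>e3\<close>, then \<open>x\<close> into the first axis. The products
  determine the remaining \<open>y\<close> up to the sign of one coordinate, which the orientation
  decides.\<close>

lemma frame_normal_form:
 assumes f: "mink f f = -1" "f$4 > 0" and n: "mink n n = 1" "mink n f = 0"
  and x: "mink x f = 0" "mink x n = 0" "mink x x = a * a" and y: "mink y f = 0" "mink y n = 0" "mink x y = a * b" "mink y y = b * b + c * c"
  and pos: "a > 0" "c > 0" and det: "det (vector [x, y, n, f] :: real^4^4) > 0"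
 obtains M where "det M = 1" "lorentz M (vector [a, 0, 0, 0]) = x" "lorentz M (vector [b, c, 0, 0]) = y"
  "lorentz M e3 = n" "lorentz M e4 = f"
proof -
 have me4: "mink v e4 = - v$4" and me3: "mink v e3 = v$3" for v by (simp_all add: mink_def e3_def e4_def)
 obtain M1 where M1: "det M1 = 1" "lorentz M1 e4 = f" using lorentz_boost f by metis
 define L1 where "L1 = lorentz (adj2 M1)"
 have i1: "mink (L1 u) (L1 v) = mink u v" for u v unfolding L1_def by (simp add: mink_lorentz M1)
 have f1: "L1 f = e4" unfolding L1_def using M1 lorentz_adj2(2) by metis
 have "L1 n$4 = 0" using i1[of n f] n(2) by (simp add: f1 me4)
 moreover have "mink (L1 n) (L1 n) = 1" by (simp add: i1 n)
 ultimately obtain M2 where M2: "det M2 = 1" "lorentz M2 e4 = e4" "lorentz M2 e3 = L1 n"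
  using lorentz_rotation_e3 by metis
 define L2 where "L2 = (\<lambda>v. lorentz (adj2 M2) (L1 v))"
 have i2: "mink (L2 u) (L2 v) = mink u v" for u v unfolding L2_def by (simp add: mink_lorentz M2 i1)
 have f2: "L2 f = e4" unfolding L2_def f1 using M2(1,2) lorentz_adj2(2) by metis
 have n2: "L2 n = e3" unfolding L2_def using M2(1,3) lorentz_adj2(2) by metis
 have "L2 x$3 = 0" "L2 x$4 = 0" using i2[of x n] i2[of x f] x by (simp_all add: f2 n2 me3 me4)
 moreover have "mink (L2 x) (L2 x) = a * a" by (simp add: i2 x)
 ultimately obtain M3 where M3: "det M3 = 1" "lorentz M3 e4 = e4" "lorentz M3 e3 = e3" "lorentz M3 (vector [a, 0, 0, 0]) = L2 x"
  using lorentz_rotation_e1 pos(1) by metis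
 define L3 where "L3 = (\<lambda>v. lorentz (adj2 M3) (L2 v))"
 have i3: "mink (L3 u) (L3 v) = mink u v" for u v unfolding L3_def by (simp add: mink_lorentz M3 i2)
 have f3: "L3 f = e4" unfolding L3_def f2 using M3(1,2) lorentz_adj2(2) by metis
 have n3: "L3 n = e3" unfolding L3_def n2 using M3(1,3) lorentz_adj2(2) by metis
 have x3: "L3 x = vector [a, 0, 0, 0]" unfolding L3_def using M3(1,4) lorentz_adj2(2) by metis
 have y34: "L3 y$3 = 0" "L3 y$4 = 0" using i3[of y n] i3[of y f] y by (simp_all add: f3 n3 me3 me4)
 have "mink (L3 x) (L3 y) = a * b" by (simp add: i3 y)
 hence "a * L3 y$1 = a * b" by (simp add: x3 mink_def)
 hence y1: "L3 y$1 = b" using pos(1) by simp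
 have "mink (L3 y) (L3 y) = b * b + c * c" by (simp add: i3 y)
 hence "L3 y$2 * L3 y$2 = c * c" using y34 y1 by (simp add: mink_def)
 hence "L3 y$2 = c \<or> L3 y$2 = - c" by (metis square_eq_iff)
 moreover have "L3 y$2 > 0"
 proof -
  have "det (vector [L3 x, L3 y, L3 n, L3 f] :: real^4^4) = det (vector [x, y, n, f] :: real^4^4)"
   unfolding L3_def L2_def L1_def by (simp add: det_lorentz_frame M1 M2 M3)
  hence "a * L3 y$2 > 0" using det unfolding det_4 by (simp add: x3 n3 f3 e3_def e4_def)
  thus ?thesis using pos(1) by (simp add: zero_less_mult_iff)
 qed
 ultimately have y2: "L3 y$2 = c" using pos(2) by auto
 have y3: "L3 y = vector [b, c, 0, 0]" using y1 y2 y34 by (simp add: vec_eq_iff forall_4)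
 define M where "M = M1 ** M2 ** M3"
 have Mv: "lorentz M (L3 v) = v" for v
  unfolding M_def L3_def L2_def L1_def lorentz_mult using M1 M2 M3 by simp
 have "det M = 1" using M1 M2 M3 by (simp add: M_def det_mul)
 thus thesis using that Mv[of x] Mv[of y] Mv[of n] Mv[of f] x3 y3 n3 f3 by simp
qed

subsection \<open>The group of Moebius transformations\<close>

lemma PSL2C_carrier: "X \<in> carrier PSL2C \<longleftrightarrow> (\<exists>M. det M = 1 \<and> X = {M, - M})"
proof -
 have "(-mat 1 :: complex^2^2) ** M = - M" for M :: "complex^2^2" by (simp add: uminus_mat_mult matrix_mul_lid)
 hence "{mat 1, - mat 1} #>\<^bsub>SL2C\<^esub> M = {M, - M}" for M
  by (auto simp: r_coset_def SL2C_def matrix_mul_lid)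
 thus ?thesis by (auto simp: PSL2C_def FactGroup_def RCOSETS_def SL2C_def)
qed

lemma PSL2C_mult: "M \<in> X ==> N \<in> Y ==> M ** N \<in> X \<otimes>\<^bsub>PSL2C\<^esub> Y"
 by (auto simp: PSL2C_def FactGroup_def set_mult_def SL2C_def)

lemma PSL2C_memD: "X \<in> carrier PSL2C ==> M \<in> X ==> det M = 1" "X \<in> carrier PSL2C ==> M \<in> X ==> X = {M, - M}"
 by (auto simp: PSL2C_carrier)

lemma psl_act_eq: "X = {M, - M} ==> psl_act X x = lorentz M x"
 unfolding psl_act_def
 by (rule the_equality) (auto simp: herm_lorentz uminus_mat_mult intro: lorentz_unique)

lemma Ad_eq: "X = {M, - M} ==> det M = 1 ==> Ad X Y = M ** Y ** adj2 M"
 unfolding Ad_def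
 by (rule the_equality) (auto simp: matrix_inv_adj2 uminus_mat_mult)

section \<open>Differentiability in a parameter\<close>

lemma bounded_bilinear_mat_mult:
 "bounded_bilinear ((**) :: 'a::{euclidean_space,real_algebra_1}^'n^'m => 'a^'k^'n => 'a^'k^'m)"
proof -
 have "bilinear ((**) :: 'a^'n^'m => 'a^'k^'n => 'a^'k^'m)"
  unfolding bilinear_def
  by (intro conjI allI linearI)
   (simp_all add: matrix_matrix_mult_def vec_eq_iff distrib_left distrib_right sum.distrib scaleR_sum_right)
 thus ?thesis by (simp add: bilinear_conv_bounded_bilinear)
qed

lemma differentiable_bilinear:
 "bounded_bilinear B ==> f differentiable (at x) ==> g differentiable (at x) ==> (\<lambda>t. B (f t) (g t)) differentiable (at x)"
 unfolding differentiable_def using bounded_bilinear.FDERIV by blast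

lemma differentiable_bounded_linear:
 "bounded_linear L ==> f differentiable (at x) ==> (\<lambda>t. L (f t)) differentiable (at x)"
 unfolding differentiable_def using bounded_linear.has_derivative by blast

lemmas differentiable_mat_mult = differentiable_bilinear[OF bounded_bilinear_mat_mult]
lemmas differentiable_nth = differentiable_bounded_linear[OF bounded_linear_vec_nth]

lemma differentiable_vec:
 fixes f :: "'a::real_normed_vector => 'b::euclidean_space^'n"
 assumes "\<And>i. (\<lambda>t. f t$i) differentiable (at x)"
 shows "f differentiable (at x)"
proof -
 have "linear (axis i :: 'b => 'b^'n)" for i
  by (intro linearI) (simp_all add: axis_def vec_eq_iff)
 hence "bounded_linear (axis i :: 'b => 'b^'n)" for i by (simp add: linear_conv_bounded_linear)
 hence "(\<lambda>t. \<Sum>i\<in>UNIV. axis i (f t$i)) differentiable (at x)"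
  using assms by (intro differentiable_sum finite ballI differentiable_bounded_linear[of "axis _"]) auto
 moreover have "(\<Sum>i\<in>UNIV. axis i (f t$i)) = f t" for t
  by (simp add: vec_eq_iff axis_def if_distrib cong: if_cong)
 ultimately show ?thesis by simp
qed

lemma differentiable_linear:
 fixes L :: "'a::euclidean_space => 'b::real_normed_vector"
 shows "linear L ==> f differentiable (at x) ==> (\<lambda>t. L (f t)) differentiable (at x)"
 by (rule differentiable_bounded_linear) (simp add: linear_conv_bounded_linear)

lemma differentiable_cong_eventually:
 assumes "f differentiable (at x)" "\<forall>\<^sub>F t in nhds x. g t = f t"
 shows "g differentiable (at x)"
proof -
 obtain T where "open T" "x \<in> T" "\<And>t. t \<in> T ==> g t = f t" using assms(2) unfolding eventually_nhds by blast
 thus ?thesis using assms(1) differentiable_cong_open by metis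
qed

lemma differentiable_Pair:
 "f differentiable (at x) ==> g differentiable (at x) ==> (\<lambda>t. (f t, g t)) differentiable (at x)"
 unfolding differentiable_def using has_derivative_Pair by blast

lemma differentiable_continuous: "f differentiable (at x) ==> isCont f x"
 by (rule differentiable_imp_continuous_within)

lemma linear_adjoint_matrix: "linear adjoint_matrix"
 by (intro linearI) (simp_all add: adjoint_matrix_def vec_eq_iff)

lemma linear_adj2: "linear adj2"
 by (intro linearI) (simp_all add: mat2_simps)

lemma linear_trace2: "linear (trace :: complex^2^2 => complex)"
 by (intro linearI) (simp_all add: mat2_simps algebra_simps)

lemma differentiable_det2: "M differentiable (at x) ==> (\<lambda>t. det (M t :: complex^2^2)) differentiable (at x)"
 unfolding det_2 by (intro differentiable_diff differentiable_mult differentiable_nth)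

text \<open>The Hermitian action determines every product of an entry with a conjugate entry, so
  \<open>M\<close> is known up to a phase. A differentiable nonzero trace removes the ambiguity:
  multiply by its conjugate and divide.\<close>

lemma spin_lift_differentiable:
 fixes M :: "real => complex^2^2"
 assumes diff: "\<And>c. (\<lambda>t. M t ** herm (axis c 1) ** adjoint_matrix (M t)) differentiable (at 0)"
  and x: "x differentiable (at 0)" "x 0 \<noteq> 0" "\<forall>\<^sub>F t in nhds 0. trace (M t) = x t"
 shows "M differentiable (at 0)"
proof -
 let ?H = "\<lambda>c t. M t ** herm (axis c 1) ** adjoint_matrix (M t)"
 have dH: "(\<lambda>t. ?H c t$i$j) differentiable (at 0)" for c i j
  by (intro differentiable_nth diff)
 have c: "Complex 0 (- 1) = - \<i>" "Complex 0 1 = \<i>" "Complex 1 0 = 1" "Complex 0 0 = 0" by (simp_all add: complex_eq_iff)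
 have "\<i> * x * \<i> * y = (\<i> * \<i>) * (x * y)" for x y by (simp only: mult_ac)
 hence ii: "\<i> * x * \<i> * y = - (x * y)" for x y by simp
 have eqs: "M t$i$1 * cnj (M t$k$1) = (?H 4 t$i$k + ?H 3 t$i$k) / 2"
  "M t$i$2 * cnj (M t$k$2) = (?H 4 t$i$k - ?H 3 t$i$k) / 2"
  "M t$i$1 * cnj (M t$k$2) = (?H 1 t$i$k + \<i> * ?H 2 t$i$k) / 2"
  "M t$i$2 * cnj (M t$k$1) = (?H 1 t$i$k - \<i> * ?H 2 t$i$k) / 2" for t i k
  by (simp_all add: matrix_matrix_mult_def sum_2 adjoint_matrix_def axis_def c ring_distribs mult.assoc[symmetric] ii)
 have prods: "(\<lambda>t. M t$i$a * cnj (M t$k$b)) differentiable (at 0)" for i a k b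
  using exhaust_2[of a] exhaust_2[of b]
  by (elim disjE; simp only: eqs; intro differentiable_divide differentiable_add differentiable_diff differentiable_mult differentiable_const dH; simp)
 show ?thesis
 proof (rule differentiable_vec, rule differentiable_vec)
  fix i j
  show "(\<lambda>t. M t$i$j) differentiable (at 0)"
  proof (rule differentiable_cong_eventually)
   have "(\<lambda>t. cnj (x t)) differentiable (at 0)" by (rule differentiable_linear[OF bounded_linear.linear[OF bounded_linear_cnj] x(1)])
   thus "(\<lambda>t. (M t$i$j * cnj (M t$1$1) + M t$i$j * cnj (M t$2$2)) / cnj (x t)) differentiable (at 0)"
    using x(2) by (intro differentiable_divide differentiable_add prods) auto
   have "isCont x 0" by (rule differentiable_continuous[OF x(1)])
   hence "\<forall>\<^sub>F t in nhds 0. x t \<noteq> 0"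
    using x(2) tendsto_imp_eventually_ne[of x "x 0" "at 0" 0] by (simp add: isCont_def eventually_nhds_conv_at)
   with x(3) show "\<forall>\<^sub>F t in nhds 0. M t$i$j = (M t$i$j * cnj (M t$1$1) + M t$i$j * cnj (M t$2$2)) / cnj (x t)"
    by eventually_elim (simp add: trace_def sum_2 eq_divide_eq flip: distrib_left complex_cnj_add)
  qed
 qed
qed

lemma has_vector_derivative_zero_iff:
 fixes h :: "real => 'b::real_normed_vector"
 assumes "h 0 = 0"
 shows "(h has_vector_derivative d) (at 0) \<longleftrightarrow> ((\<lambda>t. h t /\<^sub>R t) \<longlongrightarrow> d) (at 0)"
proof -
 have "(h has_vector_derivative d) (at 0) \<longleftrightarrow> ((\<lambda>t. norm (h t - t *R d) / norm t) \<longlongrightarrow> 0) (at 0)"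
  using assms by (simp add: has_vector_derivative_def has_derivative_at bounded_linear_scaleR_left)
 also have "\<dots> \<longleftrightarrow> ((\<lambda>t. norm (h t /\<^sub>R t - d)) \<longlongrightarrow> 0) (at 0)"
 proof (rule filterlim_cong[OF refl refl])
  show "\<forall>\<^sub>F t in at 0. norm (h t - t *R d) / norm t = norm (h t /\<^sub>R t - d)"
   unfolding eventually_at_filter
  proof (rule always_eventually, intro allI impI)
   fix t :: real assume t: "t \<noteq> 0"
   hence "h t /\<^sub>R t - d = (h t - t *R d) /\<^sub>R t" by (simp add: scaleR_diff_right)
   thus "norm (h t - t *R d) / norm t = norm (h t /\<^sub>R t - d)" by (simp add: divide_inverse mult.commute)
  qed
 qed
 also have "\<dots> \<longleftrightarrow> ((\<lambda>t. h t /\<^sub>R t) \<longlongrightarrow> d) (at 0)"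
  by (simp add: tendsto_norm_zero_iff LIM_zero_iff)
 finally show ?thesis .
qed

text \<open>Since \<open>h\<close> vanishes at 0, the difference quotient of the product is
  \<open>f\<close> times the difference quotient of \<open>h\<close>, and only a limit of
  \<open>f\<close> enters.\<close>

lemma continuous_times_differentiable_zero:
 fixes f :: "real => 'a::real_normed_vector" and h :: "real => 'b::real_normed_vector"
 assumes B: "bounded_bilinear B" and f: "isCont f 0" and h: "h differentiable (at 0)" "h 0 = 0"
 shows "(\<lambda>t. B (f t) (h t)) differentiable (at 0)"
proof -
 interpret bounded_bilinear B by (rule B)
 obtain h' where "(h has_vector_derivative h') (at 0)"
  using h(1) by (meson vector_derivative_works)
 hence "((\<lambda>t. h t /\<^sub>R t) \<longlongrightarrow> h') (at 0)" using has_vector_derivative_zero_iff[of h, OF h(2)] by blast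
 moreover have "(f \<longlongrightarrow> f 0) (at 0)" using f by (simp add: isCont_def)
 ultimately have "((\<lambda>t. B (f t) (h t /\<^sub>R t)) \<longlongrightarrow> B (f 0) h') (at 0)" by (intro tendsto)
 hence "((\<lambda>t. B (f t) (h t)) has_vector_derivative B (f 0) h') (at 0)"
  by (subst has_vector_derivative_zero_iff) (simp_all add: h(2) zero_right scaleR_right)
 thus ?thesis unfolding has_vector_derivative_def differentiable_def by blast
qed

text \<open>A nonzero traceless \<open>X\<close> commutes only with matrices of the form a + k X,
  and any two of these commute with each other.\<close>

lemma commutant_scalar:
 fixes X M N :: "complex^2^2"
 assumes "X ** M = M ** X" "X ** N = N ** X" "M ** N \<noteq> N ** M" "trace X = 0"
 shows "X = 0"
proof -
 have e: "X$2$2 = - X$1$1" using assms(4) by (simp add: trace_def sum_2 add_eq_0_iff)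
 have c: "X$1$2 * P$2$1 = P$1$2 * X$2$1"
  "2 * X$1$1 * P$1$2 = X$1$2 * (P$1$1 - P$2$2)"
  "2 * X$1$1 * P$2$1 = X$2$1 * (P$1$1 - P$2$2)" if "X ** P = P ** X" for P
 proof -
  have "(X ** P)$i$j = (P ** X)$i$j" for i j using that by simp
  from this[of 1 1] this[of 1 2] this[of 2 1]
  show "X$1$2 * P$2$1 = P$1$2 * X$2$1"
   "2 * X$1$1 * P$1$2 = X$1$2 * (P$1$1 - P$2$2)"
   "2 * X$1$1 * P$2$1 = X$2$1 * (P$1$1 - P$2$2)"
   by (simp_all add: matrix_matrix_mult_def sum_2 e algebra_simps)
 qed
 show ?thesis
 proof (rule ccontr)
  assume "X \<noteq> 0"
  hence nz: "X$1$1 \<noteq> 0 \<or> X$1$2 \<noteq> 0 \<or> X$2$1 \<noteq> 0" using e by (auto simp: vec_eq_iff forall_2)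
  have k: "\<exists>k. P$1$1 = P$2$2 + k * (2 * X$1$1) \<and> P$1$2 = k * X$1$2 \<and> P$2$1 = k * X$2$1"
   if "X ** P = P ** X" for P
  proof -
   note c = c[OF that]
   consider "X$1$2 \<noteq> 0" | "X$2$1 \<noteq> 0" | "X$1$1 \<noteq> 0" using nz by blast
   thus ?thesis
   proof cases
    case 1 thus ?thesis using c by (intro exI[of _ "P$1$2 / X$1$2"]) (simp add: field_simps)
   next
    case 2 thus ?thesis using c by (intro exI[of _ "P$2$1 / X$2$1"]) (simp add: field_simps)
   next
    case 3 thus ?thesis using c by (intro exI[of _ "(P$1$1 - P$2$2) / (2 * X$1$1)"]) (simp add: field_simps)
   qed
  qed
  obtain k1 where k1: "M$1$1 = M$2$2 + k1 * (2 * X$1$1)" "M$1$2 = k1 * X$1$2" "M$2$1 = k1 * X$2$1"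
   using k[OF assms(1)] by blast
  obtain k2 where k2: "N$1$1 = N$2$2 + k2 * (2 * X$1$1)" "N$1$2 = k2 * X$1$2" "N$2$1 = k2 * X$2$1"
   using k[OF assms(2)] by blast
  have "M ** N = N ** M"
   by (simp add: vec_eq_iff forall_2 matrix_matrix_mult_def sum_2 k1 k2 algebra_simps)
  with assms(3) show False by simp
 qed
qed

text \<open>Of \<open>A\<close> not even continuity is known. Relative to \<open>A 0\<close> it
  solves linear intertwining equations with differentiable coefficients, which at time 0 only
  scalars solve. Normalised to trace 2 the solution is therefore continuous and then differentiable;
  the scalar is recovered up to a phase, which the Hermitian action does not see.\<close>

lemma conj_differentiable:
 fixes A M M' N N' :: "real => complex^2^2"
 assumes det: "\<And>t. det (A t) = 1"
  and AM: "\<forall>\<^sub>F t in nhds 0. A t ** M t = M' t ** A t" and AN: "\<forall>\<^sub>F t in nhds 0. A t ** N t = N' t ** A t"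
  and dM: "M differentiable (at 0)" "M' differentiable (at 0)" and dN: "N differentiable (at 0)" "N' differentiable (at 0)"
  and nc: "M 0 ** N 0 \<noteq> N 0 ** M 0"
 shows "(\<lambda>t. A t ** H ** adjoint_matrix (A t)) differentiable (at 0)"
proof -
 define X where "X = (\<lambda>t. adj2 (A 0) ** A t)"
 define Mc where "Mc = (\<lambda>t. adj2 (A 0) ** M' t ** A 0)"
 define Nc where "Nc = (\<lambda>t. adj2 (A 0) ** N' t ** A 0)"
 have A0: "A 0 ** adj2 (A 0) = mat 1" by (simp add: det)
 have detX: "det (X t) = 1" for t by (simp add: X_def det_mul det)
 have X0: "X 0 = mat 1" by (simp add: X_def det)
 have tr: "X t ** P t = (adj2 (A 0) ** P' t ** A 0) ** X t" if "A t ** P t = P' t ** A t" for t and P P' :: "real => complex^2^2"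
 proof -
  have "X t ** P t = adj2 (A 0) ** (P' t ** A t)" using that by (simp add: X_def matrix_mul_assoc[symmetric])
  also have "\<dots> = adj2 (A 0) ** P' t ** (A 0 ** adj2 (A 0)) ** A t" by (simp add: A0 matrix_mul_rid matrix_mul_assoc)
  finally show ?thesis by (simp add: X_def matrix_mul_assoc)
 qed
 have XM: "\<forall>\<^sub>F t in nhds 0. X t ** M t = Mc t ** X t" using AM unfolding Mc_def by (rule eventually_mono) (rule tr)
 have XN: "\<forall>\<^sub>F t in nhds 0. X t ** N t = Nc t ** X t" using AN unfolding Nc_def by (rule eventually_mono) (rule tr)
 have Mc0: "Mc 0 = M 0" using eventually_nhds_x_imp_x[OF XM] by (simp add: X0 matrix_mul_lid matrix_mul_rid)
 have Nc0: "Nc 0 = N 0" using eventually_nhds_x_imp_x[OF XN] by (simp add: X0 matrix_mul_lid matrix_mul_rid)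
 have dMc: "Mc differentiable (at 0)" "Nc differentiable (at 0)"
  unfolding Mc_def Nc_def by (intro differentiable_mat_mult differentiable_const dM dN)+
 define a1 b1 a2 b2 where "a1 = (\<lambda>t. M 0 - M t)" and "b1 = (\<lambda>t. Mc t - M 0)" and "a2 = (\<lambda>t. N 0 - N t)" and "b2 = (\<lambda>t. Nc t - N 0)"
 have dab: "a1 differentiable (at 0)" "b1 differentiable (at 0)" "a2 differentiable (at 0)" "b2 differentiable (at 0)"
  unfolding a1_def b1_def a2_def b2_def by (intro differentiable_diff differentiable_const dM dN dMc)+
 have ab0: "a1 0 = 0" "b1 0 = 0" "a2 0 = 0" "b2 0 = 0" by (simp_all add: a1_def b1_def a2_def b2_def Mc0 Nc0)
 have mat_comm: "mat c ** P = P ** mat c" for c :: complex and P :: "complex^2^2"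
  by (simp add: mat2_simps)
 have trmat: "trace (mat c :: complex^2^2) = 2 * c" for c by (simp add: mat2_simps)
 have lmat: "linear (mat :: complex => complex^2^2)" by (intro linearI) (simp_all add: mat_def vec_eq_iff)
 \<comment> \<open>At time 0 the equations together with the trace form an injective linear map. Its
   left inverse expresses the deviation of a solution from a scalar through the small differences
   \<open>a1\<close>, \<open>b1\<close>, \<open>a2\<close>, \<open>b2\<close>.\<close>
 define l where "l = (\<lambda>W. (W ** M 0 - M 0 ** W, W ** N 0 - N 0 ** W, trace W))"
 have "linear l"
 proof -
  have "bounded_linear (\<lambda>W. (W ** M 0 - M 0 ** W, W ** N 0 - N 0 ** W, trace W))"
   by (intro bounded_linear_Pair bounded_linear_sub bounded_bilinear.bounded_linear_left[OF bounded_bilinear_mat_mult]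
     bounded_bilinear.bounded_linear_right[OF bounded_bilinear_mat_mult])
    (simp add: linear_trace2 flip: linear_conv_bounded_linear)
  thus ?thesis unfolding l_def by (simp add: linear_conv_bounded_linear)
 qed
 moreover have "inj l"
 proof (subst linear_injective_0[OF \<open>linear l\<close>], intro allI impI)
  fix W assume "l W = 0"
  thus "W = 0" using commutant_scalar[of W "M 0" "N 0"] nc by (simp add: l_def zero_prod_def)
 qed
 ultimately obtain g where g: "linear g" "g \<circ> l = id" using linear_injective_left_inverse by blast
 have bg: "bounded_linear g" using g(1) by (simp add: linear_conv_bounded_linear)
 obtain K where K: "K > 0" "\<And>x. norm (g x) \<le> norm x * K" using bounded_linear.pos_bounded[OF bg] by blast
 obtain C where C: "C > 0" "\<And>P Q. norm ((P::complex^2^2) ** (Q::complex^2^2)) \<le> norm P * norm Q * C"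
  using bounded_bilinear.pos_bounded[OF bounded_bilinear_mat_mult[where 'a=complex and 'n=2 and 'm=2 and 'k=2]] by blast
 obtain L where L: "L > 0" "\<And>c. norm (mat c :: complex^2^2) \<le> norm c * L"
  using bounded_linear.pos_bounded[of "mat :: complex => complex^2^2"] lmat by (auto simp: linear_conv_bounded_linear)
 define e where "e = (\<lambda>t. K * C * (norm (a1 t) + norm (b1 t) + norm (a2 t) + norm (b2 t)))"
 define G where "G = (\<lambda>W t. g (W ** a1 t + b1 t ** W, W ** a2 t + b2 t ** W, 0))"
 have Weq: "W - mat (trace W / 2) = G W t" if "W ** M t = Mc t ** W" "W ** N t = Nc t ** W" for W t
 proof -
  have "l (W - mat (trace W / 2)) = (W ** a1 t + b1 t ** W, W ** a2 t + b2 t ** W, 0)"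
  proof -
   have d: "(P - Q) ** R = P ** R - Q ** R" "R ** (P - Q) = R ** P - R ** Q" for P Q R :: "complex^2^2"
    by (simp_all add: bounded_bilinear.diff_left[OF bounded_bilinear_mat_mult] bounded_bilinear.diff_right[OF bounded_bilinear_mat_mult])
   have "trace (W - mat (trace W / 2)) = 0" by (simp add: linear_diff[OF linear_trace2] trmat)
   thus ?thesis
    using that by (simp add: l_def d a1_def b1_def a2_def b2_def mat_comm)
  qed
  thus ?thesis unfolding G_def using g(2) by (metis comp_apply id_apply)
 qed
 have Gn: "norm (G W t) \<le> e t * norm W" for W t
 proof -
  have "norm (W ** a1 t + b1 t ** W, W ** a2 t + b2 t ** W, 0::complex) \<le> norm (W ** a1 t + b1 t ** W) + norm (W ** a2 t + b2 t ** W)"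
   by (rule order.trans[OF norm_Pair_le]) (simp add: norm_Pair)
  also have "\<dots> \<le> (norm W * norm (a1 t) * C + norm (b1 t) * norm W * C) + (norm W * norm (a2 t) * C + norm (b2 t) * norm W * C)"
   by (intro add_mono order.trans[OF norm_triangle_ineq] C)
  finally have "norm (W ** a1 t + b1 t ** W, W ** a2 t + b2 t ** W, 0::complex) * K
    \<le> ((norm W * norm (a1 t) * C + norm (b1 t) * norm W * C) + (norm W * norm (a2 t) * C + norm (b2 t) * norm W * C)) * K"
   using K(1) by (intro mult_right_mono) auto
  also have "\<dots> = e t * norm W" unfolding e_def by (simp only: ring_distribs mult.assoc mult.commute mult.left_commute add.assoc)
  finally have "norm (W ** a1 t + b1 t ** W, W ** a2 t + b2 t ** W, 0::complex) * K \<le> e t * norm W" .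
  thus ?thesis unfolding G_def using K(2) order.trans by blast
 qed
 have ec: "isCont e 0" unfolding e_def by (intro continuous_intros differentiable_continuous dab)
 have e0: "e 0 = 0" by (simp add: e_def ab0)
 have "\<forall>\<^sub>F t in at 0. e t < 1/2" using ec e0 by (intro order_tendstoD(2)[of _ "e 0"]) (auto simp: isCont_def)
 hence ehalf: "\<forall>\<^sub>F t in nhds 0. e t < 1/2" by (simp add: eventually_nhds_conv_at e0)
 \<comment> \<open>Once \<open>e t < 1/2\<close> the deviation is absorbed, so a solution is bounded
   by its trace; in particular the trace of a solution of determinant one cannot vanish.\<close>
 have Wn: "norm W \<le> 2 * L * norm (trace W / 2)" if "W ** M t = Mc t ** W" "W ** N t = Nc t ** W" "e t < 1/2" for W t
 proof -
  have "norm W \<le> norm (W - mat (trace W / 2)) + norm (mat (trace W / 2) :: complex^2^2)"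
   by (metis diff_add_cancel norm_triangle_ineq)
  also have "\<dots> \<le> e t * norm W + norm (trace W / 2) * L"
   unfolding Weq[OF that(1,2)] by (intro add_mono Gn L)
  also have "\<dots> \<le> 1 / 2 * norm W + norm (trace W / 2) * L"
   using that(3) by (intro add_right_mono mult_right_mono) auto
  finally show ?thesis by (simp add: field_simps)
 qed
 define b where "b = (\<lambda>t. trace (X t) / 2)"
 define U where "U = (\<lambda>t. mat (1 / b t) ** X t)"
 have ev: "\<forall>\<^sub>F t in nhds 0. b t \<noteq> 0 \<and> U t - mat 1 = G (U t) t \<and> norm (U t - mat 1) \<le> e t * (2 * L)"
  using XM XN ehalf
 proof eventually_elim
  case (elim t)
  have "b t \<noteq> 0"
  proof
   assume "b t = 0"
   hence "X t = 0" using Wn[OF elim] by (simp add: b_def)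
   thus False using detX[of t] by (simp add: det_2)
  qed
  have trU: "trace (U t) / 2 = 1"
  proof -
   have "trace (mat c ** W) = c * trace W" for c and W :: "complex^2^2" by (simp add: mat2_simps algebra_simps)
   hence "trace (U t) = 1 / b t * (2 * b t)" by (simp add: U_def b_def)
   thus ?thesis using \<open>b t \<noteq> 0\<close> by simp
  qed
  have UM: "U t ** M t = Mc t ** U t" "U t ** N t = Nc t ** U t"
   using elim(1,2) unfolding U_def by (metis (no_types) mat_comm matrix_mul_assoc)+
  have "U t - mat 1 = G (U t) t" using Weq[OF UM] unfolding trU by simp
  moreover have "norm (U t) \<le> 2 * L" using Wn[OF UM elim(3)] unfolding trU by simp
  moreover have "e t \<ge> 0" using K C by (simp add: e_def)
  ultimately show ?case using Gn[of "U t" t] \<open>b t \<noteq> 0\<close> by (smt (verit) mult_left_mono)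
 qed
 have U0: "U 0 = mat 1"
 proof -
  have "b 0 = 1" by (simp add: b_def X0 trmat)
  thus ?thesis by (simp add: U_def X0 matrix_mul_lid)
 qed
 have cU: "isCont U 0"
 proof -
  have "((\<lambda>t. e t * (2 * L)) \<longlongrightarrow> 0) (at 0)" using ec e0 by (auto simp: isCont_def intro: tendsto_mult_left_zero)
  moreover have "\<forall>\<^sub>F t in at 0. norm (U t - mat 1) \<le> e t * (2 * L)"
   using ev unfolding eventually_nhds_conv_at by (auto elim: eventually_mono)
  ultimately have "((\<lambda>t. U t - mat 1) \<longlongrightarrow> 0) (at 0)" by (rule Lim_null_comparison[rotated])
  thus ?thesis by (simp add: isCont_def U0 LIM_zero_iff)
 qed
 \<comment> \<open>In \<open>U t = mat 1 + G (U t) t\<close> every term is linear in a product of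
   \<open>U t\<close> with a differentiable factor vanishing at 0, so continuity of \<open>U\<close>
   improves to differentiability.\<close>
 have dU: "U differentiable (at 0)"
 proof -
  note bm = bounded_bilinear_mat_mult[where 'a=complex and 'n=2 and 'm=2 and 'k=2]
  have "(\<lambda>t. U t ** a1 t + b1 t ** U t) differentiable (at 0)" "(\<lambda>t. U t ** a2 t + b2 t ** U t) differentiable (at 0)"
   by (intro differentiable_add continuous_times_differentiable_zero[OF bm cU]
     continuous_times_differentiable_zero[OF bounded_bilinear.flip[OF bm] cU] dab ab0)+
  hence "(\<lambda>t. (U t ** a1 t + b1 t ** U t, U t ** a2 t + b2 t ** U t, 0)) differentiable (at 0)"
   by (intro differentiable_Pair differentiable_const)
  hence "(\<lambda>t. mat 1 + G (U t) t) differentiable (at 0)"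
   unfolding G_def by (intro differentiable_add differentiable_const differentiable_bounded_linear[OF bg])
  moreover have "\<forall>\<^sub>F t in nhds 0. U t = mat 1 + G (U t) t"
   using ev by (rule eventually_mono) (metis add.commute diff_add_cancel)
  ultimately show ?thesis by (rule differentiable_cong_eventually)
 qed
 \<comment> \<open>\<open>A t\<close> is the scalar \<open>b t\<close> times
   \<open>A 0 ** U t\<close>. Only the squared modulus of the scalar enters, and determinant one
   makes it \<open>1 / norm (det (U t))\<close>; the uncontrolled phase cancels.\<close>
 have "\<forall>\<^sub>F t in nhds 0. A t ** H ** adjoint_matrix (A t) =
  (1 / norm (det (U t))) *R (A 0 ** U t ** H ** adjoint_matrix (U t) ** adjoint_matrix (A 0))"
  using ev
 proof (rule eventually_mono)
  fix t assume "b t \<noteq> 0 \<and> U t - mat 1 = G (U t) t \<and> norm (U t - mat 1) \<le> e t * (2 * L)"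
  hence b: "b t \<noteq> 0" by simp
  have "mat (b t) ** U t = X t" using b by (simp add: U_def mat2_simps)
  hence "A 0 ** (mat (b t) ** U t) = A t" by (simp add: X_def matrix_mul_assoc A0 matrix_mul_lid)
  hence A: "A t = mat (b t) ** (A 0 ** U t)" by (metis mat_comm matrix_mul_assoc)
  have "det (mat (b t) ** U t) = b t * b t * det (U t)" by (simp add: mat2_simps algebra_simps)
  hence "norm (b t) * norm (b t) * norm (det (U t)) = 1"
   using detX[of t] \<open>mat (b t) ** U t = X t\<close> by (metis norm_mult norm_one)
  hence n: "b t * cnj (b t) = complex_of_real (1 / norm (det (U t)))"
   by (metis complex_norm_square mult_eq_0_iff nonzero_eq_divide_eq power2_eq_square zero_neq_one)
  have "mat c ** P ** H ** adjoint_matrix (mat c ** P) = mat (c * cnj c) ** (P ** H ** adjoint_matrix P)" for c P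
   by (simp add: mat2_simps algebra_simps)
  hence "A t ** H ** adjoint_matrix (A t) = mat (complex_of_real (1 / norm (det (U t)))) ** (A 0 ** U t ** H ** adjoint_matrix (A 0 ** U t))"
   unfolding A n[symmetric] by blast
  also have "\<dots> = (1 / norm (det (U t))) *R (A 0 ** U t ** H ** adjoint_matrix (A 0 ** U t))"
  proof -
   have "mat (complex_of_real r) ** P = r *R P" for r and P :: "complex^2^2" by (simp add: vec_eq_iff forall_2 matrix_matrix_mult_def sum_2 mat_def) (simp add: scaleR_conv_of_real)
   thus ?thesis .
  qed
  finally show "A t ** H ** adjoint_matrix (A t) = (1 / norm (det (U t))) *R (A 0 ** U t ** H ** adjoint_matrix (U t) ** adjoint_matrix (A 0))"
   by (simp add: adjoint_matrix_mult matrix_mul_assoc)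
 qed
 moreover have "(\<lambda>t. (1 / norm (det (U t))) *R (A 0 ** U t ** H ** adjoint_matrix (U t) ** adjoint_matrix (A 0))) differentiable (at 0)"
 proof -
  have dd: "(\<lambda>t. det (U t)) differentiable (at 0)" by (rule differentiable_det2[OF dU])
  have "det (U 0) \<noteq> 0" by (simp add: U0)
  hence "(\<lambda>t. norm (det (U t))) differentiable (at 0)"
   using differentiable_compose[of norm "\<lambda>t. det (U t)" 0 UNIV] differentiable_norm_at[of "det (U 0)"] dd by simp
  hence "(\<lambda>t. 1 / norm (det (U t))) differentiable (at 0)"
   using \<open>det (U 0) \<noteq> 0\<close> by (intro differentiable_divide differentiable_const) auto
  thus ?thesis
   by (intro differentiable_bilinear[OF bounded_bilinear_scaleR] differentiable_mat_mult differentiable_const dU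
     differentiable_linear[OF linear_adjoint_matrix])
 qed
 ultimately show ?thesis by (rule differentiable_cong_eventually[rotated])
qed

text \<open>The derivative is uniformly continuous on a compact neighbourhood times
  \<open>K\<close>, and the mean value inequality converts this into uniform convergence of the
  difference quotients.\<close>

lemma uniform_parameter_derivative:
 fixes H :: "(real^2) \<times> (real^2) => 'b::euclidean_space"
 assumes "open U" "u \<in> U" "Ck_on 1 (U \<times> UNIV) H" "compact K"
 shows "uniform_limit K (\<lambda>t z. (H (u + t *R axis k 1, z) - H (u, z)) /\<^sub>R t)
  (\<lambda>z. FD H (u, z) (axis k 1, 0)) (at 0)"
proof (rule uniform_limitI)
 fix e :: real assume "e > 0"
 define D where "D = (\<lambda>q. FD H q (axis k 1, 0))"
 have b: "(axis k 1, 0) \<in> (Basis :: ((real^2) \<times> (real^2)) set)" by (auto simp: Basis_prod_def axis_in_Basis_iff)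
 have "Ck_on (Suc 0) (U \<times> UNIV) H" using assms(3) by (simp only: One_nat_def)
 hence Dc: "continuous_on (U \<times> UNIV) D" and d: "\<And>q. q \<in> U \<times> UNIV ==> H differentiable (at q)"
  using b unfolding D_def Ck_on.simps(2) by auto
 obtain r where r: "r > 0" "cball u r \<subseteq> U" using assms(1,2) open_contains_cball by blast
 have "uniformly_continuous_on (cball u r \<times> K) D"
  using r by (intro compact_uniformly_continuous continuous_on_subset[OF Dc] compact_Times assms(4)) auto
 then obtain d where d0: "d > 0" and dd: "\<And>q q'. q \<in> cball u r \<times> K ==> q' \<in> cball u r \<times> K ==> dist q' q < d ==> dist (D q') (D q) < e / 2"
  unfolding uniformly_continuous_on_def using \<open>e > 0\<close> by (metis half_gt_zero)
 have main: "dist ((H (u + t *R axis k 1, z) - H (u, z)) /\<^sub>R t) (D (u, z)) < e" if t: "\<bar>t\<bar> < min r d" "t \<noteq> 0" and z: "z \<in> K" for t z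
 proof -
  let ?I = "closed_segment 0 t"
  define q where "q = (\<lambda>a. (u + a *R axis k 1, z))"
  define h where "h = (\<lambda>a. H (q a) - a *R D (u, z))"
  have qin: "q a \<in> cball u r \<times> K" "dist (q a) (u, z) = \<bar>a\<bar>" if "\<bar>a\<bar> \<le> \<bar>t\<bar>" for a
   using that t z by (simp_all add: q_def dist_norm dist_Pair_Pair)
  have "norm (h t - h 0) \<le> e / 2 * norm (t - 0)"
  proof (rule differentiable_bound[where S = ?I])
   fix a assume "a \<in> ?I"
   hence a: "\<bar>a\<bar> \<le> \<bar>t\<bar>" by (auto simp: closed_segment_eq_real_ivl split: if_splits)
   have q': "(q has_derivative (\<lambda>x. x *R (axis k 1, 0))) (at a within ?I)"
    unfolding q_def by (auto intro!: derivative_eq_intros)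
   have qU: "q a \<in> U \<times> UNIV" using qin(1)[OF a] r by auto
   have "((\<lambda>x. H (q x)) has_derivative (\<lambda>x. x *R D (q a))) (at a within ?I)"
    using has_derivative_compose[OF q' d[OF qU, unfolded frechet_derivative_works]]
    unfolding D_def by (simp only: linear_scale[OF linear_frechet_derivative[OF d[OF qU]]])
   thus "(h has_derivative (\<lambda>x. x *R D (q a) - x *R D (u, z))) (at a within ?I)"
    unfolding h_def by (auto intro!: derivative_eq_intros)
   have "dist (D (q a)) (D (u, z)) < e / 2"
    using a t z r qin[OF a] by (intro dd) auto
   hence "norm (D (q a) - D (u, z)) \<le> e / 2" by (simp add: dist_norm)
   thus "onorm (\<lambda>x. x *R D (q a) - x *R D (u, z)) \<le> e / 2"
    unfolding scaleR_diff_right[symmetric] by (intro onorm_le) (simp only: norm_scaleR real_norm_def mult.commute[of "e / 2"] mult_left_mono abs_ge_zero)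
  qed auto
  hence "norm ((h t - h 0) /\<^sub>R t) \<le> e / 2" using t(2) by (simp add: divide_inverse_commute[symmetric] divide_le_eq)
  moreover have "(h t - h 0) /\<^sub>R t = (H (u + t *R axis k 1, z) - H (u, z)) /\<^sub>R t - D (u, z)"
   using t(2) by (simp add: h_def q_def algebra_simps)
  ultimately show ?thesis using \<open>e > 0\<close> by (simp add: dist_norm)
 qed
 have "min r d > 0" using r d0 by simp
 thus "\<forall>\<^sub>F t in at 0. \<forall>z\<in>K. dist ((H (u + t *R axis k 1, z) - H (u, z)) /\<^sub>R t) (FD H (u, z) (axis k 1, 0)) < e"
  unfolding eventually_at using main by (intro exI[of _ "min r d"]) (auto simp: dist_norm D_def)
qed

text \<open>First-order perturbation of the equation E' = 0. The uniform convergence of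
  \<open>P t s /\<^sub>R t\<close> forces the solutions to tend to the identity uniformly, and
  integrating the equation divided by \<open>t\<close> gives the derivative.\<close>

lemma linear_ode_parameter:
 fixes E P :: "real => real => real^'n^'n" and P' :: "real => real^'n^'n"
 assumes ode: "\<forall>\<^sub>F t in at 0. \<forall>s\<in>{0..1}. (E t has_vector_derivative P t s ** E t s) (at s within {0..1})"
  and P: "uniform_limit {0..1} (\<lambda>t s. P t s /\<^sub>R t) P' (at 0)"
  and P': "continuous_on {0..1} P'"
  and init: "((\<lambda>t. E t 0) has_vector_derivative E') (at 0)" "\<And>s. E 0 s = mat 1"
 shows "((\<lambda>t. E t 1) has_vector_derivative E' + integral {0..1} P') (at 0)"
proof -
 note bb = bounded_bilinear_mat_mult
 obtain C where C: "C > 0" "\<And>P Q. norm ((P::real^'n^'n) ** (Q::real^'n^'n)) \<le> norm P * norm Q * C"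
  using bounded_bilinear.pos_bounded[OF bb[where 'a=real and 'n='n and 'm='n and 'k='n]] by blast
 have bP: "bounded (P' ` {0..1})" using P' by (intro compact_imp_bounded compact_continuous_image) auto
 then obtain B where B: "B > 0" "\<And>s. s \<in> {0..1} ==> norm (P' s) \<le> B" unfolding bounded_pos by auto
 define N where "N = norm (mat 1 :: real^'n^'n) + 1"
 have N: "N > 0" unfolding N_def by (simp add: add_nonneg_pos)
 have vd: "norm (h b - h 0) \<le> M" if "\<And>s. s \<in> {0..1} ==> (h has_vector_derivative h' s) (at s within {0..1})"
  "\<And>s. s \<in> {0..1} ==> norm (h' s) \<le> M" "b \<in> {0..1}" for h h' :: "real => real^'n^'n" and M b
 proof -
  have "norm (h b - h 0) \<le> M * norm (b - 0)"
   by (rule differentiable_bound[where S = "{0..1}" and f' = "\<lambda>s x. x *R h' s"])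
    (use that in \<open>auto simp: has_vector_derivative_def mult.commute[of M] intro!: onorm_le mult_left_mono\<close>)
  also have "\<dots> \<le> M" using that(3) order.trans[OF norm_ge_zero that(2)[OF that(3)]] by (auto intro: mult_left_le)
  finally show ?thesis .
 qed
 have t0: "\<forall>\<^sub>F t in at 0. t \<noteq> (0::real)" by (simp add: eventually_at_filter)
 have E: "uniform_limit {0..1} E (\<lambda>s. mat 1) (at 0)"
 proof (rule uniform_limitI)
  fix e :: real assume e: "e > 0"
  have "((\<lambda>t. E t 0) \<longlongrightarrow> mat 1) (at 0)" using has_vector_derivative_continuous[OF init(1)] by (simp add: isCont_def init(2))
  hence e0: "\<forall>\<^sub>F t in at 0. dist (E t 0) (mat 1) < min 1 (e / 2)" using e by (intro tendstoD) auto
  have "((\<lambda>t. (B + 1) * C * \<bar>t\<bar>) \<longlongrightarrow> (B + 1) * C * \<bar>0\<bar>) (at 0)" by (intro tendsto_intros)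
  hence k: "\<forall>\<^sub>F t in at 0. (B + 1) * C * \<bar>t\<bar> < min (1 / 2) (e / (4 * N))" using e N by (intro order_tendstoD(2)) auto
  show "\<forall>\<^sub>F t in at 0. \<forall>s\<in>{0..1}. dist (E t s) (mat 1) < e"
   using ode uniform_limitD[OF P zero_less_one] e0 k t0
  proof eventually_elim
   case (elim t)
   have Pn: "norm (P t s) \<le> (B + 1) * \<bar>t\<bar>" if s: "s \<in> {0..1}" for s
   proof -
    have "norm (P t s /\<^sub>R t) \<le> B + 1"
     using elim(2) B(2)[OF s] s norm_triangle_sub[of "P t s /\<^sub>R t" "P' s"] by (force simp: dist_norm)
    thus ?thesis using elim(5) by (simp add: field_simps)
   qed
   have "continuous_on {0..1} (E t)"
    using elim(1) by (intro continuous_on_eq_continuous_within[THEN iffD2] ballI has_vector_derivative_continuous) auto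
   hence "continuous_on {0..1} (\<lambda>s. norm (E t s))" by (rule continuous_on_norm)
   then obtain s0 where s0: "s0 \<in> {0..1}" "\<And>s. s \<in> {0..1} ==> norm (E t s) \<le> norm (E t s0)"
    using continuous_attains_sup[of "{0..1::real}" "\<lambda>s. norm (E t s)"] by auto
   \<comment> \<open>The maximum \<open>W\<close> of the norm takes the place of a Gronwall
     estimate: the change over the interval is at most \<open>k * W\<close> with
     \<open>k < 1 / 2\<close>, so \<open>W\<close> is at most twice the initial bound.\<close>
   define k W where "k = (B + 1) * C * \<bar>t\<bar>" and "W = norm (E t s0)"
   have k: "k < 1 / 2" "k < e / (4 * N)" "k \<ge> 0" using elim(4) B(1) C(1) by (simp_all add: k_def)
   have diff: "norm (E t s - E t 0) \<le> k * W" if "s \<in> {0..1}" for s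
   proof (rule vd[of "E t" "\<lambda>s. P t s ** E t s", OF _ _ that])
    fix s :: real assume s: "s \<in> {0..1}"
    show "(E t has_vector_derivative P t s ** E t s) (at s within {0..1})" using elim(1) s by blast
    have "norm (P t s ** E t s) \<le> (B + 1) * \<bar>t\<bar> * W * C"
     using Pn[OF s] s0(2)[OF s] C B(1) unfolding W_def by (intro order.trans[OF C(2)] mult_right_mono mult_mono) auto
    thus "norm (P t s ** E t s) \<le> k * W" by (simp add: k_def mult_ac)
   qed
   have "W \<le> norm (E t s0 - E t 0) + norm (E t 0)" unfolding W_def by (metis diff_add_cancel norm_triangle_ineq)
   also have "\<dots> \<le> 1 / 2 * W + N"
   proof (rule add_mono)
    show "norm (E t s0 - E t 0) \<le> 1 / 2 * W"
     using diff[OF s0(1)] mult_right_mono[of k "1 / 2" W] k(1) by (simp add: W_def)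
    show "norm (E t 0) \<le> N" using elim(3) norm_triangle_sub[of "E t 0" "mat 1"] by (simp add: N_def dist_norm)
   qed
   finally have W: "W \<le> 2 * N" by simp
   show ?case
   proof
    fix s :: real assume s: "s \<in> {0..1}"
    have "norm (E t s - E t 0) \<le> k * (2 * N)" using order.trans[OF diff[OF s] mult_left_mono[OF W k(3)]] .
    also have "\<dots> < e / 2" using k(2) N by (simp add: field_simps)
    finally have "dist (E t s) (E t 0) < e / 2" by (simp add: dist_norm)
    moreover have "dist (E t 0) (mat 1) < e / 2" using elim(3) by simp
    ultimately show "dist (E t s) (mat 1) < e" using dist_triangle[of "E t s" "mat 1" "E t 0"] by linarith
   qed
  qed
 qed
 have PE: "uniform_limit {0..1} (\<lambda>t s. (P t s /\<^sub>R t) ** E t s) (\<lambda>s. P' s ** mat 1) (at 0)"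
  by (rule bounded_bilinear.bounded_uniform_limit[OF bb P E _ bP]) (auto simp: image_constant_conv)
 define h where "h = (\<lambda>t. E t 1 - E t 0)"
 have h0: "h 0 = 0" by (simp add: h_def init(2))
 have "((\<lambda>t. h t /\<^sub>R t) \<longlongrightarrow> integral {0..1} P') (at 0)"
 proof (rule tendstoI)
  fix e :: real assume e: "e > 0"
  show "\<forall>\<^sub>F t in at 0. dist (h t /\<^sub>R t) (integral {0..1} P') < e"
   using ode uniform_limitD[OF PE half_gt_zero[OF e]]
  proof eventually_elim
   case (elim t)
   define k where "k = (\<lambda>s. E t s /\<^sub>R t - integral {0..s} P')"
   have "norm (k 1 - k 0) \<le> e / 2"
   proof (rule vd[of k "\<lambda>s. (P t s /\<^sub>R t) ** E t s - P' s"])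
    fix s :: real assume s: "s \<in> {0..1}"
    have "((\<lambda>s. E t s /\<^sub>R t) has_vector_derivative (P t s /\<^sub>R t) ** E t s) (at s within {0..1})"
     unfolding bounded_bilinear.scaleR_left[OF bb] using elim(1) s
     by (intro bounded_linear.has_vector_derivative[OF bounded_linear_scaleR_right]) blast
    thus "(k has_vector_derivative (P t s /\<^sub>R t) ** E t s - P' s) (at s within {0..1})"
     unfolding k_def by (intro has_vector_derivative_diff integral_has_vector_derivative[OF P' s])
    show "norm ((P t s /\<^sub>R t) ** E t s - P' s) \<le> e / 2" using elim(2) s by (force simp: dist_norm matrix_mul_rid)
   qed simp
   moreover have "k 1 - k 0 = h t /\<^sub>R t - integral {0..1} P'" by (simp add: k_def h_def scaleR_diff_right)
   ultimately show ?case using e by (simp add: dist_norm)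
  qed
 qed
 hence "(h has_vector_derivative integral {0..1} P') (at 0)" unfolding has_vector_derivative_zero_iff[of h, OF h0] .
 from has_vector_derivative_add[OF init(1) this] show ?thesis by (simp add: h_def)
qed

section \<open>Frames in Minkowski space and their connection matrices\<close>

lemma bounded_bilinear_mink: "bounded_bilinear mink"
proof -
 have "bilinear mink"
  unfolding bilinear_def
  by (intro conjI allI linearI) (simp_all add: mink_add_left mink_add_right mink_scaleR_left mink_scaleR_right)
 thus ?thesis by (simp add: bilinear_conv_bounded_bilinear)
qed

definition eta_mat :: "real^4^4" where
 "eta_mat = vector [vector [1,0,0,0], vector [0,1,0,0], vector [0,0,1,0], vector [0,0,0,-1]]"

text \<open>Acts by \<open>P\<close> on the two tangent rows of a frame and fixes the normal row.
  The last entry is -1 in Gram matrices, the position vector being timelike, and 1 in changes of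
  coordinates.\<close>

definition block :: "real^2^2 => real => real^4^4" where
 "block P r = vector [vector [P$1$1, P$1$2, 0, 0], vector [P$2$1, P$2$2, 0, 0], vector [0,0,1,0], vector [0,0,0,r]]"

lemmas mat4_simps = vec_eq_iff forall_4 matrix_matrix_mult_def sum_4 mat_def

lemma matrix_mult_row:
 fixes X :: "real^'n^'m" and Y :: "real^'k^'n"
 shows "(X ** Y)$i = (\<Sum>k\<in>UNIV. X$i$k *R Y$k)"
 by (simp add: vec_eq_iff matrix_matrix_mult_def)

lemma vec4_eq: "x = y \<longleftrightarrow> x$1 = y$1 \<and> x$2 = y$2 \<and> x$3 = y$3 \<and> x$4 = y$4" for x y :: "'a^4"
 by (simp add: vec_eq_iff forall_4)

lemma block_mult: "block P r ** block Q s = block (P ** Q) (r * s)"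
 by (simp add: mat4_simps block_def sum_2)

lemma block_1 [simp]: "block (mat 1) 1 = mat 1"
 by (simp add: mat4_simps block_def)

lemma det_block: "det (block P r) = r * det P"
 by (simp add: det_4 det_2 block_def algebra_simps)

lemma mink_matrix: "(X ** eta_mat ** transpose Y)$a$b = mink (X$a) (Y$b)"
 by (simp add: matrix_matrix_mult_def sum_4 eta_mat_def transpose_def mink_def)

lemma det_eta_mat: "det eta_mat = -1"
 by (simp add: det_4 eta_mat_def)

lemma inverse_2x2:
 fixes P :: "real^2^2"
 assumes "det P \<noteq> 0"
 shows "matrix_inv P ** P = mat 1" "P ** matrix_inv P = mat 1"
  and matrix_inv_2x2: "matrix_inv P = vector [vector [P$2$2 / det P, - P$1$2 / det P], vector [- P$2$1 / det P, P$1$1 / det P]]"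
proof -
 let ?Q = "vector [vector [P$2$2 / det P, - P$1$2 / det P], vector [- P$2$1 / det P, P$1$1 / det P]] :: real^2^2"
 have "P ** ?Q = mat 1" "?Q ** P = mat 1"
  using assms by (simp_all add: vec_eq_iff forall_2 matrix_matrix_mult_def sum_2 mat_def field_simps) (simp_all add: det_2 field_simps)
 thus "matrix_inv P = ?Q" "matrix_inv P ** P = mat 1" "P ** matrix_inv P = mat 1"
  using matrix_inv_eqI by metis+
qed

definition frame :: "(real^2 => real^4) => (real^2 => real^4) => real^2 => real^4^4" where
 "frame f n z = vector [partial f 1 z, partial f 2 z, n z, f z]"

lemma frame_nth [simp]: "frame f n z$1 = partial f 1 z" "frame f n z$2 = partial f 2 z"
 "frame f n z$3 = n z" "frame f n z$4 = f z"
 by (simp_all add: frame_def)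

text \<open>\<open>christoffel_lower I i j l\<close> is \<open>I(\<nabla>\<^sub>i \<partial>\<^sub>j, \<partial>\<^sub>l)\<close>.\<close>

definition christoffel_lower :: "tensor => 2 => 2 => 2 => real^2 => real" where
 "christoffel_lower I i j l z = (1/2) *
  (partial (\<lambda>w. I w$j$l) i z + partial (\<lambda>w. I w$i$l) j z - partial (\<lambda>w. I w$i$j) l z)"

text \<open>The Minkowski products of the \<open>i\<close>-th derivative of the frame with the four
  frame vectors, in terms of the germ alone.\<close>

definition second_form :: "germ => 2 => real^2 => real^4^4" where
 "second_form G i z = vector [
  vector [christoffel_lower (fst G) i 1 1 z, christoffel_lower (fst G) i 1 2 z, snd G z$i$1, - fst G z$i$1],
  vector [christoffel_lower (fst G) i 2 1 z, christoffel_lower (fst G) i 2 2 z, snd G z$i$2, - fst G z$i$2],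
  vector [- snd G z$i$1, - snd G z$i$2, 0, 0],
  vector [fst G z$i$1, fst G z$i$2, 0, 0]]"

text \<open>The connection matrix, obtained from its lowered form by the inverse Gram matrix. It
  depends only on the germ and so is smooth in the parameter, whatever immersions are
  chosen.\<close>

definition weingarten :: "germ => 2 => real^2 => real^4^4" where
 "weingarten G i z = second_form G i z ** block (matrix_inv (fst G z)) (-1)"

text \<open>The frame in normal position: by \<open>frame_cholesky\<close> every frame over the
  metric \<open>P\<close> is this matrix times a Lorentz matrix, so that the unknown part of a frame
  lies in the group alone.\<close>

definition cholesky :: "real^2^2 => real^4^4" where
 "cholesky P =
  vector [vector [sqrt (P$1$1), 0, 0, 0], vector [P$1$2 / sqrt (P$1$1), sqrt (det P) / sqrt (P$1$1), 0, 0], e3, e4]"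

lemma cholesky_nth:
 "cholesky P$1 = vector [sqrt (P$1$1), 0, 0, 0]"
 "cholesky P$2 = vector [P$1$2 / sqrt (P$1$1), sqrt (det P) / sqrt (P$1$1), 0, 0]"
 "cholesky P$3 = e3" "cholesky P$4 = e4"
 unfolding cholesky_def vector_4 by (rule refl)+

section \<open>Moving frames of families of immersions\<close>

locale immersion =
 fixes f n :: "real^2 => real^4" and G :: germ
 assumes immersion: "hyperbolic_immersion f n G"
begin

lemma smooth: "smooth_on UNIV f" "smooth_on UNIV n"
 and in_H3: "mink (f z) (f z) = -1" "f z$4 > 0"
 and normal: "mink (n z) (f z) = 0" "mink (f z) (n z) = 0" "mink (n z) (n z) = 1" "mink (n z) (partial f i z) = 0" "mink (partial f i z) (n z) = 0"
 and first_form: "mink (partial f i z) (partial f j z) = fst G z$i$j"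
 and second_fundamental: "mink (partial n i z) (partial f j z) = - snd G z$i$j"
 and det_frame: "det (frame f n z) > 0"
 using immersion unfolding hyperbolic_immersion_def H3_def frame_def by (auto simp: mink_commute minus_equation_iff)

lemma Ck: "Ck_on k UNIV f" "Ck_on k UNIV n" "Ck_on k UNIV (partial f i)" "Ck_on k UNIV (partial (partial f i) j)"
 by (intro smooth_onD smooth Ck_on_partial open_UNIV)+

lemma diff: "f differentiable (at z)" "n differentiable (at z)" "partial f i differentiable (at z)"
 by (rule Ck_on_differentiable[OF Ck(1)], simp, rule Ck_on_differentiable[OF Ck(2)], simp, rule Ck_on_differentiable[OF Ck(3)], simp)

lemmas partial_mink = partial_bilinear[OF bounded_bilinear_mink]

lemma tangent [simp]: "mink (partial f i z) (f z) = 0" "mink (f z) (partial f i z) = 0"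
proof -
 have "partial (\<lambda>z. mink (f z) (f z)) i z = 0" unfolding in_H3 by simp
 thus "mink (partial f i z) (f z) = 0" "mink (f z) (partial f i z) = 0"
  unfolding partial_mink[OF diff(1) diff(1)] by (simp_all add: mink_commute)
qed

lemma normal_derivative: "mink (partial n i z) (n z) = 0" "mink (partial n i z) (f z) = 0"
proof -
 have "partial (\<lambda>z. mink (n z) (n z)) i z = 0" unfolding normal by simp
 thus "mink (partial n i z) (n z) = 0"
  unfolding partial_mink[OF diff(2) diff(2)] by (simp add: mink_commute)
 have "partial (\<lambda>z. mink (n z) (f z)) i z = 0" unfolding normal by simp
 thus "mink (partial n i z) (f z) = 0"
  unfolding partial_mink[OF diff(2) diff(1)] by (simp add: normal)
qed

lemma second_derivative_normal: "mink (partial (partial f j) i z) (n z) = snd G z$i$j"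
proof -
 have "partial (\<lambda>z. mink (n z) (partial f j z)) i z = 0" unfolding normal by simp
 thus ?thesis
  unfolding partial_mink[OF diff(2) diff(3)] by (simp add: mink_commute[of "partial f j z" "partial n i z"] second_fundamental) (simp add: mink_commute)
qed

lemma second_derivative_position: "mink (partial (partial f j) i z) (f z) = - fst G z$i$j"
proof -
 have "partial (\<lambda>z. mink (partial f j z) (f z)) i z = 0" by simp
 thus ?thesis
  unfolding partial_mink[OF diff(3) diff(1)] by (simp add: first_form mink_commute)
qed

lemma fst_sym: "fst G z$i$j = fst G z$j$i"
 by (metis first_form mink_commute)

lemma second_derivative_commute: "partial (partial f j) i z = partial (partial f i) j z"
 by (rule partial_partial_commute[OF open_UNIV UNIV_I Ck(1)])

lemma snd_sym: "snd G z$i$j = snd G z$j$i"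
 using second_derivative_normal second_derivative_commute by metis

text \<open>The Koszul formula: the derivatives of the metric coefficients are sums of such
  products, and since second derivatives of \<open>f\<close> commute, the alternating combination
  isolates one of them.\<close>

lemma second_derivative_tangent: "mink (partial (partial f j) i z) (partial f l z) = christoffel_lower (fst G) i j l z"
proof -
 have d: "partial (\<lambda>w. fst G w$b$c) a z = mink (partial (partial f b) a z) (partial f c z) + mink (partial f b z) (partial (partial f c) a z)" for a b c
  unfolding first_form[symmetric] partial_mink[OF diff(3) diff(3)] by simp
 show ?thesis
  unfolding christoffel_lower_def d second_derivative_commute[of j i] second_derivative_commute[of l i] second_derivative_commute[of l j]
  by (simp add: mink_commute)
qed

lemma frame_gram: "frame f n z ** eta_mat ** transpose (frame f n z) = block (fst G z) (-1)"
 unfolding vec_eq_iff mink_matrix forall_4 by (simp add: block_def normal first_form in_H3)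

lemma det_first: "det (fst G z) = (det (frame f n z))\<^sup>2"
proof -
 have "det (frame f n z ** eta_mat ** transpose (frame f n z)) = det (block (fst G z) (-1))" by (simp only: frame_gram)
 thus ?thesis by (simp add: det_mul det_transpose det_eta_mat det_block power2_eq_square)
qed

lemma det_first_pos: "det (fst G z) > 0" "det (fst G z) \<noteq> 0"
 using det_frame[of z] by (simp_all add: det_first)

text \<open>The Gram relation exhibits the inverse of the frame explicitly, which makes its entries
  as smooth as those of the frame and of the metric.\<close>

lemma frame_inverse: "eta_mat ** transpose (frame f n z) ** block (matrix_inv (fst G z)) (-1) ** frame f n z = mat 1"
 and frame_inverse': "frame f n z ** (eta_mat ** transpose (frame f n z) ** block (matrix_inv (fst G z)) (-1)) = mat 1"
proof -
 have "frame f n z ** (eta_mat ** transpose (frame f n z) ** block (matrix_inv (fst G z)) (-1)) =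
   block (fst G z) (-1) ** block (matrix_inv (fst G z)) (-1)" by (simp add: frame_gram[symmetric] matrix_mul_assoc)
 also have "\<dots> = mat 1" by (simp add: block_mult inverse_2x2(2) det_first_pos)
 finally show "frame f n z ** (eta_mat ** transpose (frame f n z) ** block (matrix_inv (fst G z)) (-1)) = mat 1" .
 thus "eta_mat ** transpose (frame f n z) ** block (matrix_inv (fst G z)) (-1) ** frame f n z = mat 1"
  by (simp add: matrix_left_right_inverse)
qed

lemma Ck_frame: "Ck_on k UNIV (frame f n)"
proof (rule Ck_on_vec[OF open_UNIV])
 fix i :: 4
 show "Ck_on k UNIV (\<lambda>z. frame f n z$i)" using exhaust_4[of i] by (elim disjE) (simp_all add: Ck)
qed

lemma partial_frame_nth: "partial (frame f n) i z$a = partial (\<lambda>z. frame f n z$a) i z"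
 by (rule partial_nth[symmetric]) (rule Ck_on_differentiable[OF Ck_frame], simp)

text \<open>Pairing the derivative of the frame with the frame gives \<open>second_form\<close>; the
  explicit inverse of the frame then expands the derivative in the frame itself.\<close>

lemma gauss_weingarten: "partial (frame f n) i z = weingarten G i z ** frame f n z"
proof -
 have "partial (frame f n) i z ** eta_mat ** transpose (frame f n z) = second_form G i z"
  unfolding vec_eq_iff mink_matrix forall_4
  by (simp add: partial_frame_nth second_form_def second_derivative_tangent second_derivative_normal second_derivative_position
   normal_derivative second_fundamental normal first_form)
 hence "weingarten G i z ** frame f n z = partial (frame f n) i z **
   (eta_mat ** transpose (frame f n z) ** block (matrix_inv (fst G z)) (-1) ** frame f n z)"
  by (simp add: weingarten_def matrix_mul_assoc)
 thus ?thesis by (simp add: frame_inverse)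
qed

text \<open>Expanded in the frame, \<open>m\<close> has only a normal component \<open>c\<close>;
  the norm gives \<open>c * c = 1\<close> and the orientation excludes -1.\<close>

lemma normal_unique:
 assumes "mink m (f z) = 0" "mink m (partial f 1 z) = 0" "mink m (partial f 2 z) = 0" "mink m m = 1"
  "det (vector [partial f 1 z, partial f 2 z, m, f z] :: real^4^4) > 0"
 shows "m = n z"
proof -
 define X :: "real^4^4" where "X = vector [partial f 1 z, partial f 2 z, m, f z]"
 define c where "c = mink m (n z)"
 have r3: "(X ** eta_mat ** transpose (frame f n z))$3 = vector [0, 0, c, 0]"
  by (simp add: vec_eq_iff forall_4 mink_matrix X_def assms c_def)
 have r4: "(X ** eta_mat ** transpose (frame f n z) ** block (matrix_inv (fst G z)) (-1))$3 = vector [0, 0, c, 0]"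
  unfolding matrix_mult_row[of _ "block (matrix_inv (fst G z)) (-1)"] r3 by (simp add: sum_4 vec4_eq block_def)
 have "X = X ** eta_mat ** transpose (frame f n z) ** block (matrix_inv (fst G z)) (-1) ** frame f n z"
  using frame_inverse[of z] by (metis matrix_mul_assoc matrix_mul_rid)
 hence "X$3 = (X ** eta_mat ** transpose (frame f n z) ** block (matrix_inv (fst G z)) (-1) ** frame f n z)$3" by simp
 also have "\<dots> = c *R n z"
  unfolding matrix_mult_row[of _ "frame f n z"] r4 by (simp add: sum_4)
 finally have m: "m = c *R n z" by (simp add: X_def)
 hence "c * c = 1" using assms(4) by (simp add: mink_scaleR_left mink_scaleR_right normal)
 moreover have "det X = c * det (frame f n z)" unfolding X_def m by (simp add: det_4 algebra_simps)
 hence "c > 0" using assms(5) det_frame[of z] by (simp add: X_def zero_less_mult_iff)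
 ultimately have "c = 1" by (metis abs_of_pos power2_eq_1_iff power2_eq_square abs_minus_cancel abs_one)
 thus ?thesis using m by simp
qed

text \<open>Differentiating the equivariance of \<open>f\<close> gives the tangent rows. The image
  of the normal satisfies the conditions that characterise the normal at \<open>g z\<close>; for its
  orientation, both the Jacobian and the Lorentz action preserve the sign of the
  determinant.\<close>

lemma frame_equivariant:
 assumes g: "g differentiable (at z)" "det (jacobian g (at z)) > 0" and M: "det M = 1" and eq: "\<And>z. f (g z) = lorentz M (f z)"
 shows "block (transpose (jacobian g (at z))) 1 ** frame f n (g z) = frame f n z ** lor_mat M"
proof -
 define J where "J = jacobian g (at z)"
 define m where "m = lorentz M (n z)"
 define X :: "real^4^4" where "X = vector [partial f 1 (g z), partial f 2 (g z), m, f (g z)]"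
 have df: "(J$1$j) *R partial f 1 (g z) + (J$2$j) *R partial f 2 (g z) = lorentz M (partial f j z)" for j
 proof -
  have "partial (\<lambda>z. f (g z)) j z = partial (\<lambda>z. lorentz M (f z)) j z" by (simp only: eq)
  thus ?thesis
   unfolding partial_chain[OF g(1) diff(1)] J_def
   using partial_bounded_linear[of "lorentz M", OF _ diff(1)] linear_lorentz[of M] by (simp add: linear_conv_bounded_linear)
 qed
 have X: "block (transpose J) 1 ** X = vector [lorentz M (partial f 1 z), lorentz M (partial f 2 z), lorentz M (n z), lorentz M (f z)]"
  unfolding vec4_eq[of "block _ _ ** X"]
  by (simp add: matrix_mult_row sum_4 block_def X_def m_def eq df[symmetric] transpose_def)
 have dJ: "J$1$1 * J$2$2 - J$1$2 * J$2$1 > 0" using g(2) by (simp add: J_def det_2)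
 have "mink m (lorentz M (partial f j z)) = 0" for j unfolding m_def mink_lorentz[OF M] by (rule normal)
 hence mj: "J$1$j * mink m (partial f 1 (g z)) + J$2$j * mink m (partial f 2 (g z)) = 0" for j
  unfolding df[symmetric] by (simp add: mink_add_right mink_scaleR_right)
 have "m = n (g z)"
 proof (rule normal_unique)
  show "mink m (f (g z)) = 0" "mink m m = 1" unfolding m_def eq mink_lorentz[OF M] by (rule normal)+
  define x y where "x = mink m (partial f 1 (g z))" and "y = mink m (partial f 2 (g z))"
  have mj': "J$1$1 * x + J$2$1 * y = 0" "J$1$2 * x + J$2$2 * y = 0"
   using mj unfolding x_def y_def by blast+
  have "(J$1$1 * J$2$2 - J$1$2 * J$2$1) * x = J$2$2 * (J$1$1 * x + J$2$1 * y) - J$2$1 * (J$1$2 * x + J$2$2 * y)"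
   "(J$1$1 * J$2$2 - J$1$2 * J$2$1) * y = J$1$1 * (J$1$2 * x + J$2$2 * y) - J$1$2 * (J$1$1 * x + J$2$1 * y)"
   by (simp_all add: algebra_simps)
  hence "(J$1$1 * J$2$2 - J$1$2 * J$2$1) * x = 0" "(J$1$1 * J$2$2 - J$1$2 * J$2$1) * y = 0"
   unfolding mj' by simp_all
  moreover have "J$1$1 * J$2$2 - J$1$2 * J$2$1 \<noteq> 0" using dJ by linarith
  ultimately have "x = 0" "y = 0" unfolding mult_eq_0_iff by blast+
  thus "mink m (partial f 1 (g z)) = 0" "mink m (partial f 2 (g z)) = 0" unfolding x_def y_def .
  have "det (block (transpose J) 1 ** X) > 0"
   unfolding X det_lorentz_frame[OF M] using det_frame[of z] by (simp add: frame_def)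
  thus "det (vector [partial f 1 (g z), partial f 2 (g z), m, f (g z)] :: real^4^4) > 0"
   using g(2) unfolding det_mul det_block X_def[symmetric] det_transpose J_def[symmetric] by (simp add: zero_less_mult_iff)
 qed
 hence Xf: "X = frame f n (g z)" by (simp only: X_def frame_def)
 have "frame f n z ** lor_mat M = vector [lorentz M (partial f 1 z), lorentz M (partial f 2 z), lorentz M (n z), lorentz M (f z)]"
  by (rule vec4_eq[THEN iffD2]) (simp only: mult_lor_mat frame_nth vector_4 simp_thms)
 thus ?thesis unfolding J_def[symmetric] Xf[symmetric] X by (rule sym)
qed

lemma frame_cholesky:
 assumes "fst G z$1$1 > 0"
 obtains M where "det M = 1" "frame f n z = cholesky (fst G z) ** lor_mat M"
proof -
 define a where "a = sqrt (fst G z$1$1)"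
 define b where "b = fst G z$1$2 / a"
 define c where "c = sqrt (det (fst G z)) / a"
 have a: "a > 0" "a * a = fst G z$1$1" using assms by (simp_all add: a_def)
 have ab: "a * b = fst G z$1$2" using a by (simp add: b_def)
 have c: "c > 0" using a det_first_pos[of z] by (simp add: c_def)
 have "c * c = det (fst G z) / (a * a)" using det_first_pos[of z] by (simp add: c_def)
 also have "det (fst G z) = a * a * fst G z$2$2 - a * b * (a * b)"
  unfolding det_2 fst_sym[of z 2 1] a(2) ab ..
 also have "\<dots> / (a * a) = fst G z$2$2 - b * b" using a(1) by (simp add: diff_divide_distrib)
 finally have bc: "b * b + c * c = fst G z$2$2" by simp
 obtain M where M: "det M = 1" "lorentz M (vector [a, 0, 0, 0]) = partial f 1 z" "lorentz M (vector [b, c, 0, 0]) = partial f 2 z"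
  "lorentz M e3 = n z" "lorentz M e4 = f z"
  by (rule frame_normal_form[OF in_H3 normal(3,1) tangent(1) normal(5) first_form[THEN trans, OF a(2)[symmetric]] tangent(1) normal(5)
     first_form[THEN trans, OF ab[symmetric]] first_form[THEN trans, OF bc[symmetric]] a(1) c det_frame[unfolded frame_def]])
 have ch: "cholesky (fst G z)$1 = vector [a, 0, 0, 0]" "cholesky (fst G z)$2 = vector [b, c, 0, 0]"
  "cholesky (fst G z)$3 = e3" "cholesky (fst G z)$4 = e4"
  by (simp_all only: cholesky_nth b_def c_def a_def)
 have "cholesky (fst G z) ** lor_mat M = frame f n z"
  by (rule vec4_eq[THEN iffD2]) (simp only: ch M(2-5) frame_nth mult_lor_mat simp_thms)
 thus ?thesis by (intro that[OF M(1)]) (rule sym)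
qed

end

section \<open>Matrix expressions depending smoothly on parameter and point\<close>

lemma Ck_on_mat_mult [smooth_intros]:
 fixes f :: "'a::euclidean_space => real^'n^'m" and g :: "'a => real^'k^'n"
 shows "open U ==> Ck_on k U f ==> Ck_on k U g ==> Ck_on k U (\<lambda>x. f x ** g x)"
 by (rule Ck_on_bilinear[OF bounded_bilinear_mat_mult])

lemma Ck_on_transpose [smooth_intros]:
 fixes f :: "'a::euclidean_space => real^'n^'m"
 assumes "open U" "Ck_on k U f"
 shows "Ck_on k U (\<lambda>x. transpose (f x))"
proof -
 have "linear (transpose :: real^'n^'m => real^'m^'n)" by (intro linearI) (simp_all add: transpose_def vec_eq_iff)
 thus ?thesis by (intro Ck_on_bounded_linear[OF _ assms]) (simp add: linear_conv_bounded_linear)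
qed

lemma Ck_on_vector4:
 fixes f1 f2 f3 f4 :: "'a::euclidean_space => 'b::euclidean_space"
 assumes "open U" "Ck_on k U f1" "Ck_on k U f2" "Ck_on k U f3" "Ck_on k U f4"
 shows "Ck_on k U (\<lambda>x. vector [f1 x, f2 x, f3 x, f4 x] :: 'b^4)"
proof (rule Ck_on_vec[OF assms(1)])
 fix i :: 4
 show "Ck_on k U (\<lambda>x. (vector [f1 x, f2 x, f3 x, f4 x] :: 'b^4)$i)"
  using exhaust_4[of i] assms by (elim disjE) (simp_all only: vector_4)
qed

lemma Ck_on_det2:
 fixes P :: "'a::euclidean_space => real^2^2"
 shows "open U ==> Ck_on k U P ==> Ck_on k U (\<lambda>x. det (P x))"
 unfolding det_2 by (intro smooth_intros)

lemma Ck_on_matrix_inv2_nth: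
 fixes P :: "'a::euclidean_space => real^2^2"
 assumes "open U" "Ck_on k U P" "\<And>x. x \<in> U ==> det (P x) \<noteq> 0"
 shows "Ck_on k U (\<lambda>x. matrix_inv (P x)$i$j)"
proof -
 have "Ck_on k U (\<lambda>x. (vector [vector [P x$2$2 / det (P x), - P x$1$2 / det (P x)], vector [- P x$2$1 / det (P x), P x$1$1 / det (P x)]] :: real^2^2)$i$j)"
  using exhaust_2[of i] exhaust_2[of j]
  by (elim disjE) (simp_all only: vector_2, (intro smooth_intros assms Ck_on_det2; assumption)+)
 thus ?thesis
  by (rule Ck_on_eqI[OF assms(1)]) (simp only: matrix_inv_2x2[OF assms(3)])
qed

lemma Ck_on_block:
 fixes P :: "'a::euclidean_space => real^2^2"
 assumes "open U" "\<And>i j. Ck_on k U (\<lambda>x. P x$i$j)"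
 shows "Ck_on k U (\<lambda>x. block (P x) r)"
 unfolding block_def by (intro Ck_on_vector4 assms Ck_on_const)

lemma partial_param:
 fixes H :: "(real^2) \<times> (real^2) => 'b::euclidean_space"
 assumes "H differentiable (at (v, z))"
 shows "partial (\<lambda>w. H (v, w)) i z = FD H (v, z) (0, axis i 1)"
  and "partial (\<lambda>w. H (w, z)) i v = FD H (v, z) (axis i 1, 0)"
proof -
 have p: "((\<lambda>w. (v, w)) has_derivative (\<lambda>h. (0, h))) (at z)" "((\<lambda>w. (w, z)) has_derivative (\<lambda>h. (h, 0))) (at v)"
  by (auto intro!: derivative_eq_intros)
 show "partial (\<lambda>w. H (v, w)) i z = FD H (v, z) (0, axis i 1)"
  "partial (\<lambda>w. H (w, z)) i v = FD H (v, z) (axis i 1, 0)"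
  by (rule partial_eqI[OF has_derivative_compose[OF p(1) frechet_works[OF assms]]],
    rule partial_eqI[OF has_derivative_compose[OF p(2) frechet_works[OF assms]]])
qed

lemma smooth_on_param_partial:
 fixes H :: "(real^2) \<times> (real^2) => 'b::euclidean_space"
 assumes U: "open U" and H: "smooth_on (U \<times> UNIV) H"
 shows "smooth_on (U \<times> UNIV) (\<lambda>q. partial (\<lambda>w. H (fst q, w)) i (snd q))"
  and "smooth_on (U \<times> UNIV) (\<lambda>q. partial (\<lambda>w. H (w, snd q)) i (fst q))"
proof -
 have o: "open (U \<times> (UNIV :: (real^2) set))" using U by (simp add: open_Times)
 have d: "H differentiable (at (fst q, snd q))" if "q \<in> U \<times> UNIV" for q
  using smooth_on_differentiable[OF H that] by simp
 show "smooth_on (U \<times> UNIV) (\<lambda>q. partial (\<lambda>w. H (fst q, w)) i (snd q))"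
  by (rule smooth_onI, rule Ck_on_eqI[OF o Ck_on_smooth_iff[OF o H, of _ "(0, axis i 1)"]]) (simp add: partial_param(1)[OF d])
 show "smooth_on (U \<times> UNIV) (\<lambda>q. partial (\<lambda>w. H (w, snd q)) i (fst q))"
  by (rule smooth_onI, rule Ck_on_eqI[OF o Ck_on_smooth_iff[OF o H, of _ "(axis i 1, 0)"]]) (simp add: partial_param(2)[OF d])
qed

lemma line_has_vector_derivative:
 fixes f :: "real^2 => 'b::real_normed_vector"
 assumes "f differentiable (at (z0 + s *R h))"
 shows "((\<lambda>s. f (z0 + s *R h)) has_vector_derivative
   (h$1) *R partial f 1 (z0 + s *R h) + (h$2) *R partial f 2 (z0 + s *R h)) (at s within T)"
proof -
 have "((\<lambda>s. z0 + s *R h) has_derivative (\<lambda>x. x *R h)) (at s within T)" by (auto intro!: derivative_eq_intros)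
 from has_derivative_compose[OF this frechet_works[OF assms]]
 have "((\<lambda>s. f (z0 + s *R h)) has_derivative (\<lambda>x. x *R FD f (z0 + s *R h) h)) (at s within T)"
  by (simp only: linear_scale[OF linear_frechet_derivative[OF assms]])
 thus ?thesis unfolding has_vector_derivative_def frechet_partial[OF assms] .
qed

locale germ_family =
 fixes U :: "(real^2) set" and u :: "real^2" and \<sigma> :: "real^2 => germ"
 assumes U: "open U" "u \<in> U"
  and smooth_fst: "smooth_on (U \<times> UNIV) (\<lambda>(v, z). fst (\<sigma> v) z)"
  and smooth_snd: "smooth_on (U \<times> UNIV) (\<lambda>(v, z). snd (\<sigma> v) z)"
  and pos: "\<And>v z. v \<in> U ==> fst (\<sigma> v) z$1$1 > 0" "\<And>v z. v \<in> U ==> det (fst (\<sigma> v) z) > 0"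
begin

lemma open_UxUNIV [simp]: "open (U \<times> (UNIV :: (real^2) set))"
 using U by (simp add: open_Times)

lemma Ck_fst: "Ck_on k (U \<times> UNIV) (\<lambda>q. fst (\<sigma> (fst q)) (snd q))"
 and Ck_snd: "Ck_on k (U \<times> UNIV) (\<lambda>q. snd (\<sigma> (fst q)) (snd q))"
 using smooth_onD[OF smooth_fst] smooth_onD[OF smooth_snd] by (simp_all only: case_prod_unfold)

lemma Ck_fst_partial: "Ck_on k (U \<times> UNIV) (\<lambda>q. partial (\<lambda>w. fst (\<sigma> (fst q)) w$a$b) i (snd q))"
proof -
 have "smooth_on (U \<times> UNIV) (\<lambda>q. fst (\<sigma> (fst q)) (snd q)$a$b)"
  by (intro smooth_onI smooth_intros Ck_fst open_UxUNIV)
 from smooth_onD[OF smooth_on_param_partial(1)[OF U(1) this]] show ?thesis by simp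
qed

lemma det_fst: "q \<in> U \<times> UNIV ==> det (fst (\<sigma> (fst q)) (snd q)) \<noteq> 0"
 using pos(2)[of "fst q" "snd q"] by auto

lemma Ck_slice:
 fixes H :: "(real^2) \<times> (real^2) => 'b::euclidean_space"
 assumes "v \<in> U" "Ck_on k (U \<times> UNIV) H"
 shows "Ck_on k UNIV (\<lambda>z. H (v, z))"
 by (rule Ck_on_compose[OF open_UNIV open_UxUNIV _ Ck_on_Pair[OF open_UNIV Ck_on_const Ck_on_ident] assms(2)]) (use assms(1) in auto)

lemma Ck_weingarten: "Ck_on k (U \<times> UNIV) (\<lambda>q. weingarten (\<sigma> (fst q)) i (snd q))"
proof -
 have "Ck_on k (U \<times> UNIV) (\<lambda>q. block (matrix_inv (fst (\<sigma> (fst q)) (snd q))) (-1))"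
  by (intro Ck_on_block Ck_on_matrix_inv2_nth open_UxUNIV Ck_fst det_fst)
 moreover have "Ck_on k (U \<times> UNIV) (\<lambda>q. second_form (\<sigma> (fst q)) i (snd q))"
  unfolding second_form_def christoffel_lower_def
  by (intro Ck_on_vector4 smooth_intros open_UxUNIV Ck_fst Ck_snd Ck_fst_partial)
 ultimately show ?thesis unfolding weingarten_def by (intro smooth_intros open_UxUNIV)
qed

definition variation :: "2 => 2 => real^2 => real^4^4" where
 "variation k i z = partial (\<lambda>v. weingarten (\<sigma> v) i z) k u"

lemma variation_frechet: "variation k i z = FD (\<lambda>q. weingarten (\<sigma> (fst q)) i (snd q)) (u, z) (axis k 1, 0)"
 unfolding variation_def
 using partial_param(2)[of "\<lambda>q. weingarten (\<sigma> (fst q)) i (snd q)" u z k] Ck_1_differentiable[OF Ck_weingarten, of "(u, z)"] U(2) by simp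

lemma Ck_variation: "Ck_on k UNIV (variation l i)"
proof -
 have "smooth_on (U \<times> UNIV) (\<lambda>q. weingarten (\<sigma> (fst q)) i (snd q))" by (intro smooth_onI Ck_weingarten)
 from Ck_on_smooth_iff[OF open_UxUNIV this]
 have "Ck_on k (U \<times> UNIV) (\<lambda>q. FD (\<lambda>q. weingarten (\<sigma> (fst q)) i (snd q)) q (axis l 1, 0))" .
 from Ck_slice[OF U(2) this] show ?thesis unfolding variation_frechet[abs_def] .
qed

end

text \<open>Each pair \<open>f v\<close>, \<open>n v\<close> is chosen separately: regularity in
  \<open>v\<close> is available for the germs only.\<close>

locale immersed_family = germ_family U u \<sigma> for U u \<sigma> +
 fixes f n :: "real^2 => real^2 => real^4"
 assumes immersions: "\<And>v. v \<in> U ==> hyperbolic_immersion (f v) (n v) (\<sigma> v)"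
begin

lemma immersion: "v \<in> U ==> immersion (f v) (n v) (\<sigma> v)"
 using immersions by (simp add: immersion_def)

sublocale base: immersion "f u" "n u" "\<sigma> u"
 by (rule immersion) (rule U)

definition Y :: "real^2 => real^2 => real^4^4" where
 "Y v z = frame (f v) (n v) z"

definition Yinv :: "real^2 => real^4^4" where
 "Yinv z = eta_mat ** transpose (Y u z) ** block (matrix_inv (fst (\<sigma> u) z)) (-1)"

lemma Yinv [simp]: "Yinv z ** Y u z = mat 1" "Y u z ** Yinv z = mat 1"
 unfolding Yinv_def Y_def by (rule base.frame_inverse, rule base.frame_inverse')

lemma Ck_Y: "v \<in> U ==> Ck_on k UNIV (Y v)"
 unfolding Y_def[abs_def] by (rule immersion.Ck_frame[OF immersion])

lemma Ck_Yinv: "Ck_on k UNIV Yinv"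
proof -
 have "Ck_on k UNIV (\<lambda>z. fst (\<sigma> u) z)"
  using Ck_slice[OF U(2) Ck_fst] by simp
 thus ?thesis unfolding Yinv_def[abs_def]
  by (intro smooth_intros Ck_on_block Ck_on_matrix_inv2_nth open_UNIV Ck_Y U(2) base.det_first_pos(2))
qed

lemma Y_differentiable: "v \<in> U ==> Y v differentiable (at z)" and Yinv_differentiable: "Yinv differentiable (at z)"
 by (rule Ck_1_differentiable[OF Ck_Y]) (auto intro: Ck_1_differentiable[OF Ck_Yinv])

lemma partial_Y: "v \<in> U ==> partial (Y v) i z = weingarten (\<sigma> v) i z ** Y v z"
 unfolding Y_def[abs_def] by (rule immersion.gauss_weingarten[OF immersion])

lemma partial_Yinv: "partial Yinv i z = - (Yinv z ** weingarten (\<sigma> u) i z)"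
proof -
 have "partial (\<lambda>z. Yinv z ** Y u z) i z = 0" by simp
 hence "Yinv z ** partial (Y u) i z + partial Yinv i z ** Y u z = 0"
  unfolding partial_bilinear[OF bounded_bilinear_mat_mult Yinv_differentiable Y_differentiable[OF U(2)]] .
 hence "(partial Yinv i z + Yinv z ** weingarten (\<sigma> u) i z) ** Y u z = 0"
  unfolding partial_Y[OF U(2)] by (simp add: bounded_bilinear.add_left[OF bounded_bilinear_mat_mult] matrix_mul_assoc add.commute)
 hence "(partial Yinv i z + Yinv z ** weingarten (\<sigma> u) i z) ** Y u z ** Yinv z = 0" by simp
 hence "partial Yinv i z + Yinv z ** weingarten (\<sigma> u) i z = 0"
  unfolding matrix_mul_assoc[symmetric] Yinv matrix_mul_rid .
 thus ?thesis by (simp add: eq_neg_iff_add_eq_0)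
qed

text \<open>The parameter variation of the connection, conjugated by the frame. By
  \<open>Z_has_derivative\<close> these are the coordinate derivatives of the logarithmic parameter
  derivative of the frame.\<close>

definition \<alpha> :: "2 => 2 => real^2 => real^4^4" where
 "\<alpha> k i z = Yinv z ** variation k i z ** Y u z"

lemma Ck_\<alpha>: "Ck_on k UNIV (\<alpha> l i)"
 unfolding \<alpha>_def[abs_def] by (intro smooth_intros open_UNIV Ck_Y U(2) Ck_Yinv Ck_variation)

text \<open>Along a segment both frames satisfy their connection equations, so the quotient of the
  frame at \<open>u + t *R axis k 1\<close> by the frame at \<open>u\<close> satisfies one with a
  coefficient of order \<open>t\<close>. The factor \<open>C t\<close> is constant along the segment
  and leaves room for a correction that makes differentiability at \<open>z0\<close>
  available.\<close>

lemma frame_variation: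
 assumes D: "((\<lambda>t. Yinv z0 ** Y (u + t *R axis k 1) z0 ** C t) has_vector_derivative D) (at 0)" and C0: "C 0 = mat 1"
 shows "((\<lambda>t. Yinv (z0 + h) ** Y (u + t *R axis k 1) (z0 + h) ** C t) has_vector_derivative
  D + integral {0..1} (\<lambda>s. (h$1) *R \<alpha> k 1 (z0 + s *R h) + (h$2) *R \<alpha> k 2 (z0 + s *R h))) (at 0)"
proof -
 define l where "l = (\<lambda>s. z0 + s *R h)"
 define W where "W = (\<lambda>v z. (h$1) *R weingarten (\<sigma> v) 1 z + (h$2) *R weingarten (\<sigma> v) 2 z)"
 define E where "E = (\<lambda>t s. Yinv (l s) ** Y (u + t *R axis k 1) (l s) ** C t)"
 define P where "P = (\<lambda>t s. Yinv (l s) ** (W (u + t *R axis k 1) (l s) - W u (l s)) ** Y u (l s))"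
 define P' where "P' = (\<lambda>s. (h$1) *R \<alpha> k 1 (l s) + (h$2) *R \<alpha> k 2 (l s))"
 note bb = bounded_bilinear_mat_mult
 note bm = bounded_bilinear.diff_left[OF bb] bounded_bilinear.diff_right[OF bb] bounded_bilinear.add_left[OF bb]
  bounded_bilinear.add_right[OF bb] bounded_bilinear.scaleR_left[OF bb] bounded_bilinear.scaleR_right[OF bb]
  bounded_bilinear.minus_left[OF bb]
 have "((\<lambda>t. u + t *R axis k 1) \<longlongrightarrow> u + 0 *R axis k 1) (at 0)" by (intro tendsto_intros)
 hence inU: "\<forall>\<^sub>F t in at 0. u + t *R axis k 1 \<in> U" using topological_tendstoD[OF _ U(1)] U(2) by simp
 have "((\<lambda>t. E t 1) has_vector_derivative D + integral {0..1} P') (at 0)"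
 proof (rule linear_ode_parameter[where P = P])
  show "\<forall>\<^sub>F t in at 0. \<forall>s\<in>{0..1}. (E t has_vector_derivative P t s ** E t s) (at s within {0..1})"
   using inU
  proof (rule eventually_mono, intro ballI)
   fix t s :: real assume v: "u + t *R axis k 1 \<in> U"
   let ?v = "u + t *R axis k 1"
   have dY: "((\<lambda>s. Y ?v (l s)) has_vector_derivative W ?v (l s) ** Y ?v (l s)) (at s within {0..1})"
    using line_has_vector_derivative[of "Y ?v" z0 s h "{0..1}", OF Y_differentiable[OF v]]
    by (simp only: l_def W_def partial_Y[OF v] bm)
   have dI: "((\<lambda>s. Yinv (l s)) has_vector_derivative - (Yinv (l s) ** W u (l s))) (at s within {0..1})"
    using line_has_vector_derivative[of Yinv z0 s h "{0..1}", OF Yinv_differentiable]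
    by (simp only: l_def W_def partial_Yinv bm scaleR_minus_right minus_add_distrib)
   have "(E t has_vector_derivative (Yinv (l s) ** (W ?v (l s) ** Y ?v (l s)) + - (Yinv (l s) ** W u (l s)) ** Y ?v (l s)) ** C t) (at s within {0..1})"
    unfolding E_def
    using bounded_bilinear.has_vector_derivative[OF bb bounded_bilinear.has_vector_derivative[OF bb dI dY] has_vector_derivative_const[of "C t"]]
    by simp
   moreover have "P t s ** E t s = (Yinv (l s) ** (W ?v (l s) ** Y ?v (l s)) + - (Yinv (l s) ** W u (l s)) ** Y ?v (l s)) ** C t"
   proof -
    have "P t s ** E t s = Yinv (l s) ** (W ?v (l s) - W u (l s)) ** (Y u (l s) ** Yinv (l s)) ** Y ?v (l s) ** C t"
     by (simp only: P_def E_def matrix_mul_assoc)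
    thus ?thesis by (simp add: bm matrix_mul_assoc)
   qed
   ultimately show "(E t has_vector_derivative P t s ** E t s) (at s within {0..1})" by simp
  qed
  show P'c: "continuous_on {0..1} P'"
   unfolding P'_def l_def
   by (intro continuous_intros continuous_on_compose2[OF Ck_on_imp_continuous[OF Ck_\<alpha>[of 0]]]) auto
  show "((\<lambda>t. E t 0) has_vector_derivative D) (at 0)" using D by (simp add: E_def l_def)
  show "E 0 s = mat 1" for s by (simp add: E_def C0 matrix_mul_rid)
  have bd: "bounded ((\<lambda>s. g (l s)) ` {0..1})" if "continuous_on UNIV g" for g :: "real^2 => real^4^4"
   unfolding l_def by (intro compact_imp_bounded compact_continuous_image compact_Icc continuous_on_compose2[OF that] continuous_intros) auto
  have K: "compact (l ` {0..1})" unfolding l_def by (intro compact_continuous_image continuous_intros) auto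
  define q where "q = (\<lambda>i t s. (weingarten (\<sigma> (u + t *R axis k 1)) i (l s) - weingarten (\<sigma> u) i (l s)) /\<^sub>R t)"
  have q: "uniform_limit {0..1} (q i) (\<lambda>s. variation k i (l s)) (at 0)" for i
   using uniform_parameter_derivative[OF U Ck_weingarten K, of k i]
   unfolding uniform_limit_iff q_def variation_frechet by simp
  have c: "continuous_on UNIV (variation k i)" "continuous_on UNIV Yinv" "continuous_on UNIV (Y u)" for i
   by (rule Ck_on_imp_continuous[OF Ck_variation[of 0]] Ck_on_imp_continuous[OF Ck_Yinv[of 0]] Ck_on_imp_continuous[OF Ck_Y[OF U(2), of 0]])+
  define V where "V = (\<lambda>z. (h$1) *R variation k 1 z + (h$2) *R variation k 2 z)"
  have cV: "continuous_on UNIV V" "continuous_on UNIV (\<lambda>z. Yinv z ** V z)"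
   unfolding V_def by (intro continuous_intros bounded_bilinear.continuous_on[OF bb] c)+
  have qV: "uniform_limit {0..1} (\<lambda>t s. (h$1) *R q 1 t s + (h$2) *R q 2 t s) (\<lambda>s. V (l s)) (at 0)"
   unfolding V_def by (intro uniform_limit_add bounded_linear_uniform_limit_intros q)
  note bu = bounded_bilinear.bounded_uniform_limit[OF bb]
  have "uniform_limit {0..1} (\<lambda>t s. Yinv (l s) ** ((h$1) *R q 1 t s + (h$2) *R q 2 t s) ** Y u (l s))
    (\<lambda>s. Yinv (l s) ** V (l s) ** Y u (l s)) (at 0)"
   by (rule bu[OF bu[OF uniform_limit_const qV bd[OF cV(1)] bd[OF c(2)]] uniform_limit_const bd[OF c(3)] bd[OF cV(2)]])
  also have "(\<lambda>t s. Yinv (l s) ** ((h$1) *R q 1 t s + (h$2) *R q 2 t s) ** Y u (l s)) = (\<lambda>t s. P t s /\<^sub>R t)"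
   by (intro ext) (simp add: P_def W_def q_def bm scaleR_diff_right scaleR_add_right mult.commute)
  also have "(\<lambda>s. Yinv (l s) ** V (l s) ** Y u (l s)) = P'"
   by (intro ext) (simp add: P'_def V_def \<alpha>_def bm)
  finally show "uniform_limit {0..1} (\<lambda>t s. P t s /\<^sub>R t) P' (at 0)" .
 qed
 thus ?thesis by (simp add: E_def P'_def l_def)
qed

end

lemma path_differentiable:
 fixes g :: "real^2 => 'b::real_normed_vector"
 assumes "g differentiable (at u)"
 shows "(\<lambda>t. g (u + t *R axis k 1)) differentiable (at 0)"
  and "((\<lambda>t. g (u + t *R axis k 1)) has_vector_derivative partial g k u) (at 0)"
proof -
 have a: "((\<lambda>t. u + t *R axis k 1) has_derivative (\<lambda>x. x *R axis k 1)) (at 0)" by (auto intro!: derivative_eq_intros)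
 have "(g has_derivative FD g u) (at (u + 0 *R axis k 1))"
  using frechet_works[OF assms] by simp
 from has_derivative_compose[OF a this]
 have "((\<lambda>t. g (u + t *R axis k 1)) has_derivative (\<lambda>x. x *R FD g u (axis k 1))) (at 0)"
  by (simp only: linear_scale[OF linear_frechet_derivative[OF assms]])
 thus "((\<lambda>t. g (u + t *R axis k 1)) has_vector_derivative partial g k u) (at 0)"
  unfolding has_vector_derivative_def partial_def .
 thus "(\<lambda>t. g (u + t *R axis k 1)) differentiable (at 0)"
  unfolding has_vector_derivative_def differentiable_def by blast
qed

lemma path_eventually:
 fixes u :: "real^2"
 assumes "open U" "u \<in> U"
 shows "\<forall>\<^sub>F t in nhds (0::real). u + t *R axis k 1 \<in> U"
proof -
 have "open ((\<lambda>t. u + t *R axis k 1) -` U)" by (intro continuous_open_vimage assms continuous_intros)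
 thus ?thesis unfolding eventually_nhds using assms(2) by (intro exI[of _ "(\<lambda>t. u + t *R axis k 1) -` U"]) auto
qed

lemma has_derivative_line_integral:
 fixes F :: "real^2 => 'b::euclidean_space"
 assumes F: "\<And>h. F (z + h) - F z = integral {0..1} (\<lambda>s. (h$1) *R a1 (z + s *R h) + (h$2) *R a2 (z + s *R h))"
  and a: "continuous_on UNIV a1" "continuous_on UNIV a2"
 shows "(F has_derivative (\<lambda>h. (h$1) *R a1 z + (h$2) *R a2 z)) (at z)"
 unfolding has_derivative_at_alt
proof (intro conjI allI impI)
 show "bounded_linear (\<lambda>h. (h$1) *R a1 z + (h$2) *R a2 z)"
  by (intro bounded_linear_add bounded_linear_scaleR_left[THEN bounded_linear_compose] bounded_linear_vec_nth)
 fix e :: real assume e: "e > 0"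
 have "continuous_on UNIV (\<lambda>w. norm (a1 w - a1 z) + norm (a2 w - a2 z))" by (intro continuous_intros a)
 then obtain d where d: "d > 0" "\<And>w. dist w z < d ==> norm (a1 w - a1 z) + norm (a2 w - a2 z) < e"
  using e unfolding continuous_on_iff by (fastforce dest: spec[of _ e])
 have "norm (F (z + h) - F z - ((h$1) *R a1 z + (h$2) *R a2 z)) \<le> e * norm h" if h: "norm h < d" for h
 proof -
  define g where "g = (\<lambda>s. (h$1) *R a1 (z + s *R h) + (h$2) *R a2 (z + s *R h))"
  have c: "continuous_on {0..1} g" unfolding g_def
   by (intro continuous_intros continuous_on_compose2[OF a(1)] continuous_on_compose2[OF a(2)]) auto
  have "F (z + h) - F z - ((h$1) *R a1 z + (h$2) *R a2 z) = integral {0..1} (\<lambda>s. g s - ((h$1) *R a1 z + (h$2) *R a2 z))"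
   unfolding F g_def[symmetric] by (subst integral_diff) (auto intro!: integrable_continuous_interval c)
  also have "norm \<dots> \<le> (e * norm h) * (1 - 0)"
  proof (rule integral_bound)
   fix s :: real assume "s \<in> {0..1}"
   hence "norm (s *R h) < d" using h mult_left_le_one_le[of "norm h" s] by simp
   hence w: "norm (a1 (z + s *R h) - a1 z) + norm (a2 (z + s *R h) - a2 z) < e" by (intro d(2)) (simp add: dist_norm)
   have "g s - ((h$1) *R a1 z + (h$2) *R a2 z) = (h$1) *R (a1 (z + s *R h) - a1 z) + (h$2) *R (a2 (z + s *R h) - a2 z)"
    by (simp add: g_def scaleR_diff_right)
   also have "norm \<dots> \<le> norm h * norm (a1 (z + s *R h) - a1 z) + norm h * norm (a2 (z + s *R h) - a2 z)"
    using component_le_norm_cart[of h] by (intro order.trans[OF norm_triangle_ineq add_mono]) (simp_all add: mult_right_mono)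
   also have "\<dots> \<le> e * norm h" unfolding distrib_left[symmetric] mult.commute[of e] using w by (intro mult_left_mono) auto
   finally show "norm (g s - ((h$1) *R a1 z + (h$2) *R a2 z)) \<le> e * norm h" .
  qed (auto intro!: continuous_intros c)
  finally show ?thesis by simp
 qed
 from this[of "_ - z"] show "\<exists>d>0. \<forall>y. norm (y - z) < d \<longrightarrow> norm (F y - F z - (((y - z)$1) *R a1 z + ((y - z)$2) *R a2 z)) \<le> e * norm (y - z)"
  using d(1) by (intro exI[of _ d]) simp
qed

definition cholesky_inv :: "real^2^2 => real^4^4" where
 "cholesky_inv P = vector [vector [1 / sqrt (P$1$1), 0, 0, 0],
  vector [- P$1$2 / (sqrt (P$1$1) * sqrt (det P)), sqrt (P$1$1) / sqrt (det P), 0, 0], e3, e4]"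

lemma cholesky_inv:
 assumes "P$1$1 > 0" "det P > 0"
 shows "cholesky_inv P ** cholesky P = mat 1"
proof -
 have "sqrt (P$1$1) \<noteq> 0" "sqrt (det P) \<noteq> 0" using assms by auto
 thus ?thesis
  unfolding vec4_eq matrix_mult_row[of _ "cholesky P"]
  by (simp add: sum_4 cholesky_inv_def cholesky_nth e3_def e4_def vec4_eq mat_def)
qed

lemma Ck_on_cholesky:
 fixes P :: "'a::euclidean_space => real^2^2"
 assumes "open U" "Ck_on k U P" "\<And>x. x \<in> U ==> P x$1$1 > 0" "\<And>x. x \<in> U ==> det (P x) > 0"
 shows "Ck_on k U (\<lambda>x. cholesky (P x))" "Ck_on k U (\<lambda>x. cholesky_inv (P x))"
proof -
 have s: "Ck_on k U (\<lambda>x. sqrt (P x$1$1))" "Ck_on k U (\<lambda>x. sqrt (det (P x)))"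
  by (intro smooth_intros Ck_on_det2 assms; assumption)+
 have n: "sqrt (P x$1$1) \<noteq> 0" "sqrt (det (P x)) \<noteq> 0" "sqrt (P x$1$1) * sqrt (det (P x)) \<noteq> 0" if "x \<in> U" for x
  using assms(3,4)[OF that] by auto
 show "Ck_on k U (\<lambda>x. cholesky (P x))" "Ck_on k U (\<lambda>x. cholesky_inv (P x))"
  unfolding cholesky_def cholesky_inv_def
  by (intro Ck_on_vector4 Ck_on_const Ck_on_divide Ck_on_mult s n Ck_on_minus Ck_on_nth assms(1,2); assumption)+
qed

lemma herm_lor_mat: "herm (lor_mat M$c) = M ** herm (axis c 1) ** adjoint_matrix M"
 unfolding lor_mat_def by (simp add: herm_lorentz)

lemma lor_mat_unherm: "lor_mat M$c = unherm (M ** herm (axis c 1) ** adjoint_matrix M)"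
 by (metis herm_lor_mat unherm_herm)

locale equivariant_family = surface_cover S A p + immersed_family U u \<sigma> f n
 for S :: "'a::t2_space set" and A p U u \<sigma> f n +
 fixes \<rho> :: "(real^2 => real^2) rep_family"
 assumes rep: "\<And>v. v \<in> U ==> \<rho> v \<in> representations p"
  and equivariant: "\<And>v \<gamma> z. v \<in> U ==> \<gamma> \<in> deck p ==> f v (\<gamma> z) = psl_act (\<rho> v \<gamma>) (f v z)"
  and lifts: "\<And>\<gamma>. \<gamma> \<in> deck p ==> \<exists>R. local_lift (\<lambda>v. \<rho> v \<gamma>) u R"
  and nondegenerate: "\<exists>\<gamma>\<in>deck p. \<exists>\<delta>\<in>deck p. \<exists>M\<in>\<rho> u \<gamma>. \<exists>N\<in>\<rho> u \<delta>. M ** N \<noteq> N ** M \<and> trace M \<noteq> 0 \<and> trace N \<noteq> 0"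
begin

lemma rho_carrier: "v \<in> U ==> g \<in> deck p ==> \<rho> v g \<in> carrier PSL2C"
 using rep[of v] by (auto simp: representations_def hom_def deck_group_def)

lemma rho_mult: "v \<in> U ==> g \<in> deck p ==> d \<in> deck p ==> M \<in> \<rho> v g ==> N \<in> \<rho> v d ==> M ** N \<in> \<rho> v (g \<circ> d)"
 using rep[of v] PSL2C_mult[of M "\<rho> v g" N "\<rho> v d"] by (auto simp: representations_def hom_def deck_group_def)

definition lift :: "(real^2 => real^2) => real^2 => complex^2^2" where
 "lift \<gamma> = (SOME R. local_lift (\<lambda>v. \<rho> v \<gamma>) u R)"

lemma lift_local: "g \<in> deck p ==> local_lift (\<lambda>v. \<rho> v g) u (lift g)"
 unfolding lift_def by (rule someI_ex[OF lifts])

lemma lift: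
 assumes "g \<in> deck p"
 obtains V where "open V" "u \<in> V" "V \<subseteq> U" "smooth_on V (lift g)" "\<And>v. v \<in> V ==> lift g v \<in> \<rho> v g" "\<And>v. v \<in> V ==> det (lift g v) = 1"
proof -
 obtain V where V: "open V" "u \<in> V" "smooth_on V (lift g)" "\<And>v. v \<in> V ==> lift g v \<in> \<rho> v g"
  using lift_local[OF assms] unfolding local_lift_def by blast
 show ?thesis
 proof (rule that[of "U \<inter> V"])
  show "smooth_on (U \<inter> V) (lift g)" by (rule smooth_onI, rule Ck_on_subset[OF smooth_onD[OF V(3)]]) auto
  show "det (lift g v) = 1" if "v \<in> U \<inter> V" for v
   using PSL2C_memD(1)[OF rho_carrier[of v, OF _ assms]] V(4) that by blast
 qed (use V U in auto)
qed

lemma lift_u: "g \<in> deck p ==> lift g u \<in> \<rho> u g" "g \<in> deck p ==> det (lift g u) = 1"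
 by (rule lift, blast, blast)+

lemma lift_differentiable: "g \<in> deck p ==> lift g differentiable (at u)"
 by (rule lift, blast, rule smooth_on_differentiable)

lemma Y_equivariant:
 assumes "v \<in> U" "g \<in> deck p" "M \<in> \<rho> v g"
 shows "block (transpose (jacobian g (at z))) 1 ** Y v (g z) = Y v z ** lor_mat M"
 unfolding Y_def
proof (rule immersion.frame_equivariant[OF immersion[OF assms(1)] deck_differentiable[OF assms(2)] deck_det[OF assms(2)]])
 show "det M = 1" by (rule PSL2C_memD(1)[OF rho_carrier[OF assms(1,2)] assms(3)])
 show "f v (g z) = lorentz M (f v z)" for z
  unfolding equivariant[OF assms(1,2)] by (rule psl_act_eq) (rule PSL2C_memD(2)[OF rho_carrier[OF assms(1,2)] assms(3)])
qed

lemma lift_nondegenerate: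
 obtains h d where "h \<in> deck p" "d \<in> deck p" "lift h u ** lift d u \<noteq> lift d u ** lift h u" "trace (lift h u) \<noteq> 0" "trace (lift d u) \<noteq> 0"
proof -
 obtain h d M N where g: "h \<in> deck p" "d \<in> deck p" "M \<in> \<rho> u h" "N \<in> \<rho> u d" "M ** N \<noteq> N ** M" "trace M \<noteq> 0" "trace N \<noteq> 0"
  using nondegenerate by blast
 have t: "trace (- X) = - trace X" for X :: "complex^2^2" by (simp add: trace_def sum_2)
 have "lift h u = M \<or> lift h u = - M" "lift d u = N \<or> lift d u = - N"
  using PSL2C_memD(2)[OF rho_carrier[OF U(2)]] lift_u(1) g by blast+
 hence "lift h u ** lift d u \<noteq> lift d u ** lift h u" "trace (lift h u) \<noteq> 0" "trace (lift d u) \<noteq> 0"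
  using g(5-7) by (auto simp: uminus_mat_mult t)
 thus ?thesis using that g by blast
qed

lemma Ck_fst_param: "Ck_on k U (\<lambda>v. fst (\<sigma> v) z)"
proof -
 have "(\<lambda>v. (v, z)) ` U \<subseteq> U \<times> UNIV" by auto
 from Ck_on_compose[OF U(1) open_UxUNIV this Ck_on_Pair[OF U(1) Ck_on_ident Ck_on_const] Ck_fst] show ?thesis by simp
qed

lemma Y_path_differentiable: "(\<lambda>t. Y (u + t *R axis k 1) z) differentiable (at 0)"
proof -
 let ?v = "\<lambda>t. u + t *R axis k 1"
 have "\<forall>t. \<exists>M. det M = 1 \<and> (?v t \<in> U \<longrightarrow> Y (?v t) 0 = cholesky (fst (\<sigma> (?v t)) 0) ** lor_mat M)"
 proof
  fix t show "\<exists>M. det M = 1 \<and> (?v t \<in> U \<longrightarrow> Y (?v t) 0 = cholesky (fst (\<sigma> (?v t)) 0) ** lor_mat M)"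
  proof (cases "?v t \<in> U")
   case True
   thus ?thesis unfolding Y_def using immersion.frame_cholesky[OF immersion pos(1)] by metis
  next
   case False
   thus ?thesis using det_I by blast
  qed
 qed
 then obtain A where A: "\<And>t. det (A t) = 1" "\<And>t. ?v t \<in> U ==> Y (?v t) 0 = cholesky (fst (\<sigma> (?v t)) 0) ** lor_mat (A t)"
  by metis
 define K Ki where "K = (\<lambda>t. cholesky (fst (\<sigma> (?v t)) 0))" and "Ki = (\<lambda>t. cholesky_inv (fst (\<sigma> (?v t)) 0))"
 have ck: "Ck_on 1 U (\<lambda>v. cholesky (fst (\<sigma> v) 0))" "Ck_on 1 U (\<lambda>v. cholesky_inv (fst (\<sigma> v) 0))"
  by (rule Ck_on_cholesky[OF U(1) Ck_fst_param pos(1) pos(2)]; assumption)+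
 have dK: "K differentiable (at 0)" "Ki differentiable (at 0)"
  unfolding K_def Ki_def by (intro path_differentiable(1) Ck_1_differentiable[OF ck(1) U(2)] Ck_1_differentiable[OF ck(2) U(2)])+
 \<comment> \<open>Multiplying by \<open>C t\<close> replaces the unknown \<open>A t\<close> by
   \<open>A 0\<close>, so at the origin the corrected frame is the smooth triangular factor times a
   constant; transport carries this to every point.\<close>
 define C where "C = (\<lambda>t. lor_mat (adj2 (A t)) ** lor_mat (A 0))"
 have C0: "C 0 = mat 1" by (simp add: C_def A)
 have vU: "\<forall>\<^sub>F t in nhds 0. ?v t \<in> U" by (rule path_eventually[OF U])
 have "(\<lambda>t. Y (?v t) 0 ** C t) differentiable (at 0)"
 proof (rule differentiable_cong_eventually)
  show "(\<lambda>t. K t ** lor_mat (A 0)) differentiable (at 0)" by (intro differentiable_mat_mult dK differentiable_const)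
  show "\<forall>\<^sub>F t in nhds 0. Y (?v t) 0 ** C t = K t ** lor_mat (A 0)"
   using vU
  proof (rule eventually_mono)
   fix t assume "?v t \<in> U"
   from A(2)[OF this] have "Y (?v t) 0 ** C t = K t ** (lor_mat (A t) ** lor_mat (adj2 (A t))) ** lor_mat (A 0)"
    by (simp only: C_def K_def matrix_mul_assoc)
   thus "Y (?v t) 0 ** C t = K t ** lor_mat (A 0)" by (simp add: A matrix_mul_rid)
  qed
 qed
 hence "(\<lambda>t. Yinv 0 ** Y (?v t) 0 ** C t) differentiable (at 0)"
  unfolding matrix_mul_assoc[symmetric] by (rule differentiable_mat_mult[OF differentiable_const])
 then obtain D where D: "((\<lambda>t. Yinv 0 ** Y (?v t) 0 ** C t) has_vector_derivative D) (at 0)"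
  using vector_derivative_works by blast
 have YC: "(\<lambda>t. Y (?v t) z ** C t) differentiable (at 0)" for z
 proof -
  have "(\<lambda>t. Yinv z ** Y (?v t) z ** C t) differentiable (at 0)"
   using frame_variation[OF D C0, of z] unfolding has_vector_derivative_def differentiable_def by (simp, blast)
  hence "(\<lambda>t. Y u z ** (Yinv z ** Y (?v t) z ** C t)) differentiable (at 0)"
   by (rule differentiable_mat_mult[OF differentiable_const])
  thus ?thesis by (simp add: matrix_mul_assoc matrix_mul_lid)
 qed
 \<comment> \<open>Equivariance between 0 and \<open>g 0\<close>, written in the corrected frame,
   expresses the conjugate of the holonomy by \<open>A t\<close> through differentiable factors. Its
   nonzero trace lifts this from Lorentz matrices to spin matrices.\<close>
 have M': "\<exists>M. M differentiable (at 0) \<and> (\<forall>\<^sub>F t in nhds 0. A t ** M t = lift g (?v t) ** A t) \<and> (\<lambda>t. lift g (?v t)) differentiable (at 0)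
   \<and> M 0 = adj2 (A 0) ** lift g u ** A 0"
  if g: "g \<in> deck p" "trace (lift g u) \<noteq> 0" for g
 proof -
  obtain V where V: "open V" "u \<in> V" "V \<subseteq> U" "\<And>v. v \<in> V ==> lift g v \<in> \<rho> v g" "\<And>v. v \<in> V ==> det (lift g v) = 1"
   using lift[OF g(1)] by metis
  have vV: "\<forall>\<^sub>F t in nhds 0. ?v t \<in> V" by (rule path_eventually[OF V(1,2)])
  define M where "M = (\<lambda>t. adj2 (A t) ** lift g (?v t) ** A t)"
  have dl: "(\<lambda>t. lor_mat (M t)) differentiable (at 0)"
  proof (rule differentiable_cong_eventually)
   show "(\<lambda>t. Ki t ** block (transpose (jacobian g (at 0))) 1 ** (Y (?v t) (g 0) ** C t) ** lor_mat (adj2 (A 0))) differentiable (at 0)"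
    by (intro differentiable_mat_mult dK differentiable_const YC)
   show "\<forall>\<^sub>F t in nhds 0. lor_mat (M t) = Ki t ** block (transpose (jacobian g (at 0))) 1 ** (Y (?v t) (g 0) ** C t) ** lor_mat (adj2 (A 0))"
    using vV
   proof (rule eventually_mono)
    fix t assume t: "?v t \<in> V"
    hence tU: "?v t \<in> U" using V(3) by blast
    have "Ki t ** block (transpose (jacobian g (at 0))) 1 ** (Y (?v t) (g 0) ** C t) ** lor_mat (adj2 (A 0))
      = Ki t ** (block (transpose (jacobian g (at 0))) 1 ** Y (?v t) (g 0)) ** C t ** lor_mat (adj2 (A 0))"
     by (simp only: matrix_mul_assoc)
    also have "\<dots> = (Ki t ** K t) ** lor_mat (A t) ** lor_mat (lift g (?v t)) ** lor_mat (adj2 (A t)) ** (lor_mat (A 0) ** lor_mat (adj2 (A 0)))"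
     unfolding Y_equivariant[OF tU g(1) V(4)[OF t]] A(2)[OF tU] C_def K_def by (simp only: matrix_mul_assoc)
    also have "\<dots> = lor_mat (A t) ** lor_mat (lift g (?v t)) ** lor_mat (adj2 (A t))"
     unfolding K_def Ki_def cholesky_inv[OF pos(1)[OF tU] pos(2)[OF tU]] lor_mat_inv(1)[OF A(1)] matrix_mul_lid matrix_mul_rid ..
    also have "\<dots> = lor_mat (M t)" by (simp add: M_def lor_mat_mult matrix_mul_assoc)
    finally show "lor_mat (M t) = Ki t ** block (transpose (jacobian g (at 0))) 1 ** (Y (?v t) (g 0) ** C t) ** lor_mat (adj2 (A 0))" ..
   qed
  qed
  have "(\<lambda>t. M t ** herm (axis c 1) ** adjoint_matrix (M t)) differentiable (at 0)" for c
   unfolding herm_lor_mat[symmetric] by (intro differentiable_linear[OF linear_herm] differentiable_nth dl)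
  moreover have dlift: "(\<lambda>t. lift g (?v t)) differentiable (at 0)" by (rule path_differentiable(1)[OF lift_differentiable[OF g(1)]])
  hence "(\<lambda>t. trace (lift g (?v t))) differentiable (at 0)" by (rule differentiable_linear[OF linear_trace2])
  ultimately have "M differentiable (at 0)"
   using g(2) trace_conj[of "adj2 (A _)" "lift g (?v _)"] A(1)
   by (intro spin_lift_differentiable[of M "\<lambda>t. trace (lift g (?v t))"]) (auto simp: M_def)
  moreover have "A t ** M t = lift g (?v t) ** A t" for t
  proof -
   have "A t ** M t = (A t ** adj2 (A t)) ** lift g (?v t) ** A t" by (simp only: M_def matrix_mul_assoc)
   thus ?thesis by (simp only: mult_adj2_1(1)[OF A(1)] matrix_mul_lid)
  qed
  moreover have "M 0 = adj2 (A 0) ** lift g u ** A 0" by (simp add: M_def)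
  ultimately show ?thesis using dlift by (intro exI[of _ M]) simp
 qed
 obtain g d where gd: "g \<in> deck p" "d \<in> deck p" "lift g u ** lift d u \<noteq> lift d u ** lift g u" "trace (lift g u) \<noteq> 0" "trace (lift d u) \<noteq> 0"
  by (rule lift_nondegenerate)
 obtain M where M: "M differentiable (at 0)" "\<forall>\<^sub>F t in nhds 0. A t ** M t = lift g (?v t) ** A t" "(\<lambda>t. lift g (?v t)) differentiable (at 0)"
   "M 0 = adj2 (A 0) ** lift g u ** A 0" using M'[OF gd(1,4)] by blast
 obtain N where N: "N differentiable (at 0)" "\<forall>\<^sub>F t in nhds 0. A t ** N t = lift d (?v t) ** A t" "(\<lambda>t. lift d (?v t)) differentiable (at 0)"
   "N 0 = adj2 (A 0) ** lift d u ** A 0" using M'[OF gd(2,5)] by blast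
 have conj2: "adj2 (A 0) ** P ** A 0 ** (adj2 (A 0) ** Q ** A 0) = adj2 (A 0) ** (P ** Q) ** A 0" for P Q
 proof -
  have "adj2 (A 0) ** P ** A 0 ** (adj2 (A 0) ** Q ** A 0) = adj2 (A 0) ** P ** (A 0 ** adj2 (A 0)) ** Q ** A 0" by (simp only: matrix_mul_assoc)
  thus ?thesis by (simp only: mult_adj2_1(1)[OF A(1)] matrix_mul_rid matrix_mul_assoc)
 qed
 have conj3: "A 0 ** (adj2 (A 0) ** P ** A 0) ** adj2 (A 0) = P" for P
 proof -
  have "A 0 ** (adj2 (A 0) ** P ** A 0) ** adj2 (A 0) = (A 0 ** adj2 (A 0)) ** P ** (A 0 ** adj2 (A 0))" by (simp only: matrix_mul_assoc)
  thus ?thesis by (simp only: mult_adj2_1(1)[OF A(1)] matrix_mul_rid matrix_mul_lid)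
 qed
 have nc: "M 0 ** N 0 \<noteq> N 0 ** M 0"
  unfolding M(4) N(4) conj2 using gd(3) conj3 by metis
 \<comment> \<open>The conjugated and the original holonomies are now both differentiable, and
   \<open>A t\<close> intertwines them, so its Hermitian action is differentiable as well.\<close>
 have "(\<lambda>t. A t ** H ** adjoint_matrix (A t)) differentiable (at 0)" for H
  by (rule conj_differentiable[OF A(1) M(2) N(2) M(1) M(3) N(1) N(3) nc])
 note dH = this
 have dA: "(\<lambda>t. lor_mat (A t)) differentiable (at 0)"
  by (rule differentiable_vec) (simp only: lor_mat_unherm, intro differentiable_linear[OF linear_unherm] dH)
 have "Y (?v t) z ** C t ** (lor_mat (adj2 (A 0)) ** lor_mat (A t)) = Y (?v t) z" for t
 proof -
  have "Y (?v t) z ** C t ** (lor_mat (adj2 (A 0)) ** lor_mat (A t)) =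
   Y (?v t) z ** lor_mat (adj2 (A t)) ** (lor_mat (A 0) ** lor_mat (adj2 (A 0))) ** lor_mat (A t)"
   by (simp only: C_def matrix_mul_assoc)
  also have "\<dots> = Y (?v t) z ** (lor_mat (adj2 (A t)) ** lor_mat (A t))"
   by (simp only: lor_mat_inv(1)[OF A(1)] matrix_mul_rid matrix_mul_assoc)
  finally show ?thesis by (simp only: lor_mat_inv(2)[OF A(1)] matrix_mul_rid)
 qed
 moreover have "(\<lambda>t. Y (?v t) z ** C t ** (lor_mat (adj2 (A 0)) ** lor_mat (A t))) differentiable (at 0)"
  by (intro differentiable_mat_mult YC differentiable_const dA)
 ultimately show ?thesis by simp
qed

end

text \<open>\<open>lor_mat\<close> is the restriction to the diagonal of a real bilinear map, so its
  derivative at the identity follows from the product rule.\<close>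

lemma has_vector_derivative_lor_mat:
 fixes N :: "real => complex^2^2"
 assumes N: "(N has_vector_derivative X) (at 0)" and N0: "N 0 = mat 1"
 shows "((\<lambda>t. lor_mat (N t)) has_vector_derivative lor_diff X) (at 0)"
proof -
 define B :: "complex^2^2 => complex^2^2 => real^4^4" where "B = (\<lambda>P Q. \<chi> c. unherm (P ** herm (axis c 1) ** adjoint_matrix Q))"
 note bb = bounded_bilinear_mat_mult
 note bm = bounded_bilinear.add_left[OF bb] bounded_bilinear.add_right[OF bb] bounded_bilinear.scaleR_left[OF bb] bounded_bilinear.scaleR_right[OF bb]
 have "bilinear B"
  unfolding bilinear_def B_def
  by (intro conjI allI linearI)
   (simp_all add: vec_eq_iff[where 'b=4] bm linear_add[OF linear_unherm] linear_scale[OF linear_unherm]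
    linear_add[OF linear_adjoint_matrix] linear_scale[OF linear_adjoint_matrix])
 hence B: "bounded_bilinear B" by (simp add: bilinear_conv_bounded_bilinear)
 have "lor_mat P = B P P" for P
  by (simp only: vec_eq_iff[of "lor_mat P"] B_def vec_lambda_beta lor_mat_unherm simp_thms)
 moreover have "B (N 0) X + B X (N 0) = lor_diff X"
  by (simp only: vec_eq_iff[of _ "lor_diff X"] B_def N0 lor_diff_def vec_lambda_beta vector_add_component adjoint_matrix_mat1
   matrix_mul_lid matrix_mul_rid linear_add[OF linear_unherm] add.commute simp_thms) (simp add: vec_eq_iff)
 ultimately show ?thesis using bounded_bilinear.has_vector_derivative[OF B N N] by simp
qed

section \<open>Goldman's form as an integral\<close>

definition trace_form :: "complex^2^2 => complex^2^2 => complex" where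
 "trace_form X Y = trace (X ** Y)"

lemma bounded_bilinear_trace_form: "bounded_bilinear trace_form"
proof -
 note bb = bounded_bilinear_mat_mult
 note bm = bounded_bilinear.add_left[OF bb] bounded_bilinear.add_right[OF bb] bounded_bilinear.scaleR_left[OF bb] bounded_bilinear.scaleR_right[OF bb]
 have "bilinear trace_form"
  unfolding bilinear_def trace_form_def
  by (intro conjI allI linearI) (simp_all only: bm linear_add[OF linear_trace2] linear_scale[OF linear_trace2])
 thus ?thesis by (simp add: bilinear_conv_bounded_bilinear)
qed

text \<open>Two lifts agree up to sign at each point. With the sign \<open>e\<close> taken from
  \<open>u\<close>, the sum \<open>R' v + e *R R v\<close> is nonzero at \<open>u\<close>, hence
  nearby, which excludes the other sign.\<close>

lemma local_lift_unique:
 assumes U: "open U" "u \<in> U" "\<And>v. v \<in> U ==> c v \<in> carrier PSL2C"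
  and R: "local_lift c u R" "local_lift c u R'"
 obtains W and e :: real where "open W" "u \<in> W" "e = 1 \<or> e = -1" "\<And>v. v \<in> W ==> R' v = e *R R v"
proof -
 obtain V where V: "open V" "u \<in> V" "smooth_on V R" "\<And>v. v \<in> V ==> R v \<in> c v" using R(1) unfolding local_lift_def by blast
 obtain V' where V': "open V'" "u \<in> V'" "smooth_on V' R'" "\<And>v. v \<in> V' ==> R' v \<in> c v" using R(2) unfolding local_lift_def by blast
 define W where "W = U \<inter> V \<inter> V'"
 have W: "open W" "u \<in> W" unfolding W_def using U V V' by auto
 have pm: "R' v = R v \<or> R' v = - R v" if "v \<in> W" for v
  using that PSL2C_memD(2)[OF U(3), of v "R v"] V(4)[of v] V'(4)[of v] unfolding W_def by blast
 have detR: "det (R u) = 1" using PSL2C_memD(1)[OF U(3)[OF U(2)]] V(2,4) by blast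
 have c: "isCont R u" "isCont R' u"
  using smooth_on_differentiable[OF V(3,2)] smooth_on_differentiable[OF V'(3,2)] by (auto intro: differentiable_imp_continuous_within)
 obtain e :: real where e: "e = 1 \<or> e = -1" "R' u = e *R R u" using pm[OF W(2)]
  by (metis scaleR_minus1_left scaleR_one)
 have "R u \<noteq> 0" using detR by (auto simp: det_2)
 hence ne: "R' u + e *R R u \<noteq> 0" using e by (auto simp: scaleR_2[symmetric] simp flip: minus_add_distrib)
 have "isCont (\<lambda>v. R' v + e *R R v) u" by (intro continuous_intros c)
 hence "\<forall>\<^sub>F v in at u. R' v + e *R R v \<noteq> 0" using ne by (intro tendsto_imp_eventually_ne) (auto simp: isCont_def)
 hence "\<forall>\<^sub>F v in nhds u. R' v + e *R R v \<noteq> 0" using ne by (simp add: eventually_nhds_conv_at)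
 then obtain T where T: "open T" "u \<in> T" "\<And>v. v \<in> T ==> R' v + e *R R v \<noteq> 0" unfolding eventually_nhds by blast
 show ?thesis
 proof (rule that[of "W \<inter> T" e])
  show "R' v = e *R R v" if "v \<in> W \<inter> T" for v
   using pm[of v] T(3)[of v] that e(1) by auto
 qed (use W T e in auto)
qed

context equivariant_family begin

text \<open>The sign ambiguity of a local lift cancels between the derivative and the inverse, so
  the definite description has one value.\<close>

lemma tangent_cocycle_eq:
 assumes g: "g \<in> deck p"
 shows "tangent_cocycle \<rho> k u g = partial (lift g) k u ** adj2 (lift g u)"
 unfolding tangent_cocycle_def
proof (rule the_equality)
 show "\<exists>R. local_lift (\<lambda>v. \<rho> v g) u R \<and> partial (lift g) k u ** adj2 (lift g u) = partial R k u ** matrix_inv (R u)"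
  using lift_local[OF g] matrix_inv_adj2[OF lift_u(2)[OF g]] by metis
 fix X assume "\<exists>R. local_lift (\<lambda>v. \<rho> v g) u R \<and> X = partial R k u ** matrix_inv (R u)"
 then obtain R where R: "local_lift (\<lambda>v. \<rho> v g) u R" "X = partial R k u ** matrix_inv (R u)" by blast
 obtain W e where W: "open W" "u \<in> W" "e = 1 \<or> e = -1" "\<And>v. v \<in> W ==> R v = e *R lift g v"
  using local_lift_unique[OF U rho_carrier[OF _ g] lift_local[OF g] R(1)] by metis
 have "partial R k u = partial (\<lambda>v. e *R lift g v) k u" by (rule partial_cong[OF W(1,2,4)])
 also have "\<dots> = e *R partial (lift g) k u"
  by (rule partial_bounded_linear[OF bounded_linear_scaleR_right lift_differentiable[OF g]])
 finally have p: "partial R k u = e *R partial (lift g) k u" .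
 have "adj2 (e *R lift g u) = e *R adj2 (lift g u)" by (rule linear_scale[OF linear_adj2])
 moreover have "det (e *R lift g u) = 1" using W(3) lift_u(2)[OF g] by auto
 ultimately have "matrix_inv (R u) = e *R adj2 (lift g u)" using W(4)[OF W(2)] matrix_inv_adj2 by metis
 thus "X = partial (lift g) k u ** adj2 (lift g u)"
  using W(3) unfolding R(2) p by (auto simp: scaleR_mat_mult)
qed

text \<open>The logarithmic parameter derivative of the frame, taken along a coordinate line because
  differentiability is established along such lines.\<close>

definition Z :: "2 => real^2 => real^4^4" where
 "Z k z = Yinv z ** vector_derivative (\<lambda>t. Y (u + t *R axis k 1) z) (at 0)"

lemma Y_path: "((\<lambda>t. Y (u + t *R axis k 1) z) has_vector_derivative Y u z ** Z k z) (at 0)"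
proof -
 have "Y u z ** Z k z = vector_derivative (\<lambda>t. Y (u + t *R axis k 1) z) (at 0)"
  by (simp only: Z_def matrix_mul_assoc Yinv matrix_mul_lid)
 thus ?thesis using Y_path_differentiable by (simp add: vector_derivative_works)
qed

lemma Yinv_Y_path: "((\<lambda>t. Yinv z ** Y (u + t *R axis k 1) z ** mat 1) has_vector_derivative Z k z) (at 0)"
proof -
 have "((\<lambda>t. Yinv z ** Y (u + t *R axis k 1) z) has_vector_derivative Yinv z ** (Y u z ** Z k z)) (at 0)"
  by (rule bounded_linear.has_vector_derivative[OF bounded_bilinear.bounded_linear_right[OF bounded_bilinear_mat_mult] Y_path])
 thus ?thesis by (simp only: matrix_mul_assoc Yinv matrix_mul_lid matrix_mul_rid)
qed

text \<open>With the trivial correction factor, the transport formula writes the increment of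
  \<open>Z k\<close> as a line integral of the smooth fields \<open>\<alpha> k 1\<close> and
  \<open>\<alpha> k 2\<close>.\<close>

lemma Z_has_derivative: "(Z k has_derivative (\<lambda>h. (h$1) *R \<alpha> k 1 z + (h$2) *R \<alpha> k 2 z)) (at z)"
proof (rule has_derivative_line_integral)
 fix h
 have "((\<lambda>t. Yinv (z + h) ** Y (u + t *R axis k 1) (z + h) ** mat 1) has_vector_derivative
  Z k z + integral {0..1} (\<lambda>s. (h$1) *R \<alpha> k 1 (z + s *R h) + (h$2) *R \<alpha> k 2 (z + s *R h))) (at 0)"
  by (rule frame_variation[OF Yinv_Y_path]) simp
 from vector_derivative_unique_at[OF Yinv_Y_path this]
 show "Z k (z + h) - Z k z = integral {0..1} (\<lambda>s. (h$1) *R \<alpha> k 1 (z + s *R h) + (h$2) *R \<alpha> k 2 (z + s *R h))" by simp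
qed (intro Ck_on_imp_continuous Ck_\<alpha>)+

definition \<tau> :: "2 => real^2 => complex^2^2" where
 "\<tau> k z = spin_part (Z k z)"

lemma bounded_linear_spin_part: "bounded_linear spin_part"
 using linear_spin_part by (simp add: linear_conv_bounded_linear)

lemma partial_\<tau>: "partial (\<tau> k) i z = spin_part (\<alpha> k i z)"
proof -
 have "partial (\<tau> k) i z = spin_part (partial (Z k) i z)"
  unfolding \<tau>_def[abs_def] by (rule partial_bounded_linear[OF bounded_linear_spin_part]) (use Z_has_derivative in \<open>auto simp: differentiable_def\<close>)
 moreover have "partial (Z k) i z = \<alpha> k i z"
  unfolding partial_eqI[OF Z_has_derivative] using exhaust_2[of i] by (auto simp: axis_def)
 ultimately show ?thesis by simp
qed

lemma Ck_\<tau>: "Ck_on l UNIV (\<tau> k)"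
proof (cases l)
 case 0
 have "continuous_on UNIV (Z k)"
  using Z_has_derivative by (intro continuous_at_imp_continuous_on ballI has_derivative_continuous) blast
 hence "Ck_on 0 UNIV (Z k)" by simp
 thus ?thesis unfolding 0 \<tau>_def[abs_def] by (rule Ck_on_bounded_linear[OF bounded_linear_spin_part open_UNIV])
next
 case (Suc m)
 have "Ck_on (Suc m) UNIV (Z k)"
  by (rule Ck_on_SucI[OF open_UNIV Z_has_derivative]) (intro Ck_on_add Ck_on_scaleR Ck_on_const Ck_\<alpha> open_UNIV)
 thus ?thesis unfolding Suc \<tau>_def[abs_def] by (rule Ck_on_bounded_linear[OF bounded_linear_spin_part open_UNIV])
qed

lemma \<tau>_differentiable: "\<tau> k differentiable (at z)"
 by (rule Ck_1_differentiable[OF Ck_\<tau> UNIV_I])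

abbreviation ad :: "(real^2 => real^2) => complex^2^2 => complex^2^2" where
 "ad \<gamma> X \<equiv> lift \<gamma> u ** X ** adj2 (lift \<gamma> u)"

abbreviation cocycle :: "2 => (real^2 => real^2) => complex^2^2" where
 "cocycle k \<gamma> \<equiv> tangent_cocycle \<rho> k u \<gamma>"

lemma trace_cocycle: "g \<in> deck p ==> trace (cocycle k g) = 0"
proof -
 assume g: "g \<in> deck p"
 obtain V where V: "open V" "u \<in> V" "\<And>v. v \<in> V ==> det (lift g v) = 1" by (rule lift[OF g]) blast
 have d1: "(\<lambda>v. lift g v$i$j) differentiable (at u)" for i j by (intro differentiable_nth lift_differentiable g)
 have p1: "partial (\<lambda>v. lift g v$i$j) k u = partial (lift g) k u$i$j" for i j
  using partial_nth[OF differentiable_nth[OF lift_differentiable[OF g]]] partial_nth[OF lift_differentiable[OF g]] by simp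
 have "partial (\<lambda>v. det (lift g v)) k u = partial (\<lambda>v. 1 :: complex) k u" by (rule partial_cong[OF V])
 hence "partial (\<lambda>v. lift g v$1$1 * lift g v$2$2 - lift g v$1$2 * lift g v$2$1) k u = 0" by (simp add: det_2)
 thus ?thesis
  unfolding partial_diff[OF differentiable_mult[OF d1 d1] differentiable_mult[OF d1 d1]] partial_mult[OF d1 d1] p1 tangent_cocycle_eq[OF g]
  by (simp add: mat2_simps algebra_simps)
qed

text \<open>Differentiates the equivariance of the frame in the parameter. The Jacobian block does
  not depend on the parameter and drops out of the logarithmic derivative; the derivative of the
  holonomy contributes the cocycle.\<close>

lemma \<tau>_equivariant:
 assumes g: "g \<in> deck p"
 shows "\<tau> k (g z) = cocycle k g + ad g (\<tau> k z)"
proof -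
 define M where "M = lift g u"
 define X where "X = cocycle k g"
 define J where "J = block (transpose (jacobian g (at z))) 1"
 have M: "M \<in> \<rho> u g" "det M = 1" unfolding M_def by (intro lift_u g)+
 obtain V where V: "open V" "u \<in> V" "V \<subseteq> U" "\<And>v. v \<in> V ==> lift g v \<in> \<rho> v g" by (rule lift[OF g]) blast
 let ?v = "\<lambda>t. u + t *R axis k 1"
 note bb = bounded_bilinear_mat_mult
 have N: "((\<lambda>t. lift g (?v t) ** adj2 M) has_vector_derivative X) (at 0)"
  unfolding X_def tangent_cocycle_eq[OF g] M_def
  by (rule bounded_linear.has_vector_derivative[OF bounded_bilinear.bounded_linear_left[OF bb] path_differentiable(2)[OF lift_differentiable[OF g]]])
 have dl: "((\<lambda>t. lor_mat (lift g (?v t) ** adj2 M)) has_vector_derivative lor_diff X) (at 0)"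
  by (rule has_vector_derivative_lor_mat[OF N]) (simp add: M(2) flip: M_def)
 have "((\<lambda>t. Y (?v t) z ** lor_mat M ** lor_mat (lift g (?v t) ** adj2 M)) has_vector_derivative
   Y u z ** lor_mat M ** lor_diff X + Y u z ** Z k z ** lor_mat M ** lor_mat (M ** adj2 M)) (at 0)"
  using bounded_bilinear.has_vector_derivative[OF bb bounded_linear.has_vector_derivative[OF bounded_bilinear.bounded_linear_left[OF bb] Y_path] dl]
  by (simp add: M_def)
 hence d1: "((\<lambda>t. Y (?v t) z ** lor_mat M ** lor_mat (lift g (?v t) ** adj2 M)) has_vector_derivative
   Y u z ** lor_mat M ** lor_diff X + Y u z ** Z k z ** lor_mat M) (at 0)" by (simp add: M(2) matrix_mul_rid)
 have "\<forall>\<^sub>F t in nhds 0. Y (?v t) z ** lor_mat M ** lor_mat (lift g (?v t) ** adj2 M) = J ** Y (?v t) (g z)"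
  using path_eventually[OF V(1,2)]
 proof (rule eventually_mono)
  fix t assume t: "?v t \<in> V"
  have "lor_mat M ** lor_mat (lift g (?v t) ** adj2 M) = lor_mat (lift g (?v t) ** (adj2 M ** M))"
   by (simp only: lor_mat_mult[symmetric] matrix_mul_assoc)
  hence "lor_mat M ** lor_mat (lift g (?v t) ** adj2 M) = lor_mat (lift g (?v t))"
   by (simp only: mult_adj2_1(2)[OF M(2)] matrix_mul_rid)
  thus "Y (?v t) z ** lor_mat M ** lor_mat (lift g (?v t) ** adj2 M) = J ** Y (?v t) (g z)"
   unfolding J_def using Y_equivariant[OF subsetD[OF V(3) t] g V(4)[OF t], of z] by (simp only: matrix_mul_assoc[symmetric])
 qed
 then obtain T where T: "open T" "0 \<in> T" "\<And>t. t \<in> T ==> Y (?v t) z ** lor_mat M ** lor_mat (lift g (?v t) ** adj2 M) = J ** Y (?v t) (g z)"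
  unfolding eventually_nhds by blast
 have d2: "((\<lambda>t. J ** Y (?v t) (g z)) has_vector_derivative
   Y u z ** lor_mat M ** lor_diff X + Y u z ** Z k z ** lor_mat M) (at 0)"
  by (rule has_vector_derivative_transform_within_open[OF d1 T])
 have "((\<lambda>t. J ** Y (?v t) (g z)) has_vector_derivative J ** (Y u (g z) ** Z k (g z))) (at 0)"
  by (rule bounded_linear.has_vector_derivative[OF bounded_bilinear.bounded_linear_right[OF bb] Y_path])
 from vector_derivative_unique_at[OF this d2]
 have eq: "J ** Y u (g z) ** Z k (g z) = Y u z ** lor_mat M ** lor_diff X + Y u z ** Z k z ** lor_mat M"
  by (simp only: matrix_mul_assoc)
 have "lor_mat (adj2 M) ** Yinv z ** (Y u z ** lor_mat M) = lor_mat (adj2 M) ** (Yinv z ** Y u z) ** lor_mat M"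
  by (simp only: matrix_mul_assoc)
 hence one: "lor_mat (adj2 M) ** Yinv z ** (Y u z ** lor_mat M) = mat 1"
  by (simp only: Yinv matrix_mul_rid lor_mat_inv(2)[OF M(2)])
 have "Z k (g z) = lor_mat (adj2 M) ** Yinv z ** (Y u z ** lor_mat M) ** Z k (g z)"
  unfolding one matrix_mul_lid ..
 also have "\<dots> = lor_mat (adj2 M) ** Yinv z ** (J ** Y u (g z) ** Z k (g z))"
  unfolding Y_equivariant[OF U(2) g M(1), symmetric] J_def by (simp only: matrix_mul_assoc)
 also have "\<dots> = lor_mat (adj2 M) ** Yinv z ** (Y u z ** lor_mat M) ** lor_diff X + lor_mat (adj2 M) ** (Yinv z ** Y u z) ** Z k z ** lor_mat M"
  unfolding eq by (simp only: bounded_bilinear.add_right[OF bb] matrix_mul_assoc)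
 finally have "Z k (g z) = lor_diff X + lor_mat (adj2 M) ** Z k z ** lor_mat M"
  unfolding one by (simp only: Yinv matrix_mul_lid matrix_mul_rid)
 hence "\<tau> k (g z) = spin_part (lor_diff X) + spin_part (lor_mat (adj2 M) ** Z k z ** lor_mat M)"
  unfolding \<tau>_def by (simp only: linear_add[OF linear_spin_part])
 thus ?thesis
  unfolding spin_part_conj[OF M(2)] using spin_part_lor_diff[of X] trace_cocycle[OF g, of k] by (simp add: X_def M_def \<tau>_def)
qed

definition \<theta> :: "real^2 => complex^2" where
 "\<theta> z = (\<chi> j. trace_form (\<tau> 1 z) (partial (\<tau> 2) j z))"

text \<open>Inserting the equivariance of \<tau> into the pullback of tr(\<tau>_1 d\<tau>_2) leaves,
  besides the form itself, the term tr(a Ad d\<tau>_2) with the constant matrix a of the first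
  cocycle. This function is its primitive.\<close>

definition potential :: "(real^2 => real^2) => real^2 => complex" where
 "potential \<gamma> z = trace_form (cocycle 1 \<gamma>) (ad \<gamma> (\<tau> 2 z))"

lemma ad_trace: "g \<in> deck p ==> trace_form (ad g X) (ad g X') = trace_form X X'"
proof -
 assume g: "g \<in> deck p"
 have "ad g X ** ad g X' = lift g u ** X ** (adj2 (lift g u) ** lift g u) ** X' ** adj2 (lift g u)" by (simp only: matrix_mul_assoc)
 hence "ad g X ** ad g X' = ad g (X ** X')" by (simp only: mult_adj2_1(2)[OF lift_u(2)[OF g]] matrix_mul_rid matrix_mul_assoc)
 thus ?thesis unfolding trace_form_def by (simp only: trace_conj[OF lift_u(2)[OF g]])
qed

lemma bounded_linear_ad: "bounded_linear (ad g)"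
proof -
 have "bounded_linear (\<lambda>X. (lift g u ** X) ** adj2 (lift g u))"
  using bounded_linear_compose[OF bounded_bilinear.bounded_linear_left[OF bounded_bilinear_mat_mult] bounded_bilinear.bounded_linear_right[OF bounded_bilinear_mat_mult]] .
 thus ?thesis .
qed

text \<open>The chosen spin lifts are multiplicative only up to sign, which conjugation does not
  see.\<close>

lemma ad_comp:
 assumes "g \<in> deck p" "d \<in> deck p"
 shows "ad (g \<circ> d) X = ad g (ad d X)"
proof -
 have "lift g u ** lift d u \<in> \<rho> u (g \<circ> d)" by (rule rho_mult[OF U(2) assms lift_u(1)[OF assms(1)] lift_u(1)[OF assms(2)]])
 hence "lift (g \<circ> d) u = lift g u ** lift d u \<or> lift (g \<circ> d) u = - (lift g u ** lift d u)"
  using PSL2C_memD(2)[OF rho_carrier[OF U(2) comp_deck[OF assms]]] lift_u(1)[OF comp_deck[OF assms]] by blast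
 thus ?thesis by (elim disjE) (simp_all only: uminus_mat_mult adj2_uminus adj2_mult matrix_mul_assoc minus_minus)
qed

text \<open>Read off from the equivariance of the potential at one point, in place of
  differentiating the homomorphism property.\<close>

lemma cocycle_comp:
 assumes "g \<in> deck p" "d \<in> deck p"
 shows "cocycle k (g \<circ> d) = cocycle k g + ad g (cocycle k d)"
proof -
 have "\<tau> k (g (d 0)) = cocycle k (g \<circ> d) + ad g (ad d (\<tau> k 0))"
  using \<tau>_equivariant[OF comp_deck[OF assms], of k 0] by (simp only: comp_apply ad_comp[OF assms])
 moreover have "\<tau> k (g (d 0)) = cocycle k g + (ad g (cocycle k d) + ad g (ad d (\<tau> k 0)))"
  unfolding \<tau>_equivariant[OF assms(1)] \<tau>_equivariant[OF assms(2)] linear_simps(1)[OF bounded_linear_ad] ..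
 ultimately show ?thesis by simp
qed

lemma Ck_\<theta>_potential: "Ck_on l UNIV \<theta>" "Ck_on l UNIV (potential g)"
proof -
 note bt = bounded_bilinear_trace_form
 show "Ck_on l UNIV \<theta>"
  unfolding \<theta>_def[abs_def]
  by (rule Ck_on_vec[OF open_UNIV]) (simp only: vec_lambda_beta, intro Ck_on_bilinear[OF bt] Ck_on_partial Ck_\<tau> open_UNIV)
 show "Ck_on l UNIV (potential g)"
  unfolding potential_def[abs_def]
  by (intro Ck_on_bilinear[OF bt] Ck_on_const Ck_on_bounded_linear[OF bounded_linear_ad] Ck_\<tau> open_UNIV)
qed

text \<open>The coefficient pairing B/4 is the trace form. The cocycle relation and the
  Ad-invariance of the trace cancel everything in the coboundary of \<open>potential\<close> except
  the cup product.\<close>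

lemma cochain_rep_\<theta>: "cochain_rep (cup_killing (\<rho> u) (cocycle 1) (cocycle 2)) \<theta> potential"
 unfolding cochain_rep_def
proof (intro conjI ballI allI)
 note bt = bounded_bilinear_trace_form
 show "smooth_on UNIV \<theta>" by (intro smooth_onI Ck_\<theta>_potential)
 fix g assume g: "g \<in> deck p"
 show "smooth_on UNIV (potential g)" by (intro smooth_onI Ck_\<theta>_potential)
 show "pull g \<theta> z$j - \<theta> z$j = partial (potential g) j z" for z j
 proof -
  let ?J = "jacobian g (at z)"
  have chain: "(?J$1$j) *R partial (\<tau> 2) 1 (g z) + (?J$2$j) *R partial (\<tau> 2) 2 (g z) = ad g (partial (\<tau> 2) j z)"
  proof -
   have "partial (\<lambda>z. \<tau> 2 (g z)) j z = partial (\<lambda>z. cocycle 2 g + ad g (\<tau> 2 z)) j z" by (simp only: \<tau>_equivariant[OF g])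
   thus ?thesis
    unfolding partial_chain[OF deck_differentiable[OF g] \<tau>_differentiable]
    by (simp only: partial_add[OF differentiable_const differentiable_bounded_linear[OF bounded_linear_ad \<tau>_differentiable]]
      partial_const partial_bounded_linear[OF bounded_linear_ad \<tau>_differentiable] add_0_left)
  qed
  have "pull g \<theta> z$j = trace_form (\<tau> 1 (g z)) ((?J$1$j) *R partial (\<tau> 2) 1 (g z) + (?J$2$j) *R partial (\<tau> 2) 2 (g z))"
   by (simp add: pull_def \<theta>_def sum_2 bounded_bilinear.add_right[OF bt] bounded_bilinear.scaleR_right[OF bt] scaleR_conv_of_real[where 'a=complex] mult.commute)
  also have "\<dots> = trace_form (cocycle 1 g) (ad g (partial (\<tau> 2) j z)) + \<theta> z$j"
   unfolding chain \<tau>_equivariant[OF g] bounded_bilinear.add_left[OF bt] ad_trace[OF g] by (simp add: \<theta>_def)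
  also have "trace_form (cocycle 1 g) (ad g (partial (\<tau> 2) j z)) = partial (potential g) j z"
   unfolding potential_def[abs_def]
   by (rule partial_bounded_linear[OF bounded_linear_compose[OF bounded_bilinear.bounded_linear_right[OF bt] bounded_linear_ad] \<tau>_differentiable, symmetric])
  finally show ?thesis by simp
 qed
 fix d assume d: "d \<in> deck p"
 fix z
 have "Ad (\<rho> u g) (cocycle 2 d) = ad g (cocycle 2 d)"
  by (rule Ad_eq[OF PSL2C_memD(2)[OF rho_carrier[OF U(2) g] lift_u(1)[OF g]] lift_u(2)[OF g]])
 hence "cup_killing (\<rho> u) (cocycle 1) (cocycle 2) g d = trace_form (cocycle 1 g) (ad g (cocycle 2 d))"
  by (simp add: cup_killing_def killing_form_def trace_form_def)
 moreover have "potential g (d z) = trace_form (cocycle 1 g) (ad g (cocycle 2 d)) + trace_form (cocycle 1 g) (ad g (ad d (\<tau> 2 z)))"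
  unfolding potential_def \<tau>_equivariant[OF d] linear_simps(1)[OF bounded_linear_ad] bounded_bilinear.add_right[OF bt] ..
 moreover have "potential (g \<circ> d) z = trace_form (cocycle 1 g) (ad g (ad d (\<tau> 2 z))) + potential d z"
  unfolding potential_def ad_comp[OF g d] cocycle_comp[OF g d] bounded_bilinear.add_left[OF bt] ad_trace[OF g] ..
 ultimately show "potential g (d z) + potential d z - potential (g \<circ> d) z = cup_killing (\<rho> u) (cocycle 1) (cocycle 2) g d"
  by simp
qed

text \<open>The second derivatives of \<open>\<tau> 2\<close> cancel by symmetry, which leaves the
  trace of the wedge product of the two differentials.\<close>

lemma curl_\<theta>: "curl \<theta> z = trace_form (spin_part (\<alpha> 1 1 z)) (spin_part (\<alpha> 2 2 z)) - trace_form (spin_part (\<alpha> 1 2 z)) (spin_part (\<alpha> 2 1 z))"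
proof -
 note bt = bounded_bilinear_trace_form
 have d: "partial (\<tau> 2) i differentiable (at z)" for i
  by (rule Ck_1_differentiable[OF Ck_on_partial[OF open_UNIV Ck_\<tau>] UNIV_I])
 have "partial (partial (\<tau> 2) 1) 2 z = partial (partial (\<tau> 2) 2) 1 z"
  by (rule partial_partial_commute[OF open_UNIV UNIV_I Ck_\<tau>])
 thus ?thesis
  unfolding curl_def \<theta>_def vec_lambda_beta partial_bilinear[OF bt \<tau>_differentiable d] by (simp add: partial_\<tau>)
qed

lemma omega_G_eq:
 "omega_G S p \<rho> u = integral UNIV (\<lambda>z. bump z *R
  (trace_form (spin_part (\<alpha> 1 1 z)) (spin_part (\<alpha> 2 2 z)) - trace_form (spin_part (\<alpha> 1 2 z)) (spin_part (\<alpha> 2 1 z))))"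
 unfolding omega_G_def goldman_form_def H2_evaluation_eq[OF cochain_rep_\<theta>] curl_\<theta> ..

end

section \<open>Complex structures under pullback; derivatives of inverses and roots\<close>

definition rot :: "real^2^2" where "rot = vector [vector [0, -1], vector [1, 0]]"

lemma complex_structure_nth:
 "complex_structure I z$1$1 = - I z$2$1 / sqrt (det (I z))" "complex_structure I z$1$2 = - I z$2$2 / sqrt (det (I z))"
 "complex_structure I z$2$1 = I z$1$1 / sqrt (det (I z))" "complex_structure I z$2$2 = I z$1$2 / sqrt (det (I z))"
 by (simp_all add: complex_structure_def matrix_matrix_mult_def sum_2)

text \<open>The structure is \<open>rot ** I z\<close> divided by the area density, and
  \<open>D ** rot ** transpose D\<close> is \<open>rot\<close> times the determinant of
  \<open>D\<close>, which the scaling of the density cancels.\<close>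

lemma complex_structure_pullback:
 assumes I: "pullback g I z = I z" and D: "det (jacobian g (at z)) > 0"
 shows "complex_structure I (g z) ** jacobian g (at z) = jacobian g (at z) ** complex_structure I z"
proof -
 define D where "D = jacobian g (at z)"
 have Iz: "I z = transpose D ** I (g z) ** D" using I by (simp add: pullback_def D_def)
 have "det (I z) = (det D)\<^sup>2 * det (I (g z))" unfolding Iz by (simp add: det_mul det_transpose power2_eq_square)
 hence s: "sqrt (det (I z)) = det D * sqrt (det (I (g z)))" using D by (simp add: real_sqrt_mult D_def)
 have rD: "D ** rot ** transpose D = det D *R rot"
  by (simp add: vec_eq_iff forall_2 matrix_matrix_mult_def sum_2 rot_def transpose_def det_2 algebra_simps)
 have sc: "(c *R P) ** Q = c *R (P ** Q)" "P ** (c *R Q) = c *R (P ** Q)" for c and P Q :: "real^2^2"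
  by (simp_all add: bounded_bilinear.scaleR_left[OF bounded_bilinear_mat_mult] bounded_bilinear.scaleR_right[OF bounded_bilinear_mat_mult])
 have "D ** complex_structure I z = (1 / (det D * sqrt (det (I (g z))))) *R (D ** rot ** transpose D ** I (g z) ** D)"
  unfolding complex_structure_def rot_def[symmetric] s sc by (simp only: Iz matrix_mul_assoc)
 also have "\<dots> = (1 / sqrt (det (I (g z)))) *R (rot ** I (g z) ** D)"
  unfolding rD sc using D by (simp add: D_def)
 also have "\<dots> = complex_structure I (g z) ** D"
  unfolding complex_structure_def rot_def[symmetric] sc ..
 finally show ?thesis by (simp add: D_def)
qed

lemma partial_inverse:
 fixes g :: "real^2 => real"
 assumes "g differentiable (at z)" "g z \<noteq> 0"
 shows "partial (\<lambda>z. inverse (g z)) i z = - partial g i z / (g z * g z)"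
  and "(\<lambda>z. inverse (g z)) differentiable (at z)"
proof -
 have d: "((\<lambda>z. inverse (g z)) has_derivative (\<lambda>h. - (inverse (g z) * FD g z h * inverse (g z)))) (at z)"
  using Deriv.has_derivative_inverse[OF assms(2) frechet_works[OF assms(1)]] by simp
 thus "(\<lambda>z. inverse (g z)) differentiable (at z)" unfolding differentiable_def by blast
 show "partial (\<lambda>z. inverse (g z)) i z = - partial g i z / (g z * g z)"
  unfolding partial_eqI[OF d] by (simp add: partial_def divide_inverse mult_ac)
qed

lemma partial_sqrt:
 fixes g :: "real^2 => real"
 assumes "g differentiable (at z)" "g z > 0"
 shows "partial (\<lambda>z. sqrt (g z)) i z = partial g i z / (2 * sqrt (g z))"
  and "(\<lambda>z. sqrt (g z)) differentiable (at z)"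
proof -
 have d: "((\<lambda>z. sqrt (g z)) has_derivative (\<lambda>h. inverse (sqrt (g z)) / 2 * FD g z h)) (at z)"
  by (rule has_derivative_compose[OF frechet_works[OF assms(1)] DERIV_real_sqrt[OF assms(2), unfolded has_field_derivative_def]])
 thus "(\<lambda>z. sqrt (g z)) differentiable (at z)" unfolding differentiable_def by blast
 show "partial (\<lambda>z. sqrt (g z)) i z = partial g i z / (2 * sqrt (g z))"
  unfolding partial_eqI[OF d] partial_def[symmetric, of g] by (simp add: field_simps)
qed

context immersion begin

lemma christoffel_lower_commute: "christoffel_lower (fst G) i j l z = christoffel_lower (fst G) j i l z"
 unfolding second_derivative_tangent[symmetric] by (simp only: second_derivative_commute)

lemma partial_first_form:
 "partial (\<lambda>w. fst G w$b$c) a z = christoffel_lower (fst G) a b c z + christoffel_lower (fst G) a c b z"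
 unfolding second_derivative_tangent[symmetric] first_form[symmetric] partial_mink[OF diff(3) diff(3)] by (simp add: mink_commute)

end

section \<open>Groups whose elements of nonzero trace commute, and their limit sets\<close>

lemma traceless_commuting:
 fixes X K :: "complex^2^2"
 assumes "trace X = 0" "trace K = 0" "K \<noteq> 0" "X ** K = K ** X"
 shows "\<exists>a. X = mat a ** K"
proof -
 have t: "X$2$2 = - X$1$1" "K$2$2 = - K$1$1" using assms(1,2) by (simp_all add: trace_def sum_2 add_eq_0_iff)
 have "(X ** K)$i$j = (K ** X)$i$j" for i j using assms(4) by simp
 from this[of 1 1] this[of 1 2] this[of 2 1]
 have c: "X$1$2 * K$2$1 = K$1$2 * X$2$1" "X$1$1 * K$1$2 = X$1$2 * K$1$1" "X$1$1 * K$2$1 = X$2$1 * K$1$1"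
  by (simp_all add: matrix_matrix_mult_def sum_2 t algebra_simps)
 have mk: "X = mat a ** K" if "X$1$1 = a * K$1$1" "X$1$2 = a * K$1$2" "X$2$1 = a * K$2$1" for a
  using that by (simp add: vec_eq_iff forall_2 matrix_matrix_mult_def sum_2 mat_def t)
 have "K$1$1 \<noteq> 0 \<or> K$1$2 \<noteq> 0 \<or> K$2$1 \<noteq> 0" using assms(3) t by (auto simp: vec_eq_iff forall_2)
 then consider "K$1$1 \<noteq> 0" | "K$1$2 \<noteq> 0" | "K$2$1 \<noteq> 0" by blast
 thus ?thesis
 proof cases
  case 1 thus ?thesis using c by (intro exI[of _ "X$1$1 / K$1$1"] mk) (simp_all add: field_simps)
 next
  case 2 thus ?thesis using c by (intro exI[of _ "X$1$2 / K$1$2"] mk) (simp_all add: field_simps)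
 next
  case 3 thus ?thesis using c by (intro exI[of _ "X$2$1 / K$2$1"] mk) (simp_all add: field_simps)
 qed
qed

lemma traceless_anticommuting:
 fixes X K :: "complex^2^2"
 assumes "trace X = 0" "trace K = 0" "trace (X ** K) = 0"
 shows "X ** K = - (K ** X)"
proof -
 have t: "X$2$2 = - X$1$1" "K$2$2 = - K$1$1" using assms(1,2) by (simp_all add: trace_def sum_2 add_eq_0_iff)
 have "2 * X$1$1 * K$1$1 + X$1$2 * K$2$1 + X$2$1 * K$1$2 = 0"
  using assms(3) by (simp add: trace_def matrix_matrix_mult_def sum_2 t algebra_simps)
 thus ?thesis
  by (simp add: vec_eq_iff forall_2 matrix_matrix_mult_def sum_2 t) (simp add: algebra_simps eq_neg_iff_add_eq_0)
qed

lemma rank_one_factor: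
 fixes P :: "complex^2^2"
 assumes "det P = 0" "P \<noteq> 0"
 obtains w x :: "complex^2" where "\<And>i j. P$i$j = w$i * x$j" "x \<noteq> 0" "w \<noteq> 0"
proof -
 have d: "P$1$1 * P$2$2 = P$1$2 * P$2$1" using assms(1) by (simp add: det_2)
 show ?thesis
 proof (cases "P$1 = 0")
  case False
  then consider "P$1$1 \<noteq> 0" | "P$1$2 \<noteq> 0" by (auto simp: vec_eq_iff forall_2)
  hence "\<exists>k. P$2$1 = k * P$1$1 \<and> P$2$2 = k * P$1$2"
  proof cases
   case 1 thus ?thesis using d by (intro exI[of _ "P$2$1 / P$1$1"]) (simp add: field_simps)
  next
   case 2 thus ?thesis using d by (intro exI[of _ "P$2$2 / P$1$2"]) (simp add: field_simps)
  qed
  then obtain k where k: "P$2$1 = k * P$1$1" "P$2$2 = k * P$1$2" by blast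
  have "P$i$j = (vector [1, k] :: complex^2)$i * P$1$j" for i j
   using exhaust_2[of i] exhaust_2[of j] k by (elim disjE) simp_all
  moreover have "vector [1, k] \<noteq> (0 :: complex^2)" by (simp add: vec_eq_iff forall_2)
  ultimately show ?thesis using that False by blast
 next
  case True
  have "P$i$j = (vector [0, 1] :: complex^2)$i * P$2$j" for i j
   using exhaust_2[of i] True by (elim disjE) simp_all
  moreover have "vector [0, 1] \<noteq> (0 :: complex^2)" by (simp add: vec_eq_iff forall_2)
  moreover have "P$2 \<noteq> 0" using True assms(2) by (auto simp: vec_eq_iff[of P] forall_2)
  ultimately show ?thesis using that by blast
 qed
qed

lemma mat_mult_nth: "(mat c ** X)$i$j = c * X$i$j" for X :: "complex^2^2"
 using exhaust_2[of i] by (auto simp: matrix_matrix_mult_def sum_2 mat_def)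

lemma traceless_square: "trace M = 0 ==> det M = 1 ==> M ** M = - mat 1" for M :: "complex^2^2"
proof -
 assume M: "trace M = 0" "det M = 1"
 hence "adj2 M = - M" by (simp add: vec_eq_iff forall_2 adj2_def trace_def sum_2 add_eq_0_iff)
 hence "- (M ** M) = mat 1" using mult_adj2_1(1)[OF M(2)] by (simp add: uminus_mat_mult)
 thus ?thesis by (simp add: minus_equation_iff[of _ "mat 1"])
qed

text \<open>\<open>K\<close> spans a line of traceless matrices that conjugation by every element
  preserves. The traceless part of a non-scalar element of nonzero trace serves; failing that, any
  traceless element; failing that, all elements are scalar.\<close>

lemma signed_commutant:
 fixes H :: "(complex^2^2) set"
 assumes det: "\<And>M. M \<in> H ==> det M = 1" and mult: "\<And>M N. M \<in> H ==> N \<in> H ==> M ** N \<in> H"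
  and comm: "\<And>M N. M \<in> H ==> N \<in> H ==> trace M \<noteq> 0 ==> trace N \<noteq> 0 ==> M ** N = N ** M"
 obtains K where "K \<noteq> 0" "trace K = 0" "\<And>M. M \<in> H ==> M ** K = K ** M \<or> M ** K = - (K ** M)"
proof -
 note bb = bounded_bilinear_mat_mult
 note bm = bounded_bilinear.add_left[OF bb] bounded_bilinear.add_right[OF bb]
 have mat_comm: "mat c ** P = P ** mat c" for c :: complex and P :: "complex^2^2" by (simp add: mat2_simps)
 have sq: "M ** M = - mat 1" if "M \<in> H" "trace M = 0" for M by (rule traceless_square[OF that(2) det[OF that(1)]])
 consider (reg) K where "K \<in> H" "trace K \<noteq> 0" "\<nexists>a. K = mat a" | (tl) K where "K \<in> H" "trace K = 0" "\<And>M. M \<in> H ==> trace M \<noteq> 0 ==> \<exists>a. M = mat a"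
  | (scalar) "\<And>M. M \<in> H ==> \<exists>a. M = mat a" by metis
 thus ?thesis
 proof cases
  case reg
  define h where "h = trace K / 2"
  define K0 where "K0 = K - mat h"
  have K: "K = K0 + mat h" by (simp add: K0_def)
  have "trace (mat h :: complex^2^2) = 2 * h" by (simp add: trace_def sum_2 mat_def)
  hence t0: "trace K0 = 0" by (simp add: K0_def linear_diff[OF linear_trace2] h_def)
  have nz: "K0 \<noteq> 0" using reg(3) K by auto
  have cK: "X ** K = K ** X \<longleftrightarrow> X ** K0 = K0 ** X" for X unfolding K bm mat_comm[of h X] by simp
  show ?thesis
  proof (rule that[OF nz t0])
   fix M assume M: "M \<in> H"
   show "M ** K0 = K0 ** M \<or> M ** K0 = - (K0 ** M)"
   proof (cases "trace M = 0")
    case False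
    thus ?thesis using comm[OF M reg(1) _ reg(2)] unfolding cK by blast
   next
    case True
    \<comment> \<open>As \<open>M\<close> squares to -1, the product \<open>M ** K ** M\<close> is
      minus a conjugate of \<open>K\<close>; its trace is nonzero, so it commutes with
      \<open>K\<close>. Hence \<open>M ** K0 ** M\<close> is a multiple of \<open>K0\<close>, and
      doing this twice shows that the factor squares to one.\<close>
    note MM = sq[OF M True]
    have t: "trace (M ** X ** M) = - trace X" for X
     using trace_mul_sym[of M "X ** M"] by (simp add: matrix_mul_assoc[symmetric] MM uminus_mat_mult linear_neg[OF linear_trace2])
    have "(M ** K ** M) ** K = K ** (M ** K ** M)"
     using reg(1,2) M by (intro comm mult) (simp_all add: t)
    moreover have "M ** K ** M = M ** K0 ** M + mat (- h)"
    proof -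
     have "M ** mat h ** M = mat h ** (M ** M)" by (simp only: mat_comm matrix_mul_assoc)
     thus ?thesis unfolding K bm MM by (simp add: mat2_simps)
    qed
    ultimately have "(M ** K0 ** M) ** K0 = K0 ** (M ** K0 ** M)"
     unfolding cK by (simp add: bm mat_comm)
    then obtain a where a: "M ** K0 ** M = mat a ** K0"
     using traceless_commuting[OF _ t0 nz] t[of K0] t0 by auto
    have "M ** (M ** K0 ** M) = - (K0 ** M)" "(M ** K0 ** M) ** M = - (M ** K0)"
     by (simp_all only: matrix_mul_assoc[symmetric] MM) (simp_all add: matrix_mul_assoc MM uminus_mat_mult)
    moreover have "M ** (mat a ** K0) = mat a ** (M ** K0)" "(mat a ** K0) ** M = mat a ** (K0 ** M)"
     by (metis mat_comm matrix_mul_assoc)+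
    ultimately have e: "mat a ** (M ** K0) = - (K0 ** M)" "mat a ** (K0 ** M) = - (M ** K0)" unfolding a by (simp_all only:)
    have n: "(K0 ** M)$i$j = - (a * (M ** K0)$i$j)" "(M ** K0)$i$j = - (a * (K0 ** M)$i$j)" for i j
     unfolding mat_mult_nth[symmetric] e by simp_all
    have "M ** K0 \<noteq> 0"
    proof
     assume "M ** K0 = 0"
     hence "M ** (M ** K0) = 0" by (simp add: matrix_matrix_mult_def vec_eq_iff)
     thus False using nz by (simp add: matrix_mul_assoc MM uminus_mat_mult)
    qed
    then obtain i j where "(M ** K0)$i$j \<noteq> 0" by (auto simp: vec_eq_iff)
    moreover have "(M ** K0)$i$j = a * a * (M ** K0)$i$j"
     using n[of i j] by (metis minus_minus mult.assoc mult_minus_right)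
    ultimately have "a * a = 1" by simp
    hence "a = 1 \<or> a = -1" by (simp add: square_eq_1_iff)
    moreover have "mat (-1) ** X = - X" for X :: "complex^2^2" by (simp add: mat2_simps)
    ultimately show ?thesis using e(2) by (auto simp: matrix_mul_lid minus_equation_iff[of "M ** K0"])
   qed
  qed
 next
  case tl
  have "det K = 1" by (rule det[OF tl(1)])
  hence "K \<noteq> 0" by (auto simp: det_2)
  thus ?thesis
  proof (rule that[OF _ tl(2)])
   fix M assume M: "M \<in> H"
   consider a where "M = mat a" | a where "M ** K = mat a" | "trace M = 0" "trace (M ** K) = 0"
    using tl(3)[OF M] tl(3)[OF mult[OF M tl(1)]] by blast
   thus "M ** K = K ** M \<or> M ** K = - (K ** M)"
   proof cases
    case 1 thus ?thesis by (simp add: mat_comm)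
   next
    case 2
    have "M = mat (- a) ** K"
    proof -
     have "(M ** K) ** K = - M" by (simp only: matrix_mul_assoc[symmetric] sq[OF tl(1,2)]) (simp add: uminus_mat_mult)
     thus ?thesis unfolding 2 by (simp add: mat2_simps minus_equation_iff)
    qed
    thus ?thesis by (metis mat_comm matrix_mul_assoc)
   next
    case 3 thus ?thesis using traceless_anticommuting[OF _ tl(2)] by blast
   qed
  qed
 next
  case scalar
  define D :: "complex^2^2" where "D = vector [vector [1, 0], vector [0, -1]]"
  have "D \<noteq> 0" "trace D = 0" by (simp_all add: D_def vec_eq_iff forall_2 trace_def sum_2)
  thus ?thesis by (rule that) (use scalar mat_comm in blast)
 qed
qed

text \<open>The difference of two such Hermitian matrices is traceless, so its square is a
  nonnegative scalar; a nonzero row of K - l that annihilates it forces it to vanish.\<close>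

lemma eigenvector_unique:
 assumes K: "K$i \<noteq> mat l$i" and y: "K ** herm y = mat l ** herm y" "K ** herm y' = mat l ** herm y'" and 4: "y$4 = y'$4"
 shows "y = y'"
proof -
 define D where "D = herm (y - y')"
 define b where "b = (\<lambda>j. K$i$j - mat l$i$j)"
 define d e where "d = complex_of_real ((y - y')$3)" and "e = Complex ((y - y')$1) (- (y - y')$2)"
 have D: "D$1$1 = d" "D$1$2 = e" "D$2$1 = cnj e" "D$2$2 = - d"
  using 4 by (simp_all add: D_def d_def e_def complex_eq_iff)
 have "K ** D = mat l ** D"
  unfolding D_def linear_diff[OF linear_herm] bounded_bilinear.diff_right[OF bounded_bilinear_mat_mult] y ..
 hence "(K ** D)$i$j = (mat l ** D)$i$j" for j by simp
 from this[of 1] this[of 2]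
 have 0: "b 1 * d + b 2 * cnj e = 0" "b 1 * e - b 2 * d = 0" by (simp_all add: matrix_matrix_mult_def sum_2 D b_def algebra_simps)
 have "b 1 * (d * d + e * cnj e) = d * (b 1 * d + b 2 * cnj e) + cnj e * (b 1 * e - b 2 * d)"
  "b 2 * (d * d + e * cnj e) = e * (b 1 * d + b 2 * cnj e) - d * (b 1 * e - b 2 * d)" by (simp_all add: algebra_simps)
 hence "d * d + e * cnj e = 0 \<or> (b 1 = 0 \<and> b 2 = 0)" unfolding 0 by auto
 moreover have "\<not> (b 1 = 0 \<and> b 2 = 0)" using K by (auto simp: b_def vec_eq_iff forall_2)
 moreover have "d * d + e * cnj e = complex_of_real (((y - y')$3)\<^sup>2 + (cmod e)\<^sup>2)"
  by (simp add: d_def complex_norm_square[symmetric] power2_eq_square)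
 ultimately have "((y - y')$3)\<^sup>2 + (cmod e)\<^sup>2 = 0" by (metis of_real_eq_0_iff)
 hence "(y - y')$3 = 0" "e = 0" by (simp_all add: sum_power2_eq_zero_iff)
 thus ?thesis using 4 by (simp add: e_def complex_eq_iff vec_eq_iff forall_4)
qed

text \<open>\<open>K\<close> preserves the image of a \<open>T\<close> with which it commutes or
  anticommutes. For rank one the image is a line, hence an eigenline, and the eigenvalues of a
  traceless matrix square to minus its determinant.\<close>

lemma rank_one_eigenvalue:
 fixes K T :: "complex^2^2"
 assumes K: "trace K = 0" and T: "det T = 0" "T \<noteq> 0" and KT: "T ** K = K ** T \<or> T ** K = - (K ** T)"
 obtains l where "l * l = - det K" "K ** T = mat l ** T"
proof -
 have t: "K$2$2 = - K$1$1" using K by (simp add: trace_def sum_2 add_eq_0_iff)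
 obtain w x where wx: "\<And>i j. T$i$j = w$i * x$j" "x \<noteq> 0" "w \<noteq> 0" using rank_one_factor[OF T] by metis
 obtain j where j: "x$j \<noteq> 0" using wx(2) by (auto simp: vec_eq_iff)
 obtain s where s: "s = 1 \<or> s = -1" "K ** T = mat s ** (T ** K)"
 proof -
  have "mat (-1) ** X = - X" for X :: "complex^2^2" by (simp add: mat2_simps)
  thus ?thesis using KT that[of 1] that[of "-1"] by (auto simp: matrix_mul_lid)
 qed
 define l where "l = s * (x$1 * K$1$j + x$2 * K$2$j) / x$j"
 have "(K ** T)$i$j = (mat s ** (T ** K))$i$j" for i by (simp add: s(2))
 note 0 = this
 have "(K$i$1 * w$1 + K$i$2 * w$2) * x$j = l * w$i * x$j" for i
 proof -
  have l: "l * x$j = s * (x$1 * K$1$j + x$2 * K$2$j)" using j by (simp add: l_def)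
  have "l * w$i * x$j = w$i * (l * x$j)" by simp
  thus ?thesis using 0[of i] unfolding mat_mult_nth l by (simp add: matrix_matrix_mult_def sum_2 wx algebra_simps)
 qed
 hence w: "K$i$1 * w$1 + K$i$2 * w$2 = l * w$i" for i using j by simp
 have "(l * l + det K) * w$1 = l * (l * w$1 - (K$1$1 * w$1 + K$1$2 * w$2)) + K$1$1 * (l * w$1 - (K$1$1 * w$1 + K$1$2 * w$2))
   + K$1$2 * (l * w$2 - (K$2$1 * w$1 + K$2$2 * w$2))"
  "(l * l + det K) * w$2 = l * (l * w$2 - (K$2$1 * w$1 + K$2$2 * w$2)) + K$2$1 * (l * w$1 - (K$1$1 * w$1 + K$1$2 * w$2))
   + K$2$2 * (l * w$2 - (K$2$1 * w$1 + K$2$2 * w$2))"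
  by (simp_all add: det_2 t algebra_simps)
 hence "(l * l + det K) * w$i = 0" for i unfolding w using exhaust_2[of i] by auto
 moreover obtain i where "w$i \<noteq> 0" using wx(3) by (auto simp: vec_eq_iff)
 ultimately have "l * l + det K = 0" by (metis mult_eq_0_iff)
 hence "l * l = - det K" by (simp add: add_eq_0_iff2)
 moreover have "(K ** T)$i$k = (mat l ** T)$i$k" for i k
 proof -
  have "(K ** T)$i$k = (K$i$1 * w$1 + K$i$2 * w$2) * x$k" by (simp add: matrix_matrix_mult_def sum_2 wx algebra_simps)
  thus ?thesis unfolding w mat_mult_nth wx by (simp only: mult.assoc)
 qed
 ultimately show ?thesis using that by (simp add: vec_eq_iff)
qed

text \<open>A limit point is a limit of orbit points rescaled to height one. The correspondingly
  rescaled group elements have constant norm, so they subconverge to a matrix \<open>T\<close>, and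
  a closed condition satisfied by all real multiples of group elements passes to it.\<close>

lemma (in surface_cover) limit_point_matrix:
 assumes qf: "quasi_fuchsian p r" and y: "y \<in> limit_set p r"
  and closed: "closed C" and C: "\<And>h M c. h \<in> deck p ==> M \<in> r h ==> c *R M \<in> C"
 obtains T where "T \<in> C" "herm y = T ** adjoint_matrix T" "det T = 0" "y$4 = 1"
proof -
 define x where "x = (\<lambda>h. psl_act (r h) (axis 4 1))"
 define k where "k = (\<lambda>h. (1 / x h$4) *R x h)"
 have rep: "r h \<in> carrier PSL2C" if "h \<in> deck p" for h
  using qf that by (auto simp: quasi_fuchsian_def representations_def hom_def deck_group_def)
 have "y islimpt k ` deck p" using y by (simp add: limit_set_def k_def x_def Let_def)
 then obtain yn where yn: "\<And>n. yn n \<in> k ` deck p - {y}" "yn \<longlonglongrightarrow> y" unfolding islimpt_sequential by blast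
 then obtain g where g: "\<And>n. g n \<in> deck p" "\<And>n. yn n = k (g n)"
 proof -
  have "\<forall>n. \<exists>h. h \<in> deck p \<and> yn n = k h" using yn(1) by blast
  from choice[OF this] show ?thesis using that by blast
 qed
 have "\<exists>M. M \<in> r (g n)" for n using rep[OF g(1)] unfolding PSL2C_carrier by blast
 then obtain M where M: "\<And>n. M n \<in> r (g n)" by metis
 have dM: "det (M n) = 1" for n by (rule PSL2C_memD(1)[OF rep[OF g(1)] M])
 have hx: "herm (x (g n)) = M n ** adjoint_matrix (M n)" for n
 proof -
  have "herm (axis 4 1) = mat 1" by (simp add: vec_eq_iff forall_2 mat_def axis_def complex_eq_iff)
  thus ?thesis unfolding x_def psl_act_eq[OF PSL2C_memD(2)[OF rep[OF g(1)] M]] herm_lorentz by (simp add: matrix_mul_rid)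
 qed
 have tr: "2 * z$4 = Re (trace (herm z))" for z by (simp add: trace_def sum_2)
 have trX: "Re (trace (X ** adjoint_matrix X)) = (norm X)\<^sup>2" for X :: "complex^2^2"
 proof -
  have "(norm X)\<^sup>2 = (cmod (X$1$1))\<^sup>2 + (cmod (X$1$2))\<^sup>2 + ((cmod (X$2$1))\<^sup>2 + (cmod (X$2$2))\<^sup>2)"
   by (simp add: norm_vec_def L2_set_def sum_2)
  from arg_cong[OF this, of complex_of_real] have "complex_of_real ((norm X)\<^sup>2) = trace (X ** adjoint_matrix X)"
   unfolding of_real_add complex_norm_square by (simp add: trace_def matrix_matrix_mult_def sum_2 adjoint_matrix_def)
  thus ?thesis by (metis Re_complex_of_real)
 qed
 have x4: "x (g n)$4 = (norm (M n))\<^sup>2 / 2" for n using tr[of "x (g n)"] unfolding hx trX by simp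
 have "M n \<noteq> 0" for n using dM[of n] by (auto simp: det_2)
 hence x0: "x (g n)$4 > 0" for n unfolding x4 by simp
 define T where "T = (\<lambda>n. (1 / sqrt (x (g n)$4)) *R M n)"
 have "adjoint_matrix (s *R X) = s *R adjoint_matrix X" for s X by (simp add: adjoint_matrix_def vec_eq_iff)
 hence hT: "herm (yn n) = T n ** adjoint_matrix (T n)" for n
  using x0[of n] by (simp add: g(2) k_def herm_scaleR hx T_def bounded_bilinear.scaleR_left[OF bounded_bilinear_mat_mult]
    bounded_bilinear.scaleR_right[OF bounded_bilinear_mat_mult])
 have y4: "yn n$4 = 1" for n using x0[of n] by (simp add: g(2) k_def)
 have dT: "det (T n) = complex_of_real (1 / x (g n)$4)" for n
 proof -
  have "det (c *R X) = complex_of_real (c * c) * det X" for c and X :: "complex^2^2"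
   by (simp add: det_2) (simp add: scaleR_conv_of_real algebra_simps)
  moreover have "1 / sqrt (x (g n)$4) * (1 / sqrt (x (g n)$4)) = 1 / x (g n)$4" using x0[of n] by simp
  ultimately show ?thesis unfolding T_def by (simp only: dM mult_1_right)
 qed
 have "(norm (T n))\<^sup>2 = 2" for n using tr[of "yn n"] unfolding hT trX y4 by simp
 hence "norm (T n) \<le> 2" for n by (metis power2_le_imp_le numeral_le_iff one_le_numeral order.trans power2_eq_square zero_le_numeral mult_2 le_add_same_cancel1)
 hence "bounded (range T)" unfolding bounded_iff by blast
 then obtain L s where L: "strict_mono s" "(T \<circ> s) \<longlonglongrightarrow> L" using bounded_imp_convergent_subsequence by blast
 have cont: "continuous_on UNIV herm" "continuous_on UNIV (\<lambda>X::complex^2^2. X ** adjoint_matrix X)" "continuous_on UNIV (det :: complex^2^2 => complex)"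
  by (rule linear_continuous_on, simp add: linear_herm flip: linear_conv_bounded_linear,
   intro bounded_bilinear.continuous_on[OF bounded_bilinear_mat_mult] continuous_on_id linear_continuous_on,
   simp add: linear_adjoint_matrix flip: linear_conv_bounded_linear, unfold det_2, intro continuous_intros)
 note lim = continuous_on_tendsto_compose[OF _ _ UNIV_I]
 have ys: "(yn \<circ> s) \<longlonglongrightarrow> y" by (rule LIMSEQ_subseq_LIMSEQ[OF yn(2) L(1)])
 show thesis
 proof (rule that)
  show "L \<in> C" by (rule Lim_in_closed_set[OF closed _ _ L(2)]) (auto simp: T_def intro!: always_eventually C[OF g(1) M])
  have "(\<lambda>n. herm ((yn \<circ> s) n)) \<longlonglongrightarrow> herm y" by (rule lim[OF cont(1) ys]) simp
  moreover have "(\<lambda>n. herm ((yn \<circ> s) n)) \<longlonglongrightarrow> L ** adjoint_matrix L" using lim[OF cont(2) L(2)] by (simp add: hT)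
  ultimately show "herm y = L ** adjoint_matrix L" by (rule LIMSEQ_unique)
  show "y$4 = 1" using tendsto_vec_nth[OF yn(2), of 4] by (simp add: y4 LIMSEQ_const_iff)
  have dl: "(\<lambda>n. det (T (s n))) \<longlonglongrightarrow> det L" using lim[OF cont(3) L(2)] by simp
  show "det L = 0"
  proof (rule ccontr)
   assume "det L \<noteq> 0"
   \<comment> \<open>\<open>det (T n)\<close> is the reciprocal of the height. Were its limit
     nonzero, the heights would eventually stay below \<open>R\<close>, so by proper discontinuity
     the sequence would run in a finite set avoiding \<open>y\<close> and could not converge to
     \<open>y\<close>.\<close>
   define R where "R = max 1 (2 / cmod (det L))"
   define B where "B = {x \<in> H3. x$4 \<le> R}"
   have e4B: "axis 4 1 \<in> B" by (simp add: B_def H3_def mink_def axis_def R_def)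
   have "compact B"
    unfolding compact_eq_bounded_closed
   proof
    show "bounded B"
    proof (rule boundedI[of _ "2 * R"])
     fix x assume "x \<in> B"
     hence x: "mink x x = -1" "0 < x$4" "x$4 \<le> R" by (auto simp: B_def H3_def)
     hence "(norm x)\<^sup>2 \<le> 2 * (x$4 * x$4)" by (simp add: power2_norm_eq_inner inner_vec_def sum_4 mink_def)
     also have "\<dots> \<le> 2 * (R * R)" using x by (intro mult_left_mono mult_mono) auto
     also have "\<dots> \<le> (2 * R)\<^sup>2" by (simp add: power2_eq_square)
     finally show "norm x \<le> 2 * R" by (rule power2_le_imp_le) (simp add: R_def)
    qed
    have "x$4 \<noteq> 0" if "mink x x = -1" for x using that zero_le_square[of "x$1"] zero_le_square[of "x$2"] zero_le_square[of "x$3"]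
     unfolding mink_def by force
    hence "B = {x. mink x x = -1 \<and> 0 \<le> x$4 \<and> x$4 \<le> R}" by (auto simp: B_def H3_def less_le)
    thus "closed B" unfolding mink_def
     by (simp only:) (intro closed_Collect_conj closed_Collect_eq closed_Collect_le continuous_intros)
   qed
   hence fin: "finite {h \<in> deck p. psl_act (r h) ` B \<inter> B \<noteq> {}}"
    using qf unfolding quasi_fuchsian_def B_def by blast
   have "x (g n) \<in> H3" for n
   proof -
    have "det (herm (x (g n))) = 1" unfolding hx by (simp add: det_mul dM)
    hence "mink (x (g n)) (x (g n)) = -1" unfolding det_herm by (metis minus_equation_iff of_real_eq_1_iff of_real_minus)
    thus ?thesis using x0[of n] by (simp add: H3_def)
   qed
   moreover have "\<forall>\<^sub>F n in sequentially. x (g (s n))$4 \<le> R"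
   proof -
    have "(\<lambda>n. cmod (det (T (s n)))) \<longlonglongrightarrow> cmod (det L)" by (rule tendsto_norm[OF dl])
    hence "\<forall>\<^sub>F n in sequentially. cmod (det (T (s n))) > cmod (det L) / 2" by (rule order_tendstoD) (use \<open>det L \<noteq> 0\<close> in simp)
    thus ?thesis
    proof (rule eventually_mono)
     fix n assume "cmod (det (T (s n))) > cmod (det L) / 2"
     hence "cmod (det L) / 2 < 1 / x (g (s n))$4" using x0[of "s n"] unfolding dT norm_of_real by simp
     thus "x (g (s n))$4 \<le> R" using x0[of "s n"] \<open>det L \<noteq> 0\<close> by (simp add: R_def field_simps le_max_iff_disj)
    qed
   qed
   ultimately have "\<forall>\<^sub>F n in sequentially. (yn \<circ> s) n \<in> k ` {h \<in> deck p. psl_act (r h) ` B \<inter> B \<noteq> {}} - {y}"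
   proof (elim eventually_mono)
    fix n assume "x (g (s n))$4 \<le> R" "\<And>n. x (g n) \<in> H3"
    hence "psl_act (r (g (s n))) (axis 4 1) \<in> B" by (simp add: B_def x_def)
    hence "g (s n) \<in> {h \<in> deck p. psl_act (r h) ` B \<inter> B \<noteq> {}}" using e4B g(1) by blast
    thus "(yn \<circ> s) n \<in> k ` {h \<in> deck p. psl_act (r h) ` B \<inter> B \<noteq> {}} - {y}"
     using yn(1)[of "s n"] g(2)[of "s n"] by auto
   qed
   hence "y \<in> k ` {h \<in> deck p. psl_act (r h) ` B \<inter> B \<noteq> {}} - {y}"
    by (rule Lim_in_closed_set[rotated, OF _ _ ys]) (use fin in \<open>auto intro!: finite_imp_closed\<close>)
   thus False by simp
  qed
 qed
qed

text \<open>Otherwise some traceless \<open>K\<close> commutes or anticommutes with all holonomy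
  matrices, hence with their limits. Each limit point then corresponds to one of the two eigenvalues
  of \<open>K\<close>, and at most two points cannot form a circle.\<close>

lemma (in surface_cover) nondegenerate:
 assumes qf: "quasi_fuchsian p r"
 shows "\<exists>h\<in>deck p. \<exists>d\<in>deck p. \<exists>M\<in>r h. \<exists>N\<in>r d. M ** N \<noteq> N ** M \<and> trace M \<noteq> 0 \<and> trace N \<noteq> 0"
proof (rule ccontr)
 assume "\<not> ?thesis"
 hence comm: "M ** N = N ** M" if "M \<in> (\<Union>h\<in>deck p. r h)" "N \<in> (\<Union>h\<in>deck p. r h)" "trace M \<noteq> 0" "trace N \<noteq> 0" for M N
  using that by blast
 have rep: "r \<in> hom (deck_group p) PSL2C" using qf by (simp add: quasi_fuchsian_def representations_def)
 hence det: "det M = 1" if "M \<in> (\<Union>h\<in>deck p. r h)" for M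
  using that PSL2C_memD(1) by (fastforce simp: hom_def deck_group_def)
 have mult: "M ** N \<in> (\<Union>h\<in>deck p. r h)" if M: "M \<in> (\<Union>h\<in>deck p. r h)" "N \<in> (\<Union>h\<in>deck p. r h)" for M N
 proof -
  obtain h d where g: "h \<in> deck p" "d \<in> deck p" "M \<in> r h" "N \<in> r d" using M by blast
  have "r (h \<circ> d) = r h \<otimes>\<^bsub>PSL2C\<^esub> r d" using rep g(1,2) by (auto simp: hom_def deck_group_def)
  thus ?thesis using PSL2C_mult[OF g(3,4)] comp_deck[OF g(1,2)] by blast
 qed
 obtain K where K: "K \<noteq> 0" "trace K = 0" "\<And>M. M \<in> (\<Union>h\<in>deck p. r h) ==> M ** K = K ** M \<or> M ** K = - (K ** M)"
  using signed_commutant[of "\<Union>h\<in>deck p. r h", OF det mult comm] by blast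
 note bb = bounded_bilinear_mat_mult
 define C where "C = {M. M ** K = K ** M} \<union> {M. M ** K = - (K ** M)}"
 have "closed C" unfolding C_def
  by (intro closed_Un closed_Collect_eq continuous_intros bounded_bilinear.continuous_on[OF bb])
 moreover have "c *R M \<in> C" if "h \<in> deck p" "M \<in> r h" for h M c
 proof -
  have "M \<in> (\<Union>h\<in>deck p. r h)" using that by blast
  from K(3)[OF this] show ?thesis unfolding C_def by (auto simp: bounded_bilinear.scaleR_left[OF bb] bounded_bilinear.scaleR_right[OF bb])
 qed
 ultimately have ex: "\<exists>T. T \<in> C \<and> herm y = T ** adjoint_matrix T \<and> det T = 0 \<and> y$4 = 1" if "y \<in> limit_set p r" for y
  using limit_point_matrix[OF qf that, of C] by metis
 have ev: "\<exists>l. l * l = - det K \<and> K ** herm y = mat l ** herm y \<and> y$4 = 1" if y: "y \<in> limit_set p r" for y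
 proof -
  obtain T where T: "T \<in> C" "herm y = T ** adjoint_matrix T" "det T = 0" "y$4 = 1" using ex[OF y] by blast
  have "T \<noteq> 0"
  proof
   assume "T = 0"
   hence "herm y = 0" by (simp add: T(2) matrix_matrix_mult_def vec_eq_iff)
   hence "herm y$1$1 + herm y$2$2 = 0" by simp
   thus False using T(4) by (simp add: complex_eq_iff)
  qed
  then obtain l where "l * l = - det K" "K ** T = mat l ** T"
   using rank_one_eigenvalue[OF K(2) T(3)] T(1) unfolding C_def by blast
  thus ?thesis unfolding T(2) matrix_mul_assoc using T(4) by metis
 qed
 then obtain l where l: "\<And>y. y \<in> limit_set p r ==> l y * l y = - det K" "\<And>y. y \<in> limit_set p r ==> K ** herm y = mat (l y) ** herm y"
  "\<And>y. y \<in> limit_set p r ==> y$4 = 1" by metis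
 have "K \<noteq> mat c" for c
 proof
  assume c: "K = mat c"
  hence "c = 0" using K(2) by (simp add: trace_def sum_2 mat_def)
  thus False using K(1) by (simp add: c mat_def vec_eq_iff)
 qed
 hence "\<exists>i. K$i \<noteq> mat c$i" for c by (metis vec_eq_iff)
 hence "inj_on l (limit_set p r)" using l eigenvector_unique by (intro inj_onI) metis
 moreover have "l ` limit_set p r \<subseteq> {csqrt (- det K), - csqrt (- det K)}"
 proof
  fix c assume "c \<in> l ` limit_set p r"
  hence "c\<^sup>2 = (csqrt (- det K))\<^sup>2" using l(1) by (auto simp: power2_eq_square[of "l _"])
  thus "c \<in> {csqrt (- det K), - csqrt (- det K)}" by (simp only: power2_eq_iff) simp
 qed
 ultimately have fin: "finite (limit_set p r)" by (rule inj_on_finite) simp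
 have "sphere (0::complex) 1 homeomorphic limit_set p r"
  using qf unfolding quasi_fuchsian_def by (elim conjE) (rule homeomorphic_sym[THEN iffD1])
 hence "finite (sphere (0::complex) 1)" unfolding homeomorphic_finite[OF fin] by (rule conjunct1)
 moreover have "uncountable (sphere (0::complex) 1)"
  by (rule connected_uncountable[of _ 1 "-1"]) (simp_all add: connected_sphere)
 ultimately show False by (simp add: countable_finite)
qed

section \<open>Diffeomorphisms homotopic to the identity and transport of immersions\<close>

lemma oriented_smooth_compose:
 assumes "oriented_smooth_on UNIV g" "oriented_smooth_on UNIV h"
 shows "oriented_smooth_on UNIV (\<lambda>z. g (h z))"
 unfolding oriented_smooth_on_def
proof (intro conjI ballI)
 show "smooth_on UNIV (\<lambda>z. g (h z))"
  by (rule smooth_onI, rule Ck_on_compose[OF open_UNIV open_UNIV subset_UNIV oriented_smooth_onD(2)[OF assms(2)] oriented_smooth_onD(2)[OF assms(1)]])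
 show "det (jacobian (\<lambda>z. g (h z)) (at z)) > 0" for z
  using oriented_smooth_onD(3)[OF assms(1), of "h z"] oriented_smooth_onD(3)[OF assms(2), of z]
  by (simp add: jacobian_compose[OF oriented_smooth_onD(4)[OF assms(2)] oriented_smooth_onD(4)[OF assms(1)]] det_mul)
qed simp

lemma pullback_compose:
 assumes "g differentiable (at (h z))" "h differentiable (at z)"
 shows "pullback (\<lambda>z. g (h z)) T z = pullback h (pullback g T) z"
 unfolding pullback_def jacobian_compose[OF assms(2,1)] by (simp add: matrix_transpose_mul matrix_mul_assoc)

lemma pullback_nth:
 "pullback h T z$i$j = (\<Sum>l\<in>UNIV. (\<Sum>k\<in>UNIV. jacobian h (at z)$k$i * T (h z)$k$l) * jacobian h (at z)$l$j)"
 by (simp add: pullback_def matrix_matrix_mult_def transpose_def)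

lemma (in immersion) hyperbolic_immersion_pullback:
 assumes h: "oriented_smooth_on UNIV h"
 shows "hyperbolic_immersion (\<lambda>z. f (h z)) (\<lambda>z. n (h z)) (pullback h (fst G), pullback h (snd G))"
 unfolding hyperbolic_immersion_def
proof (intro conjI allI)
 note hd = oriented_smooth_onD(4)[OF h UNIV_I]
 show "smooth_on UNIV (\<lambda>z. f (h z))" "smooth_on UNIV (\<lambda>z. n (h z))"
  by (rule smooth_onI, rule Ck_on_compose[OF open_UNIV open_UNIV subset_UNIV oriented_smooth_onD(2)[OF h] Ck(1)],
    rule smooth_onI, rule Ck_on_compose[OF open_UNIV open_UNIV subset_UNIV oriented_smooth_onD(2)[OF h] Ck(2)])
 fix z
 let ?J = "jacobian h (at z)"
 show "f (h z) \<in> H3" "mink (n (h z)) (f (h z)) = 0" "mink (n (h z)) (n (h z)) = 1"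
  by (simp_all add: H3_def in_H3 normal)
 have pf: "partial (\<lambda>z. f (h z)) i z = (?J$1$i) *R partial f 1 (h z) + (?J$2$i) *R partial f 2 (h z)" for i
  by (rule partial_chain[OF hd diff(1)])
 have pn: "partial (\<lambda>z. n (h z)) i z = (?J$1$i) *R partial n 1 (h z) + (?J$2$i) *R partial n 2 (h z)" for i
  by (rule partial_chain[OF hd diff(2)])
 show "mink (n (h z)) (partial (\<lambda>z. f (h z)) i z) = 0" for i
  unfolding pf by (simp add: mink_add_right mink_scaleR_right normal)
 have "vector [partial (\<lambda>z. f (h z)) 1 z, partial (\<lambda>z. f (h z)) 2 z, n (h z), f (h z)] = block (transpose ?J) 1 ** frame f n (h z)"
  by (rule vec4_eq[THEN iffD2]) (unfold matrix_mult_row[of "block (transpose ?J) 1"], simp add: sum_4 block_def transpose_def pf)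
 thus "det (vector [partial (\<lambda>z. f (h z)) 1 z, partial (\<lambda>z. f (h z)) 2 z, n (h z), f (h z)] :: real^4^4) > 0"
  using det_frame[of "h z"] oriented_smooth_onD(3)[OF h, of z] by (simp add: det_mul det_block det_transpose)
 have bil: "mink (a *R x + b *R y) (c *R x' + d *R y') = (a * mink x x' + b * mink y x') * c + (a * mink x y' + b * mink y y') * d"
  for a b c d x y x' y'
  by (simp add: mink_add_left mink_add_right mink_scaleR_left mink_scaleR_right algebra_simps)
 show "mink (partial (\<lambda>z. f (h z)) i z) (partial (\<lambda>z. f (h z)) j z) = fst (pullback h (fst G), pullback h (snd G)) z$i$j" for i j
  unfolding pf bil first_form fst_conv pullback_nth sum_2 ..
 show "- mink (partial (\<lambda>z. n (h z)) i z) (partial (\<lambda>z. f (h z)) j z) = snd (pullback h (fst G), pullback h (snd G)) z$i$j" for i j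
  unfolding pf pn bil second_fundamental snd_conv pullback_nth sum_2 by (simp add: algebra_simps)
qed

context surface_cover begin

lemma exists_lift:
 assumes "continuous_on S q" "q ` S \<subseteq> S"
 obtains k where "continuous_on UNIV k" "\<And>z. p (k z) = q (p z)"
proof -
 let ?h = "\<lambda>(t::real, z). q (p (t *R z))"
 have h1: "continuous_on ({0..1} \<times> UNIV) ?h"
  unfolding split_beta by (intro continuous_on_compose2[OF assms(1)] continuous_on_compose2[OF p_cont] continuous_intros) auto
 have h2: "?h ` ({0..1} \<times> UNIV) \<subseteq> S" using assms(2) by auto
 have "q (p 0) \<in> range p" using assms(2) by (auto simp: range_p)
 then obtain y where y: "p y = q (p 0)" by auto
 have h3: "?h (0, z) = p y" for z using y by simp
 obtain k where k: "continuous_on ({0..1} \<times> UNIV) k" "\<And>t z. t \<in> {0..1} ==> p (k (t, z)) = ?h (t, z)"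
  by (rule covering_space_lift_homotopy_UNIV[of p S ?h "\<lambda>_. y", OF cov h1 h2 continuous_on_const h3]) (rule that; assumption)
 have "continuous_on UNIV (\<lambda>z. k (1, z))"
  by (rule continuous_on_compose2[OF k(1)]) (auto intro!: continuous_intros)
 thus ?thesis using that[of "\<lambda>z. k (1, z)"] k(2)[of 1] by simp
qed

lemma oriented_smooth_inverse:
 assumes h: "oriented_smooth_on UNIV h" and k: "continuous_on UNIV k" "\<And>z. h (k z) = z"
 shows "oriented_smooth_on UNIV k"
 unfolding oriented_smooth_on_def
proof (intro conjI ballI)
 have Ck: "Ck_on m UNIV k" for m
 proof (rule Ck_on_implicit[OF open_UNIV open_UNIV k(1) subset_UNIV oriented_smooth_onD(2)[OF h]])
  show "Ck_on m UNIV (\<lambda>x. h (k x))" unfolding k(2) by (rule Ck_on_ident)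
  show "det (jacobian h (at y)) \<noteq> 0" for y using oriented_smooth_onD(3)[OF h UNIV_I, of y] by linarith
 qed
 thus "smooth_on UNIV k" by (rule smooth_onI)
 fix z
 have dk: "k differentiable (at z)" by (rule Ck_1_differentiable[OF Ck UNIV_I])
 have "jacobian (\<lambda>z. h (k z)) (at z) = jacobian h (at (k z)) ** jacobian k (at z)"
  by (rule jacobian_compose[OF dk oriented_smooth_onD(4)[OF h UNIV_I]])
 moreover have "jacobian (\<lambda>z. h (k z)) (at z) = mat 1"
  unfolding k(2) vec_eq_iff jacobian_nth frechet_derivative_ident by (simp add: mat_def axis_def)
 ultimately have "det (jacobian h (at (k z)) ** jacobian k (at z)) = 1" by (metis det_I)
 hence "0 < det (jacobian h (at (k z))) * det (jacobian k (at z))" by (simp add: det_mul)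
 thus "det (jacobian k (at z)) > 0" using oriented_smooth_onD(3)[OF h UNIV_I, of "k z"] by (rule zero_less_mult_pos)
qed simp

text \<open>Lifting the homotopy from the identity gives a lift \<open>h\<close> that commutes with
  the deck group: both sides are ends of lifts of one path with the same start. Any other lift of
  the same map differs from \<open>h\<close> by a deck transformation.\<close>

lemma diff0_lift:
 assumes \<phi>: "\<phi> \<in> diff0 S A" and f: "continuous_on UNIV f" "p \<circ> f = \<phi> \<circ> p"
 obtains h k e where "oriented_smooth_on UNIV h" "oriented_smooth_on UNIV k" "\<And>z. h (k z) = z" "\<And>z. k (h z) = z"
  "\<And>b z. b \<in> deck p ==> h (b z) = b (h z)" "e \<in> deck p" "\<And>z. f z = e (h z)"
proof -
 note d = \<phi>[unfolded diff0_def mem_Collect_eq]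
 from d[THEN conjunct1] obtain q where q: "homeomorphism S S \<phi> q" by (elim exE)
 have charts: "oriented_smooth_on (x ` (U \<inter> \<phi> -` V)) (y \<circ> \<phi> \<circ> inv_into U x)" if "(U, x) \<in> A" "(V, y) \<in> A" for U x V y
  using bspec[OF bspec[OF d[THEN conjunct2, THEN conjunct1] that(1), unfolded prod.case] that(2), unfolded prod.case] .
 have \<phi>S: "continuous_on S \<phi>" "continuous_on S q" "\<phi> ` S = S" "q ` S = S" "\<And>x. x \<in> S ==> q (\<phi> x) = x" "\<And>x. x \<in> S ==> \<phi> (q x) = x"
  using q unfolding homeomorphism_def by blast+
 have "homotopic_with_canon (\<lambda>_. True) S S id \<phi>"
  using d[THEN conjunct2, THEN conjunct2] by (rule homotopic_with_symD)
 then obtain H :: "real \<times> 'a => 'a" where H: "continuous_on ({0..1} \<times> S) H" "H \<in> {0..1} \<times> S \<rightarrow> S" "\<And>x. H (0, x) = x" "\<And>x. H (1, x) = \<phi> x"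
  unfolding homotopic_with_def by auto
 let ?h = "\<lambda>(t::real, z). H (t, p z)"
 have h1: "continuous_on ({0..1} \<times> UNIV) ?h"
  unfolding split_beta by (intro continuous_on_compose2[OF H(1)] continuous_on_compose2[OF p_cont] continuous_intros) auto
 have h2: "?h ` ({0..1} \<times> UNIV) \<subseteq> S" using H(2) by auto
 have h3: "?h (0, z) = p z" for z using H(3) by simp
 obtain K where K: "continuous_on ({0..1} \<times> UNIV) K" "\<And>z. K (0, z) = z" "\<And>t z. t \<in> {0..1} ==> p (K (t, z)) = H (t, p z)"
  by (rule covering_space_lift_homotopy_UNIV[of p S ?h "\<lambda>z. z", OF cov h1 h2 continuous_on_id h3]) (rule that; simp)
 have Kc: "continuous_on T (\<lambda>t. K (g t))" if "continuous_on T g" "g ` T \<subseteq> {0..1} \<times> UNIV" for T :: "'c::topological_space set" and g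
  using continuous_on_compose2[OF K(1) that] .
 define h where "h = (\<lambda>z. K (1, z))"
 have hc: "continuous_on UNIV h" unfolding h_def by (rule Kc) (auto intro!: continuous_intros)
 have ph: "p (h z) = \<phi> (p z)" for z unfolding h_def using K(3)[of 1 z] H(4) by simp
 have comm: "h (b z) = b (h z)" if b: "b \<in> deck p" for b z
  unfolding h_def
 proof (rule covering_space_lift_unique[OF cov, of "\<lambda>t. K (t, b z)" 0 "\<lambda>t. b (K (t, z))" "{0..1}" "\<lambda>t. H (t, p z)" 1])
  have c1: "continuous_on {0..1} (\<lambda>t. K (t, w))" for w by (rule Kc) (auto intro!: continuous_intros)
  show "continuous_on {0..1} (\<lambda>t. K (t, b z))" by (rule c1)
  show "continuous_on {0..1} (\<lambda>t. b (K (t, z)))" by (rule continuous_on_compose2[OF deck_cont[OF b] c1]) auto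
  show "continuous_on {0..1} (\<lambda>t. H (t, p z))" by (rule continuous_on_compose2[OF H(1)]) (auto intro!: continuous_intros)
  show "(\<lambda>t. H (t, p z)) \<in> {0..1} \<rightarrow> S" using H(2) by auto
 qed (use K b in \<open>auto simp: connected_Icc\<close>)
 have hs: "oriented_smooth_on UNIV h" by (rule lift_smooth[OF hc ph charts])
 obtain k0 where k0: "continuous_on UNIV k0" "\<And>z. p (k0 z) = q (p z)"
  using exists_lift[OF \<phi>S(2)] \<phi>S(4) by blast
 have "continuous_on UNIV (\<lambda>z. h (k0 z))" "continuous_on UNIV (\<lambda>z. k0 (h z))"
  by (rule continuous_on_compose2[OF hc k0(1)], simp, rule continuous_on_compose2[OF k0(1) hc], simp)
 hence "h \<circ> k0 \<in> deck p" "k0 \<circ> h \<in> deck p"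
  unfolding deck_iff comp_def using ph k0(2) \<phi>S(5,6) by simp_all
 note dk = this
 \<comment> \<open>A lift \<open>k0\<close> of the inverse diffeomorphism inverts \<open>h\<close>
   only up to a deck transformation, which is divided out here.\<close>
 define k where "k = (\<lambda>z. k0 (inv_into UNIV (h \<circ> k0) z))"
 have kc: "continuous_on UNIV k" unfolding k_def by (rule continuous_on_compose2[OF k0(1) deck_cont[OF inv_deck[OF dk(1)]]]) simp
 have hk: "h (k z) = z" for z using deck_inv_apply(2)[OF dk(1), of z] by (simp add: k_def)
 have "inj h" using deck_bij[OF dk(2)] by (metis bij_is_inj inj_on_imageI2)
 hence kh: "k (h z) = z" for z using hk[of "h z"] by (simp add: inj_def)
 have ks: "oriented_smooth_on UNIV k" by (rule oriented_smooth_inverse[OF hs kc hk])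
 have pf: "p (f z) = \<phi> (p z)" for z using f(2) by (metis comp_apply)
 obtain e where e: "e \<in> deck p" "e (h 0) = f 0" using deck_exists[of "h 0" "f 0"] ph pf by metis
 have "f = (\<lambda>z. e (h z))"
  by (rule lift_unique[where a = 0, OF f(1)]) (use e ph pf in \<open>auto intro: continuous_on_compose2[OF deck_cont hc]\<close>)
 hence fd: "f z = e (h z)" for z by (rule fun_cong)
 show ?thesis by (rule that[OF hs ks hk kh comm e(1) fd])
qed

lemma diff0_rel_pullback:
 assumes "((I, II), (I', II')) \<in> diff0_rel S A p" and G: "\<And>g. g \<in> deck p ==> pullback g I = I" "\<And>g. g \<in> deck p ==> pullback g II = II"
 obtains h k where "oriented_smooth_on UNIV h" "oriented_smooth_on UNIV k" "\<And>z. h (k z) = z" "\<And>z. k (h z) = z"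
  "\<And>g z. g \<in> deck p ==> h (g z) = g (h z)" "I' = pullback h I" "II' = pullback h II"
proof -
 obtain q f where f: "q \<in> diff0 S A" "continuous_on UNIV f" "p \<circ> f = q \<circ> p" "I' = pullback f I" "II' = pullback f II"
  using assms(1) unfolding diff0_rel_def by auto
 obtain h k d where h: "oriented_smooth_on UNIV h" "oriented_smooth_on UNIV k" "\<And>z. h (k z) = z" "\<And>z. k (h z) = z"
  "\<And>g z. g \<in> deck p ==> h (g z) = g (h z)" "d \<in> deck p" "\<And>z. f z = d (h z)" by (rule diff0_lift[OF f(1-3)]) (rule that; assumption)
 have pb: "pullback f T = pullback h T" if "pullback d T = T" for T
 proof
  fix z
  have "f = (\<lambda>z. d (h z))" using h(7) by blast
  thus "pullback f T z = pullback h T z"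
   using pullback_compose[OF deck_differentiable[OF h(6)] oriented_smooth_onD(4)[OF h(1) UNIV_I], of T z] that by simp
 qed
 show ?thesis by (rule that[OF h(1-5)]) (use f(4,5) pb G[OF h(6)] in auto)
qed

text \<open>The holonomy comes with some germ of the class, possibly another than the given one.
  Both are pullbacks of one germ by maps commuting with the deck group, so composing the immersion
  with the connecting map keeps its equivariance.\<close>

lemma holonomy_immersion:
 assumes F: "C \<in> almost_fuchsian_space S A p" and \<sigma>: "G' \<in> C" and \<rho>: "\<rho> \<in> holonomy_class p C"
 obtains f n where "hyperbolic_immersion f n G'" "\<And>g z. g \<in> deck p ==> f (g z) = psl_act (\<rho> g) (f z)"
proof -
 obtain G0 where G0: "G0 \<in> almost_fuchsian_germs p" "C = diff0_rel S A p `` {G0}"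
  using F unfolding almost_fuchsian_space_def quotient_def by blast
 obtain G where G: "G \<in> C" "is_holonomy p G \<rho>" using \<rho> unfolding holonomy_class_def by blast
 obtain f n where fn: "hyperbolic_immersion f n G" "\<And>g z. g \<in> deck p ==> f (g z) = psl_act (\<rho> g) (f z)"
  using G(2) unfolding is_holonomy_def by blast
 have "G0 \<in> minimal_hyperbolic_germs p" using G0(1) by (simp add: almost_fuchsian_germs_def)
 hence inv: "pullback g (fst G0) = fst G0" "pullback g (snd G0) = snd G0" if "g \<in> deck p" for g
  using that unfolding minimal_hyperbolic_germs_def riemannian_metric_def symmetric_form_on_surface_def by auto
 have r1: "((fst G0, snd G0), (fst G, snd G)) \<in> diff0_rel S A p" "((fst G0, snd G0), (fst G', snd G')) \<in> diff0_rel S A p"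
  using G(1) \<sigma> G0(2) by auto
 obtain h1 k1 where h1: "oriented_smooth_on UNIV h1" "oriented_smooth_on UNIV k1" "\<And>z. h1 (k1 z) = z" "\<And>z. k1 (h1 z) = z"
  "\<And>g z. g \<in> deck p ==> h1 (g z) = g (h1 z)" "fst G = pullback h1 (fst G0)" "snd G = pullback h1 (snd G0)"
  by (rule diff0_rel_pullback[OF r1(1) inv(1) inv(2)]; (assumption | rule that; assumption))
 obtain h2 k2 where h2: "oriented_smooth_on UNIV h2" "oriented_smooth_on UNIV k2" "\<And>z. h2 (k2 z) = z" "\<And>z. k2 (h2 z) = z"
  "\<And>g z. g \<in> deck p ==> h2 (g z) = g (h2 z)" "fst G' = pullback h2 (fst G0)" "snd G' = pullback h2 (snd G0)"
  by (rule diff0_rel_pullback[OF r1(2) inv(1) inv(2)]; (assumption | rule that; assumption))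
 define h where "h = (\<lambda>z. k1 (h2 z))"
 have h: "oriented_smooth_on UNIV h" unfolding h_def by (rule oriented_smooth_compose[OF h1(2) h2(1)])
 have k1c: "k1 (g z) = g (k1 z)" if "g \<in> deck p" for g z
  using h1(5)[OF that, of "k1 z"] unfolding h1(3) by (metis h1(4))
 have hc: "h (g z) = g (h z)" if "g \<in> deck p" for g z by (simp add: h_def h2(5)[OF that] k1c[OF that])
 have pb: "pullback h (pullback h1 T) = pullback h2 T" for T
 proof
  fix z
  have "(\<lambda>z. h1 (h z)) = h2" by (simp add: h_def h1(3))
  thus "pullback h (pullback h1 T) z = pullback h2 T z"
   using pullback_compose[OF oriented_smooth_onD(4)[OF h1(1) UNIV_I] oriented_smooth_onD(4)[OF h UNIV_I], of T z] by simp
 qed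
 have "immersion f n G" using fn(1) by (rule immersion.intro)
 from immersion.hyperbolic_immersion_pullback[OF this h]
 have "hyperbolic_immersion (\<lambda>z. f (h z)) (\<lambda>z. n (h z)) G'"
  unfolding h1(6,7) pb h2(6,7)[symmetric] prod.collapse .
 thus ?thesis by (rule that) (simp add: hc fn(2))
qed

end

section \<open>The Codazzi equation in arbitrary coordinates\<close>

lemma partial_divide:
 fixes f g :: "real^2 => real"
 assumes "f differentiable (at z)" "g differentiable (at z)" "g z \<noteq> 0"
 shows "partial (\<lambda>z. f z / g z) i z = (partial f i z * g z - f z * partial g i z) / (g z * g z)"
  and "(\<lambda>z. f z / g z) differentiable (at z)"
proof -
 note pi = partial_inverse[OF assms(2,3)]
 show "(\<lambda>z. f z / g z) differentiable (at z)" unfolding divide_inverse by (intro differentiable_mult assms pi)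
 show "partial (\<lambda>z. f z / g z) i z = (partial f i z * g z - f z * partial g i z) / (g z * g z)"
  unfolding divide_inverse[of "f _"] partial_mult[OF assms(1) pi(2)] pi(1) using assms(3) by (simp add: field_simps)
qed

text \<open>Digits denote coordinate derivatives: \<open>E1\<close> is the first one of
  \<open>E\<close>, and \<open>c112\<close> is \<open>christoffel_lower\<close> with the indices 1,
  1, 2. Multiplication by \<open>2 * E * E * s * s\<close> clears denominators, and minimality
  eliminates \<open>N\<close> through the product \<open>N * E\<close>.\<close>

lemma codazzi_real_part:
 fixes E F G s L M N :: real
 assumes s: "s > 0" "s * s = E * G - F * F" and E: "E \<noteq> 0" and min: "L * G - 2 * M * F + N * E = 0"
  and d1: "E1 = 2 * c111" "F1 = c112 + c121" "G1 = 2 * c122"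
  and s1: "s1 = (E1 * G + E * G1 - 2 * F * F1) / (2 * s)"
  and cod: "M1 - L2 = ((M * G - N * F) * c111 + (N * E - M * F) * c112 - (L * G - M * F) * c121 - (M * E - L * F) * c122) / (s * s)"
 shows "L2 - M1 = (F1 * E - F * E1) / (E * E) * L - (s1 * E - s * E1) / (E * E) * ((F * L - E * M) / s)"
proof -
 define q where "q = F * L - E * M"
 have NE: "N * E = 2 * M * F - L * G" using min by simp
 have s1': "s1 * (2 * s) = E1 * G + E * G1 - 2 * F * F1" unfolding s1 using s(1) by simp
 have cod': "s * s * (L2 - M1) = - ((M * G - N * F) * c111 + (N * E - M * F) * c112 - (L * G - M * F) * c121 - (M * E - L * F) * c122)"
 proof -
  have "s * s * (M1 - L2) = (M * G - N * F) * c111 + (N * E - M * F) * c112 - (L * G - M * F) * c121 - (M * E - L * F) * c122"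
   unfolding cod using s(1) by simp
  thus ?thesis by (simp add: algebra_simps)
 qed
 have "2 * E * (E * (s * s * (L2 - M1))) = - (2 * E * (E * (M * G * c111 - M * F * c112 - (L * G - M * F) * c121 - (M * E - L * F) * c122) + (N * E) * (- F * c111 + E * c112)))"
  unfolding cod' by (simp add: algebra_simps)
 also have "\<dots> = 2 * (E * G - F * F) * ((F1 * E - F * E1) * L + q * E1) - (E1 * G + E * G1 - 2 * F * F1) * q * E"
  unfolding NE q_def d1 by (simp add: algebra_simps)
 also have "\<dots> = 2 * (s * s) * ((F1 * E - F * E1) * L + q * E1) - s1 * (2 * s) * q * E" unfolding s1' s(2) ..
 finally have "2 * s * (s * (E * E * (L2 - M1))) = 2 * s * (s * ((F1 * E - F * E1) * L + q * E1) - s1 * q * E)" by (simp add: algebra_simps)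
 hence "s * (E * E * (L2 - M1)) = s * ((F1 * E - F * E1) * L + q * E1) - s1 * q * E" using s(1) by (simp only: mult_cancel_left) simp
 hence "(L2 - M1) * (s * (E * E)) = s * ((F1 * E - F * E1) * L + q * E1) - s1 * q * E" by (simp only: mult_ac)
 hence "L2 - M1 = (s * ((F1 * E - F * E1) * L + q * E1) - s1 * q * E) / (s * (E * E))"
  using s(1) E by (simp add: nonzero_eq_divide_eq)
 also have "\<dots> = (F1 * E - F * E1) / (E * E) * L - (s1 * E - s * E1) / (E * E) * (q / s)"
  using s(1) E by (simp add: divide_simps) (simp add: algebra_simps)
 finally show ?thesis unfolding q_def .
qed

text \<open>Here the second Codazzi equation enters too, and the derivative of the minimality
  condition, which rearranges the derivatives of II into the two Codazzi differences.\<close>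

lemma codazzi_imaginary_part:
 fixes E F G s L M N :: real
 assumes s: "s > 0" "s * s = E * G - F * F" and E: "E \<noteq> 0" and min: "L * G - 2 * M * F + N * E = 0"
  and dmin: "L1 * G + L * G1 - 2 * (M1 * F + M * F1) + N1 * E + N * E1 = 0"
  and d1: "E1 = 2 * c111" "F1 = c112 + c121" "G1 = 2 * c122" and d2: "E2 = 2 * c121" "F2 = c122 + c221" "G2 = 2 * c222"
  and s1: "s1 = (E1 * G + E * G1 - 2 * F * F1) / (2 * s)" and s2: "s2 = (E2 * G + E * G2 - 2 * F * F2) / (2 * s)"
  and cod1: "M1 - L2 = ((M * G - N * F) * c111 + (N * E - M * F) * c112 - (L * G - M * F) * c121 - (M * E - L * F) * c122) / (s * s)"
  and cod2: "N1 - M2 = ((M * G - N * F) * c121 + (N * E - M * F) * c122 - (L * G - M * F) * c221 - (M * E - L * F) * c222) / (s * s)"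
 shows "((F2 * L + F * L2 - E2 * M - E * M2) * s - (F * L - E * M) * s2) / (s * s)
   - ((G1 * L + G * L1 - F1 * M - F * M1) * s - (G * L - F * M) * s1) / (s * s)
   = (F1 * E - F * E1) / (E * E) * ((F * L - E * M) / s) + (s1 * E - s * E1) / (E * E) * L"
proof -
 have NE: "N * E = 2 * M * F - L * G" using min by simp
 have s1': "2 * s * s1 = E1 * G + E * G1 - 2 * F * F1" and s2': "2 * s * s2 = E2 * G + E * G2 - 2 * F * F2"
  unfolding s1 s2 using s(1) by simp_all
 define X Y where "X = (M * G - N * F) * c111 + (N * E - M * F) * c112 - (L * G - M * F) * c121 - (M * E - L * F) * c122"
  and "Y = (M * G - N * F) * c121 + (N * E - M * F) * c122 - (L * G - M * F) * c221 - (M * E - L * F) * c222"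
 have c1: "s * s * (M1 - L2) = X" and c2: "s * s * (N1 - M2) = Y" unfolding cod1 cod2 X_def Y_def using s(1) by simp_all
 have EX: "E * X = E * (M * G * c111 - M * F * c112 - (L * G - M * F) * c121 - (M * E - L * F) * c122) + (N * E) * (- F * c111 + E * c112)"
  and EY: "E * Y = E * (M * G * c121 - M * F * c122 - (L * G - M * F) * c221 - (M * E - L * F) * c222) + (N * E) * (- F * c121 + E * c122)"
  by (simp_all add: X_def Y_def algebra_simps)
 define D where "D = (F2 * L + F * L2 - E2 * M - E * M2) - (G1 * L + G * L1 - F1 * M - F * M1)"
 have "D = F2 * L - E2 * M - F1 * M + N * E1 - F * (M1 - L2) + E * (N1 - M2)
   - (L1 * G + L * G1 - 2 * (M1 * F + M * F1) + N1 * E + N * E1)" by (simp add: D_def algebra_simps)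
 hence D: "D = F2 * L - E2 * M - F1 * M + N * E1 - F * (M1 - L2) + E * (N1 - M2)" unfolding dmin by simp
 have "2 * (s * s) * (E * E) * D = 2 * (s * s) * (E * E) * (F2 * L - E2 * M - F1 * M) + 2 * (s * s) * E * (N * E) * E1
   - 2 * F * E * (E * (s * s * (M1 - L2))) + 2 * E * E * (E * (s * s * (N1 - M2)))"
  unfolding D by (simp add: algebra_simps)
 also have "\<dots> = (E * E) * ((E2 * G + E * G2 - 2 * F * F2) * (F * L - E * M) - (E1 * G + E * G1 - 2 * F * F1) * (G * L - F * M))
   + 2 * (E * G - F * F) * ((F1 * E - F * E1) * (F * L - E * M)) + ((E1 * G + E * G1 - 2 * F * F1) * E - 2 * (E * G - F * F) * E1) * L * (E * G - F * F)"
  unfolding c1 c2 EX EY NE unfolding s(2) d1 d2 by (simp add: algebra_simps)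
 also have "\<dots> = (E * E) * ((2 * s * s2) * (F * L - E * M) - (2 * s * s1) * (G * L - F * M))
   + 2 * (s * s) * ((F1 * E - F * E1) * (F * L - E * M)) + ((2 * s * s1) * E - 2 * (s * s) * E1) * L * (s * s)"
  unfolding s1' s2' s(2) ..
 finally have "2 * s * (s * (E * E) * D) = 2 * s * ((E * E) * (s2 * (F * L - E * M) - s1 * (G * L - F * M))
   + s * ((F1 * E - F * E1) * (F * L - E * M)) + (s1 * E - s * E1) * L * (s * s))" by (simp add: algebra_simps)
 hence key: "s * (E * E) * D = (E * E) * (s2 * (F * L - E * M) - s1 * (G * L - F * M))
   + s * ((F1 * E - F * E1) * (F * L - E * M)) + (s1 * E - s * E1) * L * (s * s)" using s(1) by (simp only: mult_cancel_left) simp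
 have "((F2 * L + F * L2 - E2 * M - E * M2) * s - (F * L - E * M) * s2) / (s * s)
   - ((G1 * L + G * L1 - F1 * M - F * M1) * s - (G * L - F * M) * s1) / (s * s)
  = (s * (E * E) * D - (E * E) * (s2 * (F * L - E * M) - s1 * (G * L - F * M))) / ((s * s) * (E * E))"
  using s(1) E unfolding D_def by (simp add: divide_simps) (simp add: algebra_simps)
 also have "\<dots> = (s * ((F1 * E - F * E1) * (F * L - E * M)) + (s1 * E - s * E1) * L * (s * s)) / ((s * s) * (E * E))" unfolding key by simp
 also have "\<dots> = (F1 * E - F * E1) / (E * E) * ((F * L - E * M) / s) + (s1 * E - s * E1) / (E * E) * L"
  using s(1) E by (simp add: divide_simps) (simp add: algebra_simps)
 finally show ?thesis .
qed

context immersion begin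

lemma Ck_snd_entry: "Ck_on k UNIV (\<lambda>z. snd G z$i$j)"
 unfolding second_derivative_normal[symmetric] by (intro Ck_on_bilinear[OF bounded_bilinear_mink] Ck open_UNIV)

lemma normal_derivative_tangent:
 "partial n i z = - (\<Sum>k\<in>UNIV. (\<Sum>m\<in>UNIV. snd G z$i$m * matrix_inv (fst G z)$m$k) *R partial f k z)"
proof -
 have row: "weingarten G i z$3 = vector [- (\<Sum>m\<in>UNIV. snd G z$i$m * matrix_inv (fst G z)$m$1),
   - (\<Sum>m\<in>UNIV. snd G z$i$m * matrix_inv (fst G z)$m$2), 0, 0]"
  unfolding weingarten_def matrix_mult_row[of "second_form G i z"] by (simp add: sum_4 sum_2 second_form_def block_def vec4_eq)
 have "partial (frame f n) i z$3 = partial n i z" unfolding partial_frame_nth frame_nth ..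
 from this[unfolded gauss_weingarten matrix_mult_row[of "weingarten G i z"] row, symmetric]
 show ?thesis by (simp add: sum_4 sum_2 scaleR_add_left scaleR_diff_left algebra_simps)
qed

lemma codazzi:
 "partial (\<lambda>w. snd G w$2$l) 1 z - partial (\<lambda>w. snd G w$1$l) 2 z =
  mink (partial n 1 z) (partial (partial f l) 2 z) - mink (partial n 2 z) (partial (partial f l) 1 z)"
proof -
 have dn: "partial n i differentiable (at z)" for i
  by (rule Ck_1_differentiable[OF Ck_on_partial[OF open_UNIV Ck(2)] UNIV_I])
 have e: "partial (\<lambda>w. snd G w$j$l) i z = - (mink (partial n j z) (partial (partial f l) i z) + mink (partial (partial n j) i z) (partial f l z))" for i j
 proof -
  have "(\<lambda>w. snd G w$j$l) = (\<lambda>w. - mink (partial n j w) (partial f l w))" by (simp add: second_fundamental)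
  thus ?thesis
   using partial_minus[OF differentiable_bilinear[OF bounded_bilinear_mink dn diff(3)]] by (simp add: partial_mink[OF dn diff(3)])
 qed
 have "partial (partial n 2) 1 z = partial (partial n 1) 2 z" by (rule partial_partial_commute[OF open_UNIV UNIV_I Ck(2)])
 thus ?thesis unfolding e by simp
qed

lemma mink_normal_derivative:
 "mink (partial n i z) (partial (partial f l) j z) = - (\<Sum>k\<in>UNIV. (\<Sum>m\<in>UNIV. snd G z$i$m * matrix_inv (fst G z)$m$k) * christoffel_lower (fst G) j l k z)"
 unfolding normal_derivative_tangent by (simp add: sum_2 mink_add_left mink_scaleR_left bounded_bilinear.minus_left[OF bounded_bilinear_mink]
   bounded_bilinear.diff_left[OF bounded_bilinear_mink] mink_commute[of "partial f _ z" "partial (partial f _) _ z"] second_derivative_tangent)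

end

section \<open>The holomorphic quadratic differential and the canonical form\<close>

locale minimal_immersion = immersion f n G for f n G +
 assumes minimal: "\<And>z. snd G z$1$1 * fst G z$2$2 - 2 * snd G z$1$2 * fst G z$1$2 + snd G z$2$2 * fst G z$1$1 = 0"
  and pos: "\<And>z. fst G z$1$1 > 0"
begin

abbreviation E where "E z \<equiv> fst G z$1$1"
abbreviation F where "F z \<equiv> fst G z$1$2"
abbreviation G' where "G' z \<equiv> fst G z$2$2"
abbreviation L where "L z \<equiv> snd G z$1$1"
abbreviation M where "M z \<equiv> snd G z$1$2"
abbreviation N where "N z \<equiv> snd G z$2$2"

definition s where "s z = sqrt (det (fst G z))"

lemma s: "s z > 0" "s z * s z = E z * G' z - F z * F z"
 using det_first_pos[of z] by (simp_all add: s_def) (simp add: det_2 fst_sym[of z 2 1])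

lemma entry_differentiable: "(\<lambda>z. fst G z$i$j) differentiable (at z)" "(\<lambda>z. snd G z$i$j) differentiable (at z)"
proof -
 have "Ck_on 1 UNIV (\<lambda>z. fst G z$i$j)"
  unfolding first_form[symmetric] by (intro Ck_on_bilinear[OF bounded_bilinear_mink] Ck open_UNIV)
 thus "(\<lambda>z. fst G z$i$j) differentiable (at z)" by (rule Ck_1_differentiable) simp
 show "(\<lambda>z. snd G z$i$j) differentiable (at z)" by (rule Ck_1_differentiable[OF Ck_snd_entry UNIV_I])
qed

lemma partial_s: "partial s i z = (partial E i z * G' z + E z * partial G' i z - 2 * F z * partial F i z) / (2 * s z)"
 and s_differentiable: "s differentiable (at z)"
proof -
 note dg = entry_differentiable(1)
 have e: "(\<lambda>w. det (fst G w)) = (\<lambda>w. E w * G' w - F w * F w)" by (simp add: det_2 fst_sym[of _ 2 1])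
 have ddet: "(\<lambda>w. det (fst G w)) differentiable (at z)" unfolding e by (intro differentiable_diff differentiable_mult dg)
 have "partial (\<lambda>w. det (fst G w)) i z = partial E i z * G' z + E z * partial G' i z - 2 * F z * partial F i z"
  unfolding e by (simp add: partial_diff[OF differentiable_mult[OF dg dg] differentiable_mult[OF dg dg]] partial_mult[OF dg dg])
 thus "partial s i z = (partial E i z * G' z + E z * partial G' i z - 2 * F z * partial F i z) / (2 * s z)"
  unfolding s_def[abs_def] partial_sqrt(1)[OF ddet det_first_pos(1)] by simp
 show "s differentiable (at z)" unfolding s_def[abs_def] by (rule partial_sqrt(2)[OF ddet det_first_pos(1)])
qed

text \<open>The form dx + m dy is of type (1,0) for the conformal structure, with m = (F + i s)/E in
  coordinates that need not be conformal, and P (dx + m dy)^2 is the quadratic differential with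
  real part II.\<close>

definition P :: "real^2 => complex" where "P z = Complex (L z) ((F z * L z - E z * M z) / s z)"
definition m :: "real^2 => complex" where "m z = Complex (F z / E z) (s z / E z)"

lemma m_P: "m z * P z = Complex (M z) ((G' z * L z - F z * M z) / s z)"
proof -
 have "F z / E z * L z - s z / E z * ((F z * L z - E z * M z) / s z) = M z"
  using pos[of z] s(1)[of z] by (simp add: field_simps)
 moreover have "F z / E z * ((F z * L z - E z * M z) / s z) + s z / E z * L z = (G' z * L z - F z * M z) / s z"
 proof -
  have "F z / E z * ((F z * L z - E z * M z) / s z) + s z / E z * L z = (F z * (F z * L z - E z * M z) + (s z * s z) * L z) / (E z * s z)"
   using pos[of z] s(1)[of z] by (simp add: field_simps)
  also have "\<dots> = (E z * (G' z * L z - F z * M z)) / (E z * s z)" unfolding s(2) by (simp add: algebra_simps)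
  also have "\<dots> = (G' z * L z - F z * M z) / s z" using pos[of z] by simp
  finally show ?thesis .
 qed
 ultimately show ?thesis by (simp add: P_def m_def complex_eq_iff)
qed

lemma partial_Complex:
 fixes a b :: "real^2 => real"
 assumes "a differentiable (at z)" "b differentiable (at z)"
 shows "partial (\<lambda>z. Complex (a z) (b z)) i z = Complex (partial a i z) (partial b i z)"
  and "(\<lambda>z. Complex (a z) (b z)) differentiable (at z)"
proof -
 have "((\<lambda>z. complex_of_real (a z) + \<i> * complex_of_real (b z)) has_derivative
   (\<lambda>h. complex_of_real (FD a z h) + \<i> * complex_of_real (FD b z h))) (at z)"
  by (intro has_derivative_add has_derivative_mult_right bounded_linear.has_derivative[OF bounded_linear_of_real] frechet_works assms)
 hence d: "((\<lambda>z. Complex (a z) (b z)) has_derivative (\<lambda>h. Complex (FD a z h) (FD b z h))) (at z)"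
  unfolding Complex_eq .
 thus "(\<lambda>z. Complex (a z) (b z)) differentiable (at z)" unfolding differentiable_def by blast
 show "partial (\<lambda>z. Complex (a z) (b z)) i z = Complex (partial a i z) (partial b i z)"
  unfolding partial_eqI[OF d] by (simp add: partial_def)
qed

lemma P_m_differentiable: "P differentiable (at z)" "m differentiable (at z)"
proof -
 note de = entry_differentiable[of _ _ z]
 have nz: "s z \<noteq> 0" "E z \<noteq> 0" using s(1)[of z] pos[of z] by auto
 show "P differentiable (at z)" unfolding P_def[abs_def]
  by (intro partial_Complex(2) de partial_divide(2) differentiable_diff differentiable_mult s_differentiable nz)
 show "m differentiable (at z)" unfolding m_def[abs_def]
  by (intro partial_Complex(2) de partial_divide(2) s_differentiable nz)
qed

text \<open>Holomorphy of P (dx + m dy)^2 written without a conformal coordinate. The real and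
  imaginary parts are the Codazzi equations combined with minimality.\<close>

lemma cauchy_riemann: "partial P 2 z = m z * partial P 1 z + 2 * partial m 1 z * P z"
proof -
 define c where "c = (\<lambda>i j l. christoffel_lower (fst G) i j l z)"
 note de = entry_differentiable[of _ _ z]
 have nz: "s z \<noteq> 0" "E z \<noteq> 0" using s(1)[of z] pos[of z] by auto
 have cc: "c 2 1 l = c 1 2 l" for l unfolding c_def by (rule christoffel_lower_commute)
 have dg: "partial (\<lambda>w. fst G w$a$b) k z = c k a b + c k b a" for a b k unfolding c_def by (rule partial_first_form)
 have d1: "partial E 1 z = 2 * c 1 1 1" "partial F 1 z = c 1 1 2 + c 1 2 1" "partial G' 1 z = 2 * c 1 2 2"
  and d2: "partial E 2 z = 2 * c 1 2 1" "partial F 2 z = c 1 2 2 + c 2 2 1" "partial G' 2 z = 2 * c 2 2 2"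
  by (simp_all add: dg cc)
 have det: "det (fst G z) = s z * s z" using det_first_pos[of z] by (simp add: s_def)
 have cod: "partial (\<lambda>w. snd G w$2$l) 1 z - partial (\<lambda>w. snd G w$1$l) 2 z =
  ((M z * G' z - N z * F z) * c 1 l 1 + (N z * E z - M z * F z) * c 1 l 2 - (L z * G' z - M z * F z) * c 2 l 1 - (M z * E z - L z * F z) * c 2 l 2) / (s z * s z)" for l
  unfolding codazzi mink_normal_derivative matrix_inv_2x2[OF det_first_pos(2)] det
  by (simp add: sum_2 fst_sym[of z 2 1] snd_sym[of z 2 1] c_def add_divide_distrib diff_divide_distrib algebra_simps)
 have ND: "(\<lambda>w. snd G w$2$1) = M" by (simp add: snd_sym)
 note cod1 = cod[of 1, unfolded ND cc] and cod2 = cod[of 2, unfolded cc]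
 have "partial (\<lambda>w. L w * G' w - 2 * (M w * F w) + N w * E w) 1 z = partial (\<lambda>w. 0 :: real) 1 z"
  using minimal by (simp add: mult.assoc)
 hence dmin: "partial L 1 z * G' z + L z * partial G' 1 z - 2 * (partial M 1 z * F z + M z * partial F 1 z) + partial N 1 z * E z + N z * partial E 1 z = 0"
  unfolding partial_add[OF differentiable_diff[OF differentiable_mult[OF de(2) de(1)] differentiable_mult[OF differentiable_const differentiable_mult[OF de(2) de(1)]]] differentiable_mult[OF de(2) de(1)]]
    partial_diff[OF differentiable_mult[OF de(2) de(1)] differentiable_mult[OF differentiable_const differentiable_mult[OF de(2) de(1)]]]
    partial_mult[OF differentiable_const differentiable_mult[OF de(2) de(1)]] partial_mult[OF de(2) de(1)] partial_const by (simp add: algebra_simps)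
 define T V where "T = (\<lambda>z. (F z * L z - E z * M z) / s z)" and "V = (\<lambda>z. (G' z * L z - F z * M z) / s z)"
 have dT: "T differentiable (at z)" "V differentiable (at z)"
  unfolding T_def V_def by (intro partial_divide(2) differentiable_diff differentiable_mult de s_differentiable nz)+
 have pq: "partial (\<lambda>z. (fst G z$a$b * snd G z$c$d - fst G z$a'$b' * snd G z$c'$d') / s z) i z =
   ((partial (\<lambda>z. fst G z$a$b) i z * snd G z$c$d + fst G z$a$b * partial (\<lambda>z. snd G z$c$d) i z
   - partial (\<lambda>z. fst G z$a'$b') i z * snd G z$c'$d' - fst G z$a'$b' * partial (\<lambda>z. snd G z$c'$d') i z) * s z
   - (fst G z$a$b * snd G z$c$d - fst G z$a'$b' * snd G z$c'$d') * partial s i z) / (s z * s z)" for a b c d a' b' c' d' i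
  unfolding partial_divide(1)[OF differentiable_diff[OF differentiable_mult[OF de(1) de(2)] differentiable_mult[OF de(1) de(2)]] s_differentiable nz(1)]
   partial_diff[OF differentiable_mult[OF de(1) de(2)] differentiable_mult[OF de(1) de(2)]] partial_mult[OF de(1) de(2)] by (simp add: algebra_simps)
 have pm: "partial m 1 z = Complex ((partial F 1 z * E z - F z * partial E 1 z) / (E z * E z)) ((partial s 1 z * E z - s z * partial E 1 z) / (E z * E z))"
  unfolding m_def[abs_def]
  by (simp only: partial_Complex(1)[OF partial_divide(2)[OF de(1) de(1) nz(2)] partial_divide(2)[OF s_differentiable de(1) nz(2)]]
   partial_divide(1)[OF de(1) de(1) nz(2)] partial_divide(1)[OF s_differentiable de(1) nz(2)])
 have pP: "partial P 2 z = Complex (partial L 2 z) (partial T 2 z)"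
  unfolding P_def[abs_def] T_def[symmetric] fun_cong[OF T_def, symmetric] by (rule partial_Complex(1)[OF de(2) dT(1)])
 have "partial (\<lambda>z. m z * P z) 1 z = Complex (partial M 1 z) (partial V 1 z)"
  unfolding m_P fun_cong[OF V_def, symmetric] by (rule partial_Complex(1)[OF de(2) dT(2)])
 hence mP: "m z * partial P 1 z + partial m 1 z * P z = Complex (partial M 1 z) (partial V 1 z)"
  unfolding partial_mult[OF P_m_differentiable(2,1)] .
 have re: "partial L 2 z - partial M 1 z = Re (partial m 1 z * P z)"
  unfolding pm P_def times_complex.sel complex.sel
  by (rule codazzi_real_part[OF s nz(2) minimal d1 partial_s cod1])
 have im: "partial T 2 z - partial V 1 z = Im (partial m 1 z * P z)"
  unfolding pm P_def times_complex.sel complex.sel T_def V_def pq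
  by (rule codazzi_imaginary_part[OF s nz(2) minimal dmin d1 d2 partial_s partial_s cod1 cod2])
 have "partial P 2 z = (m z * partial P 1 z + partial m 1 z * P z) + partial m 1 z * P z"
  unfolding mP pP using re im by (simp add: complex_eq_iff)
 thus ?thesis by simp
qed

end

locale invariant_minimal_immersion = surface_cover S A p + minimal_immersion f n G
 for S :: "'a::t2_space set" and A p f n G +
 assumes inv_fst: "\<And>\<gamma>. \<gamma> \<in> deck p ==> pullback \<gamma> (fst G) = fst G"
  and inv_snd: "\<And>\<gamma>. \<gamma> \<in> deck p ==> pullback \<gamma> (snd G) = snd G"
begin

abbreviation J :: tensor where "J \<equiv> complex_structure (fst G)"

definition \<phi> :: quadratic_form where
 "\<phi> z a b = P z * (complex_of_real (a$1) + m z * complex_of_real (a$2)) * (complex_of_real (b$1) + m z * complex_of_real (b$2))"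

lemma J_mult: "(J z *v a)$1 = - (F z * a$1 + G' z * a$2) / s z" "(J z *v a)$2 = (E z * a$1 + F z * a$2) / s z"
 unfolding s_def
 by (simp_all add: matrix_vector_mult_def sum_2 complex_structure_nth fst_sym[of z 2 1] add_divide_distrib diff_divide_distrib)

lemma J_m: "complex_of_real ((J z *v a)$1) + m z * complex_of_real ((J z *v a)$2) = \<i> * (complex_of_real (a$1) + m z * complex_of_real (a$2))"
proof -
 have nz: "s z \<noteq> 0" "E z \<noteq> 0" using s(1)[of z] pos[of z] by auto
 have "- (F z * x + G' z * y) / s z + F z / E z * ((E z * x + F z * y) / s z) = - (s z / E z * y)" for x y
 proof -
  have "- (F z * x + G' z * y) / s z + F z / E z * ((E z * x + F z * y) / s z) = - ((E z * G' z - F z * F z) * y) / (E z * s z)"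
   using nz by (simp add: divide_simps) (simp add: algebra_simps)
  also have "\<dots> = - (s z / E z * y)" unfolding s(2)[symmetric] using nz by simp
  finally show ?thesis .
 qed
 moreover have "s z / E z * ((E z * x + F z * y) / s z) = x + F z / E z * y" for x y
  using nz by (simp add: field_simps)
 ultimately show ?thesis unfolding J_mult by (simp add: complex_eq_iff m_def)
qed

lemma Re_\<phi>: "Re (\<phi> z a b) = a \<bullet> (snd G z *v b)"
proof -
 have nz: "s z \<noteq> 0" "E z \<noteq> 0" using s(1)[of z] pos[of z] by auto
 have min: "N z * E z = 2 * M z * F z - L z * G' z" using minimal[of z] by simp
 have mmP: "Re (m z * (m z * P z)) = N z"
 proof -
  have "Re (m z * (m z * P z)) = F z / E z * M z - s z / E z * ((G' z * L z - F z * M z) / s z)"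
   unfolding m_P by (simp add: m_def)
  also have "\<dots> = (F z * M z - (G' z * L z - F z * M z)) / E z" using nz by (simp add: field_simps)
  also have "F z * M z - (G' z * L z - F z * M z) = N z * E z" unfolding min by (simp add: algebra_simps)
  finally show ?thesis using nz by simp
 qed
 have "\<phi> z a b = P z * complex_of_real (a$1 * b$1) + m z * P z * complex_of_real (a$1 * b$2 + a$2 * b$1)
   + m z * (m z * P z) * complex_of_real (a$2 * b$2)"
  by (simp add: \<phi>_def algebra_simps)
 hence "Re (\<phi> z a b) = L z * (a$1 * b$1) + M z * (a$1 * b$2 + a$2 * b$1) + N z * (a$2 * b$2)"
  using mmP by (simp add: m_P) (simp add: P_def)
 thus ?thesis by (simp add: inner_vec_def matrix_vector_mult_def sum_2 snd_sym[of z 2 1] algebra_simps)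
qed

lemma \<phi>_J: "\<phi> z (J z *v a) b = \<i> * \<phi> z a b"
 unfolding \<phi>_def J_m by simp

lemma \<phi>_commute: "\<phi> z a b = \<phi> z b a"
 by (simp add: \<phi>_def mult_ac)

lemma Im_\<phi>: "Im (\<phi> z a b) = - ((J z *v a) \<bullet> (snd G z *v b))"
 unfolding Re_\<phi>[symmetric] \<phi>_J by simp

text \<open>A form that is J-complex in its first argument is determined by its real part: the
  imaginary part at \<open>a\<close> is minus the real part at \<open>J z *v a\<close>.\<close>

lemma \<phi>_unique:
 assumes "\<And>a b. q z (J z *v a) b = \<i> * q z a b" "\<And>a b. Re (q z a b) = a \<bullet> (snd G z *v b)"
 shows "q z a b = \<phi> z a b"
proof -
 have "Im (q z a b) = - Re (q z (J z *v a) b)" unfolding assms(1) by simp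
 thus ?thesis unfolding assms(2) by (simp add: complex_eq_iff Re_\<phi> Im_\<phi> assms(2))
qed

lemma J_equivariant: "g \<in> deck p ==> J (g z) ** jacobian g (at z) = jacobian g (at z) ** J z"
 by (rule complex_structure_pullback[OF _ deck_det]) (simp_all add: inv_fst)

lemma \<phi>_equivariant:
 assumes g: "g \<in> deck p"
 shows "\<phi> (g z) (jacobian g (at z) *v a) (jacobian g (at z) *v b) = \<phi> z a b"
proof -
 let ?D = "jacobian g (at z)"
 have B: "(?D *v x) \<bullet> (snd G (g z) *v (?D *v y)) = x \<bullet> (snd G z *v y)" for x y
 proof -
  have "x \<bullet> (pullback g (snd G) z *v y) = x \<bullet> (transpose ?D *v (snd G (g z) *v (?D *v y)))"
   by (simp add: pullback_def matrix_vector_mul_assoc matrix_mul_assoc)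
  also have "\<dots> = (?D *v x) \<bullet> (snd G (g z) *v (?D *v y))"
   by (metis transpose_matrix_vector dot_lmul_matrix inner_commute)
  finally show ?thesis by (simp add: inv_snd[OF g])
 qed
 have "J (g z) *v (?D *v a) = ?D *v (J z *v a)"
  using J_equivariant[OF g, of z] by (simp add: matrix_vector_mul_assoc)
 thus ?thesis by (simp add: complex_eq_iff Re_\<phi> Im_\<phi> B)
qed

text \<open>In a chart, dw = \<omega> (dx + m dy), and the candidate coefficient is P over the
  square of \<omega>. Closedness of dw gives an equation for \<omega> that turns
  \<open>cauchy_riemann\<close> into proportionality of the differential of the coefficient to dw,
  that is, into complex differentiability.\<close>

lemma \<phi>_chart:
 assumes w: "holomorphic_chart J W w"
 shows "\<exists>q. q holomorphic_on (w ` W) \<and>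
    (\<forall>z\<in>W. \<forall>a b. \<phi> z a b = q (w z) * FD w z a * FD w z b)"
proof -
 have W: "open W" "smooth_on W w" "inj_on w W" "\<And>z. z \<in> W ==> inj (FD w z)"
  "\<And>z v. z \<in> W ==> FD w z (J z *v v) = \<i> * FD w z v"
  using w unfolding holomorphic_chart_def by blast+
 have dw: "w differentiable (at z)" if "z \<in> W" for z by (rule smooth_on_differentiable[OF W(2) that])
 define \<omega> where "\<omega> = partial w 1"
 have w2: "partial w 2 z = m z * \<omega> z" if z: "z \<in> W" for z
 proof -
  have nz: "s z \<noteq> 0" "E z \<noteq> 0" using s(1)[of z] pos[of z] by auto
  have "(- F z / s z) *R \<omega> z + (E z / s z) *R partial w 2 z = \<i> * \<omega> z"
   using W(5)[OF z, of "axis 1 1"] unfolding frechet_partial[OF dw[OF z]] J_mult by (simp add: \<omega>_def axis_def)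
  hence "complex_of_real (E z) * partial w 2 z = (complex_of_real (F z) + \<i> * complex_of_real (s z)) * \<omega> z"
   using nz by (simp add: scaleR_conv_of_real field_simps)
  note A = this
  have "m z = (complex_of_real (F z) + \<i> * complex_of_real (s z)) / complex_of_real (E z)"
   by (simp add: m_def complex_eq_iff Re_divide_of_real Im_divide_of_real)
  hence "m z * \<omega> z = (complex_of_real (E z) * partial w 2 z) / complex_of_real (E z)" unfolding A by simp
  thus ?thesis using nz by simp
 qed
 have dwa: "FD w z a = \<omega> z * (complex_of_real (a$1) + m z * complex_of_real (a$2))" if z: "z \<in> W" for z a
  unfolding frechet_partial[OF dw[OF z]] w2[OF z] by (simp add: \<omega>_def scaleR_conv_of_real algebra_simps)
 have \<omega>0: "\<omega> z \<noteq> 0" if z: "z \<in> W" for z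
 proof
  assume "\<omega> z = 0"
  hence "FD w z (axis 1 1) = FD w z 0" unfolding dwa[OF z] by simp
  hence "axis 1 (1::real) = (0 :: real^2)" using W(4)[OF z] by (rule injD[rotated])
  thus False by (simp add: axis_eq_0_iff)
 qed
 have d\<omega>: "\<omega> differentiable (at z)" if z: "z \<in> W" for z
  unfolding \<omega>_def by (rule Ck_1_differentiable[OF Ck_on_partial[OF W(1) smooth_onD[OF W(2)]] z])
 define Q where "Q = (\<lambda>z. P z / (\<omega> z * \<omega> z))"
 have dQ: "Q differentiable (at z)" if z: "z \<in> W" for z
  unfolding Q_def by (intro differentiable_divide differentiable_mult P_m_differentiable d\<omega>[OF z]) (simp add: \<omega>0[OF z])
 have CR: "partial Q 2 z = m z * partial Q 1 z" if z: "z \<in> W" for z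
 proof -
  have QP: "partial P i z = Q z * (2 * \<omega> z * partial \<omega> i z) + partial Q i z * (\<omega> z * \<omega> z)" for i
  proof -
   have "partial P i z = partial (\<lambda>z. Q z * (\<omega> z * \<omega> z)) i z"
    by (rule partial_cong[OF W(1) z]) (simp add: Q_def \<omega>0)
   thus ?thesis
    unfolding partial_mult[OF dQ[OF z] differentiable_mult[OF d\<omega>[OF z] d\<omega>[OF z]]] partial_mult[OF d\<omega>[OF z] d\<omega>[OF z]] by (simp add: algebra_simps)
  qed
  have "partial \<omega> 2 z = partial (partial w 2) 1 z"
   unfolding \<omega>_def by (rule partial_partial_commute[OF W(1) z smooth_onD[OF W(2)]])
  also have "\<dots> = partial (\<lambda>z. m z * \<omega> z) 1 z" by (rule partial_cong[OF W(1) z w2])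
  finally have \<omega>2: "partial \<omega> 2 z = m z * partial \<omega> 1 z + partial m 1 z * \<omega> z"
   unfolding partial_mult[OF P_m_differentiable(2) d\<omega>[OF z]] .
  have "\<omega> z * \<omega> z * (partial Q 2 z - m z * partial Q 1 z) = (partial P 2 z - m z * partial P 1 z) - Q z * (2 * \<omega> z) * (partial \<omega> 2 z - m z * partial \<omega> 1 z)"
   unfolding QP by (simp add: algebra_simps)
  also have "\<dots> = 2 * partial m 1 z * (P z - Q z * (\<omega> z * \<omega> z))" unfolding cauchy_riemann \<omega>2 by (simp add: algebra_simps)
  also have "\<dots> = 0" by (simp add: Q_def \<omega>0[OF z])
  finally show ?thesis using \<omega>0[OF z] by simp
 qed
 have cw: "continuous_on W w" by (intro continuous_at_imp_continuous_on ballI differentiable_imp_continuous_within dw)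
 obtain g where g: "homeomorphism W (w ` W) w g"
  using invariance_of_domain_homeomorphism[OF W(1) cw _ W(3)] by auto
 have ow: "open (w ` W)" by (rule invariance_of_domain_gen[OF W(1) cw W(3)]) simp
 have gw: "g (w z) = z" if "z \<in> W" for z using g that by (auto simp: homeomorphism_def)
 have wg: "w (g y) = y" if "y \<in> w ` W" for y using g that by (auto simp: homeomorphism_def)
 have cg: "continuous_on (w ` W) g" using g by (auto simp: homeomorphism_def)
 define q where "q = (\<lambda>y. Q (g y))"
 have "q field_differentiable (at (w z))" if z: "z \<in> W" for z
 proof -
  have wz: "w z \<in> w ` W" using z by blast
  have c: "isCont g (w z)" using cg wz unfolding continuous_on_eq_continuous_at[OF ow] by blast
  have ev: "\<forall>\<^sub>F y in nhds (w z). w (g y) = y" unfolding eventually_nhds using ow wz wg by blast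
  have dg: "(w has_derivative FD w z) (at (g (w z)))" unfolding gw[OF z] by (rule frechet_works[OF dw[OF z]])
  obtain g' where g': "(g has_derivative g') (at (w z))" "\<And>v. FD w z (g' v) = v"
   using has_derivative_implicit[OF c dg W(4)[OF z] ev has_derivative_ident] by blast
  have "(q has_derivative (\<lambda>v. FD Q z (g' v))) (at (w z))"
   unfolding q_def using has_derivative_compose[OF g'(1)] frechet_works[OF dQ[OF z]] gw[OF z] by simp
  moreover have "(\<lambda>v. FD Q z (g' v)) = (*) (partial Q 1 z / \<omega> z)"
  proof
   fix v
   have "FD Q z (g' v) = partial Q 1 z * (complex_of_real (g' v$1) + m z * complex_of_real (g' v$2))"
    unfolding frechet_partial[OF dQ[OF z]] CR[OF z] by (simp add: scaleR_conv_of_real algebra_simps)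
   moreover have "v = \<omega> z * (complex_of_real (g' v$1) + m z * complex_of_real (g' v$2))" using g'(2)[of v] dwa[OF z] by simp
   ultimately show "FD Q z (g' v) = partial Q 1 z / \<omega> z * v" using \<omega>0[OF z] by (metis nonzero_mult_div_cancel_left times_divide_eq_left mult.assoc times_divide_eq_right)
  qed
  ultimately have "(q has_field_derivative (partial Q 1 z / \<omega> z)) (at (w z))" unfolding has_field_derivative_def by (simp only:)
  thus ?thesis unfolding field_differentiable_def by blast
 qed
 hence "q holomorphic_on (w ` W)" unfolding holomorphic_on_def using field_differentiable_at_within by blast
 moreover have "\<phi> z a b = q (w z) * FD w z a * FD w z b" if z: "z \<in> W" for z a b
  unfolding dwa[OF z] q_def gw[OF z] Q_def \<phi>_def using \<omega>0[OF z] by simp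
 ultimately show ?thesis by blast
qed

lemma Psi_eq: "Psi p G = (J, \<phi>)"
proof -
 have bil: "bilinear (\<phi> z)" for z
  unfolding bilinear_def \<phi>_def by (intro conjI allI linearI) (simp_all add: algebra_simps scaleR_conv_of_real[where 'a=complex])
 have mem: "\<phi> \<in> quadratic_differentials p J"
  unfolding quadratic_differentials_def using bil \<phi>_commute \<phi>_J \<phi>_equivariant \<phi>_chart by blast
 have "(THE q. q \<in> quadratic_differentials p J \<and> (\<forall>z a b. Re (q z a b) = a \<bullet> (snd G z *v b))) = \<phi>"
 proof (rule the_equality)
  show "\<phi> \<in> quadratic_differentials p J \<and> (\<forall>z a b. Re (\<phi> z a b) = a \<bullet> (snd G z *v b))" using mem Re_\<phi> by blast
  fix q assume q: "q \<in> quadratic_differentials p J \<and> (\<forall>z a b. Re (q z a b) = a \<bullet> (snd G z *v b))"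
  show "q = \<phi>"
  proof (intro ext)
   fix z a b
   have "\<And>a b. q z (J z *v a) b = \<i> * q z a b" "\<And>a b. Re (q z a b) = a \<bullet> (snd G z *v b)"
    using q[THEN conjunct1, unfolded quadratic_differentials_def mem_Collect_eq, THEN conjunct1] q[THEN conjunct2] by blast+
   thus "q z a b = \<phi> z a b" by (rule \<phi>_unique)
  qed
 qed
 thus ?thesis unfolding Psi_def Let_def by simp
qed

end

text \<open>The weight \<open>b\<close> reduces the integral to a fixed box, where the Leibniz rule
  applies to the full parameter derivative as a bounded linear map.\<close>

lemma integral_parameter_partial:
 fixes H :: "(real^2) \<times> (real^2) => complex" and b :: "real^2 => real"
 assumes U: "open U" "u \<in> U" and H: "Ck_on 1 (U \<times> UNIV) H"
  and b: "continuous_on UNIV b" "\<And>z. norm z > r ==> b z = 0"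
 shows "partial (\<lambda>v. integral UNIV (\<lambda>z. b z *R H (v, z))) k u = integral UNIV (\<lambda>z. b z *R partial (\<lambda>v. H (v, z)) k u)"
proof -
 obtain d where d: "d > 0" "ball u d \<subseteq> U" using U open_contains_ball by blast
 let ?V = "ball u d"
 obtain a :: "real^2" where a: "cball 0 r \<subseteq> cbox (- a) a" using bounded_subset_cbox_symmetric[OF bounded_cball] by blast
 let ?K = "cbox (- a) a"
 have K: "integral UNIV (\<lambda>z. b z *R g z) = integral ?K (\<lambda>z. b z *R g z)" for g :: "real^2 => complex"
 proof -
  have "b z = 0" if "z \<notin> ?K" for z using that a b(2)[of z] by (meson linorder_not_le mem_cball_0 subset_iff)
  hence "(\<lambda>z. b z *R g z) = (\<lambda>z. if z \<in> ?K then b z *R g z else 0)" by auto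
  thus ?thesis using integral_restrict_UNIV[of ?K "\<lambda>z. b z *R g z"] by simp
 qed
 define D where "D = (\<lambda>v z h. b z *R FD H (v, z) (h, 0))"
 have H': "Ck_on (Suc 0) (U \<times> UNIV) H" using H by (simp only: One_nat_def)
 have diff: "H differentiable (at (v, z))" if "v \<in> ?V" for v z
  using H' that d(2) unfolding Ck_on.simps(2) by blast
 have der: "((\<lambda>v. b z *R H (v, z)) has_derivative D v z) (at v)" if "v \<in> ?V" for v z
 proof -
  have "((\<lambda>v. (v, z)) has_derivative (\<lambda>h. (h, 0))) (at v)" by (intro has_derivative_Pair has_derivative_ident has_derivative_const)
  from has_derivative_compose[OF this frechet_works[OF diff[OF that, of z]]] show ?thesis unfolding D_def by (rule has_derivative_scaleR_right)
 qed
 have B: "blinfun_apply (Blinfun (D v z)) = D v z" if "v \<in> ?V" for v z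
  by (rule bounded_linear_Blinfun_apply[OF has_derivative_bounded_linear[OF der[OF that]]])
 have c\<Phi>: "continuous_on (U \<times> UNIV) H" by (rule Ck_on_imp_continuous[OF H])
 have cB: "continuous_on (?V \<times> ?K) (\<lambda>(v, z). Blinfun (D v z))"
 proof (rule continuous_on_blinfun_componentwise)
  fix i :: "real^2" assume "i \<in> Basis"
  hence "continuous_on (U \<times> UNIV) (\<lambda>q. FD H q (i, 0))"
   using H' unfolding Ck_on.simps by (auto simp: Basis_prod_def)
  hence "continuous_on (?V \<times> ?K) (\<lambda>q. b (snd q) *R FD H q (i, 0))"
   using d(2) by (intro continuous_on_scaleR continuous_on_compose2[OF b(1)] continuous_intros) (auto elim: continuous_on_subset)
  thus "continuous_on (?V \<times> ?K) (\<lambda>q. blinfun_apply (case q of (v, z) => Blinfun (D v z)) i)"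
   by (rule continuous_on_eq) (auto simp: B, simp add: D_def)
 qed
 have int: "(\<lambda>z. Blinfun (D u z)) integrable_on ?K"
  by (rule integrable_continuous) (rule continuous_on_compose2[OF cB, of _ "\<lambda>z. (u, z)", simplified]; use d(1) in \<open>auto intro!: continuous_intros\<close>)
 have "((\<lambda>v. integral ?K (\<lambda>z. b z *R H (v, z))) has_derivative integral ?K (\<lambda>z. Blinfun (D u z))) (at u within ?V)"
 proof (rule leibniz_rule[OF _ _ cB])
  fix v z assume v: "v \<in> ?V"
  show "((\<lambda>v. b z *R H (v, z)) has_derivative blinfun_apply (Blinfun (D v z))) (at v within ?V)"
   unfolding B[OF v] by (rule has_derivative_at_withinI[OF der[OF v]])
  show "(\<lambda>z. b z *R H (v, z)) integrable_on ?K"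
   using v d(2) by (intro integrable_continuous continuous_on_scaleR continuous_on_compose2[OF c\<Phi>] continuous_on_subset[OF b(1)] continuous_intros) auto
 qed (use d(1) in auto)
 hence "((\<lambda>v. integral UNIV (\<lambda>z. b z *R H (v, z))) has_derivative integral ?K (\<lambda>z. Blinfun (D u z))) (at u)"
  unfolding K using d(1) by (simp add: at_within_open[of u ?V])
 hence "partial (\<lambda>v. integral UNIV (\<lambda>z. b z *R H (v, z))) k u = blinfun_apply (integral ?K (\<lambda>z. Blinfun (D u z))) (axis k 1)"
  by (rule partial_eqI)
 also have "blinfun_apply (integral ?K (\<lambda>z. Blinfun (D u z))) (axis k 1) = integral ?K (\<lambda>z. D u z (axis k 1))"
  using d(1) by (simp add: blinfun_apply_integral[OF int] B)
 also have "\<dots> = integral UNIV (\<lambda>z. b z *R partial (\<lambda>v. H (v, z)) k u)"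
  unfolding K D_def using partial_param(2)[OF diff] d(1) by simp
 finally show ?thesis .
qed

lemma minimal_germ:
 assumes "G \<in> minimal_hyperbolic_germs p"
 shows "g \<in> deck p ==> pullback g (fst G) = fst G" "g \<in> deck p ==> pullback g (snd G) = snd G"
  and "fst G z$1$1 > 0" "det (fst G z) > 0"
  and "snd G z$1$1 * fst G z$2$2 - 2 * snd G z$1$2 * fst G z$1$2 + snd G z$2$2 * fst G z$1$1 = 0"
proof -
 obtain I II where G: "G = (I, II)" by (cases G)
 have a: "riemannian_metric p I" "symmetric_form_on_surface p II" "\<And>z. trace (shape_operator (I, II) z) = 0"
  using assms unfolding G minimal_hyperbolic_germs_def by (auto simp: Let_def)
 show "g \<in> deck p ==> pullback g (fst G) = fst G" "g \<in> deck p ==> pullback g (snd G) = snd G"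
  using a(1,2) unfolding G riemannian_metric_def symmetric_form_on_surface_def by simp_all
 have tr: "transpose (I z) = I z" "transpose (II z) = II z"
  using a(1,2) unfolding riemannian_metric_def symmetric_form_on_surface_def by simp_all
 hence sym: "I z$2$1 = I z$1$2" "II z$2$1 = II z$1$2"
 proof -
  have "transpose (I z)$2$1 = I z$2$1" "transpose (II z)$2$1 = II z$2$1" by (simp_all only: tr)
  thus "I z$2$1 = I z$1$2" "II z$2$1 = II z$1$2" by (simp_all add: transpose_def)
 qed
 have pd: "v \<bullet> (I z *v v) > 0" if "v \<noteq> 0" for v using a(1) that unfolding riemannian_metric_def by blast
 have v: "vector [1, 0] \<noteq> (0 :: real^2)" by (simp add: vec_eq_iff forall_2)
 have E: "I z$1$1 > 0" using pd[OF v] by (simp add: inner_vec_def matrix_vector_mult_def sum_2)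
 thus "fst G z$1$1 > 0" by (simp add: G)
 \<comment> \<open>On this vector, which is orthogonal to the first coordinate vector, the metric
   takes the value \<open>I z$1$1 * det (I z)\<close>.\<close>
 have v: "vector [- I z$1$2, I z$1$1] \<noteq> (0 :: real^2)" using E by (simp add: vec_eq_iff forall_2)
 have "vector [- I z$1$2, I z$1$1] \<bullet> (I z *v vector [- I z$1$2, I z$1$1]) = I z$1$1 * det (I z)"
  by (simp add: inner_vec_def matrix_vector_mult_def sum_2 det_2 sym algebra_simps)
 hence "I z$1$1 * det (I z) > 0" using pd[OF v] by simp
 hence d: "det (I z) > 0" using E by (simp add: zero_less_mult_iff)
 thus "det (fst G z) > 0" by (simp add: G)
 have d0: "det (I z) \<noteq> 0" using d by simp
 have "0 = det (I z) * trace (matrix_inv (I z) ** II z)" using a(3)[of z] by (simp add: shape_operator_def)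
 also have "trace (matrix_inv (I z) ** II z) = (II z$1$1 * I z$2$2 - 2 * II z$1$2 * I z$1$2 + II z$2$2 * I z$1$1) / det (I z)"
  unfolding trace_def sum_2 matrix_matrix_mult_def vec_lambda_beta matrix_inv_2x2[OF d0]
  by (simp add: sym add_divide_distrib diff_divide_distrib algebra_simps)
 finally show "snd G z$1$1 * fst G z$2$2 - 2 * snd G z$1$2 * fst G z$1$2 + snd G z$2$2 * fst G z$1$1 = 0"
  using d0 by (simp add: G)
qed

section \<open>The canonical form along a family of minimal germs\<close>

locale minimal_family = equivariant_family S A p U u \<sigma> f n \<rho>
 for S :: "'a::t2_space set" and A p U u \<sigma> f n \<rho> +
 assumes germs: "\<And>v. v \<in> U ==> \<sigma> v \<in> minimal_hyperbolic_germs p"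
begin

lemma minimal: "v \<in> U ==> minimal_immersion (f v) (n v) (\<sigma> v)"
 by (intro minimal_immersion.intro minimal_immersion_axioms.intro immersion) (simp_all add: minimal_germ[OF germs])

lemma invariant_minimal: "v \<in> U ==> invariant_minimal_immersion S A p (f v) (n v) (\<sigma> v)"
 by (intro invariant_minimal_immersion.intro invariant_minimal_immersion_axioms.intro minimal surface_cover_axioms)
  (simp_all add: minimal_germ[OF germs])

definition J :: "real^2 => tensor" where "J v = complex_structure (fst (\<sigma> v))"
definition dJ :: "2 => real^2 => tensor" where "dJ k v z = partial (\<lambda>w. J w z) k v"
definition \<mu> :: "2 => real^2 => tensor" where "\<mu> k v z = (1/2) *R (dJ k v z ** J v z)"
definition Pf :: "real^2 => real^2 => complex" where "Pf v = minimal_immersion.P (\<sigma> v)"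
definition mf :: "real^2 => real^2 => complex" where "mf v = minimal_immersion.m (\<sigma> v)"
definition sf :: "real^2 => real^2 => real" where "sf v z = sqrt (det (fst (\<sigma> v) z))"

text \<open>The integrand of the integration pairing as one function of parameter and point, so that
  joint smoothness can be stated; the quadratic differential enters through its coefficients P and
  m.\<close>

definition W :: "2 => (real^2) \<times> (real^2) => complex" where
 "W k q = (case q of (v, z) => \<i> / 2 * Pf v z * (complex_of_real (\<mu> k v z$1$2) + mf v z * complex_of_real (\<mu> k v z$2$2)
   - mf v z * (complex_of_real (\<mu> k v z$1$1) + mf v z * complex_of_real (\<mu> k v z$2$1))))"

lemma Ck_fst_nth: "Ck_on k (U \<times> UNIV) (\<lambda>q. fst (\<sigma> (fst q)) (snd q)$i$j)"
 and Ck_snd_nth: "Ck_on k (U \<times> UNIV) (\<lambda>q. snd (\<sigma> (fst q)) (snd q)$i$j)"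
 by (intro Ck_on_nth open_UxUNIV Ck_fst Ck_snd)+

lemma Ck_sf: "Ck_on k (U \<times> UNIV) (\<lambda>q. sf (fst q) (snd q))"
 unfolding sf_def by (intro Ck_on_sqrt Ck_on_det2 open_UxUNIV Ck_fst) (auto intro: pos)

lemma sf_pos: "v \<in> U ==> sf v z > 0"
 unfolding sf_def using pos(2) by simp

lemma Ck_J: "Ck_on k (U \<times> UNIV) (\<lambda>q. J (fst q) (snd q))"
proof (rule Ck_on_vec[OF open_UxUNIV], rule Ck_on_vec[OF open_UxUNIV])
 fix i j
 have nz: "sf (fst q) (snd q) \<noteq> 0" if "q \<in> U \<times> UNIV" for q using sf_pos[of "fst q" "snd q"] that by auto
 show "Ck_on k (U \<times> UNIV) (\<lambda>q. J (fst q) (snd q)$i$j)"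
  using exhaust_2[of i] exhaust_2[of j]
  by (elim disjE) (simp_all only: J_def complex_structure_nth sf_def[symmetric],
   (intro Ck_on_divide Ck_on_minus Ck_fst_nth Ck_sf open_UxUNIV nz; assumption)+)
qed

lemma Ck_dJ: "Ck_on l (U \<times> UNIV) (\<lambda>q. dJ k (fst q) (snd q))"
proof -
 have "smooth_on (U \<times> UNIV) (\<lambda>q. J (fst q) (snd q))" by (intro smooth_onI Ck_J)
 from smooth_onD[OF smooth_on_param_partial(2)[OF U(1) this, of k]] show ?thesis by (simp add: dJ_def)
qed

lemma Ck_\<mu>: "Ck_on l (U \<times> UNIV) (\<lambda>q. \<mu> k (fst q) (snd q)$i$j)"
 unfolding \<mu>_def by (intro Ck_on_nth Ck_on_scaleR Ck_on_const Ck_on_mat_mult Ck_dJ Ck_J open_UxUNIV)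

lemma Pf_eq: "v \<in> U ==> Pf v z = complex_of_real (snd (\<sigma> v) z$1$1) +
  \<i> * complex_of_real ((fst (\<sigma> v) z$1$2 * snd (\<sigma> v) z$1$1 - fst (\<sigma> v) z$1$1 * snd (\<sigma> v) z$1$2) / sf v z)"
 unfolding Pf_def sf_def by (simp only: minimal_immersion.P_def[OF minimal] minimal_immersion.s_def[OF minimal] Complex_eq)

lemma mf_eq: "v \<in> U ==> mf v z = complex_of_real (fst (\<sigma> v) z$1$2 / fst (\<sigma> v) z$1$1) + \<i> * complex_of_real (sf v z / fst (\<sigma> v) z$1$1)"
 unfolding mf_def sf_def by (simp only: minimal_immersion.m_def[OF minimal] minimal_immersion.s_def[OF minimal] Complex_eq)

lemma Ck_Pf_mf: "Ck_on l (U \<times> UNIV) (\<lambda>q. Pf (fst q) (snd q))" "Ck_on l (U \<times> UNIV) (\<lambda>q. mf (fst q) (snd q))"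
proof -
 have nz: "sf (fst q) (snd q) \<noteq> 0" "fst (\<sigma> (fst q)) (snd q)$1$1 \<noteq> 0" if "q \<in> U \<times> UNIV" for q
  using sf_pos[of "fst q" "snd q"] pos(1)[of "fst q" "snd q"] that by auto
 show "Ck_on l (U \<times> UNIV) (\<lambda>q. Pf (fst q) (snd q))"
 proof (rule Ck_on_eqI[OF open_UxUNIV])
  show "Ck_on l (U \<times> UNIV) (\<lambda>q. complex_of_real (snd (\<sigma> (fst q)) (snd q)$1$1) +
  \<i> * complex_of_real ((fst (\<sigma> (fst q)) (snd q)$1$2 * snd (\<sigma> (fst q)) (snd q)$1$1 - fst (\<sigma> (fst q)) (snd q)$1$1 * snd (\<sigma> (fst q)) (snd q)$1$2) / sf (fst q) (snd q)))"
   by (intro Ck_on_add Ck_on_mult Ck_on_const Ck_on_of_real Ck_on_divide Ck_on_diff Ck_fst_nth Ck_snd_nth Ck_sf open_UxUNIV nz; assumption)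
 qed (auto simp: Pf_eq)
 show "Ck_on l (U \<times> UNIV) (\<lambda>q. mf (fst q) (snd q))"
 proof (rule Ck_on_eqI[OF open_UxUNIV])
  show "Ck_on l (U \<times> UNIV) (\<lambda>q. complex_of_real (fst (\<sigma> (fst q)) (snd q)$1$2 / fst (\<sigma> (fst q)) (snd q)$1$1) + \<i> * complex_of_real (sf (fst q) (snd q) / fst (\<sigma> (fst q)) (snd q)$1$1))"
   by (intro Ck_on_add Ck_on_mult Ck_on_const Ck_on_of_real Ck_on_divide Ck_fst_nth Ck_sf open_UxUNIV nz; assumption)
 qed (auto simp: mf_eq)
qed

lemma Ck_W: "Ck_on l (U \<times> UNIV) (W k)"
 unfolding W_def case_prod_unfold
 by (intro Ck_on_mult Ck_on_add Ck_on_diff Ck_on_const Ck_on_of_real Ck_Pf_mf Ck_\<mu> open_UxUNIV)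

lemma J_square: "v \<in> U ==> J v z ** J v z = - mat 1"
proof -
 assume v: "v \<in> U"
 have d: "det (fst (\<sigma> v) z) = sf v z * sf v z" using pos(2)[OF v, of z] by (simp add: sf_def)
 have "sf v z \<noteq> 0" using sf_pos[OF v, of z] by simp
 have sym: "fst (\<sigma> v) z$2$1 = fst (\<sigma> v) z$1$2" by (rule immersion.fst_sym[OF immersion[OF v]])
 have e: "fst (\<sigma> v) z$1$1 * fst (\<sigma> v) z$2$2 - fst (\<sigma> v) z$1$2 * fst (\<sigma> v) z$1$2 = sf v z * sf v z" using d by (simp add: det_2 sym)
 show ?thesis
  using \<open>sf v z \<noteq> 0\<close> e unfolding J_def
  by (simp add: vec_eq_iff forall_2 matrix_matrix_mult_def sum_2 complex_structure_nth sf_def[symmetric] mat_def sym divide_simps) (simp add: algebra_simps)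
qed

lemma Ck_J_parameter: "Ck_on l U (\<lambda>w. J w z)"
proof -
 have "(\<lambda>w. (w, z)) ` U \<subseteq> U \<times> UNIV" by auto
 from Ck_on_compose[OF U(1) open_UxUNIV this Ck_on_Pair[OF U(1) Ck_on_ident Ck_on_const] Ck_J] show ?thesis by simp
qed

lemma J_differentiable: "v \<in> U ==> (\<lambda>w. J w z) differentiable (at v)"
 by (rule Ck_1_differentiable[OF Ck_J_parameter])

text \<open>At the base structure the two factors of \<open>beltrami\<close> are the inverse of 2
  and 0. Only the derivative of the vanishing factor survives, which gives half the velocity of
  \<open>J\<close> times \<open>J\<close>.\<close>

lemma velocity:
 assumes v: "v \<in> U"
 shows "teichmueller_velocity (\<lambda>v. fst (Psi p (\<sigma> v))) k v z = \<mu> k v z"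
proof -
 note bb = bounded_bilinear_mat_mult
 define X where "X = (\<lambda>w. mat 1 - J w z ** J v z)"
 define Yw where "Yw = (\<lambda>w. mat 1 + J w z ** J v z)"
 have dJJ: "(\<lambda>w. J w z ** J v z) differentiable (at v)" by (intro differentiable_mat_mult J_differentiable[OF v] differentiable_const)
 have dX: "X differentiable (at v)" "Yw differentiable (at v)" unfolding X_def Yw_def by (intro differentiable_diff differentiable_add differentiable_const dJJ)+
 have Xv: "X v = 2 *R mat 1" "Yw v = 0" unfolding X_def Yw_def J_square[OF v] by (simp_all add: scaleR_2)
 have "matrix_inv (X v) = (1/2) *R mat 1"
  unfolding Xv by (rule matrix_inv_eqI) (simp_all add: bounded_bilinear.scaleR_left[OF bb] bounded_bilinear.scaleR_right[OF bb] matrix_mul_lid)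
 note Xi = this
 have detX: "det (X v) \<noteq> 0" unfolding Xv by (simp add: det_2 mat_def)
 have CX: "Ck_on 1 U X" unfolding X_def by (intro Ck_on_diff Ck_on_mat_mult Ck_on_const U(1) Ck_J_parameter)
 define V where "V = {w \<in> U. det (X w) \<noteq> 0}"
 have "continuous_on U (\<lambda>w. det (X w))" by (rule Ck_on_imp_continuous[OF Ck_on_det2[OF U(1) CX]])
 from continuous_open_preimage[OF this U(1), of "- {0}"] have "open (U \<inter> (\<lambda>w. det (X w)) -` (- {0}))"
  by (simp add: open_Compl)
 moreover have "U \<inter> (\<lambda>w. det (X w)) -` (- {0}) = V" by (auto simp: V_def)
 ultimately have V: "open V" by simp
 have vV: "v \<in> V" using v detX by (simp add: V_def)
 have "Ck_on 1 V X" by (rule Ck_on_subset[OF CX]) (auto simp: V_def)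
 hence "Ck_on 1 V (\<lambda>w. matrix_inv (X w)$i$j)" for i j by (rule Ck_on_matrix_inv2_nth[OF V]) (simp add: V_def)
 hence "Ck_on 1 V (\<lambda>w. matrix_inv (X w))" by (intro Ck_on_vec[OF V])
 hence dI: "(\<lambda>w. matrix_inv (X w)) differentiable (at v)" by (rule Ck_1_differentiable[OF _ vV])
 have "fst (Psi p (\<sigma> w)) = J w" for w by (simp add: Psi_def Let_def J_def)
 hence "teichmueller_velocity (\<lambda>v. fst (Psi p (\<sigma> v))) k v z = partial (\<lambda>w. matrix_inv (X w) ** Yw w) k v"
  by (simp add: teichmueller_velocity_def beltrami_def X_def Yw_def)
 also have "\<dots> = (1/2) *R partial Yw k v"
  unfolding partial_bilinear[OF bb dI dX(2)] Xi Xv(2) by (simp add: bounded_bilinear.scaleR_left[OF bb] bounded_bilinear.zero_right[OF bb] matrix_mul_lid)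
 also have "partial Yw k v = dJ k v z ** J v z"
  unfolding Yw_def partial_add[OF differentiable_const dJJ] partial_const dJ_def
  using partial_bounded_linear[OF bounded_bilinear.bounded_linear_left[OF bb] J_differentiable[OF v]] by simp
 finally show ?thesis by (simp add: \<mu>_def)
qed

lemma \<mu>_equivariant:
 assumes v: "v \<in> U" and g: "g \<in> deck p"
 shows "\<mu> k v (g z) ** jacobian g (at z) = jacobian g (at z) ** \<mu> k v z"
proof -
 note bb = bounded_bilinear_mat_mult
 let ?D = "jacobian g (at z)"
 have JD: "J w (g z) ** ?D = ?D ** J w z" if "w \<in> U" for w
  unfolding J_def by (rule invariant_minimal_immersion.J_equivariant[OF invariant_minimal[OF that] g])
 have "partial (\<lambda>w. J w (g z) ** ?D) k v = partial (\<lambda>w. ?D ** J w z) k v"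
  by (rule partial_cong[OF U(1) v JD])
 hence dJD: "dJ k v (g z) ** ?D = ?D ** dJ k v z"
  unfolding dJ_def partial_bounded_linear[OF bounded_bilinear.bounded_linear_left[OF bb] J_differentiable[OF v]]
   partial_bounded_linear[OF bounded_bilinear.bounded_linear_right[OF bb] J_differentiable[OF v]] .
 have "dJ k v (g z) ** J v (g z) ** ?D = dJ k v (g z) ** (?D ** J v z)" by (simp only: JD[OF v] matrix_mul_assoc[symmetric])
 also have "\<dots> = ?D ** (dJ k v z ** J v z)" using dJD by (simp only: matrix_mul_assoc)
 finally show ?thesis by (simp add: \<mu>_def bounded_bilinear.scaleR_left[OF bb] bounded_bilinear.scaleR_right[OF bb])
qed

text \<open>Alternating in \<open>a\<close> and \<open>b\<close>, hence a multiple of the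
  determinant. This makes the integrand a 2-form and yields its transformation law under the deck
  group.\<close>

lemma W_alternating:
 assumes v: "v \<in> U"
 shows "invariant_minimal_immersion.\<phi> (\<sigma> v) z a (\<mu> k v z *v b) - invariant_minimal_immersion.\<phi> (\<sigma> v) z b (\<mu> k v z *v a)
  = complex_of_real (a$1 * b$2 - a$2 * b$1) * (W k (v, z) * 2 / \<i>)"
 unfolding invariant_minimal_immersion.\<phi>_def[OF invariant_minimal[OF v]] W_def Pf_def mf_def
 by (simp add: matrix_vector_mult_def sum_2 algebra_simps)

lemma W_eq:
 assumes v: "v \<in> U"
 shows "\<i> / 2 * (invariant_minimal_immersion.\<phi> (\<sigma> v) z (axis 1 1) (\<mu> k v z *v axis 2 1)
  - invariant_minimal_immersion.\<phi> (\<sigma> v) z (axis 2 1) (\<mu> k v z *v axis 1 1)) = W k (v, z)"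
 unfolding W_alternating[OF v] by (simp add: axis_def)

lemma W_density:
 assumes v: "v \<in> U"
 shows "invariant_density (\<lambda>z. W k (v, z))"
 unfolding invariant_density_def
proof (intro ballI allI)
 fix g z assume g: "g \<in> deck p"
 let ?D = "jacobian g (at z)" and ?\<phi> = "invariant_minimal_immersion.\<phi> (\<sigma> v)"
 have \<mu>D: "\<mu> k v (g z) *v (?D *v a) = ?D *v (\<mu> k v z *v a)" for a
  using \<mu>_equivariant[OF v g] by (simp add: matrix_vector_mul_assoc)
 have Dn: "(?D *v axis j 1)$i = ?D$i$j" for i j by (simp add: matrix_vector_mult_basis column_def)
 have "complex_of_real (det ?D) * (W k (v, g z) * 2 / \<i>) =
   ?\<phi> (g z) (?D *v axis 1 1) (\<mu> k v (g z) *v (?D *v axis 2 1)) - ?\<phi> (g z) (?D *v axis 2 1) (\<mu> k v (g z) *v (?D *v axis 1 1))"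
  unfolding W_alternating[OF v] Dn by (simp add: det_2 mult.commute)
 also have "\<dots> = ?\<phi> z (axis 1 1) (\<mu> k v z *v axis 2 1) - ?\<phi> z (axis 2 1) (\<mu> k v z *v axis 1 1)"
  unfolding \<mu>D invariant_minimal_immersion.\<phi>_equivariant[OF invariant_minimal[OF v] g] ..
 also have "\<dots> = W k (v, z) * 2 / \<i>" unfolding W_alternating[OF v] by (simp add: axis_def)
 finally show "det ?D *R W k (v, g z) = W k (v, z)" by (simp add: scaleR_conv_of_real)
qed

lemma liouville_eq:
 assumes v: "v \<in> U"
 shows "liouville_form S p (\<lambda>v. Psi p (\<sigma> v)) k v = integral UNIV (\<lambda>z. bump z *R W k (v, z))"
proof -
 have snd: "snd (Psi p (\<sigma> v)) = invariant_minimal_immersion.\<phi> (\<sigma> v)"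
  by (simp add: invariant_minimal_immersion.Psi_eq[OF invariant_minimal[OF v]])
 have "continuous_on UNIV (\<lambda>z. W k (v, z))" by (rule Ck_on_imp_continuous[OF Ck_slice[OF v Ck_W[of 0]]])
 from surface_integral_eq[OF this W_density[OF v]] show ?thesis
  unfolding liouville_form_def pairing_def snd velocity[OF v] W_eq[OF v] .
qed

lemma partial_liouville:
 "partial (liouville_form S p (\<lambda>v. Psi p (\<sigma> v)) k) j u = integral UNIV (\<lambda>z. bump z *R partial (\<lambda>v. W k (v, z)) j u)"
proof -
 have "partial (liouville_form S p (\<lambda>v. Psi p (\<sigma> v)) k) j u = partial (\<lambda>v. integral UNIV (\<lambda>z. bump z *R W k (v, z))) j u"
  by (rule partial_cong[OF U liouville_eq])
 also have "\<dots> = integral UNIV (\<lambda>z. bump z *R partial (\<lambda>v. W k (v, z)) j u)"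
  by (rule integral_parameter_partial[OF U Ck_W bump_continuous bump_zero])
 finally show ?thesis .
qed

end

text \<open>\<open>J11\<close> to \<open>J22\<close> are the entries of the complex structure,
  \<open>j11\<close> to \<open>j22\<close> their variations, and \<open>e\<close>, \<open>f\<close>,
  \<open>g\<close> those of the metric. The variation \<open>s'\<close> of the area density cancels
  in the products, and minimality brings the rest to a pairing of II with the varied metric.\<close>

lemma liouville_real_part:
 fixes E F G s L M N e f g s' :: real
 assumes s: "s > 0" "s * s = E * G - F * F" and min: "L * G - 2 * M * F + N * E = 0"
 defines "J11 \<equiv> - F / s" and "J12 \<equiv> - G / s" and "J21 \<equiv> E / s" and "J22 \<equiv> F / s"
  and "j11 \<equiv> - ((f * s - F * s') / (s * s))" and "j12 \<equiv> - ((g * s - G * s') / (s * s))"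
  and "j21 \<equiv> (e * s - E * s') / (s * s)" and "j22 \<equiv> (f * s - F * s') / (s * s)"
 shows "- (1/2) * ((F * L - E * M) / s * ((j11 * J12 + j12 * J22) / 2)
   + (G * L - F * M) / s * ((j21 * J12 + j22 * J22) / 2 - (j11 * J11 + j12 * J21) / 2)
   - (G * M - F * N) / s * ((j21 * J11 + j22 * J21) / 2)) = - (1/4) * ((L * g - 2 * M * f + N * e) / s)"
proof -
 have 1: "j11 * J12 + j12 * J22 = (f * G - g * F) / (s * s)"
  using s(1) unfolding j11_def j12_def J12_def J22_def by (simp add: divide_simps) (simp add: algebra_simps)
 have 2: "(j21 * J12 + j22 * J22) / 2 - (j11 * J11 + j12 * J21) / 2 = (g * E - e * G) / (2 * (s * s))"
  using s(1) unfolding j11_def j12_def j21_def j22_def J11_def J12_def J21_def J22_def by (simp add: divide_simps) (simp add: algebra_simps)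
 have 3: "j21 * J11 + j22 * J21 = (f * E - e * F) / (s * s)"
  using s(1) unfolding j21_def j22_def J11_def J21_def by (simp add: divide_simps) (simp add: algebra_simps)
 have NE: "N * E = 2 * M * F - L * G" using min by simp
 have "(F * L - E * M) * (f * G - g * F) + (G * L - F * M) * (g * E - e * G) - (G * M - F * N) * (f * E - e * F)
   = g * L * (E * G - F * F) - e * (G * (G * L - 2 * F * M)) - e * F * F * N + f * (F * (L * G + N * E) - 2 * E * G * M)"
  by (simp add: algebra_simps)
 also have "\<dots> = g * L * (E * G - F * F) - e * (G * (2 * M * F - N * E - 2 * F * M)) - e * F * F * N + f * (F * (2 * M * F) - 2 * E * G * M)"
  unfolding NE by (simp add: algebra_simps)
 also have "\<dots> = (s * s) * (L * g - 2 * M * f + N * e)" unfolding s(2) by (simp add: algebra_simps)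
 finally have 4: "(F * L - E * M) * (f * G - g * F) + (G * L - F * M) * (g * E - e * G) - (G * M - F * N) * (f * E - e * F)
   = (s * s) * (L * g - 2 * M * f + N * e)" .
 have "- (1/2) * ((F * L - E * M) / s * ((j11 * J12 + j12 * J22) / 2)
   + (G * L - F * M) / s * ((j21 * J12 + j22 * J22) / 2 - (j11 * J11 + j12 * J21) / 2)
   - (G * M - F * N) / s * ((j21 * J11 + j22 * J21) / 2))
  = - (((F * L - E * M) * (f * G - g * F) + (G * L - F * M) * (g * E - e * G) - (G * M - F * N) * (f * E - e * F)) / (4 * s * (s * s)))"
  unfolding 1 2 3 using s(1) by (simp add: field_simps)
 also have "\<dots> = - (1/4) * ((L * g - 2 * M * f + N * e) / s)" unfolding 4 using s(1) by simp
 finally show ?thesis .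
qed

context minimal_immersion begin

lemma Im_m_m_P: "Im (m z * (m z * P z)) = (G' z * M z - F z * N z) / s z"
proof -
 have NE: "N z * E z = 2 * M z * F z - L z * G' z" using minimal[of z] by simp
 have "Im (m z * (m z * P z)) = (F z * (G' z * L z - F z * M z) + (s z * s z) * M z) / (E z * s z)"
  unfolding m_P using pos[of z] s(1)[of z] by (simp add: m_def field_simps)
 also have "F z * (G' z * L z - F z * M z) + (s z * s z) * M z = E z * G' z * M z - F z * (2 * M z * F z - L z * G' z)"
  unfolding s(2) by (simp add: algebra_simps)
 also have "\<dots> = E z * (G' z * M z - F z * N z)" unfolding NE[symmetric] by (simp add: algebra_simps)
 also have "\<dots> / (E z * s z) = (G' z * M z - F z * N z) / s z" using pos[of z] by simp
 finally show ?thesis .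
qed

end

context minimal_family begin

definition dI :: "2 => real^2 => real^2 => 2 => 2 => real" where
 "dI k v z i j = partial (\<lambda>w. fst (\<sigma> w) z$i$j) k v"

definition dII :: "2 => real^2 => real^2 => 2 => 2 => real" where
 "dII k v z i j = partial (\<lambda>w. snd (\<sigma> w) z$i$j) k v"

lemma Ck_param:
 fixes H :: "(real^2) \<times> (real^2) => 'b::euclidean_space"
 assumes "Ck_on l (U \<times> UNIV) H"
 shows "Ck_on l U (\<lambda>w. H (w, z))"
proof -
 have "(\<lambda>w. (w, z)) ` U \<subseteq> U \<times> UNIV" by auto
 from Ck_on_compose[OF U(1) open_UxUNIV this Ck_on_Pair[OF U(1) Ck_on_ident Ck_on_const] assms] show ?thesis .
qed

lemma Ck_entries_param: "Ck_on l U (\<lambda>w. fst (\<sigma> w) z$i$j)" "Ck_on l U (\<lambda>w. snd (\<sigma> w) z$i$j)" "Ck_on l U (\<lambda>w. sf w z)"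
 using Ck_param[OF Ck_fst_nth, of l z i j] Ck_param[OF Ck_snd_nth, of l z i j] Ck_param[OF Ck_sf, of l z] by simp_all

lemma entries_param_differentiable:
 "v \<in> U ==> (\<lambda>w. fst (\<sigma> w) z$i$j) differentiable (at v)"
 "v \<in> U ==> (\<lambda>w. snd (\<sigma> w) z$i$j) differentiable (at v)"
 "v \<in> U ==> (\<lambda>w. sf w z) differentiable (at v)"
 by (rule Ck_1_differentiable[OF Ck_entries_param(1)] Ck_1_differentiable[OF Ck_entries_param(2)] Ck_1_differentiable[OF Ck_entries_param(3)]; assumption)+

lemma fst_sym: "v \<in> U ==> fst (\<sigma> v) z$2$1 = fst (\<sigma> v) z$1$2"
 and snd_sym: "v \<in> U ==> snd (\<sigma> v) z$2$1 = snd (\<sigma> v) z$1$2"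
 by (rule immersion.fst_sym[OF immersion] immersion.snd_sym[OF immersion]; assumption)+

lemma dI_sym: "v \<in> U ==> dI k v z 2 1 = dI k v z 1 2" and dII_sym: "v \<in> U ==> dII k v z 2 1 = dII k v z 1 2"
 unfolding dI_def dII_def by (rule partial_cong[OF U(1)]; simp add: fst_sym snd_sym)+

lemma sf_square: "v \<in> U ==> sf v z * sf v z = fst (\<sigma> v) z$1$1 * fst (\<sigma> v) z$2$2 - fst (\<sigma> v) z$1$2 * fst (\<sigma> v) z$1$2"
proof -
 assume v: "v \<in> U"
 have "sf v z * sf v z = det (fst (\<sigma> v) z)" using pos(2)[OF v, of z] by (simp add: sf_def)
 thus ?thesis by (simp add: det_2 fst_sym[OF v])
qed

lemma partial_sf:
 assumes v: "v \<in> U"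
 shows "partial (\<lambda>w. sf w z) k v =
  (dI k v z 1 1 * fst (\<sigma> v) z$2$2 + fst (\<sigma> v) z$1$1 * dI k v z 2 2 - 2 * fst (\<sigma> v) z$1$2 * dI k v z 1 2) / (2 * sf v z)"
proof -
 note d = entries_param_differentiable[OF v, of z]
 have "partial (\<lambda>w. sf w z * sf w z) k v = partial (\<lambda>w. fst (\<sigma> w) z$1$1 * fst (\<sigma> w) z$2$2 - fst (\<sigma> w) z$1$2 * fst (\<sigma> w) z$1$2) k v"
  by (rule partial_cong[OF U(1) v sf_square])
 hence "2 * sf v z * partial (\<lambda>w. sf w z) k v =
  dI k v z 1 1 * fst (\<sigma> v) z$2$2 + fst (\<sigma> v) z$1$1 * dI k v z 2 2 - 2 * fst (\<sigma> v) z$1$2 * dI k v z 1 2"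
  unfolding partial_diff[OF differentiable_mult[OF d(1) d(1)] differentiable_mult[OF d(1) d(1)]] partial_mult[OF d(1) d(1)] partial_mult[OF d(3) d(3)] dI_def[symmetric]
  by (simp add: algebra_simps)
 thus ?thesis using sf_pos[OF v, of z] by (simp add: field_simps)
qed

lemma dJ_nth:
 assumes v: "v \<in> U"
 shows "dJ k v z$1$1 = - ((dI k v z 1 2 * sf v z - fst (\<sigma> v) z$1$2 * partial (\<lambda>w. sf w z) k v) / (sf v z * sf v z))"
  and "dJ k v z$1$2 = - ((dI k v z 2 2 * sf v z - fst (\<sigma> v) z$2$2 * partial (\<lambda>w. sf w z) k v) / (sf v z * sf v z))"
  and "dJ k v z$2$1 = (dI k v z 1 1 * sf v z - fst (\<sigma> v) z$1$1 * partial (\<lambda>w. sf w z) k v) / (sf v z * sf v z)"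
  and "dJ k v z$2$2 = (dI k v z 1 2 * sf v z - fst (\<sigma> v) z$1$2 * partial (\<lambda>w. sf w z) k v) / (sf v z * sf v z)"
proof -
 note d = entries_param_differentiable[OF v, of z]
 have nz: "sf v z \<noteq> 0" using sf_pos[OF v, of z] by simp
 have dn: "(\<lambda>w. J w z$i) differentiable (at v)" for i
  by (rule differentiable_bounded_linear[OF bounded_linear_vec_nth J_differentiable[OF v]])
 have nth: "dJ k v z$i$j = partial (\<lambda>w. J w z$i$j) k v" for i j
  unfolding dJ_def partial_nth[OF dn] partial_nth[OF J_differentiable[OF v]] ..
 note q = partial_divide[OF d(1) d(3) nz, folded dI_def]
 show "dJ k v z$1$1 = - ((dI k v z 1 2 * sf v z - fst (\<sigma> v) z$1$2 * partial (\<lambda>w. sf w z) k v) / (sf v z * sf v z))"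
  unfolding nth J_def complex_structure_nth sf_def[symmetric] minus_divide_left[symmetric] partial_minus[OF q(2)] q(1) dI_sym[OF v] fst_sym[OF v] ..
 show "dJ k v z$1$2 = - ((dI k v z 2 2 * sf v z - fst (\<sigma> v) z$2$2 * partial (\<lambda>w. sf w z) k v) / (sf v z * sf v z))"
  unfolding nth J_def complex_structure_nth sf_def[symmetric] minus_divide_left[symmetric] partial_minus[OF q(2)] q(1) ..
 show "dJ k v z$2$1 = (dI k v z 1 1 * sf v z - fst (\<sigma> v) z$1$1 * partial (\<lambda>w. sf w z) k v) / (sf v z * sf v z)"
  and "dJ k v z$2$2 = (dI k v z 1 2 * sf v z - fst (\<sigma> v) z$1$2 * partial (\<lambda>w. sf w z) k v) / (sf v z * sf v z)"
  unfolding nth J_def complex_structure_nth sf_def[symmetric] q(1) by (rule refl)+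
qed

lemma Re_W:
 assumes v: "v \<in> U"
 shows "Re (W k (v, z)) = - (1/4) * ((snd (\<sigma> v) z$1$1 * dI k v z 2 2 - 2 * snd (\<sigma> v) z$1$2 * dI k v z 1 2 + snd (\<sigma> v) z$2$2 * dI k v z 1 1) / sf v z)"
proof -
 interpret mi: minimal_immersion "f v" "n v" "\<sigma> v" by (rule minimal[OF v])
 have s: "mi.s z = sf v z" by (simp add: mi.s_def sf_def)
 define P m where "P = mi.P z" and "m = mi.m z"
 define a b c where "a = \<mu> k v z$1$2" and "b = \<mu> k v z$2$2 - \<mu> k v z$1$1" and "c = \<mu> k v z$2$1"
 have im: "Im P = (mi.F z * mi.L z - mi.E z * mi.M z) / sf v z" "Im (m * P) = (mi.G' z * mi.L z - mi.F z * mi.M z) / sf v z"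
  "Im (m * (m * P)) = (mi.G' z * mi.M z - mi.F z * mi.N z) / sf v z"
  unfolding P_def m_def mi.Im_m_m_P unfolding mi.m_P s by (simp_all add: mi.P_def s)
 have "W k (v, z) = \<i> / 2 * (complex_of_real a * P + complex_of_real b * (m * P) - complex_of_real c * (m * (m * P)))"
  unfolding W_def prod.case Pf_def mf_def P_def[symmetric] m_def[symmetric] a_def b_def c_def by (simp add: algebra_simps)
 moreover have "Re (\<i> / 2 * (complex_of_real a * X + complex_of_real b * Y - complex_of_real c * Z)) = - (1/2) * (Im X * a + Im Y * b - Im Z * c)" for X Y Z
  by (simp add: field_simps)
 ultimately have W: "Re (W k (v, z)) = - (1/2) * (Im P * a + Im (m * P) * b - Im (m * (m * P)) * c)" by (simp only:)
 have \<mu>: "\<mu> k v z$i$j = (dJ k v z$i$1 * J v z$1$j + dJ k v z$i$2 * J v z$2$j) / 2" for i j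
  by (simp add: \<mu>_def matrix_matrix_mult_def sum_2)
 have Jn: "J v z$1$1 = - mi.F z / sf v z" "J v z$1$2 = - mi.G' z / sf v z" "J v z$2$1 = mi.E z / sf v z" "J v z$2$2 = mi.F z / sf v z"
  unfolding J_def complex_structure_nth sf_def fst_sym[OF v] by (rule refl)+
 show ?thesis
  unfolding W im a_def b_def c_def \<mu> dJ_nth[OF v] Jn
  by (rule liouville_real_part[OF sf_pos[OF v] sf_square[OF v] mi.minimal])
qed

lemma Ck_dI_param: "Ck_on l U (\<lambda>v. dI k v z i j)"
 unfolding dI_def by (rule Ck_on_partial[OF U(1) Ck_entries_param(1)])

lemma partial_Re_W:
 assumes v: "v \<in> U"
 shows "partial (\<lambda>w. Re (W k (w, z))) j v = - (1/4) * (
  (dII j v z 1 1 * dI k v z 2 2 - 2 * dII j v z 1 2 * dI k v z 1 2 + dII j v z 2 2 * dI k v z 1 1) / sf v z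
  + (snd (\<sigma> v) z$1$1 * partial (\<lambda>v. dI k v z 2 2) j v - 2 * snd (\<sigma> v) z$1$2 * partial (\<lambda>v. dI k v z 1 2) j v + snd (\<sigma> v) z$2$2 * partial (\<lambda>v. dI k v z 1 1) j v) / sf v z
  - (snd (\<sigma> v) z$1$1 * dI k v z 2 2 - 2 * snd (\<sigma> v) z$1$2 * dI k v z 1 2 + snd (\<sigma> v) z$2$2 * dI k v z 1 1) * partial (\<lambda>w. sf w z) j v / (sf v z * sf v z))"
proof -
 note d = entries_param_differentiable[OF v, of z]
 have nz: "sf v z \<noteq> 0" using sf_pos[OF v, of z] by simp
 have di: "(\<lambda>v. dI k v z a b) differentiable (at v)" for a b by (rule Ck_1_differentiable[OF Ck_dI_param v])
 define T where "T = (\<lambda>w. snd (\<sigma> w) z$1$1 * dI k w z 2 2 - 2 * (snd (\<sigma> w) z$1$2 * dI k w z 1 2) + snd (\<sigma> w) z$2$2 * dI k w z 1 1)"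
 note m = differentiable_mult[OF d(2) di]
 note m2 = differentiable_mult[OF differentiable_const[of 2] m]
 have dT: "T differentiable (at v)" unfolding T_def by (intro differentiable_add differentiable_diff m m2)
 have pT: "partial T j v = (dII j v z 1 1 * dI k v z 2 2 - 2 * dII j v z 1 2 * dI k v z 1 2 + dII j v z 2 2 * dI k v z 1 1)
   + (snd (\<sigma> v) z$1$1 * partial (\<lambda>v. dI k v z 2 2) j v - 2 * snd (\<sigma> v) z$1$2 * partial (\<lambda>v. dI k v z 1 2) j v + snd (\<sigma> v) z$2$2 * partial (\<lambda>v. dI k v z 1 1) j v)"
  unfolding T_def partial_add[OF differentiable_diff[OF m m2] m] partial_diff[OF m m2] partial_mult[OF differentiable_const m]
   partial_mult[OF d(2) di] partial_const dII_def[symmetric] by (simp add: algebra_simps)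
 have "partial (\<lambda>w. Re (W k (w, z))) j v = partial (\<lambda>w. - (1/4) * (T w / sf w z)) j v"
  by (rule partial_cong[OF U(1) v]) (simp only: Re_W T_def mult.assoc)
 also have "\<dots> = - (1/4) * partial (\<lambda>w. T w / sf w z) j v"
  by (rule partial_bounded_linear[OF bounded_linear_mult_right partial_divide(2)[OF dT d(3) nz]])
 also have "\<dots> = - (1/4) * (partial T j v / sf v z - T v * partial (\<lambda>w. sf w z) j v / (sf v z * sf v z))"
  unfolding partial_divide(1)[OF dT d(3) nz] using nz by (simp add: diff_divide_distrib)
 finally show ?thesis unfolding pT add_divide_distrib[of _ _ "sf v z"] unfolding T_def mult.assoc .
qed

definition omega_density :: "real^2 => real" where
 "omega_density z = - (1/4) * (
  ((dII 1 u z 1 1 * dI 2 u z 2 2 - 2 * dII 1 u z 1 2 * dI 2 u z 1 2 + dII 1 u z 2 2 * dI 2 u z 1 1)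
   - (dII 2 u z 1 1 * dI 1 u z 2 2 - 2 * dII 2 u z 1 2 * dI 1 u z 1 2 + dII 2 u z 2 2 * dI 1 u z 1 1)) / sf u z
  - ((snd (\<sigma> u) z$1$1 * dI 2 u z 2 2 - 2 * snd (\<sigma> u) z$1$2 * dI 2 u z 1 2 + snd (\<sigma> u) z$2$2 * dI 2 u z 1 1) * partial (\<lambda>w. sf w z) 1 u
    - (snd (\<sigma> u) z$1$1 * dI 1 u z 2 2 - 2 * snd (\<sigma> u) z$1$2 * dI 1 u z 1 2 + snd (\<sigma> u) z$2$2 * dI 1 u z 1 1) * partial (\<lambda>w. sf w z) 2 u) / (sf u z * sf u z))"

text \<open>The second parameter derivatives of the metric are symmetric in the two parameters and
  cancel, so only first variations of I and II remain.\<close>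

lemma curl_Re_W: "partial (\<lambda>w. Re (W 2 (w, z))) 1 u - partial (\<lambda>w. Re (W 1 (w, z))) 2 u = omega_density z"
proof -
 have c: "partial (\<lambda>v. dI 2 v z a b) 1 u = partial (\<lambda>v. dI 1 v z a b) 2 u" for a b
  unfolding dI_def by (rule partial_partial_commute[OF U Ck_entries_param(1)])
 have e: "- (1/4) * (a / s + x / s - b / r) - - (1/4) * (a' / s + x / s - b' / r) = - (1/4) * ((a - a') / s - (b - b') / r)" for a b x a' b' r s :: real
  by (simp add: diff_divide_distrib algebra_simps)
 show ?thesis unfolding partial_Re_W[OF U(2)] c omega_density_def by (rule e)
qed

lemma omega_H_eq: "omega_H S p \<sigma> u = integral UNIV (\<lambda>z. bump z * omega_density z)"
proof -
 define D where "D = (\<lambda>k j z. partial (\<lambda>v. W k (v, z)) j u)"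
 have cD: "continuous_on UNIV (D k j)" for k j
 proof -
  have "smooth_on (U \<times> UNIV) (W k)" by (intro smooth_onI Ck_W)
  from smooth_onD[OF smooth_on_param_partial(2)[OF U(1) this, of j], of 0]
  have "Ck_on 0 (U \<times> UNIV) (\<lambda>q. partial (\<lambda>w. W k (w, snd q)) j (fst q))" .
  from Ck_on_imp_continuous[OF Ck_slice[OF U(2) this]] show ?thesis by (simp add: D_def)
 qed
 have dW: "(\<lambda>v. W k (v, z)) differentiable (at u)" for k z
  by (rule Ck_1_differentiable[OF Ck_param[OF Ck_W] U(2)])
 have Re: "Re (D k j z) = partial (\<lambda>v. Re (W k (v, z))) j u" for k j z
  unfolding D_def by (rule partial_bounded_linear[OF bounded_linear_Re dW, symmetric])
 have "omega_H S p \<sigma> u = Re (integral UNIV (\<lambda>z. bump z *R D 2 1 z) - integral UNIV (\<lambda>z. bump z *R D 1 2 z))"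
  unfolding omega_H_def omega_can_def partial_liouville D_def ..
 also have "\<dots> = Re (integral UNIV (\<lambda>z. bump z *R (D 2 1 z - D 1 2 z)))"
  by (simp add: scaleR_diff_right integral_diff integral_bump_complex(1)[OF cD])
 also have "\<dots> = integral UNIV (\<lambda>z. bump z * Re (D 2 1 z - D 1 2 z))"
  unfolding integral_bump_complex(2)[OF continuous_on_diff[OF cD cD]] by simp
 also have "\<dots> = integral UNIV (\<lambda>z. bump z * omega_density z)"
  by (simp add: Re curl_Re_W)
 finally show ?thesis .
qed

end

section \<open>The trace form on so(3,1) and its imaginary part\<close>

definition alt :: "real^4^4 => 4 => 4 => real" where
 "alt Q i j = Q$i$j - Q$j$i"

lemma spin_part_pauli:
 fixes E :: "real^4^4"
 defines "a \<equiv> alt (E ** eta_mat)"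
 shows "spin_part E$1$1 = Complex ((trace E - a 3 4) / 4) (- a 1 2 / 4)"
  and "spin_part E$2$2 = Complex ((trace E + a 3 4) / 4) (a 1 2 / 4)"
  and "spin_part E$1$2 = Complex ((a 1 3 - a 1 4) / 4) ((a 2 4 - a 2 3) / 4)"
  and "spin_part E$2$1 = Complex ((- a 1 4 - a 1 3) / 4) ((- a 2 4 - a 2 3) / 4)"
proof -
 have e: "(E ** eta_mat)$i$1 = E$i$1" "(E ** eta_mat)$i$2 = E$i$2" "(E ** eta_mat)$i$3 = E$i$3" "(E ** eta_mat)$i$4 = - E$i$4" for i
  by (simp_all add: matrix_matrix_mult_def sum_4 eta_mat_def)
 show "spin_part E$1$1 = Complex ((trace E - a 3 4) / 4) (- a 1 2 / 4)"
  and "spin_part E$2$2 = Complex ((trace E + a 3 4) / 4) (a 1 2 / 4)"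
  and "spin_part E$1$2 = Complex ((a 1 3 - a 1 4) / 4) ((a 2 4 - a 2 3) / 4)"
  and "spin_part E$2$1 = Complex ((- a 1 4 - a 1 3) / 4) ((- a 2 4 - a 2 3) / 4)"
  unfolding a_def alt_def e spin_part_def sum_4
  by (simp_all add: herm_def eta_def adj2_def matrix_matrix_mult_def sum_2 axis_def complex_eq_iff trace_def sum_4) (simp_all add: field_simps)
qed

text \<open>Real and imaginary part of the complex trace form are two invariant forms on so(3,1).
  The imaginary one pairs rotations with boosts, so only complementary pairs of indices
  meet.\<close>

lemma Im_trace_form_spin_part:
 fixes E E' :: "real^4^4"
 defines "a \<equiv> alt (E ** eta_mat)" and "b \<equiv> alt (E' ** eta_mat)"
 shows "Im (trace_form (spin_part E) (spin_part E')) =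
  (a 1 2 * b 3 4 + a 3 4 * b 1 2 - a 1 3 * b 2 4 - a 2 4 * b 1 3 + a 1 4 * b 2 3 + a 2 3 * b 1 4) / 8"
proof -
 have t: "trace (X ** Y) = X$1$1 * Y$1$1 + X$1$2 * Y$2$1 + (X$2$1 * Y$1$2 + X$2$2 * Y$2$2)" for X Y :: "complex^2^2"
  by (simp add: trace_def matrix_matrix_mult_def sum_2)
 show ?thesis unfolding trace_form_def t spin_part_pauli a_def[symmetric] b_def[symmetric] by (simp add: field_simps)
qed

lemma cholesky_gram:
 assumes "transpose P = P" "P$1$1 > 0" "det P > 0"
 shows "cholesky P ** eta_mat ** transpose (cholesky P) = block P (-1)"
proof -
 define x s where "x = sqrt (P$1$1)" and "s = sqrt (det P)"
 have x: "x \<noteq> 0" "x * x = P$1$1" and s: "s * s = det P" using assms(2,3) by (simp_all add: x_def s_def)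
 have "transpose P$2$1 = P$2$1" by (simp only: assms(1))
 hence sym: "P$2$1 = P$1$2" by (simp add: transpose_def)
 have "P$1$2 / x * (P$1$2 / x) + s / x * (s / x) = (P$1$2 * P$1$2 + s * s) / (x * x)" by (simp add: add_divide_distrib)
 also have "\<dots> = P$2$2" unfolding s x(2) using assms(2) by (simp add: det_2 sym)
 finally have 22: "P$1$2 / x * (P$1$2 / x) + s / x * (s / x) = P$2$2" .
 have nth: "(cholesky P ** eta_mat ** transpose (cholesky P))$i$j = mink (cholesky P$i) (cholesky P$j)" for i j by (rule mink_matrix)
 have "\<forall>i j. (cholesky P ** eta_mat ** transpose (cholesky P))$i$j = block P (-1)$i$j"
  unfolding nth forall_4 cholesky_nth x_def[symmetric] s_def[symmetric] mink_def block_def vector_4 e3_def e4_def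
  using x 22 by (simp add: sym)
 thus ?thesis unfolding vec_eq_iff by blast
qed

text \<open>The unknown Lorentz factor of the frame becomes a conjugation, which the trace form does
  not see; the rest depends on the germ alone.\<close>

lemma spin_part_cholesky:
 assumes P: "transpose P = P" "P$1$1 > 0" "det P > 0" and M: "det M = 1" and Y: "Y = cholesky P ** lor_mat M" and Y': "Y' ** Y = mat 1"
 shows "spin_part (Y' ** V ** Y) = M ** spin_part (cholesky_inv P ** V ** cholesky P) ** adj2 M"
proof -
 define L where "L = lor_mat (adj2 M) ** cholesky_inv P"
 have "L ** Y = lor_mat (adj2 M) ** (cholesky_inv P ** cholesky P) ** lor_mat M" unfolding L_def Y by (simp only: matrix_mul_assoc)
 hence "L ** Y = mat 1" by (simp only: cholesky_inv[OF P(2,3)] matrix_mul_rid lor_mat_inv(2)[OF M])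
 hence "Y ** L = mat 1" using matrix_left_right_inverse by blast
 hence "Y' = L" using Y' by (metis matrix_mul_assoc matrix_mul_lid matrix_mul_rid)
 hence "Y' ** V ** Y = lor_mat (adj2 M) ** (cholesky_inv P ** V ** cholesky P) ** lor_mat M"
  unfolding L_def Y by (simp only: matrix_mul_assoc)
 thus ?thesis by (simp only: spin_part_conj[OF M])
qed

lemma cholesky_conj:
 assumes P: "transpose P = P" "P$1$1 > 0" "det P > 0" and Q: "V ** block P (-1) = Q"
 defines "E \<equiv> cholesky_inv P ** V ** cholesky P"
 shows "E ** eta_mat = cholesky_inv P ** Q ** transpose (cholesky_inv P)"
proof -
 have CC: "cholesky P ** cholesky_inv P = mat 1" using cholesky_inv[OF P(2,3)] matrix_left_right_inverse by blast
 hence t: "transpose (cholesky P) ** transpose (cholesky_inv P) = mat 1" using cholesky_inv[OF P(2,3)]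
  by (metis matrix_transpose_mul transpose_mat)
 have "cholesky_inv P ** Q ** transpose (cholesky_inv P) = cholesky_inv P ** V ** cholesky P ** eta_mat ** (transpose (cholesky P) ** transpose (cholesky_inv P))"
  unfolding Q[symmetric] cholesky_gram[OF P, symmetric] by (simp only: matrix_mul_assoc)
 thus ?thesis by (simp add: t E_def)
qed

section \<open>Comparison of the two densities\<close>

text \<open>Only the antisymmetric part of a variation of the Gauss-Weingarten matrix, with both indices lowered, enters the
 imaginary part of the trace form, and there through the polarised Pfaffian.\<close>

lemma Im_trace_form_cholesky:
 assumes P: "transpose P = P" "P$1$1 > 0" "det P > 0"
  and Q: "V ** block P (-1) = Q" "V' ** block P (-1) = Q'" and Q34: "alt Q 3 4 = 0" "alt Q' 3 4 = 0"
 shows "Im (trace_form (spin_part (cholesky_inv P ** V ** cholesky P)) (spin_part (cholesky_inv P ** V' ** cholesky P))) =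
  (- alt Q 1 3 * alt Q' 2 4 - alt Q 2 4 * alt Q' 1 3 + alt Q 1 4 * alt Q' 2 3 + alt Q 2 3 * alt Q' 1 4) / (8 * sqrt (det P))"
proof -
 define x s where "x = sqrt (P$1$1)" and "s = sqrt (det P)"
 have xs: "x > 0" "s > 0" using P(2,3) by (simp_all add: x_def s_def)
 define p q where "p = - P$1$2 / (x * s)" and "q = x / s"
 define C where "C = cholesky_inv P"
 have C: "C$1 = vector [1 / x, 0, 0, 0]" "C$2 = vector [p, q, 0, 0]" "C$3 = vector [0, 0, 1, 0]" "C$4 = vector [0, 0, 0, 1]"
  by (simp_all add: C_def cholesky_inv_def x_def s_def p_def q_def e3_def e4_def)
 have nth: "(C ** R ** transpose C)$i$j = (\<Sum>a\<in>UNIV. \<Sum>b\<in>UNIV. C$i$a * C$j$b * R$a$b)" for R i j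
  by (simp add: matrix_matrix_mult_def transpose_def sum_4 algebra_simps)
 have alt: "alt (C ** R ** transpose C) 1 3 = alt R 1 3 / x" "alt (C ** R ** transpose C) 1 4 = alt R 1 4 / x"
  "alt (C ** R ** transpose C) 2 3 = p * alt R 1 3 + q * alt R 2 3" "alt (C ** R ** transpose C) 2 4 = p * alt R 1 4 + q * alt R 2 4"
  "alt (C ** R ** transpose C) 3 4 = alt R 3 4" for R
  unfolding alt_def nth by (simp_all add: sum_4 C diff_divide_distrib algebra_simps)
 \<comment> \<open>The terms with the off-diagonal entry \<open>p\<close> cancel in pairs, and
   \<open>q / x\<close> is the reciprocal of the area density.\<close>
 have k: "- (b13 / x) * (p * c14 + q * c24) - (p * b14 + q * b24) * (c13 / x) + b14 / x * (p * c13 + q * c23) + (p * b13 + q * b23) * (c14 / x)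
   = (- b13 * c24 - b24 * c13 + b14 * c23 + b23 * c14) / s" for b13 b14 b23 b24 c13 c14 c23 c24
 proof -
  have *: "(- b13 * c24 - b24 * c13 + b14 * c23 + b23 * c14) / s = (- b13 * c24 - b24 * c13 + b14 * c23 + b23 * c14) * q / x"
   using xs by (simp add: q_def)
  show ?thesis unfolding * using xs(1) by (simp add: field_simps)
 qed
 show ?thesis
  unfolding Im_trace_form_spin_part cholesky_conj[OF P Q(1)] cholesky_conj[OF P Q(2)] unfolding C_def[symmetric] alt Q34 s_def[symmetric]
  using k[of "alt Q 1 3" "alt Q' 1 4" "alt Q' 2 4" "alt Q 1 4" "alt Q 2 4" "alt Q' 1 3" "alt Q' 2 3" "alt Q 2 3"] by simp
qed

text \<open>Small letters with index 1 or 2 are first variations in the two parameters, and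
  \<open>A11\<close> to \<open>A22\<close> are the entries of \<open>shape\<close>. The terms with
  these entries amount exactly to the variation of the area density on the right.\<close>

lemma goldman_density_identity:
 fixes E F G L M N e1 f1 g1 e2 f2 g2 l1 m1 n1 l2 m2 n2 s s1 s2 :: real
 assumes s: "s > 0" "s * s = E * G - F * F"
  and s1: "s1 = (e1 * G + E * g1 - 2 * F * f1) / (2 * s)" and s2: "s2 = (e2 * G + E * g2 - 2 * F * f2) / (2 * s)"
  and A: "A11 = (L * G - M * F) / (s * s)" "A12 = (M * E - L * F) / (s * s)" "A21 = (M * G - N * F) / (s * s)" "A22 = (N * E - M * F) / (s * s)"
 shows "((2 * l1 - (A11 * e1 + A12 * f1)) * g2 + f1 * (2 * m2 - (A21 * e2 + A22 * f2)) - e1 * (2 * n2 - (A21 * f2 + A22 * g2)) - (2 * m1 - (A11 * f1 + A12 * g1)) * f2) / (8 * s)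
  - ((2 * m1 - (A21 * e1 + A22 * f1)) * f2 + g1 * (2 * l2 - (A11 * e2 + A12 * f2)) - f1 * (2 * m2 - (A11 * f2 + A12 * g2)) - (2 * n1 - (A21 * f1 + A22 * g1)) * e2) / (8 * s)
  = (1/4) * (((l1 * g2 - 2 * m1 * f2 + n1 * e2) - (l2 * g1 - 2 * m2 * f1 + n2 * e1)) / s
    - ((L * g2 - 2 * M * f2 + N * e2) * s1 - (L * g1 - 2 * M * f1 + N * e1) * s2) / (s * s))"
 unfolding s1 s2 A using s(1) by (simp add: divide_simps) (simp add: algebra_simps)

context minimal_family begin

text \<open>Differentiates the product of \<open>weingarten\<close> with the Gram matrix, which is
  the explicit \<open>second_form\<close>, and so avoids the derivative of the inverse
  metric.\<close>

lemma lowered_variation_nth: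
 "(variation k i z ** block (fst (\<sigma> u) z) (-1))$a$b = partial (\<lambda>v. second_form (\<sigma> v) i z$a$b) k u
  - (\<Sum>c\<in>UNIV. weingarten (\<sigma> u) i z$a$c * partial (\<lambda>v. block (fst (\<sigma> v) z) (-1)$c$b) k u)"
proof -
 note bb = bounded_bilinear_mat_mult
 define w g where "w = (\<lambda>v. weingarten (\<sigma> v) i z)" and "g = (\<lambda>v. block (fst (\<sigma> v) z) (-1))"
 have dw: "w differentiable (at u)"
  using Ck_1_differentiable[OF Ck_param[OF Ck_weingarten] U(2)] by (simp add: w_def)
 have dg: "g differentiable (at u)" unfolding g_def
  by (rule Ck_1_differentiable[OF Ck_on_block[OF U(1) Ck_entries_param(1)] U(2)])
 have wg: "w v ** g v = second_form (\<sigma> v) i z" if "v \<in> U" for v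
 proof -
  have "det (fst (\<sigma> v) z) \<noteq> 0" using pos(2)[OF that, of z] by simp
  thus ?thesis by (simp add: w_def g_def weingarten_def matrix_mul_assoc[symmetric] block_mult inverse_2x2(1))
 qed
 have dp: "(\<lambda>v. w v ** g v) differentiable (at u)" by (rule differentiable_mat_mult[OF dw dg])
 have dr: "(\<lambda>v. (w v ** g v)$a) differentiable (at u)" "(\<lambda>v. g v$c) differentiable (at u)" for c
  by (rule differentiable_bounded_linear[OF bounded_linear_vec_nth dp] differentiable_bounded_linear[OF bounded_linear_vec_nth dg])+
 have "partial (\<lambda>v. second_form (\<sigma> v) i z$a$b) k u = partial (\<lambda>v. (w v ** g v)$a$b) k u"
  by (rule partial_cong[OF U]) (simp add: wg)
 also have "\<dots> = (w u ** partial g k u + partial w k u ** g u)$a$b"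
  unfolding partial_nth[OF dr(1)] partial_nth[OF dp] partial_bilinear[OF bb dw dg] by (simp add: add.commute)
 also have "\<dots> = (\<Sum>c\<in>UNIV. w u$a$c * partial (\<lambda>v. g v$c$b) k u) + (variation k i z ** g u)$a$b"
  unfolding partial_nth[OF dr(2)] partial_nth[OF dg] by (simp add: matrix_matrix_mult_def variation_def w_def)
 finally show ?thesis unfolding w_def g_def by simp
qed

text \<open>The transpose of the shape operator, as it acts on the rows of a frame.\<close>

definition shape :: "real^2 => real^2^2" where
 "shape z = snd (\<sigma> u) z ** matrix_inv (fst (\<sigma> u) z)"

text \<open>The entry with indices 1 and 2, which would contain variations of the Christoffel
  symbols, is left out on purpose: it occurs only against the entry with indices 3 and 4, which
  vanishes.\<close>

lemma alt_variation:
 defines "Q \<equiv> \<lambda>k i z. variation k i z ** block (fst (\<sigma> u) z) (-1)"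
 shows "alt (Q k i z) 1 3 = 2 * dII k u z i 1 - (shape z$i$1 * dI k u z 1 1 + shape z$i$2 * dI k u z 1 2)"
  and "alt (Q k i z) 2 3 = 2 * dII k u z i 2 - (shape z$i$1 * dI k u z 1 2 + shape z$i$2 * dI k u z 2 2)"
  and "alt (Q k i z) 1 4 = - dI k u z i 1" and "alt (Q k i z) 2 4 = - dI k u z i 2" and "alt (Q k i z) 3 4 = 0"
proof -
 note d = entries_param_differentiable[OF U(2), of z]
 have d0: "det (fst (\<sigma> u) z) \<noteq> 0" using pos(2)[OF U(2), of z] by simp
 have w3: "weingarten (\<sigma> u) i z$3$1 = - shape z$i$1" "weingarten (\<sigma> u) i z$3$2 = - shape z$i$2" "weingarten (\<sigma> u) i z$3$3 = 0" "weingarten (\<sigma> u) i z$3$4 = 0"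
  by (simp_all add: weingarten_def matrix_matrix_mult_def sum_4 sum_2 second_form_def block_def shape_def)
 have w4: "weingarten (\<sigma> u) i z$4$1 = mat 1$i$1" "weingarten (\<sigma> u) i z$4$2 = mat 1$i$2" "weingarten (\<sigma> u) i z$4$3 = 0" "weingarten (\<sigma> u) i z$4$4 = 0"
  unfolding inverse_2x2(2)[OF d0, symmetric] by (simp_all add: weingarten_def matrix_matrix_mult_def sum_4 sum_2 second_form_def block_def)
 have i: "mat 1$i$1 * x 1 + mat 1$i$2 * x 2 = x i" for x :: "2 => real"
  using exhaust_2[of i] by (auto simp: mat_def)
 have s: "dI k u z 2 1 = dI k u z 1 2" by (rule dI_sym[OF U(2)])
 show "alt (Q k i z) 1 3 = 2 * dII k u z i 1 - (shape z$i$1 * dI k u z 1 1 + shape z$i$2 * dI k u z 1 2)"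
  unfolding alt_def Q_def lowered_variation_nth sum_4 w3
  by (simp add: second_form_def block_def partial_const partial_minus[OF d(2)] dII_def[symmetric] dI_def[symmetric] s)
 show "alt (Q k i z) 2 3 = 2 * dII k u z i 2 - (shape z$i$1 * dI k u z 1 2 + shape z$i$2 * dI k u z 2 2)"
  unfolding alt_def Q_def lowered_variation_nth sum_4 w3
  by (simp add: second_form_def block_def partial_const partial_minus[OF d(2)] dII_def[symmetric] dI_def[symmetric] s)
 show "alt (Q k i z) 1 4 = - dI k u z i 1"
  unfolding alt_def Q_def lowered_variation_nth sum_4 w4
  using i[of "\<lambda>j. dI k u z j 1"] by (simp add: second_form_def block_def partial_const partial_minus[OF d(1)] dI_def[symmetric])
 show "alt (Q k i z) 2 4 = - dI k u z i 2"
  unfolding alt_def Q_def lowered_variation_nth sum_4 w4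
  using i[of "\<lambda>j. dI k u z j 2"] by (simp add: second_form_def block_def partial_const partial_minus[OF d(1)] dI_def[symmetric])
 show "alt (Q k i z) 3 4 = 0"
  unfolding alt_def Q_def lowered_variation_nth sum_4 w3 w4 by (simp add: second_form_def block_def partial_const)
qed

lemma shape_nth:
 fixes z
 defines "L \<equiv> snd (\<sigma> u) z$1$1" and "M \<equiv> snd (\<sigma> u) z$1$2" and "N \<equiv> snd (\<sigma> u) z$2$2"
  and "E \<equiv> fst (\<sigma> u) z$1$1" and "F \<equiv> fst (\<sigma> u) z$1$2" and "G \<equiv> fst (\<sigma> u) z$2$2" and "r \<equiv> sf u z"
 shows "shape z$1$1 = (L * G - M * F) / (r * r)" "shape z$1$2 = (M * E - L * F) / (r * r)"
  and "shape z$2$1 = (M * G - N * F) / (r * r)" "shape z$2$2 = (N * E - M * F) / (r * r)"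
proof -
 have d0: "det (fst (\<sigma> u) z) \<noteq> 0" using pos(2)[OF U(2), of z] by simp
 have d: "det (fst (\<sigma> u) z) = sf u z * sf u z" using pos(2)[OF U(2), of z] by (simp add: sf_def)
 show "shape z$1$1 = (L * G - M * F) / (r * r)" "shape z$1$2 = (M * E - L * F) / (r * r)"
  and "shape z$2$1 = (M * G - N * F) / (r * r)" "shape z$2$2 = (N * E - M * F) / (r * r)"
  unfolding L_def M_def N_def E_def F_def G_def r_def shape_def matrix_matrix_mult_def vec_lambda_beta sum_2 matrix_inv_2x2[OF d0] d
  by (simp_all add: fst_sym[OF U(2)] snd_sym[OF U(2)] add_divide_distrib diff_divide_distrib)
qed

lemma Im_trace_form_\<alpha>:
 defines "Q \<equiv> \<lambda>k i z. variation k i z ** block (fst (\<sigma> u) z) (-1)"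
 shows "Im (trace_form (spin_part (\<alpha> k i z)) (spin_part (\<alpha> l j z))) =
  (- alt (Q k i z) 1 3 * alt (Q l j z) 2 4 - alt (Q k i z) 2 4 * alt (Q l j z) 1 3 + alt (Q k i z) 1 4 * alt (Q l j z) 2 3 + alt (Q k i z) 2 3 * alt (Q l j z) 1 4) / (8 * sf u z)"
proof -
 let ?P = "fst (\<sigma> u) z"
 have "transpose ?P = ?P" using fst_sym[OF U(2)] by (simp add: vec_eq_iff transpose_def forall_2)
 note P = this pos(1)[OF U(2), of z] pos(2)[OF U(2), of z]
 obtain M where M: "det M = 1" "frame (f u) (n u) z = cholesky ?P ** lor_mat M" by (rule base.frame_cholesky[OF P(2)])
 have \<alpha>: "spin_part (\<alpha> k i z) = M ** spin_part (cholesky_inv ?P ** variation k i z ** cholesky ?P) ** adj2 M" for k i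
  unfolding \<alpha>_def by (rule spin_part_cholesky[OF P M(1) _ Yinv(1)]) (simp only: Y_def M(2))
 have t: "trace_form (M ** X ** adj2 M) (M ** X' ** adj2 M) = trace_form X X'" for X X'
 proof -
  have "(M ** X ** adj2 M) ** (M ** X' ** adj2 M) = M ** X ** (adj2 M ** M) ** X' ** adj2 M" by (simp only: matrix_mul_assoc)
  hence "(M ** X ** adj2 M) ** (M ** X' ** adj2 M) = M ** (X ** X') ** adj2 M"
   by (simp only: mult_adj2_1(2)[OF M(1)] matrix_mul_rid matrix_mul_assoc)
  thus ?thesis unfolding trace_form_def by (simp only: trace_conj[OF M(1)])
 qed
 have a0: "alt (Q k i z) 3 4 = 0" for k i unfolding Q_def by (rule alt_variation(5))
 have Q: "variation k i z ** block ?P (-1) = Q k i z" for k i by (simp add: Q_def)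
 show ?thesis unfolding \<alpha> t Im_trace_form_cholesky[OF P Q Q a0 a0] sf_def ..
qed

lemma Im_curl_\<theta>: "Im (curl \<theta> z) = - omega_density z"
proof -
 have sI: "dI k u z 2 1 = dI k u z 1 2" and sII: "dII k u z 2 1 = dII k u z 1 2" for k
  by (rule dI_sym[OF U(2)] dII_sym[OF U(2)])+
 have neg: "- a * - b - - c * d + - e * f + g * - h = a * b + c * d - e * f - g * h" for a b c d e f g h :: real by simp
 have "Im (curl \<theta> z) = (1/4) * (
  ((dII 1 u z 1 1 * dI 2 u z 2 2 - 2 * dII 1 u z 1 2 * dI 2 u z 1 2 + dII 1 u z 2 2 * dI 2 u z 1 1)
   - (dII 2 u z 1 1 * dI 1 u z 2 2 - 2 * dII 2 u z 1 2 * dI 1 u z 1 2 + dII 2 u z 2 2 * dI 1 u z 1 1)) / sf u z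
  - ((snd (\<sigma> u) z$1$1 * dI 2 u z 2 2 - 2 * snd (\<sigma> u) z$1$2 * dI 2 u z 1 2 + snd (\<sigma> u) z$2$2 * dI 2 u z 1 1) * partial (\<lambda>w. sf w z) 1 u
    - (snd (\<sigma> u) z$1$1 * dI 1 u z 2 2 - 2 * snd (\<sigma> u) z$1$2 * dI 1 u z 1 2 + snd (\<sigma> u) z$2$2 * dI 1 u z 1 1) * partial (\<lambda>w. sf w z) 2 u) / (sf u z * sf u z))"
  unfolding curl_\<theta> minus_complex.sel Im_trace_form_\<alpha> alt_variation neg sI sII
  by (rule goldman_density_identity[OF sf_pos[OF U(2)] sf_square[OF U(2)] partial_sf[OF U(2)] partial_sf[OF U(2)] shape_nth])
 thus ?thesis unfolding omega_density_def by simp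
qed

theorem omega_H_eq_Im_omega_G: "omega_H S p \<sigma> u = - Im (omega_G S p \<rho> u)"
proof -
 have c: "continuous_on UNIV (curl \<theta>)" by (rule Ck_on_curl[OF Ck_\<theta>_potential(1)])
 have "Im (omega_G S p \<rho> u) = integral UNIV (\<lambda>z. bump z * Im (curl \<theta> z))"
  unfolding omega_G_eq curl_\<theta>[symmetric] integral_bump_complex(2)[OF c] by simp
 also have "\<dots> = - omega_H S p \<sigma> u" unfolding omega_H_eq Im_curl_\<theta> by simp
 finally show ?thesis by simp
qed

end

theorem theorem4p9:
 fixes S :: "'a::t2_space set"
  and A :: "('a set \<times> ('a \<Rightarrow> real^2)) set"
  and p :: "real^2 \<Rightarrow> 'a"
  and g :: nat
  and U :: "(real^2) set"
  and F :: "real^2 \<Rightarrow> germ set"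
  and \<sigma> :: "real^2 \<Rightarrow> germ"
  and \<rho> :: "(real^2 \<Rightarrow> real^2) rep_family"
 assumes "closed_oriented_surface S A" and "has_genus S g" and "g \<ge> 2"
  and "universal_covering S A p"
  and "open U" and "F ` U \<subseteq> almost_fuchsian_space S A p"
  and "germ_lift p U \<sigma> F"
  and "representation_lift p U \<rho> (\<lambda>u. holonomy_class p (F u))"
  and "u \<in> U"
 shows "omega_H S p \<sigma> u = - Im (omega_G S p \<rho> u)"
proof -
 interpret surface_cover S A p by (rule surface_cover.intro[OF assms(1,4)])
 have \<sigma>: "\<And>v. v \<in> U \<Longrightarrow> \<sigma> v \<in> F v" "\<And>v. v \<in> U \<Longrightarrow> \<sigma> v \<in> minimal_hyperbolic_germs p"
  and smooth: "smooth_on (U \<times> UNIV) (\<lambda>(u, z). fst (\<sigma> u) z)" "smooth_on (U \<times> UNIV) (\<lambda>(u, z). snd (\<sigma> u) z)"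
  using assms(7) unfolding germ_lift_def by blast+
 have \<rho>: "\<And>v. v \<in> U \<Longrightarrow> \<rho> v \<in> representations p" "\<And>v. v \<in> U \<Longrightarrow> \<rho> v \<in> holonomy_class p (F v)"
  "\<And>\<gamma>. \<gamma> \<in> deck p \<Longrightarrow> \<exists>R. local_lift (\<lambda>v. \<rho> v \<gamma>) u R"
  using assms(8,9) unfolding representation_lift_def by blast+
 \<comment> \<open>The immersion behind the holonomy belongs to some germ of the class
   \<open>F v\<close>; it is transported to the germ \<open>\<sigma> v\<close> itself.\<close>
 have "\<exists>fn. hyperbolic_immersion (fst fn) (snd fn) (\<sigma> v) \<and> (\<forall>\<gamma>\<in>deck p. \<forall>z. fst fn (\<gamma> z) = psl_act (\<rho> v \<gamma>) (fst fn z))" if v: "v \<in> U" for v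
 proof -
  have "F v \<in> almost_fuchsian_space S A p" using assms(6) v by blast
  then obtain f n where "hyperbolic_immersion f n (\<sigma> v)" "\<And>\<gamma> z. \<gamma> \<in> deck p \<Longrightarrow> f (\<gamma> z) = psl_act (\<rho> v \<gamma>) (f z)"
   by (rule holonomy_immersion[OF _ \<sigma>(1)[OF v] \<rho>(2)[OF v]]) (rule that; assumption)
  thus ?thesis by (intro exI[of _ "(f, n)"]) simp
 qed
 hence "\<forall>v\<in>U. \<exists>fn. hyperbolic_immersion (fst fn) (snd fn) (\<sigma> v) \<and> (\<forall>\<gamma>\<in>deck p. \<forall>z. fst fn (\<gamma> z) = psl_act (\<rho> v \<gamma>) (fst fn z))" by blast
 \<comment> \<open>An arbitrary choice for each parameter; all regularity in the parameter is
   recovered from the germs and the holonomies.\<close>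
 from bchoice[OF this] obtain fn
  where fn: "\<And>v. v \<in> U \<Longrightarrow> hyperbolic_immersion (fst (fn v)) (snd (fn v)) (\<sigma> v)"
   "\<And>v \<gamma> z. v \<in> U \<Longrightarrow> \<gamma> \<in> deck p \<Longrightarrow> fst (fn v) (\<gamma> z) = psl_act (\<rho> v \<gamma>) (fst (fn v) z)" by blast
 note germ = minimal_germ[OF \<sigma>(2)]
 have "quasi_fuchsian p (\<rho> u)" using \<rho>(2)[OF assms(9)] unfolding holonomy_class_def is_holonomy_def by blast
 note nd = nondegenerate[OF this]
 interpret minimal_family S A p U u \<sigma> "\<lambda>v. fst (fn v)" "\<lambda>v. snd (fn v)" \<rho>
  by unfold_locales (simp_all add: fn assms(5,9) \<rho>(1) \<rho>(3) germ \<sigma>(2) smooth nd)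
 show ?thesis by (rule omega_H_eq_Im_omega_G)
qed

end
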